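(* Let $K_2,K_3>0$. There exists an increasing homeomorphism $\eta:(0,\infty)\to(0,\infty)$, depending only on $K_2$ and $K_3$, such that the following holds. Let $S$ be a planar Sierpiński carpet with $\mathcal H^2(S)=0$ whose peripheral circles $\{\partial Q_i\}_{i\in\mathbb N\cup\{0\}}$ are $K_2$-quasicircles and are $K_3$-relatively separated. Then there exists an $\eta$-quasisymmetric map $f$ from $S$ onto a square Sierpiński carpet $\mathcal R$. Furthermore, $f$ maps the outer peripheral circle of $S$ onto the outer peripheral circle of $\mathcal R$.
   Context: Planar Sierpiński carpet: let $\Omega\subset\mathbb C$ be a Jordan region and $\{Q_i\}_{i\in\mathbb N}$ open Jordan regions compactly contained in $\Omega$, with pairwise disjoint closures, with $\operatorname{diam}(Q_i)\to0$, such that $S:=\overline\Omega\setminus\bigcup_{i\in\mathbb N}Q_i$ has empty interior. With $Q_0:=\mathbb C\setminus\overline\Omega$, the peripheral circles are $\partial Q_i$, $i\in\mathbb N\cup\{0\}$; $\partial Q_0=\partial\Omega$ is the outer peripheral circle. Square Sierpiński carpet: a Sierpiński carpet for which $\Omega$ is a rectangle and all $Q_i$, $i\in\mathbb N$, are squares, with the sides of all $\partial Q_i$, $i\in\mathbb N\cup\{0\}$, parallel to the coordinate axes. A Jordan curve $J\subset\mathbb C$ is a $K_2$-quasicircle if for any two points $x,y\in J$ there is an arc $\gamma\subset J$ with endpoints $x,y$ and $\operatorname{diam}(\gamma)\le K_2|x-y|$. The peripheral circles are $K_3$-relatively separated if $\dfrac{\operatorname{dist}(\partial Q_i,\partial Q_j)}{\min\{\operatorname{diam}(\partial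 Q_i),\operatorname{diam}(\partial Q_j)\}}\ge K_3$ for all distinct $i,j\in\mathbb N\cup\{0\}$. A homeomorphism $f:X\to Y$ between metric spaces is an $\eta$-quasisymmetry if $\dfrac{d_Y(f(x),f(y))}{d_Y(f(x),f(z))}\le\eta\!\left(\dfrac{d_X(x,y)}{d_X(x,z)}\right)$ for all distinct $x,y,z\in X$. Carpets carry the Euclidean metric. $\mathcal H^2$ is planar Lebesgue measure. *)

theory Defs
  imports "HOL-Analysis.Analysis"
begin

definition jordan_curve :: "complex set \<Rightarrow> bool" where
  "jordan_curve J \<longleftrightarrow>
     (\<exists>c. simple_path c \<and> pathfinish c = pathstart c \<and> path_image c = J)"

text \<open>\<^const>\<open>inside\<close> of a Jordan curve is the bounded component of its complement.\<close>

definition jordan_region :: "complex set \<Rightarrow> bool" where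
  "jordan_region U \<longleftrightarrow> (\<exists>J. jordan_curve J \<and> U = inside J)"

text \<open>
  A carpet is given by its data \<open>\<Omega>\<close> and \<open>Q\<close>. The inner complementary regions are the
  \<open>Q i\<close> with \<open>i \<ge> 1\<close>, and \<open>Q 0\<close> is the exterior of \<open>\<Omega>\<close>, so that \<open>frontier (Q i)\<close>,
  for \<open>i\<close> ranging over all of \<^typ>\<open>nat\<close>, are the peripheral circles.
\<close>

definition carpet :: "complex set \<Rightarrow> (nat \<Rightarrow> complex set) \<Rightarrow> complex set" where
  "carpet \<Omega> Q = closure \<Omega> - (\<Union>i\<in>{1..}. Q i)"

definition sierpinski_carpet :: "complex set \<Rightarrow> (nat \<Rightarrow> complex set) \<Rightarrow> bool" where
  "sierpinski_carpet \<Omega> Q \<longleftrightarrow>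
     jordan_region \<Omega> \<and>
     Q 0 = - closure \<Omega> \<and>
     (\<forall>i\<ge>1. jordan_region (Q i) \<and> closure (Q i) \<subseteq> \<Omega>) \<and>
     (\<forall>i\<ge>1. \<forall>j\<ge>1. i \<noteq> j \<longrightarrow> closure (Q i) \<inter> closure (Q j) = {}) \<and>
     (\<lambda>i. diameter (Q i)) \<longlonglongrightarrow> 0 \<and>
     interior (carpet \<Omega> Q) = {}"

lemma frontier_exterior_jordan_region:
  assumes "jordan_region U"
  shows "frontier (- closure U) = frontier U"
proof -
  obtain c where c: "simple_path c" "pathfinish c = pathstart c" and U: "U = inside (path_image c)"
    using assms unfolding jordan_region_def jordan_curve_def by blast
  note J = Jordan_inside_outside[OF c]
  have "closure U = U \<union> path_image c"
    using J closure_Un_frontier[of U] unfolding U by simp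
  then have "- closure U = outside (path_image c)"
    using J unfolding U by blast
  then show ?thesis
    using J unfolding U by simp
qed

lemma frontier_outer_region:
  assumes "sierpinski_carpet \<Omega> Q"
  shows "frontier (Q 0) = frontier \<Omega>"
  using assms frontier_exterior_jordan_region unfolding sierpinski_carpet_def by simp

definition axis_rectangle :: "complex set \<Rightarrow> bool" where
  "axis_rectangle U \<longleftrightarrow> (\<exists>a b. Re a < Re b \<and> Im a < Im b \<and> U = box a b)"

definition axis_square :: "complex set \<Rightarrow> bool" where
  "axis_square U \<longleftrightarrow>
     (\<exists>a b. Re a < Re b \<and> Im a < Im b \<and> Re b - Re a = Im b - Im a \<and> U = box a b)"

definition square_carpet :: "complex set \<Rightarrow> (nat \<Rightarrow> complex set) \<Rightarrow> bool" where
  "square_carpet \<Omega> Q \<longleftrightarrow>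
     sierpinski_carpet \<Omega> Q \<and> axis_rectangle \<Omega> \<and> (\<forall>i\<ge>1. axis_square (Q i))"

text \<open>
  The points are taken distinct because \<^const>\<open>arc\<close> excludes degenerate (one-point) arcs;
  for coinciding points the condition is void.
\<close>

definition quasicircle :: "real \<Rightarrow> complex set \<Rightarrow> bool" where
  "quasicircle K J \<longleftrightarrow>
     jordan_curve J \<and>
     (\<forall>x\<in>J. \<forall>y\<in>J. x \<noteq> y \<longrightarrow>
        (\<exists>\<gamma>. arc \<gamma> \<and> path_image \<gamma> \<subseteq> J \<and> pathstart \<gamma> = x \<and> pathfinish \<gamma> = y \<and>
             diameter (path_image \<gamma>) \<le> K * dist x y))"

definition relatively_separated :: "real \<Rightarrow> (nat \<Rightarrow> complex set) \<Rightarrow> bool" where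
  "relatively_separated K C \<longleftrightarrow>
     (\<forall>i j. i \<noteq> j \<longrightarrow> setdist (C i) (C j) / min (diameter (C i)) (diameter (C j)) \<ge> K)"

definition increasing_homeomorphism :: "(real \<Rightarrow> real) \<Rightarrow> bool" where
  "increasing_homeomorphism \<eta> \<longleftrightarrow>
     strict_mono_on {0<..} \<eta> \<and> (\<exists>\<theta>. homeomorphism {0<..} {0<..} \<eta> \<theta>)"

definition quasisymmetry ::
  "(real \<Rightarrow> real) \<Rightarrow> 'a::metric_space set \<Rightarrow> 'b::metric_space set \<Rightarrow> ('a \<Rightarrow> 'b) \<Rightarrow> bool" where
  "quasisymmetry \<eta> X Y f \<longleftrightarrow>
     (\<exists>g. homeomorphism X Y f g) \<and>
     (\<forall>x\<in>X. \<forall>y\<in>X. \<forall>z\<in>X. x \<noteq> y \<and> y \<noteq> z \<and> x \<noteq> z \<longrightarrow>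
        dist (f x) (f y) / dist (f x) (f z) \<le> \<eta> (dist x y / dist x z))"

end

theory Submission
 imports Defs
begin

text \<open>
  A fine grid on \<open>closure \<Omega>\<close>, with the cells meeting one large \<open>Q i\<close> merged into a single vertex, is a
  triangulated quadrilateral. A weight of minimal energy among those that give length at least 1 to all
  crossings yields a tiling of a rectangle by squares indexed by the vertices. Test weights of logarithmic
  type on annuli bound its distortion uniformly in the mesh: if \<open>dist x y\<close> is much larger than
  \<open>dist x z\<close>, then so is the distance of the image of \<open>x\<close> to that of \<open>y\<close>, compared with \<open>z\<close>. The
  quasicircle condition and relative separation enter here, as an annulus meets at most one large \<open>Q i\<close>.
  A limit along a filter, as the mesh tends to 0, maps the carpet into a rectangle minus disjoint open squares,
  quasisymmetrically by a packing argument. A point of the target outside the image would give a retraction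
  of \<open>closure \<Omega>\<close> onto its frontier, so the map is onto.
\<close>

text \<open>The squares of the minimiser tile because they cover the rectangle while their total
  area equals its area, so nothing overlaps or sticks out; squares of side 0 are allowed throughout.
  Distortion is bounded by contradiction. If the image of \<open>z\<close> were too far from that of
  \<open>x\<close>, the tiles joining \<open>x\<close> to \<open>z\<close> and those joining
  \<open>y\<close> to the sides would be two large connected families at bounded relative distance
  in the rectangle, and a length-area argument would join them by lines of total weight below 1,
  whereas the annuli between them charge every joining chain at least 1. The obstacle is a large
  \<open>Q i\<close> spanning many annuli, since its single vertex crosses them all at once. It is
  left out of the chains, so the lines must bypass its square, and a weight around
  \<open>Q i\<close> keeps that square away from the sides of the rectangle. Two scales of annuli
  are provided: either no \<open>Q i\<close> spans a whole block of annuli and the blocks act as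
  annuli, or within one block a single \<open>Q i\<close> is exceptional. The sides of the
  quadrilateral come from rays issuing from four points of the outer circle.\<close>

section \<open>Connected vertex sets and components of a graph\<close>

text \<open>Connectedness is stated through separations rather than paths, so that the topological
  arguments on unions carry over unchanged. The empty set counts as connected.\<close>

definition gconn :: "('v => 'v => bool) => 'v set => bool" where
 "gconn adj C \<longleftrightarrow> (ALL A. A <= C & A ~= {} & A ~= C --> (EX a:A. EX b:C - A. adj a b))"

text \<open>Plays the part of the intermediate value theorem: most later steps find in this way the
  edge along which a chain leaves a region.\<close>

lemma gconn_edge:
 assumes "gconn adj C" "a : C" "P a" "b : C" "~ P b"
 obtains x y where "x : C" "y : C" "P x" "~ P y" "adj x y"
proof -
 have "{x : C. P x} <= C & {x : C. P x} ~= {} & {x : C. P x} ~= C" using assms by auto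
 hence "EX a:{x : C. P x}. EX b:C - {x : C. P x}. adj a b" using assms(1) unfolding gconn_def by blast
 thus ?thesis using that by blast
qed

lemma gconnI:
 assumes "!!A a b. A <= C ==> a : A ==> b : C ==> b ~: A ==>
   (!!x y. x : A ==> y : C ==> y ~: A ==> ~ adj x y) ==> False"
 shows "gconn adj C" unfolding gconn_def
proof (intro allI impI, elim conjE)
 fix A assume A: "A <= C" "A ~= {}" "A ~= C"
 then obtain a b where "a : A" "b : C" "b ~: A" by blast
 with assms[of A a b] A show "EX a:A. EX b:C - A. adj a b" by blast
qed

lemma gconn_empty [simp]: "gconn adj {}" by (auto simp: gconn_def)

lemma gconn_singleton [simp]: "gconn adj {v}" by (auto simp: gconn_def)

lemma gconn_UN:
 assumes I: "gconn iadj I" and F: "!!i. i : I ==> gconn adj (F i)" "!!i. i : I ==> F i ~= {}"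
  and e: "!!i j. i : I ==> j : I ==> iadj i j ==>
   F i Int F j ~= {} | (EX a:F i. EX b:F j. adj a b)"
 shows "gconn adj (UN i:I. F i)"
proof (rule gconnI)
 fix A a b
 assume A: "A <= (UN i:I. F i)" "a : A" "b : (UN i:I. F i)" "b ~: A"
  and no: "!!x y. x : A ==> y : (UN i:I. F i) ==> y ~: A ==> ~ adj x y"
 have dich: "F i <= A | F i Int A = {}" if i: "i : I" for i
 proof (rule ccontr)
  assume "~ ?thesis"
  then obtain x y where xy: "x : F i" "x : A" "y : F i" "y ~: A" by blast
  obtain x' y' where "x' : F i" "y' : F i" "x' : A" "y' ~: A" "adj x' y'"
   using gconn_edge[where P = "%z. z : A", OF F(1)[OF i] xy] by blast
  thus False using no i by blast
 qed
 obtain i0 j0 where ij: "i0 : I" "a : F i0" "j0 : I" "b : F j0" using A by blast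
 obtain i j where i: "i : I" "j : I" "F i <= A" "~ F j <= A" "iadj i j"
 proof (rule gconn_edge[where P = "%k. F k <= A", OF I ij(1) _ ij(3)])
  show "F i0 <= A" using dich[OF ij(1)] ij A by blast
  show "~ F j0 <= A" using ij A by blast
 qed blast
 have "F j Int A = {}" using dich[OF i(2)] i by blast
 thus False using e[OF i(1,2,5)] i no by blast
qed

lemma gconn_Un:
 assumes sym: "symp adj" and "gconn adj C" "gconn adj D" "c : C" "d : D" "c = d | adj c d"
 shows "gconn adj (C Un D)"
proof -
 have "gconn adj (UN i:UNIV. if i then C else D)"
 proof (rule gconn_UN[where iadj = "%(i::bool) j. True"])
  show "gconn (%(i::bool) j. True) UNIV" by (auto simp: gconn_def)
  show "gconn adj (if i then C else D)" for i using assms by auto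
  show "(if i then C else D) ~= {}" for i using assms by auto
  show "(if i then C else D) Int (if j then C else D) ~= {} |
    (EX a:if i then C else D. EX b:if j then C else D. adj a b)" for i j using assms(4-6) sympD[OF sym] by (cases i; cases j) auto
 qed
 moreover have "(UN i:UNIV. if i then C else D) = C Un D" by (auto)
 ultimately show ?thesis by simp
qed

lemma gconn_insert:
 assumes sym: "symp adj" and "gconn adj C" "c : C" "adj c v"
 shows "gconn adj (insert v C)" using gconn_Un[OF sym assms(2) gconn_singleton assms(3), of v] assms(4) by simp

text \<open>The value is empty when \<open>a\<close> lies outside \<open>F\<close>, so components
  can be formed without checking membership first.\<close>

definition gcomp :: "('v => 'v => bool) => 'v set => 'v => 'v set" where
 "gcomp adj F a = \<Union>{C. C <= F & gconn adj C & a : C}"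

lemma gcomp_subset: "gcomp adj F a <= F" by (auto simp: gcomp_def)

lemma gcomp_self: "a : F ==> a : gcomp adj F a" unfolding gcomp_def by (rule UnionI[of "{a}"]) auto

lemma gconn_gcomp: "gconn adj (gcomp adj F a)"
proof -
 let ?I = "{C. C <= F & gconn adj C & a : C}"
 have "gconn adj (UN C:?I. C)" by (rule gconn_UN[where iadj = "%i j. True"]) (auto simp: gconn_def)
 thus ?thesis by (simp add: gcomp_def)
qed

lemma gcomp_maximal: "C <= F ==> gconn adj C ==> a : C ==> C <= gcomp adj F a" unfolding gcomp_def by auto

lemma gcomp_nonempty: "gcomp adj F a ~= {} ==> a : gcomp adj F a" unfolding gcomp_def by auto

lemma gcomp_absorb:
 assumes sym: "symp adj" and C: "C <= F" "gconn adj C" "c : C"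
  and d: "d : gcomp adj F a" and "c = d | adj c d"
 shows "C <= gcomp adj F a"
proof -
 have "gconn adj (C Un gcomp adj F a)" by (rule gconn_Un[OF sym C(2) gconn_gcomp C(3) d assms(6)])
 moreover have "a : gcomp adj F a" using gcomp_nonempty[of adj F a] d by auto
 moreover have "C Un gcomp adj F a <= F" using C(1) gcomp_subset[of adj F a] by simp
 ultimately have "C Un gcomp adj F a <= gcomp adj F a" by (intro gcomp_maximal UnI2)
 thus ?thesis by blast
qed

section \<open>Tilings of a rectangle by squares indexed by the vertices of a graph\<close>

text \<open>\<open>X v\<close> and \<open>Y v\<close> are the left and lower coordinates of a square
  of side \<open>m v\<close>. Side 0 is allowed, hence disjointness is only asked of squares of
  positive side. Adjacency forces touching but touching squares need not be adjacent;
  \<open>vert\<close> and \<open>horiz\<close> supply the chains along each line.\<close>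

locale square_tiling =
 fixes V :: "'v set" and adj :: "'v => 'v => bool" and X Y m :: "'v => real"
  and L R B T :: "'v set" and W H :: real
 assumes finV: "finite V" and adj_symp: "symp adj"
  and m_nonneg: "!!v. v : V ==> 0 <= m v"
  and X_ge: "!!v. v : V ==> 0 <= X v" and X_le: "!!v. v : V ==> X v + m v <= W"
  and Y_ge: "!!v. v : V ==> 0 <= Y v" and Y_le: "!!v. v : V ==> Y v + m v <= H"
  and W_pos: "0 < W" and H_pos: "0 < H"
  and touchX: "!!v w. v : V ==> w : V ==> adj v w ==> X v <= X w + m w"
  and touchY: "!!v w. v : V ==> w : V ==> adj v w ==> Y v <= Y w + m w"
  and disj: "!!v w. v : V ==> w : V ==> v ~= w ==> 0 < m v ==> 0 < m w ==>
    X v + m v <= X w | X w + m w <= X v | Y v + m v <= Y w | Y w + m w <= Y v"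
  and sideL: "!!v. v : V ==> v : L ==> X v = 0" and sideR: "!!v. v : V ==> v : R ==> X v + m v = W"
  and sideB: "!!v. v : V ==> v : B ==> Y v = 0" and sideT: "!!v. v : V ==> v : T ==> Y v + m v = H"
  and vert: "!!a. 0 <= a ==> a <= W ==>
    EX D<={v : V. X v <= a & a <= X v + m v}. gconn adj D & D Int B ~= {} & D Int T ~= {}"
  and horiz: "!!b. 0 <= b ==> b <= H ==>
    EX D<={v : V. Y v <= b & b <= Y v + m v}. gconn adj D & D Int L ~= {} & D Int R ~= {}"
begin

lemma adj_sym: "adj a b ==> adj b a" using adj_symp by (rule sympD)

lemma transpose: "square_tiling V adj Y X m B T L R H W"
proof unfold_locales
 show "Y v + m v <= Y w | Y w + m w <= Y v | X v + m v <= X w | X w + m w <= X v"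
  if "v : V" "w : V" "v ~= w" "0 < m v" "0 < m w" for v w using disj[OF that] by auto
qed (fact finV adj_symp W_pos H_pos | (rule m_nonneg X_ge X_le Y_ge Y_le sideL sideR sideB sideT touchX touchY vert horiz;
   assumption))+

text \<open>Estimates are proved for one side of the rectangle; this reflection and
  \<open>transpose\<close> carry them to the other three.\<close>

lemma reflect_X: "square_tiling V adj (%v. W - X v - m v) Y m R L B T W H"
proof unfold_locales
 show "EX D<={v : V. W - X v - m v <= a & a <= W - X v - m v + m v}. gconn adj D & D Int B ~= {} & D Int T ~= {}"
  if "0 <= a" "a <= W" for a
 proof -
  have "{v : V. W - X v - m v <= a & a <= W - X v - m v + m v} = {v : V. X v <= W - a & W - a <= X v + m v}" by auto
  thus ?thesis using vert[of "W - a"] that by simp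
 qed
 show "EX D<={v : V. Y v <= b & b <= Y v + m v}. gconn adj D & D Int R ~= {} & D Int L ~= {}" if "0 <= b" "b <= H" for b
  using horiz[OF that] by blast
 show "W - X v - m v <= W - X w - m w + m w" if "v : V" "w : V" "adj v w" for v w using touchX[OF that(2,1) adj_sym[OF that(3)]] by simp
 show "W - X v - m v + m v <= W - X w - m w | W - X w - m w + m w <= W - X v - m v |
      Y v + m v <= Y w | Y w + m w <= Y v" if "v : V" "w : V" "v ~= w" "0 < m v" "0 < m w" for v w using disj[OF that] by auto
 show "finite V" by (rule finV)
 show "symp adj" by (rule adj_symp)
 show "0 <= m v" if "v : V" for v using that by (rule m_nonneg)
 show "0 <= W - X v - m v" if "v : V" for v using X_le[OF that] by simp
 show "W - X v - m v + m v <= W" if "v : V" for v using X_ge[OF that] by simp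
 show "0 <= Y v" if "v : V" for v using that by (rule Y_ge)
 show "Y v + m v <= H" if "v : V" for v using that by (rule Y_le)
 show "0 < W" "0 < H" by (rule W_pos H_pos)+
 show "Y v <= Y w + m w" if "v : V" "w : V" "adj v w" for v w using that by (rule touchY)
 show "W - X v - m v = 0" if "v : V" "v : R" for v using sideR[OF that] by simp
 show "W - X v - m v + m v = W" if "v : V" "v : L" for v using sideL[OF that] by simp
 show "Y v = 0" if "v : V" "v : B" for v using that by (rule sideB)
 show "Y v + m v = H" if "v : V" "v : T" for v using that by (rule sideT)
qed

end

section \<open>A weight of minimal energy and the tiling it defines\<close>

text \<open>It suffices to minimise over weights with values in the unit interval, since cutting a
  weight down to 1 keeps every set of \<open>\<C>\<close> at length at least 1 and does not raise
  the energy. The cube over the whole type is compact by Tychonoff.\<close>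

lemma admissible_minimizer:
 fixes V :: "'v set"
 assumes fin: "finite V" and \<C>: "ALL C:\<C>. C <= V & C ~= {}"
 shows "EX m :: 'v => real. (ALL v. 0 <= m v) & (ALL C:\<C>. 1 <= sum m C) &
  (ALL ro. (ALL v:V. 0 <= ro v) --> (ALL C:\<C>. 1 <= sum ro C) -->
   (SUM v:V. (m v)^2) <= (SUM v:V. (ro v)^2))"
proof -
 define K where "K = (PiE UNIV (%_. {0..1}) :: ('v => real) set)"
 define Ad where "Ad = (INT C:\<C>. {ro::'v => real. 1 <= sum ro C})"
 have "compactin (product_topology (%_. euclidean) UNIV) K" unfolding K_def compactin_PiE by (simp)
 hence "compact K" by (simp add: euclidean_product_topology)
 moreover have "closed Ad" unfolding Ad_def by (intro closed_INT ballI closed_Collect_le continuous_intros continuous_on_product_coordinates)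
 ultimately have comp: "compact (K Int Ad)" by (rule compact_Int_closed)
 have cont: "continuous_on (K Int Ad) (%ro. SUM v:V. (ro v)^2)"
  by (intro continuous_intros continuous_on_product_coordinates continuous_on_subset[OF continuous_on_product_coordinates]) auto
 have fC: "finite C" if "C : \<C>" for C using bspec[OF \<C> that] fin finite_subset by blast
 have "(%_. 1) : K Int Ad"
 proof -
  have "1 <= real (card C)" if "C : \<C>" for C using bspec[OF \<C> that] fC[OF that] by (simp add: Suc_le_eq card_gt_0_iff)
  thus ?thesis by (auto simp: K_def Ad_def)
 qed
 then obtain m where m: "m : K Int Ad" "!!ro. ro : K Int Ad ==> (SUM v:V. (m v)^2) <= (SUM v:V. (ro v)^2)"
  using continuous_attains_inf[OF comp _ cont] by blast
 show ?thesis
 proof (intro exI[of _ m] conjI allI ballI impI)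
  show "0 <= m v" for v using m(1) by (auto simp: K_def Pi_def)
  show "1 <= sum m C" if "C : \<C>" for C using m(1) that by (auto simp: Ad_def)
  fix ro :: "'v => real" assume ro': "ALL v:V. 0 <= ro v" "ALL C:\<C>. 1 <= sum ro C"
  hence ro: "!!v. v : V ==> 0 <= ro v" "!!C. C : \<C> ==> 1 <= sum ro C" by auto
  define \<sigma> where "\<sigma> v = (if v : V then min 1 (ro v) else 0)" for v
  have "\<sigma> : K" using ro(1) by (auto simp: K_def \<sigma>_def)
  moreover have "1 <= sum \<sigma> C" if C: "C : \<C>" for C
  proof (cases "EX v:C. 1 <= ro v")
   case True
   then obtain v where v: "v : C" "1 <= ro v" by blast
   have "1 = \<sigma> v" using v bspec[OF \<C> C] by (auto simp: \<sigma>_def)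
   also have "... <= sum \<sigma> C" using v fC[OF C] ro(1) by (intro member_le_sum) (auto simp: \<sigma>_def)
   finally show ?thesis .
  next
   case False
   hence "sum \<sigma> C = sum ro C" using bspec[OF \<C> C] by (intro sum.cong) (auto simp: \<sigma>_def)
   thus ?thesis using ro(2)[OF C] by simp
  qed
  ultimately have "(SUM v:V. (m v)^2) <= (SUM v:V. (\<sigma> v)^2)" by (intro m(2)) (auto simp: Ad_def)
  also have "... <= (SUM v:V. (ro v)^2)" by (intro sum_mono power_mono) (use ro(1) in \<open>auto simp: \<sigma>_def\<close>)
  finally show "(SUM v:V. (m v)^2) <= (SUM v:V. (ro v)^2)" .
 qed
qed

text \<open>First variation: along the segment from \<open>m\<close> to \<open>ro\<close> the energy
  is a quadratic in \<open>t\<close> that does not drop below its value at 0, so its linear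
  coefficient is nonnegative.\<close>

lemma minimizer_variation:
 fixes m ro :: "'v => real"
 assumes "!!t. 0 < t ==> t <= 1 ==> (SUM v:V. (m v)^2) <= (SUM v:V. (m v + t * (ro v - m v))^2)"
 shows "(SUM v:V. (m v)^2) <= (SUM v:V. m v * ro v)"
proof (rule ccontr)
 define p where "p = (SUM v:V. m v * (ro v - m v))"
 define q where "q = (SUM v:V. (ro v - m v)^2)"
 assume "~ ?thesis"
 hence p: "p < 0" by (simp add: p_def algebra_simps sum_subtractf power2_eq_square)
 have q: "0 <= q" unfolding q_def by (simp add: sum_nonneg)
 have eq: "(SUM v:V. (m v + t * (ro v - m v))^2) = (SUM v:V. (m v)^2) + 2 * t * p + t\<^sup>2 * q" for t
 proof -
  have "(m v + t * (ro v - m v))^2 = (m v)^2 + (2 * t) * (m v * (ro v - m v)) + t\<^sup>2 * (ro v - m v)^2" for v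
   by (simp add: power2_eq_square algebra_simps)
  thus ?thesis by (simp add: sum.distrib p_def q_def sum_distrib_left)
 qed
 \<comment> \<open>Small enough for the linear term \<open>2 * t * p\<close> to outweigh
   \<open>t\<^sup>2 * q\<close>; the \<open>+ 1\<close> covers \<open>q = 0\<close>.\<close>
 define t where "t = min 1 (- p / (q + 1))"
 have t: "0 < t" "t <= 1" "t <= - p / (q + 1)" using p q by (auto simp: t_def divide_neg_pos)
 hence t3: "t * (q + 1) <= - p" using q pos_le_divide_eq[of "q + 1" t "- p"] by linarith
 have "0 <= 2 * t * p + t\<^sup>2 * q" using assms[OF t(1,2)] eq[of t] by linarith
 hence "0 <= t * (2 * p + t * q)" by (simp add: power2_eq_square algebra_simps)
 hence "0 <= 2 * p + t * q" using t(1) by (simp add: zero_le_mult_iff)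
 moreover have "t * q <= - p" using t t3 by (simp add: algebra_simps)
 ultimately show False using p by linarith
qed

text \<open>The weight of \<open>v\<close> itself is counted, so this is the far end of the square
  of \<open>v\<close>, and subtracting \<open>m v\<close> gives the near end. Connected sets stand
  in for paths; with nonnegative weights the minimum is the same.\<close>

definition side_dist :: "('v => 'v => bool) => 'v set => ('v => real) => 'v set => 'v => real" where
 "side_dist adj V m S v = Min (sum m ` {C. C <= V & gconn adj C & v : C & C Int S ~= {}})"

context
 fixes V :: "'v set" and adj :: "'v => 'v => bool" and m :: "'v => real" and S :: "'v set"
 assumes fin: "finite V" and sym: "symp adj" and conn: "gconn adj V"
  and S: "S <= V" "S ~= {}" and m0: "ALL v. 0 <= m v"
begin

lemma side_dist_le: "C <= V ==> gconn adj C ==> v : C ==> C Int S ~= {} ==> side_dist adj V m S v <= sum m C"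
 unfolding side_dist_def by (rule Min_le) (use fin in auto)

lemma side_dist_attained:
 assumes "v : V"
 obtains C where "C <= V" "gconn adj C" "v : C" "C Int S ~= {}" "sum m C = side_dist adj V m S v"
proof -
 let ?F = "{C. C <= V & gconn adj C & v : C & C Int S ~= {}}"
 have "V : ?F" using assms conn S by auto
 hence "Min (sum m ` ?F) : sum m ` ?F" using fin by (intro Min_in) auto
 then obtain C where "C : ?F" "Min (sum m ` ?F) = sum m C" by blast
 thus ?thesis using that[of C] unfolding side_dist_def by simp
qed

lemma side_dist_ge: assumes "v : V" shows "m v <= side_dist adj V m S v"
proof -
 obtain C where C: "C <= V" "v : C" "sum m C = side_dist adj V m S v" using side_dist_attained[OF assms] by metis
 thus ?thesis using member_le_sum[of v C m] m0 fin finite_subset by metis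
qed

lemma side_dist_side: assumes "v : S" shows "side_dist adj V m S v = m v" using side_dist_ge[of v] side_dist_le[of "{v}" v] assms S by fastforce

lemma side_dist_adj:
 assumes "v : V" "w : V" "adj v w"
 shows "side_dist adj V m S w <= side_dist adj V m S v + m w"
proof -
 obtain C where C: "C <= V" "gconn adj C" "v : C" "C Int S ~= {}" "sum m C = side_dist adj V m S v"
  using side_dist_attained[OF assms(1)] by metis
 have "side_dist adj V m S w <= sum m (insert w C)" by (rule side_dist_le) (use C assms gconn_insert[OF sym C(2,3) assms(3)] in auto)
 also have "... <= sum m C + m w" using C(1) fin spec[OF m0, of w] finite_subset[of C V] by (cases "w : C") (auto simp: insert_absorb)
 finally show ?thesis using C by simp
qed

end

text \<open>Area count: the squares have total area \<open>A\<close>, exactly that of the rectangle,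
  so removing the open set \<open>U\<close> from one of them leaves too little area for a
  covering.\<close>

lemma box_cover_no_waste:
 fixes X Y m :: "'v => real" and V
 defines "Z \<equiv> %v. cbox (X v, Y v) (X v + m v, Y v + m v)"
 assumes fin: "finite V" and m: "!!v. v : V ==> 0 <= m v" and A: "A = (SUM v:V. (m v)^2)"
  and w: "w : V" and U: "open U" "U ~= {}" "U <= Z w"
  and cov: "cbox (0::real, 0::real) (1, A) <= (UN v:V - {w}. Z v) Un (Z w - U)"
 shows False
proof -
 have A0: "0 <= A" unfolding A by (simp add: sum_nonneg)
 have mZ: "measure lebesgue (Z v) = (m v)^2" if "v : V" for v using m[OF that] by (simp add: Z_def content_Pair power2_eq_square)
 have lZ: "Z v : lmeasurable" for v by (simp add: Z_def)
 have lU: "U : lmeasurable" using U by (intro lmeasurable_open) (auto simp: Z_def intro: bounded_subset[OF bounded_cbox])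
 have pU: "0 < measure lebesgue U" using U lU negligible_iff_measure0 open_not_negligible by (metis measure_nonneg order_le_less)
 have "A = measure lebesgue (cbox (0::real, 0::real) (1, A))" using A0 by (simp add: content_Pair)
 also have "... <= measure lebesgue ((UN v:V - {w}. Z v) Un (Z w - U))"
  by (intro measure_mono_fmeasurable cov fmeasurable.Un fmeasurable.finite_UN)
   (use fin lZ lU in "auto")
 also have "... <= measure lebesgue (UN v:V - {w}. Z v) + measure lebesgue (Z w - U)"
  by (intro measure_Un_le) (use fin lZ lU in "auto")
 also have "measure lebesgue (UN v:V - {w}. Z v) <= (SUM v:V - {w}. measure lebesgue (Z v))"
  by (intro measure_UNION_le) (use fin lZ in "auto")
 also have "(SUM v:V - {w}. measure lebesgue (Z v)) = (SUM v:V - {w}. (m v)^2)" by (intro sum.cong) (auto simp: mZ)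
 also have "measure lebesgue (Z w - U) = (m w)^2 - measure lebesgue U"
  using U(3) lU lZ mZ[OF w] by (subst measurable_measure_Diff) (auto intro: fmeasurableD)
 finally have "A <= (SUM v:V - {w}. (m v)^2) + ((m w)^2 - measure lebesgue U)" by simp
 also have "... = A - measure lebesgue U" unfolding A using fin w by (simp add: sum.remove)
 finally show False using pU by simp
qed

text \<open>\<open>cross\<close> and \<open>block\<close> are the two halves of the duality between
  left-right and bottom-top chains. The minimiser \<open>m\<close> gives left-right chains length at
  least 1, and duality gives bottom-top chains length at least the energy \<open>A\<close>. The
  squares placed by the two distance functions then cover the 1 by \<open>A\<close> rectangle with
  total area \<open>A\<close>.\<close>

theorem square_tiling_exists:
 fixes V :: "'v set"
 assumes fin: "finite V" and sym: "symp adj" and conn: "gconn adj V"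
  and sides: "L <= V" "R <= V" "B <= V" "T <= V"
  and cross: "!!C D. C <= V ==> gconn adj C ==> C Int L ~= {} ==> C Int R ~= {} ==>
    D <= V ==> gconn adj D ==> D Int B ~= {} ==> D Int T ~= {} ==> C Int D ~= {}"
  and block: "!!W. W <= V ==>
    (!!C. C <= V ==> gconn adj C ==> C Int L ~= {} ==> C Int R ~= {} ==> C Int W ~= {}) ==>
    EX D<=W. gconn adj D & D Int B ~= {} & D Int T ~= {}"
 obtains X Y m A where "square_tiling V adj X Y m L R B T 1 A"
proof -
 define \<C> where "\<C> = {C. C <= V & gconn adj C & C Int L ~= {} & C Int R ~= {}}"
 have CV: "ALL C:\<C>. C <= V & C ~= {}" by (auto simp: \<C>_def)
 obtain m :: "'v => real" where m': "(ALL v. 0 <= m v) & (ALL C:\<C>. 1 <= sum m C) &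
  (ALL ro. (ALL v:V. 0 <= ro v) --> (ALL C:\<C>. 1 <= sum ro C) -->
   (SUM v:V. (m v)^2) <= (SUM v:V. (ro v)^2))" using admissible_minimizer[OF fin CV] by (elim exE)
 have m0: "ALL v. 0 <= m v" using m' by blast
 have m: "!!v. 0 <= m v" and mC: "!!C. C : \<C> ==> 1 <= sum m C" using m' by blast+
 have min: "(SUM v:V. (m v)^2) <= (SUM v:V. (ro v)^2)"
  if "!!v. v : V ==> 0 <= ro v" "!!C. C : \<C> ==> 1 <= sum ro C" for ro using m' that by simp
 have "\<C> ~= {}"
 proof
  assume "\<C> = {}"
  hence "EX D<={}. gconn adj D & D Int B ~= {} & D Int T ~= {}" by (intro block) (auto simp: \<C>_def)
  thus False by blast
 qed
 then obtain C0 where C0: "C0 : \<C>" by blast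
 have LR: "L ~= {}" "R ~= {}" using C0 by (auto simp: \<C>_def)
 have "EX D<=V. gconn adj D & D Int B ~= {} & D Int T ~= {}" by (intro block) auto
 hence BT: "B ~= {}" "T ~= {}" by auto
 define A where "A = (SUM v:V. (m v)^2)"
 have Apos: "0 < A"
 proof (rule ccontr)
  assume "~ ?thesis"
  hence "A = 0" using sum_nonneg[of V "%v. (m v)^2"] by (simp add: A_def)
  hence "!!v. v : V ==> m v = 0" using fin by (simp add: A_def sum_nonneg_eq_0_iff)
  hence "sum m C0 = 0" using C0 by (intro sum.neutral) (auto simp: \<C>_def)
  thus False using mC[OF C0] by simp
 qed
 \<comment> \<open>The indicator of \<open>D\<close> is admissible since every left-right chain
   meets \<open>D\<close>; the claim is the first variation at \<open>m\<close> in its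
   direction.\<close>
 have BTlen: "A <= sum m D" if D: "D <= V" "gconn adj D" "D Int B ~= {}" "D Int T ~= {}" for D
 proof -
  define ro where "ro v = (if v : D then 1 else 0 :: real)" for v
  have "A <= (SUM v:V. m v * ro v)" unfolding A_def
  proof (rule minimizer_variation)
   fix t :: real assume t: "0 < t" "t <= 1"
   have eq: "m v + t * (ro v - m v) = (1 - t) * m v + t * ro v" for v by (simp add: algebra_simps)
   show "(SUM v:V. (m v)^2) <= (SUM v:V. (m v + t * (ro v - m v))^2)"
   proof (rule min)
    show "0 <= m v + t * (ro v - m v)" for v unfolding eq using t m by (simp add: ro_def)
    fix C assume C: "C : \<C>"
    then obtain c where c: "c : C" "c : D" using cross[of C D] D by (auto simp: \<C>_def)
    have "finite C" using C fin finite_subset by (auto simp: \<C>_def)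
    hence "ro c <= sum ro C" using c by (intro member_le_sum) (auto simp: ro_def)
    hence "1 <= sum ro C" using c by (simp add: ro_def)
    moreover have "(1 - t) * 1 + t * 1 <= (1 - t) * sum m C + t * sum ro C"
     using t mC[OF C] \<open>1 <= sum ro C\<close> by (intro add_mono mult_left_mono) auto
    ultimately show "1 <= (SUM v:C. m v + t * (ro v - m v))" unfolding eq by (simp add: sum.distrib sum_distrib_left)
   qed
  qed
  also have "... = (SUM v:D. m v)" unfolding ro_def using fin D(1) by (simp add: sum.If_cases if_distrib Int_absorb1 cong: if_cong)
  finally show ?thesis .
 qed
 define x where "x = side_dist adj V m L"
 define y where "y = side_dist adj V m B"
 note xs = side_dist_le[OF fin sym conn sides(1) LR(1) m0] side_dist_attained[OF fin sym conn sides(1) LR(1) m0]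
  side_dist_ge[OF fin sym conn sides(1) LR(1) m0] side_dist_side[OF fin sym conn sides(1) LR(1) m0]
  side_dist_adj[OF fin sym conn sides(1) LR(1) m0]
 note ys = side_dist_le[OF fin sym conn sides(3) BT(1) m0] side_dist_attained[OF fin sym conn sides(3) BT(1) m0]
  side_dist_ge[OF fin sym conn sides(3) BT(1) m0] side_dist_side[OF fin sym conn sides(3) BT(1) m0]
  side_dist_adj[OF fin sym conn sides(3) BT(1) m0]
 have xm: "m v <= x v" "m v <= y v" if "v : V" for v using xs(3)[OF that] ys(3)[OF that] by (auto simp: x_def y_def)
 have xL: "x v = m v" if "v : L" for v using xs(4)[OF that] by (simp add: x_def)
 have yB: "y v = m v" if "v : B" for v using ys(4)[OF that] by (simp add: y_def)
 have xadj: "x w - m w <= x v" "y w - m w <= y v" if "v : V" "w : V" "adj v w" for v w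
  using xs(5)[OF that] ys(5)[OF that] by (auto simp: x_def y_def)
 have xR: "1 <= x v" if "v : R" for v
 proof -
  have "v : V" using that sides by blast
  then obtain C where "C <= V" "gconn adj C" "v : C" "C Int L ~= {}" "sum m C = x v" using xs(2) unfolding x_def by metis
  thus ?thesis using mC[of C] that by (auto simp: \<C>_def)
 qed
 have yT: "A <= y v" if "v : T" for v
 proof -
  have "v : V" using that sides by blast
  then obtain C where "C <= V" "gconn adj C" "v : C" "C Int B ~= {}" "sum m C = y v" using ys(2) unfolding y_def by metis
  thus ?thesis using BTlen[of C] that by auto
 qed
 have LRmeet: "EX v:C. x v - m v <= a & a <= x v" if C: "C <= V" "gconn adj C" "C Int L ~= {}" "C Int R ~= {}"
  and a: "0 <= a" "a <= 1" for C a
 proof (rule ccontr)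
  assume no: "~ ?thesis"
  obtain l r where lr: "l : C" "l : L" "r : C" "r : R" using C by blast
  have "x l - m l <= a" using xL[OF lr(2)] a by simp
  hence l: "x l < a" using no lr by fastforce
  have r: "~ x r < a" using xR[OF lr(4)] a by simp
  obtain v w where vw: "v : C" "w : C" "x v < a" "~ x w < a" "adj v w"
   using gconn_edge[where P = "%v. x v < a", OF C(2) lr(1) l lr(3) r] by blast
  hence "x w - m w <= x v" using xadj C(1) by blast
  thus False using no vw by force
 qed
 have BTmeet: "EX v:C. y v - m v <= b & b <= y v" if C: "C <= V" "gconn adj C" "C Int B ~= {}" "C Int T ~= {}"
  and b: "0 <= b" "b <= A" for C b
 proof (rule ccontr)
  assume no: "~ ?thesis"
  obtain l r where lr: "l : C" "l : B" "r : C" "r : T" using C by blast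
  have "y l - m l <= b" using yB[OF lr(2)] b by simp
  hence l: "y l < b" using no lr by fastforce
  have r: "~ y r < b" using yT[OF lr(4)] b by simp
  obtain v w where vw: "v : C" "w : C" "y v < b" "~ y w < b" "adj v w"
   using gconn_edge[where P = "%v. y v < b", OF C(2) lr(1) l lr(3) r] by blast
  hence "y w - m w <= y v" using xadj C(1) by blast
  thus False using no vw by force
 qed
 \<comment> \<open>Every left-right chain has a square meeting the line at \<open>a\<close>, so
   these squares block and contain a bottom-top chain.\<close>
 have Vert: "EX D<={v : V. x v - m v <= a & a <= x v}. gconn adj D & D Int B ~= {} & D Int T ~= {}" if a: "0 <= a" "a <= 1" for a
 proof (rule block)
  fix C assume C: "C <= V" "gconn adj C" "C Int L ~= {}" "C Int R ~= {}"
  show "C Int {v : V. x v - m v <= a & a <= x v} ~= {}" using LRmeet[OF C a] C(1) by blast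
 qed auto
 \<comment> \<open>The same duality by contradiction: if the squares at height \<open>b\<close>
   contained no left-right chain, their complement would block and contain a bottom-top chain
   missing height \<open>b\<close>.\<close>
 have Horiz: "EX D<={v : V. y v - m v <= b & b <= y v}. gconn adj D & D Int L ~= {} & D Int R ~= {}" if b: "0 <= b" "b <= A" for b
 proof (rule ccontr)
  let ?W = "{v : V. y v - m v <= b & b <= y v}"
  assume no: "~ ?thesis"
  have "EX D<=V - ?W. gconn adj D & D Int B ~= {} & D Int T ~= {}"
  proof (rule block)
   fix C assume C: "C <= V" "gconn adj C" "C Int L ~= {}" "C Int R ~= {}"
   hence "~ C <= ?W" using no by blast
   thus "C Int (V - ?W) ~= {}" using C(1) by blast
  qed auto
  then obtain D where D: "D <= V - ?W" "gconn adj D" "D Int B ~= {}" "D Int T ~= {}" by blast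
  moreover have "D <= V" using D by blast
  ultimately show False using BTmeet[of D b] b by blast
 qed
 define Z where "Z v = cbox (x v - m v, y v - m v) (x v - m v + m v, y v - m v + m v)" for v
 have cov: "cbox (0::real, 0::real) (1, A) <= (UN v:V. Z v)"
 proof
  fix z :: "real \<times> real" assume "z : cbox (0, 0) (1, A)"
  then obtain a b where z: "z = (a, b)" "0 <= a" "a <= 1" "0 <= b" "b <= A" by (cases z) (auto)
  obtain D where D: "D <= {v : V. x v - m v <= a & a <= x v}" "gconn adj D" "D Int B ~= {}" "D Int T ~= {}" using Vert[of a] z by blast
  then obtain v where "v : D" "y v - m v <= b" "b <= y v" using BTmeet[of D b] z by blast
  hence "v : V" "z : Z v" using D(1) z by (auto simp: Z_def)
  thus "z : (UN v:V. Z v)" by blast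
 qed
 \<comment> \<open>An open part of a square that the covering can spare contradicts the area count.
   This excludes both squares that stick out and overlaps.\<close>
 have waste: False if w: "w : V" and U: "open U" "U ~= {}" "U <= Z w"
  and cov': "cbox (0::real, 0::real) (1, A) Int U <= (UN v:V - {w}. Z v)" for w U
 proof (rule box_cover_no_waste[where X = "%v. x v - m v" and Y = "%v. y v - m v", OF fin m A_def w U(1,2)])
  show "U <= cbox (x w - m w, y w - m w) (x w - m w + m w, y w - m w + m w)" using U(3) by (simp add: Z_def)
  show "cbox (0, 0) (1, A) <= (UN v:V - {w}. cbox (x v - m v, y v - m v) (x v - m v + m v, y v - m v + m v))
    Un (cbox (x w - m w, y w - m w) (x w - m w + m w, y w - m w + m w) - U)" using cov cov' unfolding Z_def by blast
 qed
 have in1: "x v <= 1" if v: "v : V" "0 < m v" for v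
 proof (rule ccontr)
  assume c: "~ ?thesis"
  show False by (rule waste[OF v(1), of "{max 1 (x v - m v)<..<x v} \<times> {y v - m v<..<y v}"])
    (use c v in "auto simp: Z_def intro!: open_Times")
 qed
 have in2: "y v <= A" if v: "v : V" "0 < m v" for v
 proof (rule ccontr)
  assume c: "~ ?thesis"
  show False by (rule waste[OF v(1), of "{x v - m v<..<x v} \<times> {max A (y v - m v)<..<y v}"])
    (use c v in "auto simp: Z_def intro!: open_Times")
 qed
 \<comment> \<open>Area says nothing about squares of side 0. For them the bound spreads along edges
   from \<open>L\<close>: the first square past 1 would have \<open>m w = 0\<close> and hence
   \<open>x w <= x u\<close>.\<close>
 have in1': "x v <= 1" if v: "v : V" for v
 proof (rule ccontr)
  assume c: "~ ?thesis"
  obtain l where l: "l : L" using LR by blast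
  hence l': "l : V" "x l <= 1" using in1[of l] xL[of l] sides by force+
  obtain u w where uw: "u : V" "w : V" "x u <= 1" "~ x w <= 1" "adj u w"
   using gconn_edge[where P = "%v. x v <= 1", OF conn l' v c] by blast
  thus False using xadj(1)[of u w] in1[of w] by fastforce
 qed
 have in2': "y v <= A" if v: "v : V" for v
 proof (rule ccontr)
  assume c: "~ ?thesis"
  obtain l where l: "l : B" using BT by blast
  hence l': "l : V" "y l <= A" using in2[of l] yB[of l] sides Apos by force+
  obtain u w where uw: "u : V" "w : V" "y u <= A" "~ y w <= A" "adj u w"
   using gconn_edge[where P = "%v. y v <= A", OF conn l' v c] by blast
  thus False using xadj(2)[of u w] in2[of w] by fastforce
 qed
 have "square_tiling V adj (%v. x v - m v) (%v. y v - m v) m L R B T 1 A"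
 proof unfold_locales
  show "x v - m v + m v <= x w - m w | x w - m w + m w <= x v - m v |
    y v - m v + m v <= y w - m w | y w - m w + m w <= y v - m v" if vw: "v : V" "w : V" "v ~= w" "0 < m v" "0 < m w" for v w
  proof (rule ccontr)
   assume c: "~ ?thesis"
   let ?U = "{max (x v - m v) (x w - m w)<..<min (x v) (x w)} \<times> {max (y v - m v) (y w - m w)<..<min (y v) (y w)}"
   have U: "?U ~= {}" "?U <= Z w" "?U <= Z v" using c vw by (auto simp: Z_def)
   have "open ?U" by (intro open_Times open_greaterThanLessThan)
   moreover have "cbox (0, 0) (1, A) Int ?U <= (UN u:V - {w}. Z u)" using U(3) vw by blast
   ultimately show False using waste[OF vw(2) _ U(1,2)] by blast
  qed
  show "finite V" by (rule fin)
  show "symp adj" by (rule sym)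
  show "0 <= m v" for v by (rule m)
  show "0 <= x v - m v" "0 <= y v - m v" if "v : V" for v using xm[OF that] by auto
  show "x v - m v + m v <= 1" "y v - m v + m v <= A" if "v : V" for v using in1'[OF that] in2'[OF that] by auto
  show "0 < (1::real)" "0 < A" using Apos by auto
  show "x v - m v <= x w - m w + m w" "y v - m v <= y w - m w + m w" if "v : V" "w : V" "adj v w" for v w
   using xadj[OF that(2,1) sympD[OF sym that(3)]] by auto
  show "x v - m v = 0" if "v : L" for v using xL[OF that] by simp
  show "y v - m v = 0" if "v : B" for v using yB[OF that] by simp
  show "x v - m v + m v = 1" if "v : V" "v : R" for v using xR[OF that(2)] in1'[OF that(1)] by simp
  show "y v - m v + m v = A" if "v : V" "v : T" for v using yT[OF that(2)] in2'[OF that(1)] by simp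
  show "EX D<={v : V. x v - m v <= a & a <= x v - m v + m v}. gconn adj D & D Int B ~= {} & D Int T ~= {}"
   if "0 <= a" "a <= 1" for a using Vert[OF that] by simp
  show "EX D<={v : V. y v - m v <= b & b <= y v - m v + m v}. gconn adj D & D Int L ~= {} & D Int R ~= {}"
   if "0 <= b" "b <= A" for b using Horiz[OF that] by simp
 qed
 thus ?thesis using that by blast
qed

section \<open>Length-area estimates in a square tiling\<close>

definition overlap :: "real => real => real => real => real" where
 "overlap a b l r = max 0 (min b r - max a l)"

lemma overlap_nonneg: "0 <= overlap a b l r" by (simp add: overlap_def)

text \<open>Integrate over \<open>a\<close> the total weight of the intervals containing
  \<open>a\<close>: an average below \<open>c\<close> leaves some value below \<open>c\<close>.
  Finitely many values of \<open>a\<close> can be avoided, which also makes the inequalities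
  strict.\<close>

lemma exists_below_average:
 fixes w l r :: "'v => real"
 assumes fin: "finite V" "finite E" and a: "a1 < a2"
  and avg: "(SUM v:V. w v * overlap a1 a2 (l v) (r v)) < c * (a2 - a1)"
 obtains a where "a1 < a" "a < a2" "a ~: E" "(SUM v:{v : V. l v < a & a < r v}. w v) < c"
proof (rule ccontr)
 assume no: "~ thesis"
 define E' where "E' = E Un {a1, a2} Un l ` V Un r ` V"
 define g where "g a = (SUM v:V. w v * (if a : {l v..r v} then 1 else 0))" for a
 have "((%a. if a : {l v..r v} then 1 else 0) has_integral overlap a1 a2 (l v) (r v)) {a1..a2}" for v
 proof -
  have "((%a::real. 1::real) has_integral overlap a1 a2 (l v) (r v)) ({l v..r v} Int {a1..a2})"
  proof -
   have "measure lborel {max (l v) a1..min (r v) a2} = overlap a1 a2 (l v) (r v)" by (simp add: overlap_def max.commute min.commute max_def)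
   thus ?thesis using has_integral_const_real[of "1::real" "max (l v) a1" "min (r v) a2"] by (simp)
  qed
  thus ?thesis by (subst has_integral_restrict_Int)
 qed
 hence g: "(g has_integral (SUM v:V. w v * overlap a1 a2 (l v) (r v))) {a1..a2}"
  unfolding g_def by (intro has_integral_sum fin has_integral_mult_right)
 have 1: "((%a. if a : E' then c else g a) has_integral (SUM v:V. w v * overlap a1 a2 (l v) (r v))) {a1..a2}"
  by (rule has_integral_spike_finite[OF _ _ g, of E']) (use fin in "auto simp: E'_def")
 have 2: "((%a. c) has_integral c * (a2 - a1)) {a1..a2}" using has_integral_const_real[of c a1 a2] a by (simp add: mult.commute)
 have "c * (a2 - a1) <= (SUM v:V. w v * overlap a1 a2 (l v) (r v))"
 proof (rule has_integral_le[OF 2 1])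
  fix a assume "a : {a1..a2}"
  show "c <= (if a : E' then c else g a)"
  proof (cases "a : E'")
   case False
   hence a: "a1 < a" "a < a2" "a ~: E" using \<open>a : {a1..a2}\<close> by (auto simp: E'_def)
   have "g a = (SUM v:V. if l v < a & a < r v then w v else 0)" unfolding g_def using False by (intro sum.cong) (auto simp: E'_def)
   also have "... = (SUM v:{v : V. l v < a & a < r v}. w v)" using fin by (simp add: sum.inter_filter)
   finally have "g a = (SUM v:{v : V. l v < a & a < r v}. w v)" .
   moreover have "~ (SUM v:{v : V. l v < a & a < r v}. w v) < c" using no a that by blast
   ultimately show ?thesis by simp
  qed simp
 qed
 thus False using avg by simp
qed

text \<open>A generic coordinate misses all edges of squares, so the squares met by its line have
  positive side and are stacked without overlap.\<close>

definition generic :: "'v set => ('v => real) => ('v => real) => real => bool" where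
 "generic V X m a \<longleftrightarrow> (ALL v:V. a ~= X v & a ~= X v + m v)"

definition line :: "'v set => ('v => real) => ('v => real) => real => 'v set" where
 "line V X m a = {v : V. X v < a & a < X v + m v}"

context square_tiling begin

lemma line_iff: "generic V X m a ==> v : V ==> X v <= a ==> a <= X v + m v ==> v : line V X m a" by (auto simp: line_def generic_def)

lemma line_order:
 assumes "u : line V X m a" "v : line V X m a" "u ~= v"
 shows "Y u + m u <= Y v | Y v + m v <= Y u" using disj[of u v] assms by (force simp: line_def)

lemma line_pos: "v : line V X m a ==> 0 < m v" by (simp add: line_def)

text \<open>The chain \<open>D\<close> supplied by \<open>vert\<close> covers every height, while
  squares on a generic line overlap vertically at most in end points; hence no square of the line is
  missing from \<open>D\<close>.\<close>

lemma line_spans: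
 assumes "generic V X m a" "0 <= a" "a <= W"
 shows "gconn adj (line V X m a)" "line V X m a Int B ~= {}" "line V X m a Int T ~= {}"
  and "!!y. 0 <= y ==> y <= H ==> EX v:line V X m a. Y v <= y & y <= Y v + m v"
proof -
 obtain D where D: "D <= {v : V. X v <= a & a <= X v + m v}" "gconn adj D" "D Int B ~= {}" "D Int T ~= {}"
  using vert[OF assms(2,3)] by blast
 have DL: "D <= line V X m a" using D(1) line_iff[OF assms(1)] by blast
 have DV: "D <= V" using D by blast
 have cov: "EX v:D. Y v <= y & y <= Y v + m v" if y: "0 <= y" "y <= H" for y
 proof (rule ccontr)
  assume no: "~ ?thesis"
  obtain l r where lr: "l : D" "l : B" "r : D" "r : T" using D by blast
  have "Y l <= y" using sideB[of l] lr DV y by auto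
  hence l: "Y l + m l < y" using no lr by fastforce
  have r: "~ Y r + m r < y" using sideT[of r] lr DV y by auto
  obtain v w where vw: "v : D" "w : D" "Y v + m v < y" "~ Y w + m w < y" "adj v w"
   using gconn_edge[where P = "%v. Y v + m v < y", OF D(2) lr(1) l lr(3) r] by blast
  have "Y w <= Y v + m v" using touchY[OF _ _ adj_sym[OF vw(5)]] vw DV by blast
  thus False using no vw by force
 qed
 have "line V X m a <= D"
 proof
  fix v assume v: "v : line V X m a"
  hence vV: "v : V" "0 < m v" by (auto simp: line_def)
  obtain w where w: "w : D" "Y w <= Y v + m v / 2" "Y v + m v / 2 <= Y w + m w"
   using cov[of "Y v + m v / 2"] Y_ge[OF vV(1)] Y_le[OF vV(1)] vV by auto
  show "v : D"
  proof (rule ccontr)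
   assume "v ~: D"
   hence "Y v + m v <= Y w | Y w + m w <= Y v" using line_order[OF v, of w] w DL by blast
   thus False using w vV by auto
  qed
 qed
 with DL have "line V X m a = D" by blast
 with D cov show "gconn adj (line V X m a)" "line V X m a Int B ~= {}" "line V X m a Int T ~= {}"
  "!!y. 0 <= y ==> y <= H ==> EX v:line V X m a. Y v <= y & y <= Y v + m v" by auto
qed

lemma line_predecessor:
 assumes a: "generic V X m a" "0 <= a" "a <= W"
  and vw: "v : line V X m a" "w : line V X m a" "Y v < Y w"
 obtains u where "u : line V X m a" "Y u + m u = Y w" "adj u w"
proof -
 let ?P = "%u. Y u + m u <= Y w"
 have "?P v" using line_order[OF vw(1,2)] vw(3) line_pos[OF vw(2)] by force
 moreover have "~ ?P w" using line_pos[OF vw(2)] by simp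
 ultimately obtain u z where uz: "u : line V X m a" "z : line V X m a" "?P u" "~ ?P z" "adj u z"
  using gconn_edge[where P = ?P, OF line_spans(1)[OF a] vw(1) _ vw(2)] by blast
 have "Y z <= Y u + m u" using touchY[of z u] adj_sym[OF uz(5)] uz by (simp add: line_def)
 moreover have "z = w | Y w + m w <= Y z" using line_order[OF uz(2) vw(2)] uz(4) by blast
 ultimately have "z = w" using uz(3) line_pos[OF vw(2)] by linarith
 thus ?thesis using that[of u] uz \<open>Y z <= Y u + m u\<close> by force
qed

text \<open>In a separation of \<open>S\<close>, take the part holding the lowest square and then
  the lowest square outside that part. The square directly below it on the line is adjacent to it,
  convexity puts it in \<open>S\<close>, and it belongs to the first part.\<close>

lemma line_segment_gconn:
 assumes a: "generic V X m a" "0 <= a" "a <= W"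
  and S: "S <= line V X m a"
  and conv: "!!u v w. u : S ==> w : S ==> v : line V X m a ==> Y u <= Y v ==> Y v <= Y w ==> v : S"
 shows "gconn adj S"
proof (rule gconnI)
 fix A p q assume A: "A <= S" "p : A" "q : S" "q ~: A"
  and no: "!!x y. x : A ==> y : S ==> y ~: A ==> ~ adj x y"
 have finS: "finite S" using S finV finite_subset by (fastforce simp: line_def)
 define v0 where "v0 = arg_min_on Y S"
 have v0: "v0 : S" "!!v. v : S ==> Y v0 <= Y v"
  using arg_min_if_finite[OF finS, of Y] arg_min_least[OF finS, of _ Y] A unfolding v0_def by auto
 have *: False if A1: "v0 : A1" "A1 <= S" "q1 : S" "q1 ~: A1"
   and no1: "!!x y. x : A1 ==> y : S - A1 ==> ~ adj x y" for A1 q1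
 proof -
  have fin1: "finite (S - A1)" "S - A1 ~= {}" using finS A1 by auto
  define w where "w = arg_min_on Y (S - A1)"
  have w: "w : S - A1" "!!v. v : S - A1 ==> Y w <= Y v"
   using arg_min_if_finite[OF fin1, of Y] arg_min_least[OF fin1, of _ Y] unfolding w_def by auto
  have wl: "w : line V X m a" "v0 : line V X m a" "w ~= v0" using w S A1 by auto
  have "Y v0 < Y w" using line_order[OF wl] line_pos[OF wl(1)] line_pos[OF wl(2)] v0(2)[of w] w by force
  then obtain u where u: "u : line V X m a" "Y u + m u = Y w" "adj u w" using line_predecessor[OF a wl(2,1)] by blast
  have "Y v0 <= Y u" using line_order[OF wl(2) u(1)] u(2) \<open>Y v0 < Y w\<close> line_pos[OF wl(2)] by force
  hence uS: "u : S" using conv[OF v0(1) _ u(1), of w] w u line_pos[OF u(1)] by force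
  have "u : A1" using w(2)[of u] uS u(2) line_pos[OF u(1)] by force
  thus False using no1[of u w] u w by blast
 qed
 show False
 proof (cases "v0 : A")
  case True thus False using *[of A q] A no by blast
 next
  case False
  show False by (rule *[of "S - A" p]) (use A False v0 no adj_sym in blast)+
 qed
qed

text \<open>Each product of overlaps is the area of a square clipped to the window, and clipped
  squares meet in null sets.\<close>

lemma pack:
 shows "(SUM v:V. overlap a1 a2 (X v) (X v + m v) * overlap b1 b2 (Y v) (Y v + m v))
   <= max 0 (a2 - a1) * max 0 (b2 - b1)"
proof -
 define f where "f v = cbox (max a1 (X v), max b1 (Y v)) (min a2 (X v + m v), min b2 (Y v + m v))" for v
 have mf: "measure lebesgue (f v) = overlap a1 a2 (X v) (X v + m v) * overlap b1 b2 (Y v) (Y v + m v)" for v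
  by (auto simp: f_def content_Pair overlap_def max_def)
 have "(SUM v:V. measure lebesgue (f v)) = measure lebesgue (\<Union>(f ` V))"
 proof (rule measure_negligible_finite_Union_image[symmetric, OF finV])
  show "f v : lmeasurable" for v by (simp add: f_def)
  show "pairwise (%x y. negligible (f x Int f y)) V"
  proof (rule pairwiseI)
   fix u v assume uv: "u : V" "v : V" "u ~= v"
   let ?I = "cbox (max (X u) (X v), max (Y u) (Y v)) (min (X u + m u) (X v + m v), min (Y u + m u) (Y v + m v))"
   have sub: "f u Int f v <= ?I" by (auto simp: f_def)
   have "measure lebesgue ?I = 0"
   proof (cases "m u = 0 | m v = 0")
    case True
    thus ?thesis by (auto simp: content_Pair max_def min_def)
   next
    case False
    hence "0 < m u" "0 < m v" using m_nonneg[OF uv(1)] m_nonneg[OF uv(2)] by auto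
    from disj[OF uv this] show ?thesis by (auto simp: content_Pair min_def)
   qed
   hence "negligible ?I" by (simp add: negligible_iff_measure)
   thus "negligible (f u Int f v)" using sub negligible_subset by blast
  qed
 qed
 also have "... <= measure lebesgue (cbox (a1, b1) (a2, b2))"
 proof (rule measure_mono_fmeasurable)
  show "\<Union> (f ` V) <= cbox (a1, b1) (a2, b2)" by (auto simp: f_def)
  show "\<Union> (f ` V) : sets lebesgue" by (intro fmeasurableD fmeasurable.finite_UN finV) (simp add: f_def)
  show "cbox (a1, b1) (a2, b2) : lmeasurable" by (rule lmeasurable_cbox)
 qed
 also have "... = max 0 (a2 - a1) * max 0 (b2 - b1)" by (simp add: content_Pair)
 finally show ?thesis by (simp add: mf)
qed

lemma pack_le:
 assumes "0 <= a2 - a1" "0 <= b2 - b1" "G <= V"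
  and "!!v. v : G ==> c v <= overlap a1 a2 (X v) (X v + m v) * overlap b1 b2 (Y v) (Y v + m v)"
 shows "(SUM v:G. c v) <= (a2 - a1) * (b2 - b1)"
proof -
 have "(SUM v:G. c v) <= (SUM v:G. overlap a1 a2 (X v) (X v + m v) * overlap b1 b2 (Y v) (Y v + m v))" by (rule sum_mono) (rule assms(4))
 also have "... <= (SUM v:V. overlap a1 a2 (X v) (X v + m v) * overlap b1 b2 (Y v) (Y v + m v))"
  by (rule sum_mono2) (use assms finV in "auto simp: overlap_def")
 also have "... <= (a2 - a1) * (b2 - b1)" using pack[of a1 a2 b1 b2] assms by simp
 finally show ?thesis .
qed

text \<open>Averaging the weight of the line over \<open>a\<close> and Cauchy-Schwarz bound the mean
  by the energy and the sum of squared horizontal overlaps. That sum is controlled because the tiles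
  are squares: in the window enlarged by \<open>a2 - a1\<close> the vertical overlap is at least the
  horizontal one, so packing applies.\<close>

lemma cheap_line:
 fixes ro :: "'v => real"
 assumes a: "0 <= a1" "a1 < a2" "a2 <= W" and b: "b1 <= b2" and ro: "!!v. v : V ==> 0 <= ro v" and c: "0 < c"
  and en: "(SUM v:V. (ro v)^2) * (b2 - b1 + 2 * (a2 - a1)) < c\<^sup>2 * (a2 - a1)"
 obtains a where "a1 < a" "a < a2" "generic V X m a"
  "(SUM v:{v : line V X m a. Y v <= b2 & b1 <= Y v + m v}. ro v) < c"
proof -
 define h where "h = a2 - a1"
 define G where "G = {v : V. Y v <= b2 & b1 <= Y v + m v}"
 define o' where "o' v = overlap a1 a2 (X v) (X v + m v)" for v
 have h: "0 < h" using a by (simp add: h_def)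
 have "(SUM v:G. (o' v)^2) <= (a2 - a1) * ((b2 + h) - (b1 - h))"
 proof (rule pack_le)
  fix v assume v: "v : G"
  hence vV: "v : V" "0 <= m v" using m_nonneg by (auto simp: G_def)
  have "o' v <= overlap (b1 - h) (b2 + h) (Y v) (Y v + m v)" using v b by (auto simp: o'_def G_def overlap_def h_def max_def min_def)
  thus "(o' v)^2 <= overlap a1 a2 (X v) (X v + m v) * overlap (b1 - h) (b2 + h) (Y v) (Y v + m v)"
   unfolding power2_eq_square o'_def by (intro mult_left_mono) (auto simp: overlap_nonneg)
 qed (use b h in "auto simp: G_def h_def")
 hence en_o: "(SUM v:G. (o' v)^2) <= h * (b2 - b1 + 2 * h)" by (simp add: h_def algebra_simps)
 have "(SUM v:G. ro v * o' v)^2 <= (SUM v:G. (ro v)^2) * (SUM v:G. (o' v)^2)" by (rule Cauchy_Schwarz_ineq_sum)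
 also have "... <= (SUM v:V. (ro v)^2) * (h * (b2 - b1 + 2 * h))"
  by (intro mult_mono en_o sum_mono2 finV sum_nonneg) (auto simp: G_def)
 also have "... < c\<^sup>2 * h * h" using mult_strict_right_mono[OF en h] by (simp add: h_def mult_ac)
 finally have "(SUM v:G. ro v * o' v)^2 < (c * h)^2" by (simp add: power2_eq_square mult_ac)
 hence lt: "(SUM v:G. ro v * o' v) < c * (a2 - a1)" using c h by (simp add: h_def power2_less_imp_less)
 obtain a where aa: "a1 < a" "a < a2" "a ~: X ` V Un (%v. X v + m v) ` V"
  "(SUM v:{v : G. X v < a & a < X v + m v}. ro v) < c"
  by (rule exists_below_average[where V = G and w = ro and l = X and r = "%v. X v + m v" and E =
     "X ` V Un (%v. X v + m v) ` V", OF _ _ a(2) lt[unfolded o'_def]]) (use finV in "auto simp: G_def")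
 have "{v : G. X v < a & a < X v + m v} = {v : line V X m a. Y v <= b2 & b1 <= Y v + m v}" by (auto simp: G_def line_def)
 thus ?thesis using that[of a] aa by (auto simp: generic_def)
qed

text \<open>Each generic vertical line through the square \<open>j\<close> carries a chain from
  \<open>B\<close> to \<open>j\<close> of weight at least 1. The squares below \<open>j\<close> over
  its width have clipped area at most \<open>m j * Y j\<close>, and Cauchy-Schwarz
  concludes.\<close>

lemma wall_distance:
 fixes ro :: "'v => real"
 assumes j: "j : V" "0 < m j" "j ~: B" and ro: "!!v. v : V ==> 0 <= ro v"
  and adm: "!!C. C <= V - {j} ==> gconn adj C ==> C Int B ~= {} ==> (EX v:C. adj v j) ==> 1 <= sum ro C"
 shows "m j <= Y j * (SUM v:V. (ro v)^2)"
proof -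
 define G where "G = {v : V. Y v < Y j & Y v + m v <= Y j}"
 define o' where "o' v = overlap (X j) (X j + m j) (X v) (X v + m v)" for v
 have "1 * (X j + m j - X j) <= (SUM v:G. ro v * o' v)"
 proof (rule ccontr)
  assume "~ ?thesis"
  hence lt: "(SUM v:G. ro v * o' v) < 1 * (X j + m j - X j)" by simp
  have jj: "X j < X j + m j" using j by simp
  obtain a where a: "X j < a" "a < X j + m j" "a ~: X ` V Un (%v. X v + m v) ` V"
   "(SUM v:{v : G. X v < a & a < X v + m v}. ro v) < 1"
   by (rule exists_below_average[where V = G and w = ro and l = X and r = "%v. X v + m v" and E =
     "X ` V Un (%v. X v + m v) ` V", OF _ _ jj lt[unfolded o'_def]]) (use finV in "auto simp: G_def")
  have gen: "generic V X m a" "0 <= a" "a <= W" using a X_ge[OF j(1)] X_le[OF j(1)] by (auto simp: generic_def)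
  have jl: "j : line V X m a" using a j by (simp add: line_def)
  define C where "C = {v : line V X m a. Y v < Y j}"
  have Cm: "Y v + m v <= Y j" if "v : C" for v using line_order[of v a j] that jl line_pos[OF jl] by (force simp: C_def)
  have CG: "C = {v : G. X v < a & a < X v + m v}" using Cm by (auto simp: C_def G_def line_def)
  obtain v0 where v0: "v0 : line V X m a" "v0 : B" using line_spans(2)[OF gen] by blast
  have "Y v0 = 0" using sideB v0 by (auto simp: line_def)
  hence "Y v0 < Y j" using line_order[OF v0(1) jl] line_pos[OF v0(1)] v0 j Y_ge[OF j(1)] by force
  hence v0C: "v0 : C" using v0 by (simp add: C_def)
  obtain u where u: "u : line V X m a" "Y u + m u = Y j" "adj u j" using line_predecessor[OF gen v0(1) jl \<open>Y v0 < Y j\<close>] by blast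
  hence "u : C" using line_pos[OF u(1)] by (simp add: C_def)
  have "1 <= sum ro C"
  proof (rule adm)
   show "C <= V - {j}" by (auto simp: C_def line_def)
   show "gconn adj C" by (rule line_segment_gconn[OF gen]) (auto simp: C_def)
   show "C Int B ~= {}" using v0C v0 by blast
   show "EX v:C. adj v j" using u \<open>u : C\<close> by blast
  qed
  thus False using a(4) CG by simp
 qed
 hence 1: "m j <= (SUM v:G. ro v * o' v)" by simp
 have "(SUM v:G. (o' v)^2) <= (X j + m j - X j) * (Y j - 0)"
 proof (rule pack_le)
  fix v assume v: "v : G"
  hence vV: "v : V" "0 <= m v" "0 <= Y v" using m_nonneg Y_ge by (auto simp: G_def)
  have "o' v <= overlap 0 (Y j) (Y v) (Y v + m v)" using v vV by (auto simp: o'_def G_def overlap_def max_def min_def)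
  thus "(o' v)^2 <= overlap (X j) (X j + m j) (X v) (X v + m v) * overlap 0 (Y j) (Y v) (Y v + m v)"
   unfolding power2_eq_square o'_def by (intro mult_left_mono) (auto simp: overlap_nonneg)
 qed (use j Y_ge[OF j(1)] in \<open>auto simp: G_def\<close>)
 hence en_o: "(SUM v:G. (o' v)^2) <= m j * Y j" by simp
 have "m j * m j <= (SUM v:G. ro v * o' v)^2" using 1 j unfolding power2_eq_square by (intro mult_mono) auto
 also have "... <= (SUM v:G. (ro v)^2) * (SUM v:G. (o' v)^2)" by (rule Cauchy_Schwarz_ineq_sum)
 also have "... <= (SUM v:V. (ro v)^2) * (m j * Y j)" by (intro mult_mono en_o sum_mono2 finV sum_nonneg) (auto simp: G_def)
 finally have "m j * m j <= m j * (Y j * (SUM v:V. (ro v)^2))" by (simp add: mult_ac)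
 thus ?thesis using j by simp
qed

text \<open>The same length-area count over all vertical lines of the rectangle. It bounds the
  aspect ratio on one side, and its transposed form on the other.\<close>

lemma crossing_modulus:
 fixes ro :: "'v => real"
 assumes adm: "!!C. C <= V ==> gconn adj C ==> C Int B ~= {} ==> C Int T ~= {} ==> 1 <= sum ro C"
 shows "W <= H * (SUM v:V. (ro v)^2)"
proof -
 define o' where "o' v = overlap 0 W (X v) (X v + m v)" for v
 have "1 * (W - 0) <= (SUM v:V. ro v * o' v)"
 proof (rule ccontr)
  assume "~ ?thesis"
  hence lt: "(SUM v:V. ro v * o' v) < 1 * (W - 0)" by simp
  obtain a where a: "0 < a" "a < W" "a ~: X ` V Un (%v. X v + m v) ` V"
   "(SUM v:{v : V. X v < a & a < X v + m v}. ro v) < 1"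
   by (rule exists_below_average[where V = V and w = ro and l = X and r = "%v. X v + m v" and E =
     "X ` V Un (%v. X v + m v) ` V", OF _ _ W_pos lt[unfolded o'_def]]) (use finV in auto)
  have gen: "generic V X m a" "0 <= a" "a <= W" using a by (auto simp: generic_def)
  have "1 <= sum ro (line V X m a)" by (rule adm) (use line_spans[OF gen] in "auto simp: line_def")
  thus False using a(4) by (simp add: line_def)
 qed
 hence 1: "W <= (SUM v:V. ro v * o' v)" by simp
 have "(SUM v:V. (o' v)^2) <= (W - 0) * (H - 0)"
 proof (rule pack_le)
  fix v assume v: "v : V"
  have "o' v <= overlap 0 H (Y v) (Y v + m v)" using Y_ge[OF v] Y_le[OF v]
   by (auto simp: o'_def overlap_def max_def min_def)
  thus "(o' v)^2 <= overlap 0 W (X v) (X v + m v) * overlap 0 H (Y v) (Y v + m v)"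
   unfolding power2_eq_square o'_def by (intro mult_left_mono) (auto simp: overlap_nonneg)
 qed (use W_pos H_pos in auto)
 hence en_o: "(SUM v:V. (o' v)^2) <= W * H" by simp
 have "W * W <= (SUM v:V. ro v * o' v)^2" using 1 W_pos unfolding power2_eq_square by (intro mult_mono) auto
 also have "... <= (SUM v:V. (ro v)^2) * (SUM v:V. (o' v)^2)" by (rule Cauchy_Schwarz_ineq_sum)
 also have "... <= (SUM v:V. (ro v)^2) * (W * H)" by (intro mult_left_mono en_o sum_nonneg) auto
 finally have "W * W <= W * (H * (SUM v:V. (ro v)^2))" by (simp add: mult_ac)
 thus ?thesis using W_pos by simp
qed

end

section \<open>Networks of lines that bypass an exceptional square\<close>

definition grid_adj :: "nat \<times> nat => nat \<times> nat => bool" where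
 "grid_adj p q \<longleftrightarrow> fst p = fst q & (snd p = Suc (snd q) | snd q = Suc (snd p)) |
   snd p = snd q & (fst p = Suc (fst q) | fst q = Suc (fst p))"

lemma symp_grid_adj: "symp grid_adj" by (auto simp: symp_def grid_adj_def)

lemma interval_gconn: "gconn (%i j. i = Suc j | j = Suc i) {a..b::nat}"
proof (rule gconnI)
 fix A p q assume A: "A <= {a..b}" "p : A" "q : {a..b}" "q ~: A"
  and no: "!!x y. x : A ==> y : {a..b} ==> y ~: A ==> ~ (x = Suc y | y = Suc x)"
 have up: "p + k <= b ==> p + k : A" for k
 proof (induction k)
  case (Suc k)
  hence "p + k : A" by simp
  moreover have "Suc (p + k) : {a..b}" using Suc A by auto
  ultimately show ?case using no[of "p + k" "Suc (p + k)"] by auto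
 qed (use A in simp)
 have down: "a + k <= p ==> p - k : A" for k
 proof (induction k)
  case (Suc k)
  hence "p - k : A" by simp
  moreover have "p - Suc k : {a..b}" "p - k = Suc (p - Suc k)" using Suc A by auto
  ultimately show ?case using no[of "p - k" "p - Suc k"] by auto
 qed (use A in simp)
 show False
 proof (cases "p <= q")
  case True thus False using up[of "q - p"] A by auto
 next
  case False
  hence "a + (p - q) <= p" "p - (p - q) = q" using A by auto
  thus False using down[of "p - q"] A by auto
 qed
qed

lemma column_gconn: "gconn grid_adj ({i} \<times> {a..b})"
proof -
 have "gconn grid_adj (UN l:{a..b}. {(i, l)})" by (rule gconn_UN[OF interval_gconn]) (auto simp: grid_adj_def)
 moreover have "(UN l:{a..b}. {(i, l)}) = {i} \<times> {a..b}" by auto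
 ultimately show ?thesis by simp
qed

lemma row_gconn: "gconn grid_adj ({a..b} \<times> {l})"
proof -
 have "gconn grid_adj (UN i:{a..b}. {(i, l)})" by (rule gconn_UN[OF interval_gconn]) (auto simp: grid_adj_def)
 moreover have "(UN i:{a..b}. {(i, l)}) = {a..b} \<times> {l}" by auto
 ultimately show ?thesis by simp
qed

lemma rectangle_gconn: "gconn grid_adj ({a..b} \<times> {c..d})"
proof -
 have "gconn grid_adj (UN i:{a..b}. {i} \<times> {c..d})" if "c <= d"
  by (rule gconn_UN[OF interval_gconn column_gconn]) (use that in "auto simp: grid_adj_def")
 moreover have "(UN i:{a..b}. {i} \<times> {c..d}) = {a..b} \<times> {c..d}" by auto
 ultimately show ?thesis by (cases "c <= d") auto
qed

text \<open>A block disconnects a window only if it spans it and leaves cells on both sides. A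
  column and a row that miss the block form a hub to which every remaining cell is joined; if there
  is no such pair, what remains is a rectangle.\<close>

lemma grid_minus_block_gconn:
 fixes cl ch rl rh i1 i2 l1 l2 :: nat
 defines "blk \<equiv> %i l. i1 <= i & i < i2 & l1 <= l & l < l2"
 assumes rows: "l1 <= rl ==> rh < l2 ==> rl <= rh ==> i1 <= cl | ch < i2"
  and cols: "i1 <= cl ==> ch < i2 ==> cl <= ch ==> l1 <= rl | rh < l2"
 shows "gconn grid_adj {(i, l). i : {cl..ch} & l : {rl..rh} & ~ blk i l}" (is "gconn _ ?S")
proof (cases "cl <= ch & rl <= rh")
 case False
 hence "?S = {}" by auto
 thus ?thesis by (metis gconn_empty)
next
 case ne: True
 consider (AB) "(EX c:{cl..ch}. ~ (i1 <= c & c < i2))" "(EX r:{rl..rh}. ~ (l1 <= r & r < l2))"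
  | (C) "ALL r:{rl..rh}. l1 <= r & r < l2" | (D) "ALL c:{cl..ch}. i1 <= c & c < i2" by blast
 thus ?thesis
 proof cases
  case AB
  then obtain c r where c: "c : {cl..ch}" "~ (i1 <= c & c < i2)" and r: "r : {rl..rh}" "~ (l1 <= r & r < l2)" by blast
  define hub where "hub = ({c} \<times> {rl..rh}) Un ({cl..ch} \<times> {r})"
  have hub: "gconn grid_adj hub" unfolding hub_def
   by (rule gconn_Un[OF symp_grid_adj column_gconn row_gconn, where c = "(c, r)" and d = "(c, r)"]) (use c r in auto)
  define F where "F p = hub Un (if i1 <= fst p & fst p < i2 then {cl..ch} \<times> {snd p} else {fst p} \<times> {rl..rh})" for p
  have F: "gconn grid_adj (F p)" if "p : ?S" for p
  proof (cases "i1 <= fst p & fst p < i2")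
   case True
   have "gconn grid_adj (hub Un ({cl..ch} \<times> {snd p}))"
    by (rule gconn_Un[OF symp_grid_adj hub row_gconn, where c = "(c, snd p)" and d = "(c, snd p)"])
     (use c that in "auto simp: hub_def")
   thus ?thesis unfolding F_def if_P[OF True] .
  next
   case False
   have "gconn grid_adj (hub Un ({fst p} \<times> {rl..rh}))"
    by (rule gconn_Un[OF symp_grid_adj hub column_gconn, where c = "(fst p, r)" and d = "(fst p, r)"])
     (use r that in "auto simp: hub_def")
   thus ?thesis unfolding F_def if_not_P[OF False] .
  qed
  have cr: "(c, r) : F p" for p using r by (auto simp: F_def hub_def)
  have "gconn grid_adj (UN p:?S. F p)"
  proof (rule gconn_UN[where iadj = "%p q. True"])
   show "gconn (%p q. True) ?S" by (auto simp: gconn_def)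
   show "F p ~= {}" for p using cr by blast
   show "F p Int F q ~= {} | (EX a:F p. EX b:F q. grid_adj a b)" for p q using cr by blast
  qed (rule F)
  moreover have "(UN p:?S. F p) = ?S"
  proof
   have hubS: "hub <= ?S" using c r by (auto simp: hub_def blk_def)
   have "F (i, l) <= ?S" if "i : {cl..ch}" "l : {rl..rh}" "~ blk i l" for i l
   proof (cases "i1 <= i & i < i2")
    case True
    hence "{cl..ch} \<times> {l} <= ?S" using that by (auto simp: blk_def)
    thus ?thesis using hubS True by (simp add: F_def)
   next
    case False
    hence "{i} \<times> {rl..rh} <= ?S" using that by (auto simp: blk_def)
    moreover have "F (i, l) = hub Un {i} \<times> {rl..rh}" unfolding F_def fst_conv if_not_P[OF False] ..
    ultimately show ?thesis using hubS by simp
   qed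
   thus "(UN p:?S. F p) <= ?S" by (intro UN_least) (clarify, blast)
   show "?S <= (UN p:?S. F p)"
   proof
    fix p assume "p : ?S"
    moreover from this have "p : F p" by (cases p) (simp add: F_def)
    ultimately show "p : (UN p:?S. F p)" by blast
   qed
  qed
  ultimately show ?thesis by simp
 next
  case C
  hence "l1 <= rl" "rh < l2" using ne by auto
  hence "i1 <= cl | ch < i2" using rows ne by blast
  thus ?thesis
  proof (cases "i1 <= cl")
   case True
   hence "?S = {max cl i2..ch} \<times> {rl..rh}" using C by (auto simp: blk_def)
   thus ?thesis by (simp add: rectangle_gconn)
  next
   case False
   hence "?S = {cl..min ch (i1 - 1)} \<times> {rl..rh}" using C \<open>i1 <= cl | ch < i2\<close> by (auto simp: blk_def)
   thus ?thesis by (simp add: rectangle_gconn)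
  qed
 next
  case D
  hence "i1 <= cl" "ch < i2" using ne by auto
  hence "l1 <= rl | rh < l2" using cols ne by blast
  thus ?thesis
  proof (cases "l1 <= rl")
   case True
   hence "?S = {cl..ch} \<times> {max rl l2..rh}" using D by (auto simp: blk_def)
   thus ?thesis by (simp add: rectangle_gconn)
  next
   case False
   hence "?S = {cl..ch} \<times> {rl..min rh (l1 - 1)}" using D \<open>l1 <= rl | rh < l2\<close> by (auto simp: blk_def)
   thus ?thesis by (simp add: rectangle_gconn)
  qed
 qed
qed

text \<open>\<open>J\<close> holds the exceptional square, if any; the cells with
  \<open>i1 <= i < i2\<close> and \<open>l1 <= l < l2\<close> are the block it covers, empty when
  the chosen lines miss it. The block has as many columns as rows and stays off the border, which
  keeps every window minus the block connected.\<close>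

locale tiling_grid = square_tiling +
 fixes J :: "'a set" and xs ys a b :: "nat => real" and K M i1 i2 l1 l2 :: nat
 assumes J: "J <= V"
  and xs_less: "!!i. i < K ==> xs i < xs (Suc i)" and xs0: "xs 0 = 0" and xsK: "xs K = W"
  and ys_less: "!!i. i < M ==> ys i < ys (Suc i)" and ys0: "ys 0 = 0" and ysM: "ys M = H"
  and a_in: "!!i. i < K ==> xs i < a i & a i < xs (Suc i) & generic V X m (a i)"
  and b_in: "!!l. l < M ==> ys l < b l & b l < ys (Suc l) & generic V Y m (b l)"
  and JX: "!!j i. j : J ==> i < K ==> X j <= a i ==> a i <= X j + m j ==>
    i1 <= i & i < i2 & Y j = ys l1 & Y j + m j = ys l2"
  and JY: "!!j l. j : J ==> l < M ==> Y j <= b l ==> b l <= Y j + m j ==>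
    l1 <= l & l < l2 & X j = xs i1 & X j + m j = xs i2"
  and blockX: "i1 < i2 ==> 0 < i1 & i2 < K & l1 < l2 & l2 - l1 = i2 - i1"
  and blockY: "l1 < l2 ==> 0 < l1 & l2 < M & i1 < i2"
  and blockJ: "i1 < i2 ==> EX j:J. X j = xs i1 & X j + m j = xs i2 & Y j = ys l1 & Y j + m j = ys l2"
begin

lemma tiling_grid_transpose: "tiling_grid V adj Y X m B T L R H W J ys xs b a M K l1 l2 i1 i2"
proof -
 interpret t: square_tiling V adj Y X m B T L R H W by (rule transpose)
 show ?thesis
 proof unfold_locales
  show "0 < l1 & l2 < M & i1 < i2 & i2 - i1 = l2 - l1" if "l1 < l2" using blockY[OF that] blockX by auto
  show "0 < i1 & i2 < K & l1 < l2" if "i1 < i2" using blockX[OF that] by auto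
  show "EX j:J. Y j = ys l1 & Y j + m j = ys l2 & X j = xs i1 & X j + m j = xs i2" if "l1 < l2" using blockY[OF that] blockJ by auto
 qed (fact J xs0 xsK ys0 ysM | (rule xs_less ys_less a_in b_in JX JY; assumption))+
qed

lemma xs_mono: "i <= k ==> k <= K ==> xs i <= xs k"
proof (induction rule: dec_induct)
 case (step n) thus ?case using xs_less[of n] by auto
qed simp

lemma ys_mono: "i <= k ==> k <= M ==> ys i <= ys k"
proof (induction rule: dec_induct)
 case (step n) thus ?case using ys_less[of n] by auto
qed simp

lemma ys_strict: "i < k ==> k <= M ==> ys i < ys k" using ys_mono[of "Suc i" k] ys_less[of i] by force

lemma a_range: "i < K ==> 0 <= a i & a i <= W" using a_in[of i] xs_mono[of 0 i] xs_mono[of "Suc i" K] xs0 xsK by auto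

abbreviation blk where "blk i l \<equiv> i1 <= i & i < i2 & l1 <= l & l < l2"

definition stripe where
 "stripe i l = {v : line V X m (a i). v ~: J & Y v <= ys (Suc l) & ys l <= Y v + m v}"

text \<open>The stripe is an interval of the line, and a square of \<open>J\<close> in between would
  force the cell to be blocked.\<close>

lemma stripe_gconn:
 assumes "i < K" "l < M" "~ blk i l"
 shows "gconn adj (stripe i l)"
proof (rule line_segment_gconn)
 show "generic V X m (a i)" "0 <= a i" "a i <= W" using a_in[OF assms(1)] a_range[OF assms(1)] by auto
 show "stripe i l <= line V X m (a i)" by (auto simp: stripe_def)
 fix u v w assume u: "u : stripe i l" and w: "w : stripe i l" and v: "v : line V X m (a i)" and
  uv: "Y u <= Y v" "Y v <= Y w"
 have pos: "0 < m u" "0 < m v" "0 < m w" using u v w line_pos by (auto simp: stripe_def)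
 have 1: "u = v | Y u + m u <= Y v" using line_order[of u "a i" v] u v uv pos by (force simp: stripe_def)
 have 2: "w = v | Y v + m v <= Y w" using line_order[of v "a i" w] w v uv pos by (force simp: stripe_def)
 have "v ~: J"
 proof
  assume "v : J"
  hence j: "i1 <= i" "i < i2" "Y v = ys l1" "Y v + m v = ys l2" using JX[of v i] v assms(1) by (auto simp: line_def)
  have ne: "u ~= v" "w ~= v" using u w \<open>v : J\<close> by (auto simp: stripe_def)
  have l12: "l1 < l2" "l2 < M" using blockX blockY j by auto
  have "l < l1 | l2 <= l" using assms(3) j by auto
  thus False
  proof
   assume "l < l1"
   hence "ys (Suc l) <= ys l1" using ys_mono[of "Suc l" l1] l12 by auto
   thus False using 2 ne w j pos by (auto simp: stripe_def)
  next
   assume "l2 <= l"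
   hence "ys l2 <= ys l" using ys_mono assms(2) by auto
   thus False using 1 ne u j pos by (auto simp: stripe_def)
  qed
 qed
 thus "v : stripe i l" using u v w uv 1 pos by (auto simp: stripe_def)
qed

lemma stripe_next:
 assumes "i < K" "Suc l < M" "~ blk i l" "~ blk i (Suc l)"
 shows "stripe i l Int stripe i (Suc l) ~= {}"
proof -
 have y: "0 <= ys (Suc l)" "ys (Suc l) <= H" using ys_mono[of 0 "Suc l"] ys_mono[of "Suc l" M] ys0 ysM assms by auto
 obtain v where v: "v : line V X m (a i)" "Y v <= ys (Suc l)" "ys (Suc l) <= Y v + m v"
  using line_spans(4)[of "a i" "ys (Suc l)"] a_in[OF assms(1)] a_range[OF assms(1)] y by blast
 have "v ~: J"
 proof
  assume "v : J"
  hence j: "i1 <= i" "i < i2" "Y v = ys l1" "Y v + m v = ys l2" using JX[of v i] v assms(1) by (auto simp: line_def)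
  have l12: "l1 < l2" "l2 < M" using blockX blockY j by auto
  have "l1 <= Suc l" using ys_strict[of "Suc l" l1] v j l12 by force
  moreover have "Suc l <= l2" using ys_strict[of l2 "Suc l"] v j assms by force
  ultimately show False using assms j l12 by auto
 qed
 moreover have "ys l <= ys (Suc l)" "ys (Suc l) <= ys (Suc (Suc l))" using ys_less[of l] ys_less[of "Suc l"] assms by auto
 ultimately have "v : stripe i l Int stripe i (Suc l)" using v by (auto simp: stripe_def)
 thus ?thesis by blast
qed

text \<open>A point of a grid line next to the row \<open>l0\<close> lies in a stripe of an unblocked cell; when it lies on the
  boundary of the block, the neighbouring row has to be used.\<close>

lemma stripe_hit:
 assumes i: "i < K" and v: "v : V" "v ~: J" "X v <= a i" "a i <= X v + m v" "Y v <= y" "y <= Y v + m v"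
  and l0: "l0 < M" and lo: "0 < l0 ==> b (l0 - 1) <= y" and hi: "Suc l0 < M ==> y <= b (Suc l0)"
 obtains l where "l < M" "l <= Suc l0" "l0 <= Suc l" "~ blk i l" "v : stripe i l"
proof -
 have y0: "0 <= y" "y <= H" using v Y_ge[OF v(1)] Y_le[OF v(1)] by auto
 have vl: "v : line V X m (a i)" using line_iff a_in[OF i] v by blast
 have lo': "ys (l0 - 1) <= y & (0 < l0 --> ys (l0 - 1) < y)"
 proof (cases "l0 = 0")
  case False thus ?thesis using lo b_in[of "l0 - 1"] l0 by force
 qed (use y0 ys0 in simp)
 have hi': "y <= ys (min M (l0 + 2)) & (Suc l0 < M --> y < ys (l0 + 2))"
 proof (cases "Suc l0 < M")
  case True
  hence "y < ys (l0 + 2)" using hi[OF True] b_in[OF True] by simp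
  moreover have "min M (l0 + 2) = l0 + 2" using True by simp
  ultimately show ?thesis by simp
 next
  case False thus ?thesis using y0 ysM l0 by (auto simp: min_def)
 qed
 obtain l where l: "l < M" "l <= Suc l0" "l0 <= Suc l" "ys l <= y" "y <= ys (Suc l)"
 proof -
  have "0 < l0" if "y < ys l0" using that ys0 y0 by (cases l0) auto
  moreover have "Suc l0 < M" if "ys (Suc l0) < y"
  proof (rule ccontr)
   assume "~ Suc l0 < M"
   hence "min M (l0 + 2) = Suc l0" using l0 by auto
   thus False using hi' that by simp
  qed
  ultimately consider "y <= ys l0" "0 < l0" | "ys l0 <= y" "y <= ys (Suc l0)" | "ys (Suc l0) < y" "Suc l0 < M" by linarith
  thus thesis
  proof cases
   case 1 thus thesis using that[of "l0 - 1"] lo' l0 by auto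
  next
   case 2 thus thesis using that[of l0] l0 by auto
  next
   case 3 thus thesis using that[of "Suc l0"] hi' by (auto simp: min_def split: if_splits)
  qed
 qed
 have st: "v : stripe i l'" if "l' < M" "ys l' <= y" "y <= ys (Suc l')" for l' using vl v that by (auto simp: stripe_def)
 show ?thesis
 proof (cases "blk i l")
  case False thus ?thesis using that[of l] st l by blast
 next
  case True
  hence "i1 < i2" by auto
  then obtain j where j: "j : J" "X j = xs i1" "X j + m j = xs i2" "Y j = ys l1" "Y j + m j = ys l2" using blockJ by blast
  have bl: "0 < i1" "i2 < K" "l1 < l2" "0 < l1" "l2 < M" using blockX blockY \<open>i1 < i2\<close> by auto
  have "xs i1 < a i" "a i < xs i2" using a_in[OF i] xs_mono[of i1 i] xs_mono[of "Suc i" i2] True bl i by auto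
  hence jl: "j : line V X m (a i)" using j J by (auto simp: line_def)
  have "v ~= j" using v j by blast
  hence "Y v + m v <= ys l1 | ys l2 <= Y v" using line_order[OF vl jl] j by auto
  thus ?thesis
  proof
   assume "Y v + m v <= ys l1"
   moreover have "ys l1 <= ys l" using ys_mono[of l1 l] True l by auto
   ultimately have y: "y = ys l" "y = ys l1" using v l by auto
   have "l = l1" using ys_strict[of l1 l] True y l by (cases "l = l1") auto
   have "~ l < l0"
   proof
    assume "l < l0"
    hence "l = l0 - 1" "0 < l0" using l by auto
    hence "ys l < y" using lo' by simp
    thus False using y(1) by simp
   qed
   show ?thesis
   proof (rule that[of "l - 1"])
    have "l - 1 < M" "ys (l - 1) <= y" "y <= ys (Suc (l - 1))" using \<open>l = l1\<close> bl l y ys_mono[of "l - 1" l] by auto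
    thus "v : stripe i (l - 1)" by (rule st)
    show "l - 1 < M" "l - 1 <= Suc l0" "l0 <= Suc (l - 1)" "~ blk i (l - 1)" using \<open>l = l1\<close> bl l \<open>~ l < l0\<close> by auto
   qed
  next
   assume "ys l2 <= Y v"
   moreover have "ys (Suc l) <= ys l2" using ys_mono[of "Suc l" l2] True bl by auto
   ultimately have y: "y = ys (Suc l)" "y = ys l2" using v l by auto
   have "Suc l = l2" using ys_strict[of "Suc l" l2] True y bl by (cases "Suc l = l2") auto
   have "~ l0 < l"
   proof
    assume "l0 < l"
    hence "l = Suc l0" "Suc l0 < M" using l by auto
    hence "y < ys (Suc l)" using hi' by simp
    thus False using y(1) by simp
   qed
   show ?thesis
   proof (rule that[of "Suc l"])
    have "Suc l < M" "ys (Suc l) <= y" "y <= ys (Suc (Suc l))" using \<open>Suc l = l2\<close> bl y ys_mono[of "Suc l" "Suc (Suc l)"] by auto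
    thus "v : stripe i (Suc l)" by (rule st)
    show "Suc l < M" "Suc l <= Suc l0" "l0 <= Suc (Suc l)" "~ blk i (Suc l)" using \<open>Suc l = l2\<close> bl l \<open>~ l0 < l\<close> by auto
   qed
  qed
 qed
qed

definition hstripe where
 "hstripe i l = {v : line V Y m (b l). v ~: J & X v <= xs (Suc i) & xs i <= X v + m v}"

definition cross where
 "cross i l = stripe i l Un hstripe i l"

lemma hstripe_gconn:
 assumes "i < K" "l < M" "~ blk i l"
 shows "gconn adj (hstripe i l)"
proof -
 interpret t: tiling_grid V adj Y X m B T L R H W J ys xs b a M K l1 l2 i1 i2 by (rule tiling_grid_transpose)
 show ?thesis using t.stripe_gconn[of l i] assms by (auto simp: hstripe_def t.stripe_def)
qed

lemma hstripe_next:
 assumes "Suc i < K" "l < M" "~ blk i l" "~ blk (Suc i) l"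
 shows "hstripe i l Int hstripe (Suc i) l ~= {}"
proof -
 interpret t: tiling_grid V adj Y X m B T L R H W J ys xs b a M K l1 l2 i1 i2 by (rule tiling_grid_transpose)
 show ?thesis using t.stripe_next[of l i] assms by (auto simp: hstripe_def t.stripe_def)
qed

lemma hstripe_hit:
 assumes l: "l < M" and v: "v : V" "v ~: J" "Y v <= b l" "b l <= Y v + m v" "X v <= x" "x <= X v + m v"
  and i0: "i0 < K" and lo: "0 < i0 ==> a (i0 - 1) <= x" and hi: "Suc i0 < K ==> x <= a (Suc i0)"
 obtains i where "i < K" "i <= Suc i0" "i0 <= Suc i" "~ blk i l" "v : hstripe i l"
proof -
 interpret t: tiling_grid V adj Y X m B T L R H W J ys xs b a M K l1 l2 i1 i2 by (rule tiling_grid_transpose)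
 show ?thesis
 proof (rule t.stripe_hit[OF l v i0 lo hi])
  fix i assume "i < K" "i <= Suc i0" "i0 <= Suc i" "~ (l1 <= l & l < l2 & i1 <= i & i < i2)" "v : t.stripe l i"
  thus thesis by (intro that[of i]) (auto simp: hstripe_def t.stripe_def)
 qed
qed

text \<open>A square containing the intersection point of the two lines lies in both stripes. It is
  not in \<open>J\<close>, since a square of \<open>J\<close> met by both lines makes the cell
  blocked.\<close>

lemma cross_centre:
 assumes "i < K" "l < M" "~ blk i l"
 shows "stripe i l Int hstripe i l ~= {}"
proof -
 interpret t: tiling_grid V adj Y X m B T L R H W J ys xs b a M K l1 l2 i1 i2 by (rule tiling_grid_transpose)
 have b: "0 <= b l" "b l <= H" using t.a_range[OF assms(2)] by auto
 obtain v where v: "v : line V X m (a i)" "Y v <= b l" "b l <= Y v + m v"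
  using line_spans(4)[of "a i" "b l"] a_in[OF assms(1)] a_range[OF assms(1)] b by blast
 have vV: "v : V" using v by (simp add: line_def)
 have h: "v : line V Y m (b l)" using t.line_iff b_in[OF assms(2)] v vV by blast
 have "v ~: J" using JX[of v i] JY[of v l] v assms by (auto simp: line_def)
 hence "v : stripe i l Int hstripe i l" using v h a_in[OF assms(1)] b_in[OF assms(2)] by (auto simp: stripe_def hstripe_def line_def)
 thus ?thesis by blast
qed

lemma cross_gconn:
 assumes "i < K" "l < M" "~ blk i l"
 shows "gconn adj (cross i l)"
proof -
 obtain v where "v : stripe i l" "v : hstripe i l" using cross_centre[OF assms] by blast
 thus ?thesis unfolding cross_def using gconn_Un[OF adj_symp stripe_gconn[OF assms] hstripe_gconn[OF assms], of v v] by simp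
qed

definition window where
 "window i0 l0 n = {(i, l). i : {i0 - n..min (K - 1) (i0 + n)} & l : {l0 - n..min (M - 1) (l0 + n)} & ~ blk i l}"

definition net where
 "net P = (UN (i, l):P. cross i l)"

text \<open>The window has at most \<open>2 * n + 1\<close> columns and rows. If the block covers
  all its rows, these are not cut off by the border, so the block has at least
  \<open>2 * n + 1\<close> rows, hence as many columns, and cannot leave window columns on both
  sides.\<close>

lemma window_gconn: "gconn grid_adj (window i0 l0 n)" unfolding window_def
proof (rule grid_minus_block_gconn)
 assume "l1 <= l0 - n" "min (M - 1) (l0 + n) < l2" "l0 - n <= min (M - 1) (l0 + n)"
 thus "i1 <= i0 - n | min (K - 1) (i0 + n) < i2" using blockX blockY by (auto simp: min_def split: if_splits)
next
 assume "i1 <= i0 - n" "min (K - 1) (i0 + n) < i2" "i0 - n <= min (K - 1) (i0 + n)"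
 thus "l1 <= l0 - n | min (M - 1) (l0 + n) < l2" using blockX blockY by (auto simp: min_def split: if_splits)
qed

lemma window_in: assumes "i0 < K" "l0 < M" "(i, l) : window i0 l0 n" shows "i < K" "l < M" "~ blk i l" using assms by (auto simp: window_def)

lemma net_gconn:
 assumes "i0 < K" "l0 < M"
 shows "gconn adj (net (window i0 l0 n))"
proof -
 note wi = window_in[OF assms]
 have "gconn adj (UN p:window i0 l0 n. cross (fst p) (snd p))"
 proof (rule gconn_UN[OF window_gconn])
  show "gconn adj (cross (fst p) (snd p))" if "p : window i0 l0 n" for p using wi[of "fst p" "snd p"] that cross_gconn by (cases p) auto
  show "cross (fst p) (snd p) ~= {}" if "p : window i0 l0 n" for p
   using wi[of "fst p" "snd p"] that cross_centre[of "fst p" "snd p"] by (cases p) (auto simp: cross_def)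
  fix p q assume pq: "p : window i0 l0 n" "q : window i0 l0 n" "grid_adj p q"
  obtain i l i' l' where [simp]: "p = (i, l)" "q = (i', l')" by (cases p; cases q) auto
  have w: "i < K" "l < M" "~ blk i l" "i' < K" "l' < M" "~ blk i' l'" using wi[of i l] wi[of i' l'] pq by auto
  consider "i = i'" "l = Suc l'" | "i = i'" "l' = Suc l" | "l = l'" "i = Suc i'" | "l = l'" "i' = Suc i" using pq(3) by (auto simp: grid_adj_def)
  hence "cross i l Int cross i' l' ~= {}"
  proof cases
   case 1 thus ?thesis using stripe_next[of i l'] w by (auto simp: cross_def)
  next
   case 2 thus ?thesis using stripe_next[of i l] w by (auto simp: cross_def)
  next
   case 3 thus ?thesis using hstripe_next[of i' l] w by (auto simp: cross_def)
  next
   case 4 thus ?thesis using hstripe_next[of i l] w by (auto simp: cross_def)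
  qed
  thus "cross (fst p) (snd p) Int cross (fst q) (snd q) ~= {} |
    (EX a:cross (fst p) (snd p). EX b:cross (fst q) (snd q). adj a b)" by simp
 qed
 thus ?thesis by (simp add: net_def case_prod_beta)
qed

lemma net_sub: "net P <= V - J" by (auto simp: net_def cross_def stripe_def hstripe_def line_def)

text \<open>\<open>In v\<close> says that a square lies strictly inside the frame of lines through
  the neighbouring cells, the sides of the rectangle replacing missing lines. A chain that avoids
  the net cannot leave the frame, because consecutive squares share a point; but in each coordinate
  the frame stays within \<open>4 * tt\<close> of the starting point.\<close>

lemma net_hit:
 assumes i0: "i0 < K" "l0 < M" and E: "E <= V - J" "gconn adj E" "e : E" "e' : E"
  and p: "X e <= px" "px <= X e + m e" "Y e <= py" "py <= Y e + m e"
  and pc: "xs i0 <= px" "px <= xs (Suc i0)" "ys l0 <= py" "py <= ys (Suc l0)"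
  and q: "X e' <= qx" "qx <= X e' + m e'" "Y e' <= qy" "qy <= Y e' + m e'"
  and tt: "!!i. i < K ==> xs (Suc i) - xs i <= 2 * tt" "!!i. i < M ==> ys (Suc i) - ys i <= 2 * tt" "0 < tt"
  and far: "4 * tt <= \<bar>qx - px\<bar> | 4 * tt <= \<bar>qy - py\<bar>"
 shows "E Int net (window i0 l0 1) ~= {}"
proof (rule ccontr)
 assume "~ ?thesis"
 hence no: "v ~: net (window i0 l0 1)" if "v : E" for v using that by blast
 define In where "In v \<longleftrightarrow> (0 < i0 --> a (i0 - 1) < X v) & (Suc i0 < K --> X v + m v < a (Suc i0)) &
  (0 < l0 --> b (l0 - 1) < Y v) & (Suc l0 < M --> Y v + m v < b (Suc l0))" for v
 define Bx where "Bx x y \<longleftrightarrow> (0 < i0 --> a (i0 - 1) <= x) & (Suc i0 < K --> x <= a (Suc i0)) &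
  (0 < l0 --> b (l0 - 1) <= y) & (Suc l0 < M --> y <= b (Suc l0))" for x y
 have xhit: False if v: "v : E" "X v <= a i" "a i <= X v + m v" "Y v <= y" "y <= Y v + m v"
  and i: "i < K" "i0 <= Suc i" "i <= Suc i0" and B: "Bx x y" for v i x y
 proof -
  obtain l where l: "l < M" "l <= Suc l0" "l0 <= Suc l" "~ blk i l" "v : stripe i l"
   by (rule stripe_hit[of i v y l0]) (use v i i0 E B in "auto simp: Bx_def")
  have "(i, l) : window i0 l0 1" using i l by (auto simp: window_def)
  hence "v : net (window i0 l0 1)" using l(5) by (force simp: net_def cross_def)
  thus False using no v by blast
 qed
 have yhit: False if v: "v : E" "Y v <= b l" "b l <= Y v + m v" "X v <= x" "x <= X v + m v"
  and i: "l < M" "l0 <= Suc l" "l <= Suc l0" and B: "Bx x y" for v l x y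
 proof -
  obtain i where l: "i < K" "i <= Suc i0" "i0 <= Suc i" "~ blk i l" "v : hstripe i l"
   by (rule hstripe_hit[of l v x i0]) (use v i i0 E B in "auto simp: Bx_def")
  have "(i, l) : window i0 l0 1" using i l by (auto simp: window_def)
  hence "v : net (window i0 l0 1)" using l(5) by (force simp: net_def cross_def)
  thus False using no v by blast
 qed
 have InI: "In v" if v: "v : E" "X v <= x" "x <= X v + m v" "Y v <= y" "y <= Y v + m v" and B: "Bx x y" for v x y
 proof (rule ccontr)
  assume "~ In v"
  then consider "0 < i0" "X v <= a (i0 - 1)" | "Suc i0 < K" "a (Suc i0) <= X v + m v"
   | "0 < l0" "Y v <= b (l0 - 1)" | "Suc l0 < M" "b (Suc l0) <= Y v + m v" unfolding In_def by fastforce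
  thus False
  proof cases
   case 1 show False by (rule xhit[of v "i0 - 1" y x]) (use v B i0 1 in "auto simp: Bx_def")
  next
   case 2 show False by (rule xhit[of v "Suc i0" y x]) (use v B i0 2 in "auto simp: Bx_def")
  next
   case 3 show False by (rule yhit[of v "l0 - 1" x y]) (use v B i0 3 in "auto simp: Bx_def")
  next
   case 4 show False by (rule yhit[of v "Suc l0" x y]) (use v B i0 4 in "auto simp: Bx_def")
  qed
 qed
 have "Bx px py" unfolding Bx_def using a_in[of "i0 - 1"] a_in[of "Suc i0"] b_in[of "l0 - 1"] b_in[of "Suc l0"] i0 pc by force
 hence Ine: "In e" using InI[OF E(3) p] by blast
 have "In e'"
 proof (rule ccontr)
  assume "~ In e'"
  then obtain v w where vw: "v : E" "w : E" "In v" "~ In w" "adj v w" using gconn_edge[where P = In, OF E(2,3) Ine E(4)] by blast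
  hence V: "v : V" "w : V" using E by auto
  have m: "0 <= m v" "0 <= m w" using m_nonneg V by auto
  note t = touchX[OF V vw(5)] touchX[OF V(2,1) adj_sym[OF vw(5)]] touchY[OF V vw(5)] touchY[OF V(2,1) adj_sym[OF vw(5)]]
  \<comment> \<open>The point with these coordinates lies in both squares.\<close>
  have "Bx (max (X v) (X w)) (max (Y v) (Y w))" using vw(3) t m unfolding Bx_def In_def by auto
  hence "In w" using InI[of w "max (X v) (X w)" "max (Y v) (Y w)"] vw t m by auto
  thus False using vw by blast
 qed
 hence "Bx qx qy" using q unfolding In_def Bx_def by auto
 have eV: "e' : V" using E by auto
 have qr: "0 <= qx" "qx <= W" "0 <= qy" "qy <= H" using q X_ge[OF eV] X_le[OF eV] Y_ge[OF eV] Y_le[OF eV] by auto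
 have "px - 4 * tt < qx"
 proof (cases "0 < i0")
  case True
  thus ?thesis using In_def \<open>In e'\<close> a_in[of "i0 - 1"] tt(1)[of "i0 - 1"] tt(1)[of i0] i0 pc q by force
 next
  case False
  thus ?thesis using tt(1)[of i0] tt(3) i0 pc qr xs0 by auto
 qed
 moreover have "qx < px + 4 * tt"
 proof (cases "Suc i0 < K")
  case True
  thus ?thesis using In_def \<open>In e'\<close> a_in[of "Suc i0"] tt(1)[of "Suc i0"] tt(1)[of i0] i0 pc q by force
 next
  case False
  hence "Suc i0 = K" using i0 by simp
  thus ?thesis using tt(1)[of i0] tt(3) i0 pc qr xsK by auto
 qed
 moreover have "py - 4 * tt < qy"
 proof (cases "0 < l0")
  case True
  thus ?thesis using In_def \<open>In e'\<close> b_in[of "l0 - 1"] tt(2)[of "l0 - 1"] tt(2)[of l0] i0 pc q by force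
 next
  case False
  thus ?thesis using tt(2)[of l0] tt(3) i0 pc qr ys0 by auto
 qed
 moreover have "qy < py + 4 * tt"
 proof (cases "Suc l0 < M")
  case True
  thus ?thesis using In_def \<open>In e'\<close> b_in[of "Suc l0"] tt(2)[of "Suc l0"] tt(2)[of l0] i0 pc q by force
 next
  case False
  hence "Suc l0 = M" using i0 by simp
  thus ?thesis using tt(2)[of l0] tt(3) i0 pc qr ysM by auto
 qed
 ultimately show False using far by linarith
qed

end

lemma partition_cell:
 fixes xs :: "nat => real"
 assumes "xs 0 <= x" "x <= xs K" "0 < K"
 obtains i where "i < K" "xs i <= x" "x <= xs (Suc i)"
proof -
 have "EX i<K. xs i <= x & x <= xs (Suc i)" using assms
 proof (induction K)
  case (Suc K)
  show ?case
  proof (cases "K = 0 | xs K <= x")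
   case True thus ?thesis using Suc by (intro exI[of _ K]) auto
  next
   case False thus ?thesis using Suc by fastforce
  qed
 qed simp
 thus ?thesis using that by blast
qed

lemma partition_gap:
 fixes xs :: "nat => real"
 assumes step: "ALL i<K. tt <= xs (Suc i) - xs i" and "i <= k" "k <= K"
 shows "real (k - i) * tt <= xs k - xs i" using assms(2,3)
proof (induction rule: dec_induct)
 case (step n)
 thus ?case using assms(1)[rule_format, of n] by (auto simp: algebra_simps)
qed simp

lemma partition_gap_le:
 fixes xs :: "nat => real"
 assumes step: "ALL i<K. xs (Suc i) - xs i <= tt" and "i <= k" "k <= K"
 shows "xs k - xs i <= real (k - i) * tt" using assms(2,3)
proof (induction rule: dec_induct)
 case (step n)
 thus ?case using assms(1)[rule_format, of n] by (auto simp: algebra_simps)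
qed simp

lemma floor_step:
 fixes u tt :: real
 assumes "0 < tt" "tt <= u"
 defines "g \<equiv> nat \<lfloor>u / tt\<rfloor>"
 shows "0 < g" "tt <= u / real g" "u / real g <= 2 * tt"
proof -
 have t: "1 <= u / tt" using assms by simp
 thus g: "0 < g" by (simp add: g_def)
 have g1: "real g <= u / tt" "u / tt < real g + 1" using t by (auto simp: g_def)
 show "tt <= u / real g" using g1(1) g assms(1,2) by (simp add: field_simps)
 have "u / tt <= 2 * real g" using g1(2) g by (simp)
 thus "u / real g <= 2 * tt" using g assms(1,2) by (simp add: field_simps)
qed

lemma partition_exists:
 fixes W tt :: real
 assumes "0 < tt" "tt <= W"
 obtains xs :: "nat => real" and K where "xs 0 = 0" "xs K = W" "!!i. i < K ==> tt <= xs (Suc i) - xs i"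
  "!!i. i < K ==> xs (Suc i) - xs i <= 2 * tt"
proof -
 define g where "g = nat \<lfloor>W / tt\<rfloor>"
 note g = floor_step[OF assms, folded g_def]
 define s where "s = W / real g"
 have "real g * s = W" using g by (simp add: s_def)
 thus ?thesis by (intro that[of "%i. real i * s" g]) (use g in "auto simp: algebra_simps")
qed

text \<open>The number of steps between \<open>\<alpha>\<close> and \<open>\<beta>\<close> depends
  on \<open>\<beta> - \<alpha>\<close> and \<open>tt\<close> alone, so the two coordinate partitions
  cut a square into equally many columns and rows.\<close>

lemma partition_through:
 fixes W tt \<alpha> \<beta> :: real
 assumes tt: "0 < tt" "tt <= \<alpha>" "tt <= \<beta> - \<alpha>" "tt <= W - \<beta>"
 obtains xs :: "nat => real" and K g where "xs 0 = 0" "xs K = W" "xs g = \<alpha>" "xs (g + nat \<lfloor>(\<beta> - \<alpha>) / tt\<rfloor>) = \<beta>"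
  "0 < g" "0 < nat \<lfloor>(\<beta> - \<alpha>) / tt\<rfloor>" "g + nat \<lfloor>(\<beta> - \<alpha>) / tt\<rfloor> < K"
  "!!i. i < K ==> tt <= xs (Suc i) - xs i" "!!i. i < K ==> xs (Suc i) - xs i <= 2 * tt"
proof -
 define g1 where "g1 = nat \<lfloor>\<alpha> / tt\<rfloor>"
 define g2 where "g2 = nat \<lfloor>(\<beta> - \<alpha>) / tt\<rfloor>"
 define g3 where "g3 = nat \<lfloor>(W - \<beta>) / tt\<rfloor>"
 note g1 = floor_step[OF tt(1,2), folded g1_def] and g2 = floor_step[OF tt(1,3), folded g2_def]
  and g3 = floor_step[OF tt(1,4), folded g3_def]
 define s1 s2 s3 where "s1 = \<alpha> / real g1" and "s2 = (\<beta> - \<alpha>) / real g2" and "s3 = (W - \<beta>) / real g3"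
 have s: "real g1 * s1 = \<alpha>" "real g2 * s2 = \<beta> - \<alpha>" "real g3 * s3 = W - \<beta>"
  using g1 g2 g3 by (auto simp: s1_def s2_def s3_def)
 define xs where "xs i = (if i <= g1 then real i * s1 else if i <= g1 + g2 then \<alpha> + real (i - g1) * s2
  else \<beta> + real (i - g1 - g2) * s3)" for i
 have v: "xs 0 = 0" "xs g1 = \<alpha>" "xs (g1 + g2) = \<beta>" "xs (g1 + g2 + g3) = W" using s by (auto simp: xs_def)
 have step: "xs (Suc i) - xs i = (if i < g1 then s1 else if i < g1 + g2 then s2 else s3)" for i
 proof -
  consider "i < g1" | "i = g1" | "g1 < i" "i < g1 + g2" | "i = g1 + g2" | "g1 + g2 < i" by linarith
  thus ?thesis
  proof cases
   case 1 thus ?thesis by (simp add: xs_def algebra_simps)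
  next
   case 2 thus ?thesis using g2(1) v(2) by (simp add: xs_def)
  next
   case 3
   hence "real (Suc i - g1) = real (i - g1) + 1" by simp
   thus ?thesis using 3 by (simp add: xs_def algebra_simps)
  next
   case 4 thus ?thesis using v(3) by (simp add: xs_def)
  next
   case 5
   hence "real (Suc i - g1 - g2) = real (i - g1 - g2) + 1" by simp
   thus ?thesis using 5 by (simp add: xs_def algebra_simps del: of_nat_diff)
  qed
 qed
 show ?thesis
  by (rule that[of xs "g1 + g2 + g3" g1]) (use v step g1 g2 g3 in "auto simp: g2_def[symmetric] s1_def[symmetric] s2_def[symmetric] s3_def[symmetric]")
qed

lemma interval_avoiding:
 fixes u tt e1 e2 :: real
 assumes "0 < tt" "tt <= v - u" "e2 - e1 <= tt / 2"
 obtains u' v' where "u <= u'" "v' <= v" "tt / 4 <= v' - u'" "v' - u' <= tt" "!!x. u' < x ==> x < v' ==> ~ (e1 <= x & x <= e2)"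
proof (cases "u + tt / 4 <= e1")
 case True thus ?thesis using assms by (intro that[of u "u + tt / 4"]) auto
next
 case False thus ?thesis using assms by (intro that[of "u + 3 * tt / 4" "u + tt"]) auto
qed

lemma sum_UN_le:
 fixes f :: "'a => real"
 assumes "finite I" "!!i. i : I ==> finite (A i)" "!!i v. i : I ==> v : A i ==> 0 <= f v"
 shows "sum f (UN i:I. A i) <= (SUM i:I. sum f (A i))" using assms
proof (induction I rule: finite_induct)
 case (insert i I)
 have fin: "finite (A i)" "finite (UN j:I. A j)" using insert by auto
 have "sum f (A i Un (UN j:I. A j)) <= sum f (A i) + sum f (UN j:I. A j)"
  using sum.union_inter[OF fin, of f] sum_nonneg[of "A i Int (UN j:I. A j)" f] insert.prems(2) by force
 also have "... <= sum f (A i) + (SUM j:I. sum f (A j))"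
 proof -
  have "sum f (UN j:I. A j) <= (SUM j:I. sum f (A j))" by (rule insert.IH) (use insert.prems in auto)
  thus ?thesis by simp
 qed
 finally show ?case using insert by simp
qed simp

context tiling_grid begin

text \<open>\<open>E\<close> meets the net in the window of radius 1 about the cell of its point,
  \<open>F\<close> does so about its own, and these cells differ by at most \<open>k + 1\<close> in
  each index; so one window of radius \<open>k + 2\<close> serves both. It uses at most
  \<open>4 * n + 2\<close> lines, each of weight below \<open>c\<close>.\<close>

lemma network_chain_grid:
 fixes ro :: "'a => real"
 assumes ro: "!!v. v : V ==> 0 <= ro v"
  and tt: "0 < tt" "!!i. i < K ==> tt <= xs (Suc i) - xs i" "!!i. i < M ==> tt <= ys (Suc i) - ys i"
   "!!i. i < K ==> xs (Suc i) - xs i <= 2 * tt" "!!i. i < M ==> ys (Suc i) - ys i <= 2 * tt"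
  and E: "E <= V - J" "gconn adj E" "e : E" "e' : E"
  and p: "X e <= px" "px <= X e + m e" "Y e <= py" "py <= Y e + m e"
  and p': "X e' <= px'" "px' <= X e' + m e'" "Y e' <= py'" "py' <= Y e' + m e'"
  and farE: "4 * tt <= \<bar>px' - px\<bar> | 4 * tt <= \<bar>py' - py\<bar>"
  and F: "F <= V - J" "gconn adj F" "f : F" "f' : F"
  and q: "X f <= qx" "qx <= X f + m f" "Y f <= qy" "qy <= Y f + m f"
  and q': "X f' <= qx'" "qx' <= X f' + m f'" "Y f' <= qy'" "qy' <= Y f' + m f'"
  and farF: "4 * tt <= \<bar>qx' - qx\<bar> | 4 * tt <= \<bar>qy' - qy\<bar>"
  and near: "\<bar>qx - px\<bar> <= real k * tt" "\<bar>qy - py\<bar> <= real k * tt"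
  and i0: "i0 < K" "xs i0 <= px" "px <= xs (Suc i0)" and l0: "l0 < M" "ys l0 <= py" "py <= ys (Suc l0)"
  and n: "n = k + 2" and c: "0 < c" "c * real (4 * n + 2) <= 1"
  and costX: "!!i. i < K ==> (SUM v:{v : line V X m (a i). Y v <= ys (min M (Suc (l0 + n))) & ys (l0 - n) <= Y v + m v}. ro v) < c"
  and costY: "!!l. l < M ==> (SUM v:{v : line V Y m (b l). X v <= xs (min K (Suc (i0 + n))) & xs (i0 - n) <= X v + m v}. ro v) < c"
 obtains C where "C <= V - J" "gconn adj C" "C Int E ~= {}" "C Int F ~= {}" "sum ro C < 1"
proof -
 have eV: "e : V" "f : V" using E F by auto
 have r: "0 <= qx" "qx <= W" "0 <= qy" "qy <= H" using q X_ge[OF eV(2)] X_le[OF eV(2)] Y_ge[OF eV(2)] Y_le[OF eV(2)] by auto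
 have KM: "0 < K" "0 < M" using i0 l0 by auto
 obtain i' where i': "i' < K" "xs i' <= qx" "qx <= xs (Suc i')" using partition_cell[of xs qx K] r xs0 xsK KM by auto
 obtain l' where l': "l' < M" "ys l' <= qy" "qy <= ys (Suc l')" using partition_cell[of ys qy M] r ys0 ysM KM by auto
 have close: "i' <= i0 + (k + 1) & i0 <= i' + (k + 1)"
  if st: "ALL i<K'. tt <= zs (Suc i) - zs i" and i: "i0 < K'" "i' < K'" "zs i0 <= s" "s <= zs (Suc i0)" "zs i' <= t" "t <= zs (Suc i')"
   and st2: "\<bar>t - s\<bar> <= real k * tt" for zs :: "nat => real" and K' i0 i' s t
 proof (rule ccontr)
  assume "~ ?thesis"
  then consider "Suc i0 <= i'" "k + 1 <= i' - Suc i0" | "Suc i' <= i0" "k + 1 <= i0 - Suc i'" by fastforce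
  thus False
  proof cases
   case 1
   have "real (k + 1) * tt <= real (i' - Suc i0) * tt" using 1 tt(1) by (intro mult_right_mono) auto
   also have "... <= zs i' - zs (Suc i0)" by (rule partition_gap[OF st 1(1)]) (use i in auto)
   also have "... <= t - s" using i by simp
   finally show False using st2 tt(1) by (simp add: algebra_simps)
  next
   case 2
   have "real (k + 1) * tt <= real (i0 - Suc i') * tt" using 2 tt(1) by (intro mult_right_mono) auto
   also have "... <= zs i0 - zs (Suc i')" by (rule partition_gap[OF st 2(1)]) (use i in auto)
   also have "... <= s - t" using i by simp
   finally show False using st2 tt(1) by (simp add: algebra_simps)
  qed
 qed
 have tx: "ALL i<K. tt <= xs (Suc i) - xs i" and ty: "ALL i<M. tt <= ys (Suc i) - ys i" using tt by blast+
 have ci: "i' <= i0 + (k + 1) & i0 <= i' + (k + 1)" by (rule close[OF tx i0(1) i'(1) i0(2,3) i'(2,3) near(1)])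
 have cl: "l' <= l0 + (k + 1) & l0 <= l' + (k + 1)" by (rule close[OF ty l0(1) l'(1) l0(2,3) l'(2,3) near(2)])
 define C where "C = net (window i0 l0 n)"
 have W1: "window i0 l0 1 <= window i0 l0 n" "window i' l' 1 <= window i0 l0 n" using ci cl n by (auto simp: window_def)
 have nm: "net P <= net P'" if "P <= P'" for P P' using that unfolding net_def by blast
 have "E Int net (window i0 l0 1) ~= {}" by (rule net_hit[OF i0(1) l0(1) E p i0(2,3) l0(2,3) p' tt(4,5,1) farE])
 hence CE: "C Int E ~= {}" using nm[OF W1(1)] by (auto simp: C_def)
 have "F Int net (window i' l' 1) ~= {}" by (rule net_hit[OF i'(1) l'(1) F q i'(2,3) l'(2,3) q' tt(4,5,1) farF])
 hence CF: "C Int F ~= {}" using nm[OF W1(2)] by (auto simp: C_def)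
 define I where "I = {i0 - n..min (K - 1) (i0 + n)}"
 define L' where "L' = {l0 - n..min (M - 1) (l0 + n)}"
 define SX where "SX i = {v : line V X m (a i). Y v <= ys (min M (Suc (l0 + n))) & ys (l0 - n) <= Y v + m v}" for i
 define SY where "SY l = {v : line V Y m (b l). X v <= xs (min K (Suc (i0 + n))) & xs (i0 - n) <= X v + m v}" for l
 have sub: "C <= (UN i:I. SX i) Un (UN l:L'. SY l)"
 proof
  fix v assume "v : C"
  then obtain i l where il: "(i, l) : window i0 l0 n" "v : cross i l" by (auto simp: C_def net_def)
  hence il': "i : I" "l : L'" "i < K" "l < M" using i0 l0 by (auto simp: window_def I_def L'_def)
  have y: "ys (l0 - n) <= ys l" "ys (Suc l) <= ys (min M (Suc (l0 + n)))" using il' by (auto intro!: ys_mono simp: L'_def)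
  have x: "xs (i0 - n) <= xs i" "xs (Suc i) <= xs (min K (Suc (i0 + n)))" using il' by (auto intro!: xs_mono simp: I_def)
  from il(2) consider "v : stripe i l" | "v : hstripe i l" by (auto simp: cross_def)
  thus "v : (UN i:I. SX i) Un (UN l:L'. SY l)"
  proof cases
   case 1 hence "v : SX i" using y by (auto simp: stripe_def SX_def)
   thus ?thesis using il' by blast
  next
   case 2 hence "v : SY l" using x by (auto simp: hstripe_def SY_def)
   thus ?thesis using il' by blast
  qed
 qed
 have fS: "SX i <= V" "SY l <= V" for i l by (auto simp: SX_def SY_def line_def)
 have fin: "finite (UN i:I. SX i)" "finite (UN l:L'. SY l)"
  using finite_subset[OF fS(1) finV] finite_subset[OF fS(2) finV] by (auto simp: I_def L'_def)
 have pos: "0 <= ro v" if "v : (UN i:I. SX i) Un (UN l:L'. SY l)" for v using that fS ro by blast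
 have "sum ro C <= sum ro ((UN i:I. SX i) Un (UN l:L'. SY l))" by (rule sum_mono2) (use fin sub pos in auto)
 also have "... <= sum ro (UN i:I. SX i) + sum ro (UN l:L'. SY l)"
  using sum.union_inter[OF fin, of ro] sum_nonneg[of "(UN i:I. SX i) Int (UN l:L'. SY l)" ro] pos by force
 also have "... <= (SUM i:I. sum ro (SX i)) + (SUM l:L'. sum ro (SY l))"
 proof (intro add_mono sum_UN_le)
  show "finite (SX i)" "finite (SY i)" for i using finite_subset[OF fS(1) finV] finite_subset[OF fS(2) finV] by blast+
  show "0 <= ro v" if "v : SX i" for i v using fS(1) ro that by blast
  show "0 <= ro v" if "v : SY i" for i v using fS(2) ro that by blast
 qed (auto simp: I_def L'_def)
 also have "... < (SUM i:I. c) + (SUM l:L'. c)"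
 proof (rule add_strict_mono)
  show "(SUM i:I. sum ro (SX i)) < (SUM i:I. c)" by (rule sum_strict_mono) (use costX i0 in "auto simp: I_def SX_def")
  show "(SUM l:L'. sum ro (SY l)) < (SUM l:L'. c)" by (rule sum_strict_mono) (use costY l0 in "auto simp: L'_def SY_def")
 qed
 also have "... <= real (2 * n + 1) * c + real (2 * n + 1) * c"
 proof -
  have "card I <= 2 * n + 1" "card L' <= 2 * n + 1" by (auto simp: I_def L'_def)
  hence "real (card I) * c <= real (2 * n + 1) * c" "real (card L') * c <= real (2 * n + 1) * c" using c(1) by (intro mult_right_mono; simp)+
  thus ?thesis by (simp add: algebra_simps)
 qed
 also have "... <= 1" using c(2) by (simp add: algebra_simps)
 finally have "sum ro C < 1" .
 thus ?thesis using that[OF _ _ CE CF] net_gconn[OF i0(1) l0(1), of n] net_sub[of "window i0 l0 n"] by (auto simp: C_def)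
qed

end

context square_tiling begin

text \<open>The average is taken over a subinterval of length at least \<open>tt / 4\<close> that
  misses the exceptional interval. The window height is then at most \<open>4 * (4 * n + 2)\<close>
  such lengths, and the enlargement by two more gives \<open>16 * n + 10\<close>.\<close>

lemma avoiding_cheap_line:
 fixes ro :: "'v => real" and n :: nat
 assumes ro: "!!v. v : V ==> 0 <= ro v" and c: "0 < c"
  and en: "(SUM v:V. (ro v)^2) * real (16 * n + 10) < c\<^sup>2"
  and u: "0 <= u" "v <= W" "0 < tt" "tt <= v - u" and e: "e2 - e1 <= tt / 2"
  and b: "b1 <= b2" "b2 - b1 <= real (4 * n + 2) * tt"
 obtains a where "u < a" "a < v" "generic V X m a" "~ (e1 <= a & a <= e2)"
  "(SUM v:{v : line V X m a. Y v <= b2 & b1 <= Y v + m v}. ro v) < c"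
proof -
 obtain u' v' where uv: "u <= u'" "v' <= v" "tt / 4 <= v' - u'" "v' - u' <= tt" "!!x. u' < x ==> x < v' ==> ~ (e1 <= x & x <= e2)"
  using interval_avoiding[OF u(3,4) e] by blast
 have h: "0 < v' - u'" using uv u by simp
 have "b2 - b1 + 2 * (v' - u') <= real (4 * n + 2) * (4 * (v' - u')) + 2 * (v' - u')"
 proof -
  have "real (4 * n + 2) * tt <= real (4 * n + 2) * (4 * (v' - u'))" using uv(3) by (intro mult_left_mono) auto
  thus ?thesis using b(2) by linarith
 qed
 also have "... = real (16 * n + 10) * (v' - u')" by (simp add: algebra_simps)
 finally have "(SUM v:V. (ro v)^2) * (b2 - b1 + 2 * (v' - u')) <= (SUM v:V. (ro v)^2) * (real (16 * n + 10) * (v' - u'))"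
  by (intro mult_left_mono) (auto intro: sum_nonneg)
 also have "... < c\<^sup>2 * (v' - u')" using mult_strict_right_mono[OF en h] by (simp)
 finally have en': "(SUM v:V. (ro v)^2) * (b2 - b1 + 2 * (v' - u')) < c\<^sup>2 * (v' - u')" .
 have "0 <= u'" "u' < v'" "v' <= W" using uv u h by auto
 then obtain a where "u' < a" "a < v'" "generic V X m a" "(SUM v:{v : line V X m a. Y v <= b2 & b1 <= Y v + m v}. ro v) < c"
  using cheap_line[OF _ _ _ b(1) ro c en', of thesis] by blast
 thus ?thesis using that[of a] uv by auto
qed

text \<open>A network of cheap lines at scale \<open>tt\<close> joins any two connected sets of squares that are large at that scale,
  avoiding one exceptional square \<open>j\<close>; the exceptional square has to be either too small to
  matter or well separated from the sides of the rectangle.\<close>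

theorem network_chain:
 fixes ro :: "'v => real"
 assumes ro: "!!v. v : V ==> 0 <= ro v" and tt: "0 < tt" "tt <= W" "tt <= H"
  and J: "J = {} | (EX j:V. J = {j} & (m j <= tt / 2 |
    (tt <= m j & tt <= X j & X j + m j + tt <= W & tt <= Y j & Y j + m j + tt <= H)))"
  and E: "E <= V - J" "gconn adj E" "e : E" "e' : E"
  and p: "X e <= px" "px <= X e + m e" "Y e <= py" "py <= Y e + m e"
  and p': "X e' <= px'" "px' <= X e' + m e'" "Y e' <= py'" "py' <= Y e' + m e'"
  and farE: "4 * tt <= \<bar>px' - px\<bar> | 4 * tt <= \<bar>py' - py\<bar>"
  and F: "F <= V - J" "gconn adj F" "f : F" "f' : F"
  and q: "X f <= qx" "qx <= X f + m f" "Y f <= qy" "qy <= Y f + m f"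
  and q': "X f' <= qx'" "qx' <= X f' + m f'" "Y f' <= qy'" "qy' <= Y f' + m f'"
  and farF: "4 * tt <= \<bar>qx' - qx\<bar> | 4 * tt <= \<bar>qy' - qy\<bar>"
  and near: "\<bar>qx - px\<bar> <= real k * tt" "\<bar>qy - py\<bar> <= real k * tt"
  and en: "(SUM v:V. (ro v)^2) * (real (16 * k + 42) * (real (4 * k + 10))^2) < 1"
 obtains C where "C <= V - J" "gconn adj C" "C Int E ~= {}" "C Int F ~= {}" "sum ro C < 1"
proof -
 interpret t: square_tiling V adj Y X m B T L R H W by (rule transpose)
 define n where "n = k + 2"
 define c where "c = 1 / real (4 * n + 2)"
 have c: "0 < c" "c * real (4 * n + 2) <= 1" by (auto simp: c_def)
 have en': "(SUM v:V. (ro v)^2) * real (16 * n + 10) < c\<^sup>2"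
 proof -
  have "0 < (real (4 * n + 2))^2" by simp
  moreover have "16 * k + 42 = 16 * n + 10" "4 * k + 10 = 4 * n + 2" by (auto simp: n_def)
  ultimately show ?thesis using en unfolding c_def power_divide by (simp only: pos_less_divide_eq mult.assoc power_one)
 qed
 define small where "small \<longleftrightarrow> (ALL j:J. m j <= tt / 2)"
 define j where "j = (SOME j. j : J)"
 have jJ: "J = {} | (J = {j} & j : V)" using J by (auto simp: j_def)
 have big: "J = {j} & j : V & tt <= m j & tt <= X j & X j + m j + tt <= W & tt <= Y j & Y j + m j + tt <= H" if "~ small"
  using that J jJ by (auto simp: small_def)
 obtain xs ys :: "nat => real" and K M i1 i2 l1 l2 where xy: "xs 0 = 0" "xs K = W" "ys 0 = 0" "ys M = H"
  and st: "!!i. i < K ==> tt <= xs (Suc i) - xs i" "!!i. i < M ==> tt <= ys (Suc i) - ys i"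
   "!!i. i < K ==> xs (Suc i) - xs i <= 2 * tt" "!!i. i < M ==> ys (Suc i) - ys i <= 2 * tt"
  and sm: "small ==> i1 = 0 & i2 = 0 & l1 = 0 & l2 = 0"
  and bg: "~ small ==> 0 < i1 & i2 < K & i1 < i2 & 0 < l1 & l2 < M & l1 < l2 & i2 - i1 = l2 - l1 &
   xs i1 = X j & xs i2 = X j + m j & ys l1 = Y j & ys l2 = Y j + m j"
 proof (cases small)
  case True
  obtain xs :: "nat => real" and K where 1: "xs 0 = 0" "xs K = W" "!!i. i < K ==> tt <= xs (Suc i) - xs i"
   "!!i. i < K ==> xs (Suc i) - xs i <= 2 * tt" by (rule partition_exists[OF tt(1,2)]) blast
  obtain ys :: "nat => real" and M where 2: "ys 0 = 0" "ys M = H" "!!i. i < M ==> tt <= ys (Suc i) - ys i"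
   "!!i. i < M ==> ys (Suc i) - ys i <= 2 * tt" by (rule partition_exists[OF tt(1,3)]) blast
  show thesis by (rule that[of xs K ys M 0 0 0 0]) (use 1 2 True in auto)
 next
  case False
  note b = big[OF False]
  have bx: "tt <= X j" "tt <= (X j + m j) - X j" "tt <= W - (X j + m j)" using b by auto
  have by': "tt <= Y j" "tt <= (Y j + m j) - Y j" "tt <= H - (Y j + m j)" using b by auto
  define g' where "g' = nat \<lfloor>m j / tt\<rfloor>"
  obtain xs :: "nat => real" and K g where 1: "xs 0 = 0" "xs K = W" "xs g = X j" "xs (g + g') = X j + m j"
   "0 < g" "0 < g'" "g + g' < K" "!!i. i < K ==> tt <= xs (Suc i) - xs i" "!!i. i < K ==> xs (Suc i) - xs i <= 2 * tt"
   using partition_through[OF tt(1) bx] by (simp add: g'_def) blast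
  obtain ys :: "nat => real" and M h where 2: "ys 0 = 0" "ys M = H" "ys h = Y j" "ys (h + g') = Y j + m j"
   "0 < h" "0 < g'" "h + g' < M" "!!i. i < M ==> tt <= ys (Suc i) - ys i" "!!i. i < M ==> ys (Suc i) - ys i <= 2 * tt"
   using partition_through[OF tt(1) by'] by (simp add: g'_def) blast
  show thesis by (rule that[of xs K ys M g "g + g'" h "h + g'"]) (use 1 2 False in auto)
 qed
 have eV: "e : V" using E by auto
 have r: "0 <= px" "px <= W" "0 <= py" "py <= H" using p X_ge[OF eV] X_le[OF eV] Y_ge[OF eV] Y_le[OF eV] by auto
 have KM: "0 < K" "0 < M" using xy W_pos H_pos by (metis less_irrefl gr0I)+
 obtain i0 where i0: "i0 < K" "xs i0 <= px" "px <= xs (Suc i0)" using partition_cell[of xs px K] r xy KM by auto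
 obtain l0 where l0: "l0 < M" "ys l0 <= py" "py <= ys (Suc l0)" using partition_cell[of ys py M] r xy KM by auto
 have stx: "ALL i<K. tt <= xs (Suc i) - xs i" "ALL i<M. tt <= ys (Suc i) - ys i"
   "ALL i<K. xs (Suc i) - xs i <= 2 * tt" "ALL i<M. ys (Suc i) - ys i <= 2 * tt" using st by blast+
 have xm: "xs i <= xs k" if "i <= k" "k <= K" for i k using partition_gap[OF stx(1) that] tt(1) by (smt (verit) mult_nonneg_nonneg of_nat_0_le_iff)
 have ym: "ys i <= ys k" if "i <= k" "k <= M" for i k using partition_gap[OF stx(2) that] tt(1) by (smt (verit) mult_nonneg_nonneg of_nat_0_le_iff)
 have wy: "ys (min M (Suc (l0 + n))) - ys (l0 - n) <= real (4 * n + 2) * tt"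
 proof -
  have "ys (min M (Suc (l0 + n))) - ys (l0 - n) <= real (min M (Suc (l0 + n)) - (l0 - n)) * (2 * tt)"
   by (rule partition_gap_le[OF stx(4)]) (use l0 in auto)
  also have "... <= real (2 * n + 1) * (2 * tt)" using tt(1) by (intro mult_right_mono) auto
  finally show ?thesis by (simp add: algebra_simps)
 qed
 have wx: "xs (min K (Suc (i0 + n))) - xs (i0 - n) <= real (4 * n + 2) * tt"
 proof -
  have "xs (min K (Suc (i0 + n))) - xs (i0 - n) <= real (min K (Suc (i0 + n)) - (i0 - n)) * (2 * tt)"
   by (rule partition_gap_le[OF stx(3)]) (use i0 in auto)
  also have "... <= real (2 * n + 1) * (2 * tt)" using tt(1) by (intro mult_right_mono) auto
  finally show ?thesis by (simp add: algebra_simps)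
 qed
 \<comment> \<open>Width of the interval that the lines have to avoid, namely the whole square if it
   is small. The value - 1 makes the interval empty: a large square is taken care of by the
   block.\<close>
 define ex where "ex = (if small & J ~= {} then m j else - 1)"
 have ex: "(X j + ex) - X j <= tt / 2" "(Y j + ex) - Y j <= tt / 2" using tt(1) jJ by (auto simp: ex_def small_def)
 have "EX a. ALL i<K. xs i < a i & a i < xs (Suc i) & generic V X m (a i) & ~ (X j <= a i & a i <= X j + ex) &
  (SUM v:{v : line V X m (a i). Y v <= ys (min M (Suc (l0 + n))) & ys (l0 - n) <= Y v + m v}. ro v) < c"
 proof (rule choice, rule allI)
  fix i
  show "EX y. i < K --> xs i < y & y < xs (Suc i) & generic V X m y & ~ (X j <= y & y <= X j + ex) &
   (SUM v:{v : line V X m y. Y v <= ys (min M (Suc (l0 + n))) & ys (l0 - n) <= Y v + m v}. ro v) < c"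
  proof (cases "i < K")
   case True
   have h: "0 <= xs i" "xs (Suc i) <= W" using xm[of 0 i] xm[of "Suc i" K] True xy by auto
   have h3: "ys (l0 - n) <= ys (min M (Suc (l0 + n)))" using l0 by (intro ym) auto
   show ?thesis by (rule avoiding_cheap_line[OF ro c(1) en' h tt(1) st(1)[OF True] ex(1) h3 wy]) (assumption | blast)+
  qed simp
 qed
 then obtain a where a: "!!i. i < K ==> xs i < a i & a i < xs (Suc i) & generic V X m (a i)"
  "!!i. i < K ==> ~ (X j <= a i & a i <= X j + ex)"
  "!!i. i < K ==> (SUM v:{v : line V X m (a i). Y v <= ys (min M (Suc (l0 + n))) & ys (l0 - n) <= Y v + m v}. ro v) < c" by blast
 have "EX b. ALL l<M. ys l < b l & b l < ys (Suc l) & generic V Y m (b l) & ~ (Y j <= b l & b l <= Y j + ex) &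
  (SUM v:{v : line V Y m (b l). X v <= xs (min K (Suc (i0 + n))) & xs (i0 - n) <= X v + m v}. ro v) < c"
 proof (rule choice, rule allI)
  fix i
  show "EX y. i < M --> ys i < y & y < ys (Suc i) & generic V Y m y & ~ (Y j <= y & y <= Y j + ex) &
   (SUM v:{v : line V Y m y. X v <= xs (min K (Suc (i0 + n))) & xs (i0 - n) <= X v + m v}. ro v) < c"
  proof (cases "i < M")
   case True
   have h: "0 <= ys i" "ys (Suc i) <= H" using ym[of 0 i] ym[of "Suc i" M] True xy by auto
   have h3: "xs (i0 - n) <= xs (min K (Suc (i0 + n)))" using i0 by (intro xm) auto
   show ?thesis by (rule t.avoiding_cheap_line[OF ro c(1) en' h tt(1) st(2)[OF True] ex(2) h3 wx]) (assumption | blast)+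
  qed simp
 qed
 then obtain b where b: "!!i. i < M ==> ys i < b i & b i < ys (Suc i) & generic V Y m (b i)"
  "!!i. i < M ==> ~ (Y j <= b i & b i <= Y j + ex)"
  "!!i. i < M ==> (SUM v:{v : line V Y m (b i). X v <= xs (min K (Suc (i0 + n))) & xs (i0 - n) <= X v + m v}. ro v) < c" by blast
 have inblock: "i1 <= i & i < i2" if "~ small" "i < K" "X j <= a i" "a i <= X j + m j" for i
 proof (rule ccontr)
  assume "~ ?thesis"
  hence "Suc i <= i1 | i2 <= i" by auto
  thus False using xm[of "Suc i" i1] xm[of i2 i] a(1)[OF that(2)] bg[OF that(1)] that by force
 qed
 have inblock': "l1 <= i & i < l2" if "~ small" "i < M" "Y j <= b i" "b i <= Y j + m j" for i
 proof (rule ccontr)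
  assume "~ ?thesis"
  hence "Suc i <= l1 | l2 <= i" by auto
  thus False using ym[of "Suc i" l1] ym[of l2 i] b(1)[OF that(2)] bg[OF that(1)] that by force
 qed
 interpret g: tiling_grid V adj X Y m L R B T W H J xs ys a b K M i1 i2 l1 l2
 proof unfold_locales
  show "J <= V" using jJ by blast
  show "xs i < xs (Suc i)" if "i < K" for i using st(1)[OF that] tt(1) by simp
  show "ys i < ys (Suc i)" if "i < M" for i using st(2)[OF that] tt(1) by simp
  show "i1 <= i & i < i2 & Y j' = ys l1 & Y j' + m j' = ys l2" if "j' : J" "i < K" "X j' <= a i" "a i <= X j' + m j'" for j' i
  proof -
   have jj: "j' = j" "J ~= {}" using that jJ by auto
   have ns: "~ small" using a(2)[OF that(2)] that jj by (auto simp: ex_def)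
   thus ?thesis using inblock[OF ns that(2)] that jj bg[OF ns] by auto
  qed
  show "l1 <= i & i < l2 & X j' = xs i1 & X j' + m j' = xs i2" if "j' : J" "i < M" "Y j' <= b i" "b i <= Y j' + m j'" for j' i
  proof -
   have jj: "j' = j" "J ~= {}" using that jJ by auto
   have ns: "~ small" using b(2)[OF that(2)] that jj by (auto simp: ex_def)
   thus ?thesis using inblock'[OF ns that(2)] that jj bg[OF ns] by auto
  qed
  show "0 < i1 & i2 < K & l1 < l2 & l2 - l1 = i2 - i1" if "i1 < i2" using sm bg that by (cases small) auto
  show "0 < l1 & l2 < M & i1 < i2" if "l1 < l2" using sm bg that by (cases small) auto
  show "EX j:J. X j = xs i1 & X j + m j = xs i2 & Y j = ys l1 & Y j + m j = ys l2" if "i1 < i2" using sm bg that big by (cases small) auto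
 qed (use xy a(1) b(1) in auto)
 show ?thesis by (rule g.network_chain_grid[OF ro tt(1) st E p p' farE F q q' farF near i0 l0 n_def c a(3) b(3)]) (assumption | rule that)+
qed

end

section \<open>Crossing and blocking on the triangular lattice\<close>

lemma rectangle_crossing:
 fixes S1 S2 :: "complex set"
 assumes S: "path_connected S1" "path_connected S2" "S1 <= cbox a b" "S2 <= cbox a b"
  and z: "z : S1" "Re z = Re a" "z' : S1" "Re z' = Re b"
  and w: "w : S2" "Im w = Im a" "w' : S2" "Im w' = Im b"
 shows "S1 Int S2 ~= {}"
proof -
 define h :: "complex => real^2" where "h z = (\<chi> i. if i = 1 then Re z else Im z)" for z
 have h12: "h z $ 1 = Re z" "h z $ (2::2) = Im z" for z by (auto simp: h_def)
 have contr: "continuous_on A h" for A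
 proof -
  have "continuous_on A (%z. if i = 1 then Re z else Im z)" for i :: 2 by (cases "i = 1") (auto intro!: continuous_intros)
  thus ?thesis unfolding h_def by (rule continuous_on_vec_lambda)
 qed
 have inj: "h z = h w ==> z = w" for z w using h12 by (metis complex_eqI)
 obtain f where f: "path f" "path_image f <= S1" "pathstart f = z" "pathfinish f = z'" using S(1) z unfolding path_connected_def by blast
 obtain g where g: "path g" "path_image g <= S2" "pathstart g = w" "pathfinish g = w'" using S(2) w unfolding path_connected_def by blast
 have box: "h z : cbox (h a) (h b)" if "z : cbox a b" for z using that by (auto simp: mem_box_cart forall_2 h12 in_cbox_complex_iff)
 obtain y where y: "y : path_image (h \<circ> f)" "y : path_image (h \<circ> g)"
 proof (rule fashoda[of "h \<circ> f" "h \<circ> g" "h a" "h b"])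
  show "path (h \<circ> f)" "path (h \<circ> g)" using f g contr by (auto intro: path_continuous_image)
  show "path_image (h \<circ> f) <= cbox (h a) (h b)" "path_image (h \<circ> g) <= cbox (h a) (h b)"
   using f g S(3,4) box unfolding path_image_compose by blast+
 qed (use f g z w h12 in "auto simp: pathstart_compose pathfinish_compose")
 thus ?thesis using f g inj unfolding path_image_compose by blast
qed

text \<open>The square lattice with one family of diagonals, that is, the triangular lattice. All
  its faces are triangles, so crossing and blocking are dual with the same adjacency for
  both.\<close>

definition lat_adj :: "int \<times> int => int \<times> int => bool" where
 "lat_adj p q \<longleftrightarrow> (fst q - fst p, snd q - snd p) : {(1, 0), (- 1, 0), (0, 1), (0, - 1), (1, 1), (- 1, - 1)}"

lemma symp_lat_adj: "symp lat_adj" by (auto simp: symp_def lat_adj_def)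

definition lat_pt :: "int \<times> int => complex" where
 "lat_pt p = Complex (of_int (fst p)) (of_int (snd p))"

lemma lat_pt_simps: "Re (lat_pt p) = of_int (fst p)" "Im (lat_pt p) = of_int (snd p)" by (simp_all add: lat_pt_def)

text \<open>As the diagonals have direction (1, 1), coordinates in the interior of an edge round
  down to its lower left end. Hence two edges drawn in the plane that meet have a common
  vertex.\<close>

lemma floor_on_lattice_edge:
 assumes "z : closed_segment (lat_pt a) (lat_pt b)" "lat_adj a b | a = b"
 shows "(\<lfloor>Re z\<rfloor>, \<lfloor>Im z\<rfloor>) : {a, b}"
proof -
 obtain t where t: "0 <= t" "t <= 1" and z: "z = (1 - t) *\<^sub>R lat_pt a + t *\<^sub>R lat_pt b"
  using assms(1) unfolding closed_segment_def by blast
 obtain i j k l where [simp]: "a = (i, j)" "b = (k, l)" by (cases a; cases b) auto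
 have re: "Re z = of_int i + t * of_int (k - i)" "Im z = of_int j + t * of_int (l - j)" by (auto simp: z lat_pt_def algebra_simps)
 consider "t = 0" | "t = 1" | "0 < t" "t < 1" using t by fastforce
 thus ?thesis
 proof cases
  case 1 thus ?thesis by (simp add: re)
 next
  case 2 thus ?thesis by (simp add: re)
 next
  case 3
  have f: "\<lfloor>of_int n + t\<rfloor> = n" "\<lfloor>of_int n - t\<rfloor> = n - 1" for n :: int using 3 by linarith+
  have fl: "\<lfloor>of_int n + t * of_int e\<rfloor> = (if e = - 1 then n - 1 else n)" if "e = - 1 | e = 0 | e = 1" for n e :: int
   using that f[of 0] by auto
  have e: "k - i = - 1 | k - i = 0 | k - i = 1" "l - j = - 1 | l - j = 0 | l - j = 1" using assms(2) unfolding lat_adj_def by auto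
  have "(\<lfloor>Re z\<rfloor>, \<lfloor>Im z\<rfloor>) = (if k - i = - 1 then i - 1 else i, if l - j = - 1 then j - 1 else j)"
   unfolding re fl[OF e(1)] fl[OF e(2)] ..
  also have "... : {a, b}" using assms(2) unfolding lat_adj_def by (auto)
  finally show ?thesis .
 qed
qed

definition lat_graph :: "(int \<times> int) set => complex set" where
 "lat_graph U = (UN (a, b):{(a, b) : U \<times> U. lat_adj a b | a = b}. closed_segment (lat_pt a) (lat_pt b))"

lemma lat_pt_in_graph: "u : U ==> lat_pt u : lat_graph U" unfolding lat_graph_def by (rule UN_I[of "(u, u)"]) auto

lemma path_connected_lat_graph:
 assumes "gconn lat_adj U"
 shows "path_connected (lat_graph U)"
proof (cases "U = {}")
 case True thus ?thesis by (simp add: lat_graph_def)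
next
 case False
 then obtain u0 where u0: "u0 : U" by blast
 have seg: "path_component (lat_graph U) x y"
  if "a : U" "b : U" "lat_adj a b | a = b" "x : closed_segment (lat_pt a) (lat_pt b)" "y : closed_segment (lat_pt a) (lat_pt b)"
  for a b x y
 proof -
  have "closed_segment (lat_pt a) (lat_pt b) <= lat_graph U" unfolding lat_graph_def using that by blast
  moreover have "path_component (closed_segment (lat_pt a) (lat_pt b)) x y"
   using convex_imp_path_connected[OF convex_closed_segment] that(4,5) by (meson path_connected_component)
  ultimately show ?thesis using path_component_of_subset by blast
 qed
 have pc: "path_component (lat_graph U) (lat_pt u0) (lat_pt v)" if v: "v : U" for v
 proof (rule ccontr)
  assume c: "~ ?thesis"
  let ?P = "%v. path_component (lat_graph U) (lat_pt u0) (lat_pt v)"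
  have "?P u0" using lat_pt_in_graph[OF u0] by (simp add: path_component_refl)
  then obtain x y where "x : U" "y : U" "?P x" "~ ?P y" "lat_adj x y" using gconn_edge[where P = ?P, OF assms u0 _ v c] by blast
  thus False using seg[of x y "lat_pt x" "lat_pt y"] path_component_trans by fastforce
 qed
 have "path_component (lat_graph U) (lat_pt u0) z" if zU: "z : lat_graph U" for z
 proof -
  obtain a b where "a : U" "b : U" "lat_adj a b | a = b" "z : closed_segment (lat_pt a) (lat_pt b)"
   using zU unfolding lat_graph_def by blast
  thus ?thesis using seg[of a b "lat_pt a" z] pc[of a] path_component_trans by fastforce
 qed
 thus ?thesis by (meson path_connected_component path_component_sym path_component_trans)
qed

lemma lattice_crossing:
 assumes U: "gconn lat_adj U1" "gconn lat_adj U2" "U1 <= {- N..N} \<times> {- N..N}" "U2 <= {- N..N} \<times> {- N..N}"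
  and u: "u : U1" "fst u = - N" "u' : U1" "fst u' = N" and w: "w : U2" "snd w = - N" "w' : U2" "snd w' = N"
 shows "U1 Int U2 ~= {}"
proof -
 have sub: "lat_graph U <= cbox (lat_pt (- N, - N)) (lat_pt (N, N))" if "U <= {- N..N} \<times> {- N..N}" for U
 proof -
  have "lat_pt a : cbox (lat_pt (- N, - N)) (lat_pt (N, N))" if "a : U" for a
   using that \<open>U <= _\<close> by (cases a) (force simp: lat_pt_def in_cbox_complex_iff)
  hence "closed_segment (lat_pt a) (lat_pt b) <= cbox (lat_pt (- N, - N)) (lat_pt (N, N))" if "a : U" "b : U" for a b
   using that by (simp add: closed_segment_subset)
  thus ?thesis unfolding lat_graph_def by fastforce
 qed
 have "lat_graph U1 Int lat_graph U2 ~= {}" by (rule rectangle_crossing[OF path_connected_lat_graph[OF U(1)] path_connected_lat_graph[OF U(2)]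
     sub[OF U(3)] sub[OF U(4)], of "lat_pt u" "lat_pt u'" "lat_pt w" "lat_pt w'"])
   (use u w in "simp_all add: lat_pt_in_graph lat_pt_simps")
 then obtain z where z: "z : lat_graph U1" "z : lat_graph U2" by blast
 have "(\<lfloor>Re z\<rfloor>, \<lfloor>Im z\<rfloor>) : U" if "z : lat_graph U" for U
  using that floor_on_lattice_edge[of z] unfolding lat_graph_def by blast
 thus ?thesis using z by blast
qed

lemma sum_telescope_int:
 fixes f :: "int => int"
 assumes "a <= b"
 shows "(SUM i:{a..<b}. f i - f (i + 1)) = f a - f b" using assms
proof (induction b rule: int_ge_induct)
 case (step b)
 have "{a..<b + 1} = insert b {a..<b}" using step by auto
 thus ?case using step by simp
qed simp

text \<open>A set with no connection from one corner to the opposite one in its complement contains a crossing. The boundary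
  edges of the component of the corner, counted with sign, form a closed discrete 1-form on the triangulated
  square, whose sums along the two boundary paths between the corners agree.\<close>

lemma lattice_blocking:
 fixes N :: int
 defines "G \<equiv> {- N..N} \<times> {- N..N}"
 assumes N: "0 < N" and W: "W <= G" "(- N, N) ~: W" "(N, - N) ~: W"
  and no: "!!U. U <= G - W ==> gconn lat_adj U ==> (- N, N) : U ==> (N, - N) : U ==> False"
 shows "EX D<=W. gconn lat_adj D & (EX v:D. fst v = N | snd v = N) & (EX v:D. fst v = - N | snd v = - N)"
proof (rule ccontr)
 assume contra: "~ ?thesis"
 define X where "X = gcomp lat_adj (G - W) (- N, N)"
 have pX: "(- N, N) : X" unfolding X_def by (rule gcomp_self) (use W N in "auto simp: G_def")
 have XG: "X <= G - W" unfolding X_def by (rule gcomp_subset)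
 have qX: "(N, - N) ~: X" using no[OF XG _ pX] gconn_gcomp X_def by metis
 define Wb where "Wb = {b : G - X. EX a:X. lat_adj a b}"
 have WbW: "Wb <= W"
 proof
  fix b assume b: "b : Wb"
  then obtain a where a: "a : X" "lat_adj a b" "b : G" "b ~: X" by (auto simp: Wb_def)
  show "b : W"
  proof (rule ccontr)
   assume "b ~: W"
   hence "{b} <= gcomp lat_adj (G - W) (- N, N)" by (intro gcomp_absorb[OF symp_lat_adj, of _ _ b a]) (use a sympD[OF symp_lat_adj] X_def in auto)
   thus False using a X_def by auto
  qed
 qed
 define top where "top v \<longleftrightarrow> fst v = N | snd v = N" for v :: "int \<times> int"
 define D where "D = \<Union>{C. C <= Wb & gconn lat_adj C & (EX v:C. top v)}"
 have DWb: "D <= Wb" by (auto simp: D_def)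
 have Dtop: "v : D" if "v : Wb" "top v" for v unfolding D_def by (rule UnionI[of "{v}"]) (use that in auto)
 have Dadj: "c : D" if "b : D" "c : Wb" "lat_adj b c" for b c
 proof -
  obtain C where C: "C <= Wb" "gconn lat_adj C" "EX v:C. top v" "b : C" using \<open>b : D\<close> by (auto simp: D_def)
  have "gconn lat_adj (insert c C)" by (rule gconn_insert[OF symp_lat_adj C(2,4) that(3)])
  thus ?thesis unfolding D_def using C that by (intro UnionI[of "insert c C"]) auto
 qed
 have Dbot: "fst v ~= - N & snd v ~= - N" if vD: "v : D" for v
 proof -
  obtain C where C: "C <= Wb" "gconn lat_adj C" "EX v:C. top v" "v : C" using vD by (auto simp: D_def)
  thus ?thesis using contra WbW unfolding top_def by blast
 qed
 have DX: "v ~: D" if "v : X" for v using that DWb by (auto simp: Wb_def)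
 define ch where "ch a b = (of_bool (a : X & b : D) :: int)" for a b
 define \<omega> where "\<omega> a b = ch a b - ch b a" for a b
 \<comment> \<open>Two boundary vertices that form a triangle with \<open>a\<close> are adjacent,
   hence both or neither in \<open>D\<close>; this is what makes \<open>\<omega>\<close>
   closed.\<close>
 have same: "b : D \<longleftrightarrow> c : D" if "a : X" "b : G" "c : G" "b ~: X" "c ~: X" "lat_adj a b" "lat_adj a c" "lat_adj b c" for a b c
  using Dadj[of b c] Dadj[of c b] that sympD[OF symp_lat_adj] by (auto simp: Wb_def)
 have tri: "\<omega> a b + \<omega> b c = \<omega> a c" if "a : G" "b : G" "c : G" "lat_adj a b" "lat_adj b c" "lat_adj a c" for a b c
 proof -
  note s = sympD[OF symp_lat_adj]
  show ?thesis using same[of a b c] same[of b a c] same[of c a b] DX that s[OF that(4)] s[OF that(5)] s[OF that(6)]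
   unfolding \<omega>_def ch_def by (cases "a : X"; cases "b : X"; cases "c : X") auto
 qed
 define Hh where "Hh i j = \<omega> (i, j) (i + 1, j)" for i j
 define Vv where "Vv i j = \<omega> (i, j) (i, j + 1)" for i j
 have sq: "Hh i j - Hh i (j + 1) = Vv i j - Vv (i + 1) j" if "i : {- N..<N}" "j : {- N..<N}" for i j
 proof -
  have g: "(i, j) : G" "(i + 1, j) : G" "(i, j + 1) : G" "(i + 1, j + 1) : G" using that by (auto simp: G_def)
  show ?thesis using tri[OF g(1,2,4)] tri[OF g(1,3,4)] by (simp add: Hh_def Vv_def lat_adj_def)
 qed
 have "(SUM i:{- N..<N}. Hh i (- N) - Hh i N) = (SUM i:{- N..<N}. SUM j:{- N..<N}. Hh i j - Hh i (j + 1))"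
  by (simp add: sum_telescope_int)
 also have "... = (SUM i:{- N..<N}. SUM j:{- N..<N}. Vv i j - Vv (i + 1) j)" by (intro sum.cong refl sq)
 also have "... = (SUM j:{- N..<N}. SUM i:{- N..<N}. Vv i j - Vv (i + 1) j)" by (rule sum.swap)
 also have "... = (SUM j:{- N..<N}. Vv (- N) j - Vv N j)"
  by (intro sum.cong refl sum_telescope_int[where f = "%i. Vv i _"]) auto
 finally have sums: "(SUM i:{- N..<N}. Hh i (- N) - Hh i N) = (SUM j:{- N..<N}. Vv (- N) j - Vv N j)" .
 have "(i, - N) ~: D" "(- N, i) ~: D" for i using Dbot[of "(i, - N)"] Dbot[of "(- N, i)"] by auto
 hence bot: "Hh i (- N) = 0" "Vv (- N) i = 0" for i by (auto simp: Hh_def Vv_def \<omega>_def ch_def)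
 define x where "x v = (of_bool (v : X) :: int)" for v
 \<comment> \<open>On the top and right sides all boundary vertices of \<open>X\<close> belong to
   \<open>D\<close>, so \<open>\<omega>\<close> is a difference of values of the indicator of
   \<open>X\<close>. On the other two sides \<open>D\<close> is absent and \<open>\<omega>\<close>
   vanishes.\<close>
 have topw: "\<omega> a b = x a - x b" if "a : G" "b : G" "lat_adj a b" "top a" "top b" for a b
  using Dtop[of a] Dtop[of b] DX that sympD[OF symp_lat_adj, of a b] unfolding \<omega>_def ch_def x_def Wb_def by auto
 have "Hh i N = x (i, N) - x (i + 1, N)" if "i : {- N..<N}" for i
  unfolding Hh_def by (rule topw) (use that in "auto simp: G_def top_def lat_adj_def")
 hence "(SUM i:{- N..<N}. Hh i (- N) - Hh i N) = - (SUM i:{- N..<N}. x (i, N) - x (i + 1, N))"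
  unfolding sum_negf[symmetric] by (intro sum.cong refl) (simp add: bot)
 also have "... = - (x (- N, N) - x (N, N))" using N by (subst sum_telescope_int[where f = "%i. x (i, N)"]) auto
 finally have 1: "(SUM i:{- N..<N}. Hh i (- N) - Hh i N) = x (N, N) - x (- N, N)" by simp
 have "Vv N i = x (N, i) - x (N, i + 1)" if "i : {- N..<N}" for i
  unfolding Vv_def by (rule topw) (use that in "auto simp: G_def top_def lat_adj_def")
 hence "(SUM i:{- N..<N}. Vv (- N) i - Vv N i) = - (SUM i:{- N..<N}. x (N, i) - x (N, i + 1))"
  unfolding sum_negf[symmetric] by (intro sum.cong refl) (simp add: bot)
 also have "... = - (x (N, - N) - x (N, N))" using N by (subst sum_telescope_int[where f = "%i. x (N, i)"]) auto
 finally have 2: "(SUM i:{- N..<N}. Vv (- N) i - Vv N i) = x (N, N) - x (N, - N)" by simp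
 have "x (- N, N) = 1" "x (N, - N) = 0" using pX qX by (auto simp: x_def)
 thus False using sums 1 2 by simp
qed

section \<open>Jordan curves and quasicircles\<close>

lemma quasicircleD: "quasicircle K J ==> jordan_curve J" by (simp add: quasicircle_def)

lemma jordan_curveE:
 assumes "jordan_curve J"
 obtains c where "simple_path c" "pathfinish c = pathstart c" "path_image c = J" using assms unfolding jordan_curve_def by blast

lemma jordan_curve_compact: "jordan_curve J ==> compact J" by (metis jordan_curveE compact_path_image simple_path_imp_path)

lemma jordan_curve_connected: "jordan_curve J ==> connected J" by (metis jordan_curveE connected_path_image simple_path_imp_path)

lemma jordan_curve_inside_outside:
 assumes "jordan_curve J"
 shows "inside J ~= {}" "open (inside J)" "connected (inside J)" "outside J ~= {}" "open (outside J)" "connected (outside J)"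
  "bounded (inside J)" "~ bounded (outside J)" "inside J Int outside J = {}" "inside J Un outside J = - J"
  "frontier (inside J) = J" "frontier (outside J) = J" using assms Jordan_inside_outside unfolding jordan_curve_def by metis+

lemma jordan_curve_two_points:
 assumes "jordan_curve J"
 obtains x y where "x : J" "y : J" "x ~= y"
proof -
 obtain c where c: "simple_path c" "path_image c = J" using jordan_curveE[OF assms] by metis
 have "ALL s:{0..1}. ALL t:{0..1}. c s = c t --> s = t | s = 0 & t = 1 | s = 1 & t = 0"
  using c(1) by (simp add: simple_path_def loop_free_def)
 from this[rule_format, of 0 "1/2"] have "c 0 ~= c (1/2)" by auto
 moreover have "c 0 : J" "c (1/2) : J" using c(2) unfolding path_image_def by auto
 ultimately show ?thesis using that by blast
qed

lemma dist_le_diameter: "compact S ==> x : S ==> y : S ==> dist x y <= diameter (S::complex set)"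
 by (simp add: compact_imp_bounded diameter_bounded_bound)

lemma quasicircle_ge_1:
 assumes "quasicircle K J"
 shows "1 <= K"
proof -
 obtain x y where xy: "x : J" "y : J" "x ~= y" using jordan_curve_two_points quasicircleD[OF assms] by blast
 then obtain g where g: "arc g" "pathstart g = x" "pathfinish g = y" "diameter (path_image g) <= K * dist x y"
  using assms unfolding quasicircle_def by blast
 have "dist x y <= diameter (path_image g)" using g by (intro dist_le_diameter) (auto simp: compact_path_image arc_imp_path)
 hence "1 * dist x y <= K * dist x y" using g(4) by simp
 thus ?thesis using xy by simp
qed

text \<open>The arc of small diameter from \<open>a\<close> to \<open>b\<close> passes from one of
  the complementary arcs to the other and so contains \<open>x\<close> or \<open>y\<close>.\<close>

lemma quasicircle_arcs_apart:
 assumes J: "quasicircle K J" and u: "arc u" "arc d" "path_image u Int path_image d = {x, y}" "path_image u Un path_image d = J"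
  and a: "a : path_image u" and b: "b : path_image d"
 shows "dist a x <= K * dist a b | dist a y <= K * dist a b"
proof (cases "a = x | a = y | b = x | b = y")
 case True
 have "dist a b <= K * dist a b" using mult_right_mono[OF quasicircle_ge_1[OF J], of "dist a b"] by simp
 moreover have "0 <= K * dist a b" using quasicircle_ge_1[OF J] by simp
 ultimately show ?thesis using True by (elim disjE) (auto)
next
 case False
 hence ab: "a ~: path_image d" "b ~: path_image u" using u a b by blast+
 hence "a ~= b" using a by blast
 moreover have "a : J" "b : J" using u a b by auto
 ultimately obtain g where g: "arc g" "path_image g <= J" "pathstart g = a" "pathfinish g = b" "diameter (path_image g) <= K * dist a b"
  using J unfolding quasicircle_def by blast
 have cl: "closed (path_image u)" "closed (path_image d)" using u(1,2) by (auto intro: closed_path_image arc_imp_path)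
 have aging: "a : path_image g" "b : path_image g" using g by auto
 have "x : path_image g | y : path_image g"
 proof (rule ccontr)
  assume no: "~ ?thesis"
  have "path_image g Int (path_image u Int path_image d) = {}" unfolding u(3) using no by blast
  hence "path_image g Int path_image u Int path_image d = {}" by (simp only: Int_assoc)
  hence "path_image g Int path_image u = {} | path_image g Int path_image d = {}"
   using connected_closedD[OF connected_path_image[OF arc_imp_path[OF g(1)]], of "path_image u" "path_image d"] cl g(2) u(4) by blast
  thus False using aging a b by blast
 qed
 moreover have "dist a z <= K * dist a b" if "z : path_image g" for z
  using dist_le_diameter[OF compact_path_image[OF arc_imp_path[OF g(1)]] aging(1) that] g(5) by simp
 ultimately show ?thesis by blast
qed

text \<open>If both arcs between \<open>a\<close> and \<open>b\<close> entered the ball, they would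
  come within \<open>2 * R\<close> of each other, and an end point would lie within
  \<open>R + 2 * K * R\<close> of the centre. This is the origin of the factor
  \<open>2 * K2 + 1\<close> in later constants.\<close>

lemma quasicircle_avoids_ball:
 assumes J: "quasicircle K J" and ab: "a : J" "b : J" "(2 * K + 1) * R < dist x a" "(2 * K + 1) * R < dist x b" and R: "0 <= R"
 obtains G where "connected G" "G <= J" "a : G" "b : G" "G Int cball x R = {}"
proof (cases "a = b")
 case True
 have "R <= (2 * K + 1) * R" using quasicircle_ge_1[OF J] R by (simp add: algebra_simps)
 hence "a ~: cball x R" using ab by auto
 thus ?thesis using that[of "{a}"] True ab by auto
next
 case False
 obtain c where c: "simple_path c" "pathfinish c = pathstart c" "path_image c = J" using jordan_curveE[OF quasicircleD[OF J]] .
 obtain u d where ud: "arc u" "arc d" "pathstart u = a" "pathfinish u = b" "pathstart d = b" "pathfinish d = a"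
  "path_image u Int path_image d = {a, b}" "path_image u Un path_image d = J"
  using exists_double_arc[OF c(1,2), of a b] c(3) ab False by metis
 have "path_image u Int cball x R = {} | path_image d Int cball x R = {}"
 proof (rule ccontr)
  assume "~ ?thesis"
  then obtain s t where st: "s : path_image u" "dist x s <= R" "t : path_image d" "dist x t <= R" by auto
  have "dist s t <= 2 * R" using st dist_triangle3[of s t x] by linarith
  hence K2: "K * dist s t <= K * (2 * R)" using quasicircle_ge_1[OF J] by (intro mult_left_mono) auto
  from quasicircle_arcs_apart[OF J ud(1,2,7,8) st(1,3)]
  have "dist s a <= K * (2 * R) | dist s b <= K * (2 * R)" using K2 by linarith
  hence "dist x a <= R + K * (2 * R) | dist x b <= R + K * (2 * R)" using dist_triangle[of x a s] dist_triangle[of x b s] st(2) by linarith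
  thus False using ab by (auto simp: algebra_simps)
 qed
 thus ?thesis
 proof
  assume "path_image u Int cball x R = {}"
  thus ?thesis using that[of "path_image u"] ud connected_path_image[OF arc_imp_path[OF ud(1)]]
    pathfinish_in_path_image[of u] by auto
 next
  assume "path_image d Int cball x R = {}"
  thus ?thesis using that[of "path_image d"] ud connected_path_image[OF arc_imp_path[OF ud(2)]]
    pathfinish_in_path_image[of d] by auto
 qed
qed

lemma first_point_on_segment:
 fixes x z :: complex
 assumes "closed C" "closed_segment x z Int C ~= {}"
 obtains a where "a : closed_segment x z" "a : C" "!!y. y : closed_segment x a ==> y : C ==> y = a"
proof -
 have "compact (closed_segment x z Int C)" using assms by (intro compact_Int_closed) auto
 then obtain a where a: "a : closed_segment x z Int C" "!!y. y : closed_segment x z Int C ==> dist x a <= dist x y"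
  using distance_attains_inf[of "closed_segment x z Int C" x] assms(2) compact_imp_closed by metis
 have "y = a" if y: "y : closed_segment x a" "y : C" for y
 proof -
  have "closed_segment x a <= closed_segment x z" using a(1) by (simp add: subset_closed_segment)
  hence "dist x a <= dist x y" using a(2) y by blast
  moreover have "dist x a = dist x y + dist y a" using y(1) by (metis between_mem_segment between)
  ultimately show ?thesis by simp
 qed
 thus ?thesis using that a(1) by blast
qed

lemma closed_segment_first_frontier:
 fixes x z :: complex
 assumes U: "open U" "x ~: U" "closed_segment x z Int closure U ~= {}"
 obtains a where "a : closed_segment x z" "a : frontier U" "closed_segment x a Int U = {}"
proof -
 obtain a where a: "a : closed_segment x z" "a : closure U" "!!y. y : closed_segment x a ==> y : closure U ==> y = a"
  using first_point_on_segment[OF closed_closure U(3)] by blast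
 have "a ~: U"
 proof
  assume aU: "a : U"
  then obtain e where e: "0 < e" "ball a e <= U" using U(1) open_contains_ball by blast
  have "x ~= a" using aU U(2) by blast
  define s where "s = min 1 (e / (2 * dist x a))"
  have s: "0 < s" "s <= 1" "s * dist x a < e" using e(1) \<open>x ~= a\<close> by (auto simp: s_def min_def field_simps)
  define y where "y = (1 - s) *\<^sub>R a + s *\<^sub>R x"
  have "y : closed_segment a x" unfolding closed_segment_def y_def using s by auto
  hence 1: "y : closed_segment x a" by (simp add: closed_segment_commute)
  have d: "a - y = s *\<^sub>R (a - x)" by (simp add: y_def algebra_simps)
  hence "dist a y = s * dist x a" using s by (simp add: dist_norm norm_minus_commute)
  hence "y : U" using e s by auto
  hence "y = a" using a(3)[OF 1] closure_subset by blast
  thus False using d s \<open>x ~= a\<close> by simp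
 qed
 hence f: "a : frontier U" using a(2) U(1) by (simp add: frontier_def interior_open)
 have "closed_segment x a Int U = {}" using a(3) \<open>a ~: U\<close> closure_subset by blast
 thus ?thesis using that a(1) f by blast
qed

text \<open>Follow the segment from each end up to its first point on the boundary of
  \<open>U\<close>, and join the two points by a boundary arc of diameter at most
  \<open>K * dist x z\<close>.\<close>

lemma quasicircle_detour:
 assumes J: "quasicircle K (frontier U)" and U: "open U" "x ~: U" "z ~: U"
 obtains E where "connected E" "compact E" "x : E" "z : E" "E Int U = {}" "E <= cball x ((1 + K) * dist x z)"
  "E <= closed_segment x z Un frontier U"
proof -
 have K: "1 <= K" by (rule quasicircle_ge_1[OF J])
 have seg: "dist x w <= dist x z" if "w : closed_segment x z" for w using segment_bound(1)[OF that] by (simp add: dist_norm norm_minus_commute)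
 have Kd: "dist x z <= (1 + K) * dist x z" using K by (simp add: algebra_simps)
 have segc: "closed_segment x z <= cball x ((1 + K) * dist x z)" using seg Kd by (meson mem_cball order_trans subsetI)
 show ?thesis
 proof (cases "closed_segment x z Int closure U = {}")
  case True
  hence "closed_segment x z Int U = {}" using closure_subset by blast
  thus ?thesis using that[of "closed_segment x z"] segc by auto
 next
  case False
  obtain a where a: "a : closed_segment x z" "a : frontier U" "closed_segment x a Int U = {}"
   using closed_segment_first_frontier[OF U(1,2) False] by blast
  have "closed_segment z x Int closure U ~= {}" using False by (simp add: closed_segment_commute)
  then obtain b where b: "b : closed_segment z x" "b : frontier U" "closed_segment z b Int U = {}"
   using closed_segment_first_frontier[OF U(1,3)] by blast
  have b1: "b : closed_segment x z" using b(1) by (simp add: closed_segment_commute)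
  obtain g where g: "connected g" "compact g" "a : g" "b : g" "g <= frontier U" "g <= cball a (K * dist a b)"
  proof (cases "a = b")
   case True thus thesis using that[of "{a}"] a by auto
  next
   case False
   then obtain h where h: "arc h" "path_image h <= frontier U" "pathstart h = a" "pathfinish h = b" "diameter (path_image h) <= K * dist a b"
    using J a(2) b(2) unfolding quasicircle_def by blast
   have p: "path h" using h arc_imp_path by blast
   have e: "a : path_image h" "b : path_image h" using h by auto
   have "path_image h <= cball a (K * dist a b)" using dist_le_diameter[OF compact_path_image[OF p] e(1)] h(5) by force
   thus thesis using that[of "path_image h"] e h p connected_path_image compact_path_image by metis
  qed
  have sub: "closed_segment x a <= closed_segment x z" "closed_segment z b <= closed_segment x z" using a(1) b1 by (auto simp: subset_closed_segment)
  have dab: "dist a b <= dist x z" using segment_furthest_le[OF a(1), of b] segment_bound[OF b1] by (auto simp: dist_norm norm_minus_commute)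
  have gx: "g <= cball x ((1 + K) * dist x z)"
  proof
   fix w assume "w : g"
   hence "dist a w <= K * dist a b" using g by auto
   also have "... <= K * dist x z" using dab K by (intro mult_left_mono) auto
   finally have "dist a w <= K * dist x z" .
   thus "w : cball x ((1 + K) * dist x z)" using dist_triangle[of x w a] seg[OF a(1)] by (simp add: algebra_simps)
  qed
  have c1: "connected (closed_segment x a Un g)" by (rule connected_Un) (use g in auto)
  have c2: "connected (closed_segment x a Un g Un closed_segment z b)" by (rule connected_Un[OF c1]) (use g in auto)
  have gU: "g Int U = {}" using g(5) U(1) by (auto simp: frontier_def interior_open)
  show ?thesis by (rule that[OF c2]) (use g a b gU gx sub segc in "auto intro!: compact_Un")
 qed
qed

text \<open>Coordinates with origin \<open>c\<close> and first axis \<open>e\<close>. Dividing by an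
  \<open>e\<close> that is not a unit also rescales, which later gives grid coordinates in units of
  the mesh.\<close>

definition frame :: "complex => complex => complex => complex" where
 "frame c e z = (z - c) / e"

definition unframe :: "complex => complex => complex => complex" where
 "unframe c e w = c + e * w"

lemma frame_unframe [simp]: "e ~= 0 ==> frame c e (unframe c e w) = w"
 and unframe_frame [simp]: "e ~= 0 ==> unframe c e (frame c e z) = z" by (auto simp: frame_def unframe_def)

lemma frame_inj: "e ~= 0 ==> frame c e z = frame c e w \<longleftrightarrow> z = w" by (auto simp: frame_def)

lemma dist_frame: "e ~= 0 ==> dist (frame c e z) (frame c e w) = dist z w / norm e"
proof -
 have "frame c e z - frame c e w = (z - w) / e" by (simp add: frame_def diff_divide_distrib)
 thus ?thesis by (simp add: dist_norm norm_divide)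
qed

lemma continuous_on_frame [continuous_intros]: "e ~= 0 ==> continuous_on S f ==> continuous_on S (%x. frame c e (f x))"
 and continuous_on_unframe [continuous_intros]: "continuous_on S f ==> continuous_on S (%x. unframe c e (f x))"
 unfolding frame_def unframe_def by (auto intro!: continuous_intros)

lemma frame_crossing:
 assumes e: "e ~= 0" and S: "path_connected S1" "path_connected S2"
  and box: "!!z. z : S1 Un S2 ==> xl <= Re (frame c e z) & Re (frame c e z) <= xr & yl <= Im (frame c e z) & Im (frame c e z) <= yr"
  and z: "z : S1" "Re (frame c e z) = xl" "z' : S1" "Re (frame c e z') = xr"
  and w: "w : S2" "Im (frame c e w) = yl" "w' : S2" "Im (frame c e w') = yr"
 shows "S1 Int S2 ~= {}"
proof -
 have "frame c e ` S1 Int frame c e ` S2 ~= {}"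
 proof (rule rectangle_crossing)
  show "path_connected (frame c e ` S1)" "path_connected (frame c e ` S2)"
   using S e by (auto intro!: path_connected_continuous_image continuous_intros)
  show "frame c e ` S1 <= cbox (Complex xl yl) (Complex xr yr)" "frame c e ` S2 <= cbox (Complex xl yl) (Complex xr yr)"
   using box by (auto simp: in_cbox_complex_iff)
  show "frame c e z : frame c e ` S1" "frame c e z' : frame c e ` S1" "frame c e w : frame c e ` S2" "frame c e w' : frame c e ` S2"
   using z w by auto
 qed (use z w in auto)
 then obtain x y where "x : S1" "y : S2" "frame c e x = frame c e y" by blast
 thus ?thesis unfolding frame_inj[OF e] by blast
qed

definition vseg :: "complex => complex => real => real => real => complex set" where
 "vseg c e x y1 y2 = {z. Re (frame c e z) = x & y1 <= Im (frame c e z) & Im (frame c e z) <= y2}"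

lemma path_connected_vseg: assumes "e ~= 0" shows "path_connected (vseg c e x y1 y2)"
proof -
 have "vseg c e x y1 y2 = (%t. unframe c e (Complex x t)) ` {y1..y2}"
 proof
  show "vseg c e x y1 y2 <= (%t. unframe c e (Complex x t)) ` {y1..y2}"
  proof
   fix z assume z: "z : vseg c e x y1 y2"
   hence "z = unframe c e (Complex x (Im (frame c e z)))"
    using assms by (metis (mono_tags, lifting) complex.exhaust_sel mem_Collect_eq unframe_frame vseg_def)
   thus "z : (%t. unframe c e (Complex x t)) ` {y1..y2}" using z by (auto simp: vseg_def)
  qed
 qed (use assms in "auto simp: vseg_def")
 moreover have "continuous_on {y1..y2} (%t. unframe c e (Complex x t))" by (intro continuous_intros)
 ultimately show ?thesis using path_connected_continuous_image[OF _ convex_imp_path_connected[OF convex_real_interval(5)]] by metis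
qed

lemma path_connected_arc_interior:
 assumes "arc g"
 shows "path_connected (path_image g - {pathstart g, pathfinish g})"
proof -
 have inj: "inj_on g {0..1}" using assms by (simp add: arc_def)
 have "path_image g - {pathstart g, pathfinish g} = g ` {0<..<1}"
 proof -
  have "g t ~= g 0" "g t ~= g 1" if "t : {0<..<1}" for t using inj_onD[OF inj, of t 0] inj_onD[OF inj, of t 1] that by auto
  moreover have "t : {0<..<1}" if "t : {0..1}" "g t ~= g 0" "g t ~= g 1" for t using that by (cases "t = 0"; cases "t = 1") auto
  ultimately have "g ` {0..1} - {g 0, g 1} = g ` {0<..<1}"
  proof (intro equalityI subsetI)
   fix y assume "y : g ` {0..1} - {g 0, g 1}"
   then obtain t where t: "t : {0..1}" "y = g t" "y ~= g 0" "y ~= g 1" by blast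
   hence "t : {0<..<1}" using \<open>!!t. t : {0..1} ==> g t ~= g 0 ==> g t ~= g 1 ==> t : {0<..<1}\<close> by blast
   thus "y : g ` {0<..<1}" using t by blast
  next
   fix y assume "y : g ` {0<..<1}"
   then obtain t where t: "t : {0<..<1}" "y = g t" by blast
   hence "y ~= g 0" "y ~= g 1" "t : {0..1}"
    using \<open>!!t. t : {0<..<1} ==> g t ~= g 0\<close> \<open>!!t. t : {0<..<1} ==> g t ~= g 1\<close> by auto
   thus "y : g ` {0..1} - {g 0, g 1}" using t by blast
  qed
  thus ?thesis unfolding path_image_def pathstart_def pathfinish_def .
 qed
 moreover have "continuous_on {0<..<1} g" using arc_imp_path[OF assms] unfolding path_def by (rule continuous_on_subset) auto
 ultimately show ?thesis using path_connected_continuous_image[OF _ convex_imp_path_connected[OF convex_real_interval(8)]] by metis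
qed

text \<open>As in proofs of the Jordan curve theorem by crossings in a rectangle. With
  \<open>p\<close>, \<open>q\<close> at maximal distance, look at the perpendicular bisector:
  between the top point \<open>b\<close> of the lower arc and the next point \<open>a\<close> of the
  upper arc above it lie only points inside the curve. The one equidistant from both arcs is far
  from both by the quasicircle condition.\<close>

lemma quasicircle_fat_aux:
 assumes J: "quasicircle K J"
  and g: "arc g1" "arc g2" "pathstart g1 = p" "pathfinish g1 = q" "pathstart g2 = q" "pathfinish g2 = p"
   "path_image g1 Int path_image g2 = {p, q}" "path_image g1 Un path_image g2 = J"
  and pq: "p ~= q" "dist p q = diameter J"
 defines "d \<equiv> dist p q"
 defines "X \<equiv> %z. Re (frame ((p + q) / 2) ((q - p) / of_real d) z)"
  and "Y \<equiv> %z. Im (frame ((p + q) / 2) ((q - p) / of_real d) z)"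
 assumes u: "u : path_image g1" "X u = 0" "!!z. z : J ==> X z = 0 ==> Y z <= Y u"
  and w: "w : J" "X w = 0" "!!z. z : J ==> X z = 0 ==> Y w <= Y z"
 shows "w : path_image g2 & (EX z. ball z (d / (8 * K)) <= inside J)"
proof -
 define c e where "c = (p + q) / 2" and "e = (q - p) / of_real d"
 have d: "0 < d" unfolding d_def using pq(1) by simp
 have ne: "norm e = 1" using d by (simp add: e_def norm_divide d_def dist_norm norm_minus_commute)
 hence e0: "e ~= 0" by auto
 have XY: "X = (%z. Re (frame c e z))" "Y = (%z. Im (frame c e z))" by (auto simp: X_def Y_def c_def e_def)
 have frp: "frame c e p = of_real (- d / 2)" "frame c e q = of_real (d / 2)" using pq d unfolding frame_def c_def e_def by (auto simp: field_simps)
 have Xp: "X p = - d / 2" "Y p = 0" "X q = d / 2" "Y q = 0" unfolding XY frp by auto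
 have Xeq: "z = z'" if "X z = X z'" "Y z = Y z'" for z z' using that complex_eqI[of "frame c e z" "frame c e z'"] frame_inj[OF e0] by (auto simp: XY)
 have dXY: "(dist z z')^2 = (X z - X z')^2 + (Y z - Y z')^2" for z z'
 proof -
  have "dist z z' = dist (frame c e z) (frame c e z')" using dist_frame[OF e0] ne by simp
  thus ?thesis by (simp add: XY dist_norm cmod_power2)
 qed
 have dX: "\<bar>X z - X z'\<bar> <= dist z z'" for z z'
  using dXY[of z z'] by (metis abs_ge_zero abs_le_square_iff abs_of_nonneg le_add_same_cancel1 zero_le_dist zero_le_power2)
 have K: "1 <= K" by (rule quasicircle_ge_1[OF J])
 have cJ: "compact J" by (rule jordan_curve_compact[OF quasicircleD[OF J]])
 define J1 J2 where "J1 = path_image g1" and "J2 = path_image g2"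
 have J12: "J1 Int J2 = {p, q}" "J1 Un J2 = J" using g by (auto simp: J1_def J2_def)
 have pJ: "p : J1" "q : J1" "p : J2" "q : J2" using J12 by auto
 have cont: "continuous_on A X" "continuous_on A Y" for A unfolding XY using e0 by (auto intro!: continuous_intros)
 have JX: "\<bar>X z\<bar> <= d / 2" "\<bar>Y z\<bar> <= d" "\<bar>X z\<bar> = d / 2 ==> z = p | z = q" if z: "z : J" for z
 proof -
  have "dist z p <= d" "dist z q <= d" using dist_le_diameter[OF cJ z] pJ J12 pq by (auto simp: d_def)
  hence "(dist z p)^2 <= d\<^sup>2" "(dist z q)^2 <= d\<^sup>2" by (auto intro: power_mono)
  hence 1: "(X z + d / 2)^2 + (Y z)^2 <= d\<^sup>2" "(X z - d / 2)^2 + (Y z)^2 <= d\<^sup>2" unfolding dXY Xp by simp_all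
  hence "(X z + d / 2)^2 <= d\<^sup>2" "(X z - d / 2)^2 <= d\<^sup>2" "(Y z)^2 <= d\<^sup>2"
   using zero_le_power2[of "Y z"] zero_le_power2[of "X z + d / 2"] by linarith+
  hence 2: "\<bar>X z + d / 2\<bar> <= d" "\<bar>X z - d / 2\<bar> <= d" "\<bar>Y z\<bar> <= d" using d by (auto simp: abs_le_square_iff[symmetric])
  thus "\<bar>X z\<bar> <= d / 2" "\<bar>Y z\<bar> <= d" by auto
  assume "\<bar>X z\<bar> = d / 2"
  hence "X z = d / 2 | X z = - d / 2" by auto
  thus "z = p | z = q"
  proof
   assume x: "X z = d / 2"
   hence "X z + d / 2 = d" by simp
   hence "(Y z)^2 <= 0" using 1(1) by simp
   thus ?thesis using Xeq[of z q] x Xp by simp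
  next
   assume x: "X z = - d / 2"
   hence "X z - d / 2 = - d" by simp
   hence "(Y z)^2 <= 0" using 1(2) by simp
   thus ?thesis using Xeq[of z p] x Xp by simp
  qed
 qed
 define D where "D = 2 * d"
 have crossing: "S1 Int S2 ~= {}"
  if "path_connected S1" "path_connected S2" "!!z. z : S1 Un S2 ==> \<bar>X z\<bar> <= d / 2 & \<bar>Y z\<bar> <= D" "p : S1" "q : S1" "t : S2" "Y t = D" "s : S2" "Y s = - D"
  for S1 S2 s t
 proof (rule frame_crossing[OF e0 that(1,2), where xl = "- d / 2" and xr = "d / 2" and yl = "- D" and yr = D and c = c and z = p and z' = q and w = s and w' = t])
  show "- d / 2 <= Re (frame c e z) & Re (frame c e z) <= d / 2 & - D <= Im (frame c e z) & Im (frame c e z) <= D" if "z : S1 Un S2" for z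
   using \<open>!!z. z : S1 Un S2 ==> \<bar>X z\<bar> <= d / 2 & \<bar>Y z\<bar> <= D\<close>[OF that] by (auto simp: XY abs_le_iff)
 qed (use that Xp in "auto simp: XY")
 have pcJ: "path_connected J1" "path_connected J2" unfolding J1_def J2_def using g by (auto intro: path_connected_path_image arc_imp_path)
 have pcI: "path_connected (J1 - {p, q})" "path_connected (J2 - {p, q})"
  using path_connected_arc_interior[OF g(1)] path_connected_arc_interior[OF g(2)] g by (auto simp: J1_def J2_def insert_commute)
 have cl: "compact J1" "compact J2" unfolding J1_def J2_def using g by (auto intro: compact_path_image arc_imp_path)
 have uJ: "u : J1" "u : J" using u J12 by (auto simp: J1_def)
 have not_pq: "z ~= p & z ~= q" if "X z = 0" for z using that Xp d by auto
 let ?V = "vseg c e"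
 have V: "z : ?V x y1 y2 \<longleftrightarrow> X z = x & y1 <= Y z & Y z <= y2" for z x y1 y2 by (simp add: vseg_def XY)
 have pt: "EX z. X z = x & Y z = y" for x y by (rule exI[of _ "unframe c e (Complex x y)"]) (use e0 in "simp add: XY")
 obtain tu where tu: "X tu = 0" "Y tu = D" using pt by blast
 obtain bw where bw: "X bw = 0" "Y bw = - D" using pt by blast
 have Yu: "\<bar>Y u\<bar> <= d" "\<bar>Y w\<bar> <= d" using JX uJ w by auto
 have upV: "?V 0 (Y u) D Int J <= {u}" using u(2,3) Xeq by (auto simp: V) (metis antisym)
 have dnV: "?V 0 (- D) (Y w) Int J <= {w}" using w(2,3) Xeq by (auto simp: V) (metis antisym)
 have uV: "u : ?V 0 (Y u) D" "w : ?V 0 (- D) (Y w)" "tu : ?V 0 (Y u) D" "bw : ?V 0 (- D) (Y w)"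
  using u(2) w(2) Yu d tu bw by (auto simp: V D_def)
 have JB: "\<bar>X z\<bar> <= d / 2 & \<bar>Y z\<bar> <= D" if "z : J" for z using JX(1,2)[OF that] d by (auto simp: D_def)
 have uB: "\<bar>X z\<bar> <= d / 2 & \<bar>Y z\<bar> <= D" if "z : ?V 0 (Y u) D" for z using that Yu d by (auto simp: V D_def)
 have wB: "\<bar>X z\<bar> <= d / 2 & \<bar>Y z\<bar> <= D" if "z : ?V 0 (- D) (Y w)" for z using that Yu d by (auto simp: V D_def)
 \<comment> \<open>Otherwise the vertical segments above \<open>u\<close> and below \<open>w\<close>
   together with \<open>J1\<close> without its ends would join top to bottom and miss
   \<open>J2\<close>, which joins \<open>p\<close> to \<open>q\<close>.\<close>
 have w2: "w : J2"
 proof (rule ccontr)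
  assume "w ~: J2"
  hence w1: "w : J1" using w J12 by blast
  have uI: "u : J1 - {p, q}" "w : J1 - {p, q}" using uJ w1 not_pq u w by auto
  have "path_connected (?V 0 (Y u) D Un (J1 - {p, q}))" by (rule path_connected_Un[OF path_connected_vseg[OF e0] pcI(1)]) (use uI uV in blast)
  hence "path_connected ((?V 0 (Y u) D Un (J1 - {p, q})) Un ?V 0 (- D) (Y w))"
   by (rule path_connected_Un[OF _ path_connected_vseg[OF e0]]) (use uI uV in blast)
  hence "J2 Int ((?V 0 (Y u) D Un (J1 - {p, q})) Un ?V 0 (- D) (Y w)) ~= {}"
  proof (rule crossing[OF pcJ(2), of _ tu bw])
   fix z assume "z : J2 Un ((?V 0 (Y u) D Un (J1 - {p, q})) Un ?V 0 (- D) (Y w))"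
   hence "z : J | z : ?V 0 (Y u) D | z : ?V 0 (- D) (Y w)" using J12(2) by blast
   thus "\<bar>X z\<bar> <= d / 2 & \<bar>Y z\<bar> <= D" using JB uB wB by blast
  qed (use pJ tu bw uV in auto)
  moreover have "J2 Int (?V 0 (Y u) D Un (J1 - {p, q}) Un ?V 0 (- D) (Y w)) = {}"
   using upV dnV J12 uI \<open>w ~: J2\<close> by blast
  ultimately show False by blast
 qed
 have "EX b:J2 Int {z. X z = 0}. ALL z:J2 Int {z. X z = 0}. Y z <= Y b"
 proof (rule continuous_attains_sup)
  show "compact (J2 Int {z. X z = 0})" using cl(2) closed_Collect_eq[OF cont(1)[of UNIV], of "%_. 0"] by (intro compact_Int_closed) auto
 qed (use w2 w cont in auto)
 then obtain b where b: "b : J2" "X b = 0" "!!z. z : J2 ==> X z = 0 ==> Y z <= Y b" by blast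
 have bu: "Y b <= Y u" using u(3)[of b] b J12 by auto
 have "EX a:J1 Int {z. X z = 0 & Y b <= Y z}. ALL z:J1 Int {z. X z = 0 & Y b <= Y z}. Y a <= Y z"
 proof (rule continuous_attains_inf)
  show "compact (J1 Int {z. X z = 0 & Y b <= Y z})"
   using cl(1) by (intro compact_Int_closed closed_Collect_conj closed_Collect_eq closed_Collect_le cont continuous_intros) auto
 qed (use uJ u bu cont in auto)
 then obtain a where a: "a : J1" "X a = 0" "Y b <= Y a" "!!z. z : J1 ==> X z = 0 ==> Y b <= Y z ==> Y a <= Y z" by blast
 have "a ~= b" using a b J12 not_pq by blast
 hence ab: "Y b < Y a" using a(2,3) b(2) Xeq[of a b] by force
 define P where "P t = unframe c e (Complex 0 t)" for t
 have P: "X (P t) = 0" "Y (P t) = t" for t using e0 by (auto simp: P_def XY)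
 have Pab: "P (Y a) = a" "P (Y b) = b" using Xeq[of "P (Y a)" a] Xeq[of "P (Y b)" b] P a b by auto
 have contP: "continuous_on A P" for A unfolding P_def Complex_eq by (intro continuous_intros)
 \<comment> \<open>Between \<open>b\<close> and \<open>a\<close> the difference of the distances to
   the two arcs changes sign.\<close>
 have "EX t>=Y b. t <= Y a & infdist (P t) J2 - infdist (P t) J1 = 0"
 proof (rule IVT')
  show "infdist (P (Y b)) J2 - infdist (P (Y b)) J1 <= 0" "0 <= infdist (P (Y a)) J2 - infdist (P (Y a)) J1"
   using a b by (auto simp: Pab infdist_nonneg)
 qed (use ab contP in "auto intro!: continuous_intros")
 then obtain t where t: "Y b <= t" "t <= Y a" "infdist (P t) J2 = infdist (P t) J1" by auto
 define z where "z = P t"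
 define s where "s = infdist z J1"
 have z: "X z = 0" "Y z = t" using P by (auto simp: z_def)
 obtain a' where a': "a' : J1" "infdist z J1 = dist z a'" using infdist_attains_inf[of J1 z] cl pJ compact_imp_closed by blast
 obtain b' where b': "b' : J2" "infdist z J2 = dist z b'" using infdist_attains_inf[of J2 z] cl pJ compact_imp_closed by blast
 have s: "dist z a' = s" "dist z b' = s" using a' b' t(3) by (auto simp: s_def z_def)
 \<comment> \<open>The nearest points of the two arcs are within \<open>2 * s\<close> of each other,
   and the one on \<open>J1\<close> is at least \<open>d / 2 - s\<close> away from \<open>p\<close>
   and \<open>q\<close>; separation of the arcs bounds \<open>s\<close> from below.\<close>
 have sd: "d / (8 * K) <= s"
 proof (cases "s < d / 8")
  case False
  have "d / (8 * K) <= d / 8" using K d by (intro divide_left_mono) auto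
  thus ?thesis using False by simp
 next
  case True
  have far: "d / 2 - s <= dist a' p" "d / 2 - s <= dist a' q" using dX[of a' p] dX[of a' q] dX[of z a'] s z Xp by linarith+
  have "dist a' b' <= 2 * s" using s dist_triangle3[of a' b' z] by simp
  hence "K * dist a' b' <= K * (2 * s)" using K by (intro mult_left_mono) auto
  moreover have "dist a' p <= K * dist a' b' | dist a' q <= K * dist a' b'"
   by (rule quasicircle_arcs_apart[OF J g(1,2,7,8)]) (use a' b' in "auto simp: J1_def J2_def")
  ultimately have "d / 2 - s <= K * (2 * s)" using far by linarith
  hence "d <= 8 * K * s" using True d by (simp add: field_simps)
  thus ?thesis using K by (simp add: pos_divide_le_eq mult.commute)
 qed
 have s0: "0 < s" using sd K d by (smt (verit) divide_pos_pos mult_pos_pos)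
 have ballJ: "ball z (d / (8 * K)) Int J = {}"
 proof -
  have "s <= dist z y" if "y : J" for y
  proof -
   from that consider "y : J1" | "y : J2" using J12 by blast
   thus ?thesis
   proof cases
    case 1 thus ?thesis using infdist_le[of y J1 z] by (simp add: s_def)
   next
    case 2 thus ?thesis using infdist_le[of y J2 z] b' s by simp
   qed
  qed
  thus ?thesis using sd by fastforce
 qed
 have r0: "0 < d / (8 * K)" using d K by simp
 have zJ: "z ~: J" using ballJ r0 centre_in_ball by blast
 have zab: "Y b < t" "t < Y a" using t zJ a b J12 Pab unfolding z_def by (metis Un_iff order_less_le)+
 note io = jordan_curve_inside_outside[OF quasicircleD[OF J]]
 \<comment> \<open>A path from \<open>z\<close> to the boundary of the rectangle \<open>S\<close>
   that misses \<open>J\<close> could be continued along the wall, up or down, and completed to a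
   connected set from top to bottom missing \<open>J1\<close> or \<open>J2\<close>.\<close>
 have "z : inside J"
 proof (rule ccontr)
  assume "z ~: inside J"
  hence zo: "z : outside J" using io(10) zJ by blast
  define S where "S = {z. \<bar>X z\<bar> <= d / 2 & \<bar>Y z\<bar> <= D}"
  have clS: "closed S" unfolding S_def by (intro closed_Collect_conj closed_Collect_le cont continuous_intros)
  have zS: "z : S" using z t Yu JX(2)[of a] JX(2)[of b] a b J12 d by (auto simp: S_def D_def abs_le_iff)
  have bS: "bounded S"
  proof (rule boundedI)
   fix y assume "y : S"
   hence "norm (frame c e y) <= d / 2 + D" using cmod_le[of "frame c e y"] by (auto simp: S_def XY)
   hence "norm (e * frame c e y) <= d / 2 + D" by (simp add: norm_mult ne)
   thus "norm y <= norm c + (d / 2 + D)" using norm_triangle_ineq[of c "e * frame c e y"] unframe_frame[OF e0, of c y] by (simp add: unframe_def)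
  qed
  obtain y where y: "y : outside J" "y ~: S" using io(8) bS bounded_subset by blast
  obtain g0 where g0: "path g0" "path_image g0 <= outside J" "pathstart g0 = z" "pathfinish g0 = y"
   using connected_open_path_connected[OF io(5,6)] zo y unfolding path_connected_def by blast
  obtain h where h: "path h" "pathstart h = z" "path_image h <= path_image g0 Int S" "pathfinish h : frontier S"
   using exists_path_subpath_to_frontier_closed[OF clS g0(1)] g0 zS y by metis
  define t0 where "t0 = pathfinish h"
  have hJ: "path_image h Int J = {}" using h g0 io(10) by blast
  have th: "t0 : path_image h" "z : path_image h" using h pathfinish_in_path_image[of h] pathstart_in_path_image[of h] by (auto simp: t0_def)
  have t0S: "\<bar>X t0\<bar> <= d / 2" "\<bar>Y t0\<bar> <= D" using th h by (auto simp: S_def)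
  have "\<bar>X t0\<bar> = d / 2 | \<bar>Y t0\<bar> = D"
  proof (rule ccontr)
   assume n: "~ ?thesis"
   have "open {z. \<bar>X z\<bar> < d / 2 & \<bar>Y z\<bar> < D}" by (intro open_Collect_conj open_Collect_less cont continuous_intros)
   moreover have "{z. \<bar>X z\<bar> < d / 2 & \<bar>Y z\<bar> < D} <= S" by (auto simp: S_def)
   moreover have "t0 : {z. \<bar>X z\<bar> < d / 2 & \<bar>Y z\<bar> < D}" using n t0S by auto
   ultimately have "t0 : interior S" using interior_maximal by blast
   thus False using h(4) by (simp add: t0_def frontier_def)
  qed
  moreover have "t0 ~: J" using hJ th by blast
  hence "t0 ~= p" "t0 ~= q" using pJ J12 by auto
  ultimately have Y0: "Y t0 ~= 0" using Xeq[of t0 p] Xeq[of t0 q] Xp d by (auto simp: D_def abs_if split: if_splits)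
  have wallJ: "~ (X y = X t0 & y : J)" if "0 < Y y & Y t0 <= Y y & 0 < Y t0 | Y y < 0 & Y y <= Y t0 & Y t0 < 0" for y
  proof
   assume y: "X y = X t0 & y : J"
   from \<open>\<bar>X t0\<bar> = d / 2 | \<bar>Y t0\<bar> = D\<close> show False
   proof
    assume "\<bar>X t0\<bar> = d / 2"
    hence "y = p | y = q" using JX(3)[of y] y by auto
    thus False using that Xp by auto
   next
    assume "\<bar>Y t0\<bar> = D"
    thus False using JX(2)[of y] y that d by (auto simp: D_def)
   qed
  qed
  have pch: "path_connected (path_image h)" using h by (simp add: path_connected_path_image)
  have hS: "\<bar>X y\<bar> <= d / 2 & \<bar>Y y\<bar> <= D" if "y : path_image h" for y using that h by (auto simp: S_def)
  obtain tt where tt: "X tt = X t0" "Y tt = D" using pt by blast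
  obtain tb where tb: "X tb = X t0" "Y tb = - D" using pt by blast
  show False
  proof (cases "0 < Y t0")
   case True
   let ?S2 = "((?V (X t0) (Y t0) D Un path_image h) Un ?V 0 (Y b) t) Un (J2 - {p, q}) Un ?V 0 (- D) (Y w)"
   have tV: "t0 : ?V (X t0) (Y t0) D" "z : ?V 0 (Y b) t" "b : ?V 0 (Y b) t" "tt : ?V (X t0) (Y t0) D"
    using t0S z zab b tt by (auto simp: V)
   have bI: "b : J2 - {p, q}" "w : J2 - {p, q}" using b w2 w not_pq by auto
   have "path_connected ?S2" by (intro path_connected_Un path_connected_vseg[OF e0] pch pcI)
     (use th bI uV in "blast intro: tV")+
   hence "J1 Int ?S2 ~= {}"
   proof (rule crossing[OF pcJ(1), of _ tt bw])
    fix y assume "y : J1 Un ?S2"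
    hence "y : J | y : ?V (X t0) (Y t0) D | y : path_image h | y : ?V 0 (Y b) t | y : ?V 0 (- D) (Y w)" using J12(2) by blast
    moreover have "\<bar>X y\<bar> <= d / 2 & \<bar>Y y\<bar> <= D" if "y : ?V (X t0) (Y t0) D" using that t0S by (auto simp: V)
    moreover have "\<bar>X y\<bar> <= d / 2 & \<bar>Y y\<bar> <= D" if "y : ?V 0 (Y b) t" using that zS z JB[of b] b J12 d by (auto simp: V S_def)
    ultimately show "\<bar>X y\<bar> <= d / 2 & \<bar>Y y\<bar> <= D" using JB hS wB by blast
   qed (use pJ tt bw uV tV in auto)
   moreover have "J1 Int ?V (X t0) (Y t0) D = {}" using wallJ True J12 by (force simp: V)
   moreover have "J1 Int path_image h = {}" "J1 Int (J2 - {p, q}) = {}" using hJ J12 by blast+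
   moreover have "J1 Int ?V 0 (Y b) t = {}" using a(4) zab by (force simp: V)
   moreover have "J1 Int ?V 0 (- D) (Y w) = {}" using dnV w2 J12 not_pq[OF w(2)] by blast
   ultimately show False by blast
  next
   case False
   hence neg: "Y t0 < 0" using Y0 by simp
   have tV: "z : ?V 0 t D" "t0 : ?V (X t0) (- D) (Y t0)" "tb : ?V (X t0) (- D) (Y t0)" "tu : ?V 0 t D"
    using t0S z zS tb tu by (auto simp: V S_def)
   let ?S2 = "(?V 0 t D Un path_image h) Un ?V (X t0) (- D) (Y t0)"
   have "path_connected ?S2" by (intro path_connected_Un path_connected_vseg[OF e0] pch)
     (use th in "blast intro: tV")+
   hence "J2 Int ?S2 ~= {}"
   proof (rule crossing[OF pcJ(2), of _ tu tb])
    fix y assume "y : J2 Un ?S2"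
    hence "y : J | y : ?V 0 t D | y : path_image h | y : ?V (X t0) (- D) (Y t0)" using J12(2) by blast
    moreover have "\<bar>X y\<bar> <= d / 2 & \<bar>Y y\<bar> <= D" if "y : ?V (X t0) (- D) (Y t0)" using that t0S by (auto simp: V)
    moreover have "\<bar>X y\<bar> <= d / 2 & \<bar>Y y\<bar> <= D" if "y : ?V 0 t D" using that zS z d by (auto simp: V S_def)
    ultimately show "\<bar>X y\<bar> <= d / 2 & \<bar>Y y\<bar> <= D" using JB hS by blast
   qed (use pJ tu tb tV in auto)
   moreover have "J2 Int ?V (X t0) (- D) (Y t0) = {}" using wallJ neg J12 by (force simp: V)
   moreover have "J2 Int path_image h = {}" using hJ J12 by blast
   moreover have "J2 Int ?V 0 t D = {}" using b(3) zab by (force simp: V)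
   ultimately show False by blast
  qed
 qed
 moreover have "connected (ball z (d / (8 * K)))" by simp
 ultimately have "ball z (d / (8 * K)) <= inside J"
  using connectedD[OF \<open>connected (ball z (d / (8 * K)))\<close> io(2,5)] ballJ io(9,10) r0 centre_in_ball[of z "d / (8 * K)"] by blast
 thus ?thesis using w2 by (auto simp: J2_def)
qed

text \<open>The highest and the lowest point of the curve on the perpendicular bisector lie on
  different arcs between \<open>p\<close> and \<open>q\<close>, so the quasicircle condition keeps
  them apart. For the outer circle these four points become the corners of the
  quadrilateral.\<close>

lemma quasicircle_extremal_frame:
 assumes J: "quasicircle K J"
 obtains p q h1 h3 where "p : J" "q : J" "dist p q = diameter J" "0 < diameter J"
  "unframe ((p + q) / 2) ((q - p) / of_real (diameter J)) (Complex 0 h1) : J"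
  "unframe ((p + q) / 2) ((q - p) / of_real (diameter J)) (Complex 0 h3) : J"
  "!!z. z : J ==> Re (frame ((p + q) / 2) ((q - p) / of_real (diameter J)) z) = 0 ==>
    h3 <= Im (frame ((p + q) / 2) ((q - p) / of_real (diameter J)) z) & Im (frame ((p + q) / 2) ((q - p) / of_real (diameter J)) z) <= h1"
  "diameter J / (2 * K) <= h1 - h3" "EX z. ball z (diameter J / (8 * K)) <= inside J"
proof -
 have cJ: "compact J" by (rule jordan_curve_compact[OF quasicircleD[OF J]])
 obtain x y where xy: "x : J" "y : J" "x ~= y" using jordan_curve_two_points quasicircleD[OF J] by blast
 obtain p q where pq: "p : J" "q : J" "dist p q = diameter J" using diameter_compact_attained[OF cJ] xy by blast
 define d where "d = diameter J"
 have d: "0 < d" using dist_le_diameter[OF cJ xy(1,2)] xy(3) zero_less_dist_iff[of x y] unfolding d_def by linarith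
 have pq': "p ~= q" "dist p q = d" using d pq(3) by (auto simp: d_def)
 define c e where "c = (p + q) / 2" and "e = (q - p) / of_real d"
 have ne: "norm e = 1" using d pq' by (simp add: e_def norm_divide dist_norm norm_minus_commute)
 hence e0: "e ~= 0" by auto
 have frp: "frame c e p = of_real (- d / 2)" "frame c e q = of_real (d / 2)" using pq' unfolding frame_def c_def e_def by (auto simp: field_simps)
 obtain s where s: "simple_path s" "pathfinish s = pathstart s" "path_image s = J" using jordan_curveE[OF quasicircleD[OF J]] .
 obtain g1 g2 where g: "arc g1" "arc g2" "pathstart g1 = p" "pathfinish g1 = q" "pathstart g2 = q" "pathfinish g2 = p"
   "path_image g1 Int path_image g2 = {p, q}" "path_image g1 Un path_image g2 = J"
  using exists_double_arc[OF s(1,2), of p q] pq pq' s(3) by metis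
 have cont: "continuous_on A (%z. Re (frame c e z))" "continuous_on A (%z. Im (frame c e z))" for A
  using e0 by (auto intro!: continuous_intros)
 have "connected ((%z. Re (frame c e z)) ` J)" by (intro connected_continuous_image cont jordan_curve_connected quasicircleD[OF J])
 moreover have "- d / 2 : (%z. Re (frame c e z)) ` J" "d / 2 : (%z. Re (frame c e z)) ` J"
 proof -
  have "Re (frame c e p) = - d / 2" "Re (frame c e q) = d / 2" unfolding frp by simp_all
  thus "- d / 2 : (%z. Re (frame c e z)) ` J" "d / 2 : (%z. Re (frame c e z)) ` J" using pq by (metis image_eqI)+
 qed
 ultimately have "0 : (%z. Re (frame c e z)) ` J" using connected_contains_Icc[of _ "- d / 2" "d / 2"] d by fastforce
 then obtain y0 where y0: "y0 : J Int {z. Re (frame c e z) = 0}" by auto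
 have comp: "compact (J Int {z. Re (frame c e z) = 0})" using cJ by (intro compact_Int_closed closed_Collect_eq cont continuous_intros) auto
 obtain u where u: "u : J" "Re (frame c e u) = 0" "!!z. z : J ==> Re (frame c e z) = 0 ==> Im (frame c e z) <= Im (frame c e u)"
  using continuous_attains_sup[OF comp _ cont(2)] y0 by (auto; blast)
 obtain w where w: "w : J" "Re (frame c e w) = 0" "!!z. z : J ==> Re (frame c e z) = 0 ==> Im (frame c e w) <= Im (frame c e z)"
  using continuous_attains_inf[OF comp _ cont(2)] y0 by (auto; blast)
 have main: "dist u w >= d / (2 * K) & (EX z. ball z (d / (8 * K)) <= inside J)"
  if g: "arc g1" "arc g2" "pathstart g1 = p" "pathfinish g1 = q" "pathstart g2 = q" "pathfinish g2 = p"
   "path_image g1 Int path_image g2 = {p, q}" "path_image g1 Un path_image g2 = J" "u : path_image g1" for g1 g2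
 proof -
  have "w : path_image g2 & (EX z. ball z (dist p q / (8 * K)) <= inside J)" by (rule quasicircle_fat_aux[OF J g(1-8) pq'(1) pq(3) g(9)])
    (use u w pq'(2) in \<open>auto simp: c_def[symmetric] e_def[symmetric]\<close>)
  hence w2: "w : path_image g2" "EX z. ball z (d / (8 * K)) <= inside J" using pq' by auto
  have K: "1 <= K" by (rule quasicircle_ge_1[OF J])
  have du: "d / 2 <= dist u p" "d / 2 <= dist u q" using abs_Re_le_cmod[of "frame c e u - frame c e p"] abs_Re_le_cmod[of "frame c e u - frame c e q"]
    dist_frame[OF e0, of c u p] dist_frame[OF e0, of c u q] ne u frp d by (auto simp: dist_norm)
  have "dist u p <= K * dist u w | dist u q <= K * dist u w" by (rule quasicircle_arcs_apart[OF J g(1,2,7,8,9) w2(1)])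
  hence "d / 2 <= K * dist u w" using du by linarith
  hence "d / (2 * K) <= dist u w" using K by (simp add: field_simps)
  thus ?thesis using w2 by blast
 qed
 have "dist u w >= d / (2 * K) & (EX z. ball z (d / (8 * K)) <= inside J)"
 proof (cases "u : path_image g1")
  case True thus ?thesis using main[OF g] by blast
 next
  case False
  hence "u : path_image (reversepath g2)" using g(8) u(1) by auto
  thus ?thesis by (intro main[of "reversepath g2" "reversepath g1"]) (use g in "auto simp: arc_reversepath")
 qed
 moreover have "dist u w = Im (frame c e u) - Im (frame c e w)"
 proof -
  have "dist u w = dist (frame c e u) (frame c e w)" using dist_frame[OF e0, of c u w] ne by simp
  also have "... = \<bar>Im (frame c e u) - Im (frame c e w)\<bar>" using u(2) w(2) by (simp add: dist_norm cmod_def)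
  finally show ?thesis using u(3)[OF w(1,2)] by simp
 qed
 moreover have "unframe c e (Complex 0 (Im (frame c e u))) = u" "unframe c e (Complex 0 (Im (frame c e w))) = w"
  using u(2) w(2) unframe_frame[OF e0, of c u] unframe_frame[OF e0, of c w] by (metis complex_surj)+
 ultimately show ?thesis by (intro that[of p q "Im (frame c e u)" "Im (frame c e w)"])
   (use pq u w d in "auto simp: d_def[symmetric] c_def[symmetric] e_def[symmetric]")
qed

text \<open>Prolong the segment from \<open>x\<close> to \<open>y\<close> beyond both ends until it
  reaches the boundary.\<close>

lemma dist_le_of_frontier:
 assumes "bounded U" "open U" "x : closure U" "y : closure U"
 shows "dist x y <= diameter (frontier (U::complex set))"
proof (cases "x = y")
 case True
 have "bounded (frontier U)" using bounded_closure[OF assms(1)] by (auto simp: frontier_def)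
 thus ?thesis using True by (simp add: diameter_ge_0)
next
 case False
 have bF: "bounded (frontier U)" using bounded_closure[OF assms(1)] by (auto simp: frontier_def)
 have far: "EX x':frontier U. EX t>=0. x' = x + t *\<^sub>R (x - y)" if "x : closure U" "x ~= y" for x y
 proof (cases "x : frontier U")
  case True thus ?thesis by (intro bexI[of _ x] exI[of _ 0]) auto
 next
  case False
  hence "x : interior U" using that by (simp add: frontier_def)
  then obtain t where "0 < t" "x + t *\<^sub>R (x - y) : frontier U"
   using ray_to_frontier[OF assms(1), of x "x - y"] \<open>x ~= y\<close> by (metis right_minus_eq)
  thus ?thesis by (intro bexI[of _ "x + t *\<^sub>R (x - y)"] exI[of _ t]) auto
 qed
 obtain x' t where x': "x' : frontier U" "t >= 0" "x' = x + t *\<^sub>R (x - y)" using far[OF assms(3) False] by blast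
 obtain y' s where y': "y' : frontier U" "s >= 0" "y' = y + s *\<^sub>R (y - x)" using far[OF assms(4)] False by metis
 have "x' - y' = (1 + t + s) *\<^sub>R (x - y)" by (simp add: x' y' algebra_simps)
 hence "dist x' y' = (1 + t + s) * dist x y" using x' y' by (simp add: dist_norm)
 moreover have "1 * dist x y <= (1 + t + s) * dist x y" using x' y' by (intro mult_right_mono) auto
 ultimately have "dist x y <= dist x' y'" by simp
 also have "... <= diameter (frontier U)" using x' y' bF by (intro diameter_bounded_bound)
 finally show ?thesis .
qed

section \<open>Metric geometry of the carpet and its four corners\<close>

locale carpet_setup =
 fixes Om :: "complex set" and Q :: "nat => complex set" and K2 K3 :: real
 assumes carpet: "sierpinski_carpet Om Q" and qc: "!!i. quasicircle K2 (frontier (Q i))"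
  and sep: "relatively_separated K3 (%i. frontier (Q i))" and K3: "0 < K3"
begin

definition dl :: "nat => real" where "dl i = diameter (frontier (Q i))"

lemma K2: "1 <= K2" by (rule quasicircle_ge_1[OF qc])

lemma frontier_Q0: "frontier (Q 0) = frontier Om" by (rule frontier_outer_region[OF carpet])

lemma jordan_frontier: "jordan_curve (frontier (Q i))" by (rule quasicircleD[OF qc])

lemma dl_pos: "0 < dl i" using quasicircle_extremal_frame[OF qc[of i]] unfolding dl_def by metis

lemma Om_inside: "Om = inside (frontier Om)"
proof -
 obtain J where J: "jordan_curve J" "Om = inside J" using carpet unfolding sierpinski_carpet_def jordan_region_def by blast
 thus ?thesis using jordan_curve_inside_outside(11) by metis
qed

lemma Q_inside: assumes "1 <= i" shows "Q i = inside (frontier (Q i))"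
proof -
 obtain J where J: "jordan_curve J" "Q i = inside J" using carpet assms unfolding sierpinski_carpet_def jordan_region_def by blast
 thus ?thesis using jordan_curve_inside_outside(11) by metis
qed

lemma jordan_Om: "jordan_curve (frontier Om)" using jordan_frontier[of 0] frontier_Q0 by simp

lemma Om_props: "open Om" "bounded Om" "connected Om" "Om ~= {}" using jordan_curve_inside_outside[OF jordan_Om] Om_inside by metis+

lemma Q_props: assumes "1 <= i" shows "open (Q i)" "bounded (Q i)" "connected (Q i)" "Q i ~= {}"
 using jordan_curve_inside_outside[OF jordan_frontier] Q_inside[OF assms] by metis+

lemma Q0: "Q 0 = - closure Om" using carpet by (simp add: sierpinski_carpet_def)

lemma Q0_outside: "Q 0 = outside (frontier Om)"
proof -
 have "closure Om = Om Un frontier Om" using closure_Un_frontier by blast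
 moreover have "Om = inside (frontier Om)" by (rule Om_inside)
 moreover note jordan_curve_inside_outside(9,10)[OF jordan_Om]
 ultimately show ?thesis using Q0 by blast
qed

lemma open_Q: "open (Q i)" using Q_props(1)[of i] Q0 by (cases "i = 0") auto

lemma connected_Q: "connected (Q i)" using Q_props(3)[of i] Q0_outside jordan_curve_inside_outside(6)[OF jordan_Om] by (cases "i = 0") auto

lemma closure_Q: "closure (Q i) = Q i Un frontier (Q i)" using closure_Un_frontier by blast

lemma Q_frontier_disj: "Q i Int frontier (Q i) = {}" using open_Q[of i] by (auto simp: frontier_def interior_open)

lemma closure_Q_sub: "1 <= i ==> closure (Q i) <= Om" using carpet by (simp add: sierpinski_carpet_def)

lemma closure_disj: assumes "i ~= j" shows "closure (Q i) Int closure (Q j) = {}"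
proof -
 have 0: "closure (Q 0) Int Om = {}"
 proof -
  have "closure (Q 0) = Q 0 Un frontier Om" using closure_Q[of 0] frontier_Q0 by simp
  moreover have "Q 0 Int Om = {}" using Q0 closure_subset[of Om] by auto
  ultimately show ?thesis using Om_props(1) by (auto simp: frontier_def interior_open)
 qed
 show ?thesis
 proof (cases "i = 0 | j = 0")
  case True thus ?thesis using 0 assms closure_Q_sub[of i] closure_Q_sub[of j] by (cases "i = 0") auto
 next
  case False thus ?thesis using carpet assms by (auto simp: sierpinski_carpet_def)
 qed
qed

lemma carpet_iff: "x : carpet Om Q \<longleftrightarrow> (ALL i. x ~: Q i)"
proof -
 have "(ALL i. x ~: Q i) \<longleftrightarrow> x ~: Q 0 & (ALL i>=1. x ~: Q i)" by (metis One_nat_def Suc_leI neq0_conv)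
 thus ?thesis by (auto simp: carpet_def Q0)
qed

lemma frontier_sub_carpet: "frontier (Q i) <= carpet Om Q"
proof
 fix x assume x: "x : frontier (Q i)"
 have "x ~: Q j" for j using x Q_frontier_disj closure_disj[of i j] closure_Q by (cases "i = j") blast+
 thus "x : carpet Om Q" by (simp add: carpet_iff)
qed

lemma carpet_sub: "carpet Om Q <= closure Om" by (auto simp: carpet_def)

lemma sep_frontier:
 assumes "i ~= j" "x : frontier (Q i)" "y : frontier (Q j)"
 shows "K3 * min (dl i) (dl j) <= dist x y"
proof -
 have "K3 <= setdist (frontier (Q i)) (frontier (Q j)) / min (dl i) (dl j)" using sep assms(1) unfolding relatively_separated_def dl_def by blast
 hence "K3 * min (dl i) (dl j) <= setdist (frontier (Q i)) (frontier (Q j))" using dl_pos by (simp add: pos_le_divide_eq)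
 also have "... <= dist x y" using assms by (intro setdist_le_dist)
 finally show ?thesis .
qed

text \<open>The segment from \<open>x\<close> to \<open>y\<close> meets both boundary curves, so
  relative separation passes from the curves to the closed regions.\<close>

lemma sep_closure:
 assumes ij: "i ~= j" and x: "x : closure (Q i)" and y: "y : closure (Q j)"
 shows "K3 * min (dl i) (dl j) <= dist x y"
proof -
 have xj: "x ~: Q j" "y ~: Q i" using closure_disj[OF ij] x y closure_subset by blast+
 obtain a where a: "a : closed_segment x y" "a : frontier (Q j)"
  using closed_segment_first_frontier[OF open_Q xj(1), of y] y ends_in_segment(2)[of y x] by blast
 have "a ~: Q i" using closure_disj[OF ij] a(2) closure_Q by blast
 then obtain b where b: "b : closed_segment a x" "b : frontier (Q i)"
  using closed_segment_first_frontier[OF open_Q _, of a i x] x ends_in_segment(2)[of x a] by blast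
 have "K3 * min (dl i) (dl j) <= dist b a" by (rule sep_frontier[OF ij b(2) a(2)])
 also have "... <= dist a x" using segment_bound(1)[OF b(1)] by (simp add: dist_norm norm_minus_commute)
 also have "... <= dist x y" using segment_bound(1)[OF a(1)] by (simp add: dist_norm norm_minus_commute)
 finally show ?thesis .
qed

lemma dist_le_dl: "1 <= i ==> x : closure (Q i) ==> y : closure (Q i) ==> dist x y <= dl i"
 unfolding dl_def by (intro dist_le_of_frontier Q_props)

lemma dist_le_dl0: "x : closure Om ==> y : closure Om ==> dist x y <= dl 0"
 unfolding dl_def frontier_Q0 by (intro dist_le_of_frontier Om_props)

lemma fat: assumes "1 <= i" shows "EX z. ball z (dl i / (8 * K2)) <= Q i"
 using quasicircle_extremal_frame[OF qc[of i]] Q_inside[OF assms] unfolding dl_def by metis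

text \<open>\<open>c\<close> is the midpoint of two boundary points at maximal distance,
  \<open>e\<close> their direction, and \<open>s k\<close> the last parameter at which the line
  through \<open>c\<close> in direction \<open>e * \<i> ^ k\<close> meets \<open>closure Om\<close>.
  As \<open>c\<close> need not lie in \<open>Om\<close>, the values \<open>s 1\<close> and
  \<open>s 3\<close> may be negative.\<close>

lemma corner_data:
 obtains c e :: complex and s :: "nat => real" where "norm e = 1" "s 0 = dl 0 / 2" "s 2 = dl 0 / 2"
  "dl 0 / (2 * K2) <= s 1 + s 3" "\<bar>s 1\<bar> <= dl 0" "\<bar>s 3\<bar> <= dl 0"
  "!!k. k < 4 ==> c + of_real (s k) * (e * \<i> ^ k) : frontier Om"
  "!!k t. k < 4 ==> s k < t ==> c + of_real t * (e * \<i> ^ k) ~: closure Om"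
  "!!z. z : closure Om ==> dist c z <= dl 0"
proof -
 obtain p q h1 h3 where h: "p : frontier (Q 0)" "q : frontier (Q 0)" "dist p q = dl 0" "0 < dl 0"
  "unframe ((p + q) / 2) ((q - p) / of_real (dl 0)) (Complex 0 h1) : frontier (Q 0)"
  "unframe ((p + q) / 2) ((q - p) / of_real (dl 0)) (Complex 0 h3) : frontier (Q 0)"
  "!!z. z : frontier (Q 0) ==> Re (frame ((p + q) / 2) ((q - p) / of_real (dl 0)) z) = 0 ==>
    h3 <= Im (frame ((p + q) / 2) ((q - p) / of_real (dl 0)) z) & Im (frame ((p + q) / 2) ((q - p) / of_real (dl 0)) z) <= h1"
  "dl 0 / (2 * K2) <= h1 - h3" using quasicircle_extremal_frame[OF qc[of 0]] unfolding dl_def[symmetric] by metis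
 define d c e where "d = dl 0" and "c = (p + q) / 2" and "e = (q - p) / of_real d"
 note h = h[folded d_def, folded c_def e_def, unfolded frontier_Q0]
 have ne: "norm e = 1" using h(3,4) by (simp add: e_def norm_divide dist_norm norm_minus_commute)
 hence e0: "e ~= 0" by auto
 have cp: "c - of_real (d / 2) * e = p" "c + of_real (d / 2) * e = q" using h(4) by (auto simp: c_def e_def field_simps)
 have clf: "frontier Om <= closure Om" by (simp add: frontier_def)
 have far: "dist c z <= d" if "z : closure Om" for z
 proof -
  have "2 * dist c z <= dist p z + dist q z"
  proof -
   have "2 *\<^sub>R (c - z) = (p - z) + (q - z)" by (simp add: c_def scaleR_conv_of_real)
   hence "norm (2 *\<^sub>R (c - z)) <= norm (p - z) + norm (q - z)" using norm_triangle_ineq by metis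
   thus ?thesis by (simp add: dist_norm)
  qed
  moreover have "p : closure Om" "q : closure Om" using h(1,2) clf by auto
  ultimately show ?thesis using dist_le_dl0[of p z] dist_le_dl0[of q z] that by (simp add: d_def)
 qed
 have bdd: "EX z':frontier Om. EX t'>=t. z' = c + of_real t' * v" if z: "c + of_real t * v : closure Om" and v: "v ~= 0" for t v
 proof (cases "c + of_real t * v : frontier Om")
  case True thus ?thesis by blast
 next
  case False
  hence "c + of_real t * v : interior Om" using z by (simp add: frontier_def)
  then obtain r where r: "0 < r" "c + of_real t * v + r *\<^sub>R v : frontier Om"
   using ray_to_frontier[OF Om_props(2), of "c + of_real t * v" v] v by metis
  have "c + of_real t * v + r *\<^sub>R v = c + of_real (t + r) * v" by (simp add: scaleR_conv_of_real algebra_simps)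
  thus ?thesis using r by (metis less_eq_real_def less_add_same_cancel1)
 qed
 define s where "s k = (if k = 1 then h1 else if k = 3 then - h3 else d / 2)" for k :: nat
 have un: "unframe c e (Complex 0 h) = c + of_real h * (e * \<i>)" for h by (simp add: unframe_def Complex_eq)
 have i3: "\<i> ^ 3 = - \<i>" by (simp add: power3_eq_cube)
 have pts: "c + of_real (s 0) * (e * \<i> ^ 0) = q" "c + of_real (s 2) * (e * \<i> ^ 2) = p"
   "c + of_real (s 1) * (e * \<i> ^ 1) = unframe c e (Complex 0 h1)" "c + of_real (s 3) * (e * \<i> ^ 3) = unframe c e (Complex 0 h3)"
  using cp by (auto simp: s_def un i3)
 have k4: "k < 4 \<longleftrightarrow> k = 0 | k = 1 | k = 2 | k = (3::nat)" for k by auto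
 have fr: "c + of_real (s k) * (e * \<i> ^ k) : frontier Om" if "k < 4" for k using that pts h(1,2,5,6) unfolding k4 by auto
 have out: "c + of_real t * (e * \<i> ^ k) ~: closure Om" if k: "k < 4" and t: "s k < t" for k t
 proof
  assume "c + of_real t * (e * \<i> ^ k) : closure Om"
  then obtain z' t' where z': "z' : frontier Om" "t' >= t" "z' = c + of_real t' * (e * \<i> ^ k)" using bdd e0 by fastforce
  show False
  proof (cases "k = 1 | k = 3")
   case True
   have "frame c e z' = of_real t' * \<i> ^ k" using z'(3) e0 by (simp add: frame_def)
   hence "Re (frame c e z') = 0" "Im (frame c e z') = (if k = 1 then t' else - t')" using True by (auto simp: i3)
   thus False using h(7)[OF z'(1)] z'(2) t True by (auto simp: s_def)
  next
   case False
   hence k02: "k = 0 | k = 2" using k by auto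
   \<comment> \<open>The opposite end of the diameter: a point of \<open>closure Om\<close> beyond
     \<open>s k\<close> would be farther than \<open>dl 0\<close> from it.\<close>
   define z0 where "z0 = c - of_real (d / 2) * (e * \<i> ^ k)"
   have "z0 = p | z0 = q" using k02 cp by (auto simp: z0_def)
   hence "dist z' z0 <= d" using dist_le_dl0[of z' z0] z'(1) h(1,2) clf by (auto simp: d_def)
   moreover have "z' - z0 = of_real (t' + d / 2) * (e * \<i> ^ k)" by (simp add: z'(3) z0_def algebra_simps)
   hence "dist z' z0 = \<bar>t' + d / 2\<bar>" by (simp only: dist_norm norm_mult norm_of_real norm_power norm_ii ne) simp
   ultimately show False using t z'(2) k02 by (auto simp: s_def)
  qed
 qed
 have s13: "\<bar>s k\<bar> <= d" if k: "k < 4" for k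
 proof -
  have "dist c (c + of_real (s k) * (e * \<i> ^ k)) <= d" using far fr[OF k] clf by blast
  thus ?thesis by (simp add: dist_norm norm_mult norm_power ne)
 qed
 show ?thesis by (rule that[of e s c]) (use ne s13[of 1] s13[of 3] fr out far h(8) in \<open>auto simp: s_def d_def\<close>)
qed

end

section \<open>The carpet on a grid, and the four regions outside it\<close>

text \<open>A quarter turn, used to treat the four corners alike. It does not preserve
  \<open>lat_adj\<close>, because it turns the diagonals, so only unit steps are
  transported.\<close>

definition rot :: "int \<times> int => int \<times> int" where
 "rot v = (- snd v, fst v)"

lemma rot_adj: "\<bar>fst p - fst q\<bar> + \<bar>snd p - snd q\<bar> = 1 ==> lat_adj ((rot ^^ k) p) ((rot ^^ k) q)"
proof -
 assume a: "\<bar>fst p - fst q\<bar> + \<bar>snd p - snd q\<bar> = 1"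
 have "\<bar>fst ((rot ^^ k) p) - fst ((rot ^^ k) q)\<bar> + \<bar>snd ((rot ^^ k) p) - snd ((rot ^^ k) q)\<bar> = 1"
 proof (induction k)
  case (Suc k)
  have "\<bar>fst (rot u) - fst (rot v)\<bar> + \<bar>snd (rot u) - snd (rot v)\<bar> = \<bar>fst u - fst v\<bar> + \<bar>snd u - snd v\<bar>" for u v
   by (simp add: rot_def)
  thus ?case using Suc by simp
 qed (use a in simp)
 moreover have "\<bar>a - b\<bar> + \<bar>c - d\<bar> = 1 ==> (b - a, d - c) = (1, 0) | (b - a, d - c) = (- 1, 0) |
  (b - a, d - c) = (0, 1) | (b - a, d - c) = (0, - 1)" for a b c d :: int unfolding prod.inject by arith
 ultimately show ?thesis unfolding lat_adj_def by blast
qed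

lemma int_interval_gconn: "gconn (%i j. \<bar>i - j\<bar> = 1) {a..b::int}"
proof (rule gconnI)
 fix A p q assume A: "A <= {a..b}" "p : A" "q : {a..b}" "q ~: A"
  and no: "!!x y. x : A ==> y : {a..b} ==> y ~: A ==> ~ \<bar>x - y\<bar> = 1"
 have up: "p + int k <= b ==> p + int k : A" for k
 proof (induction k)
  case (Suc k)
  hence "p + int k : A" by simp
  moreover have "p + int (Suc k) : {a..b}" using Suc A by auto
  ultimately show ?case using no[of "p + int k" "p + int (Suc k)"] by auto
 qed (use A in simp)
 have down: "a <= p - int k ==> p - int k : A" for k
 proof (induction k)
  case (Suc k)
  hence "p - int k : A" by simp
  moreover have "p - int (Suc k) : {a..b}" using Suc A by auto
  ultimately show ?case using no[of "p - int k" "p - int (Suc k)"] by auto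
 qed (use A in simp)
 show False using up[of "nat (q - p)"] down[of "nat (p - q)"] A by (cases "p <= q") auto
qed

lemma rot_row_gconn: "gconn lat_adj ((%i. (rot ^^ k) (i, j)) ` {a..b})"
 and rot_col_gconn: "gconn lat_adj ((%i. (rot ^^ k) (j, i)) ` {a..b})"
proof -
 have "gconn lat_adj (UN i:{a..b}. {(rot ^^ k) (i, j)})" "gconn lat_adj (UN i:{a..b}. {(rot ^^ k) (j, i)})"
  by (rule gconn_UN[OF int_interval_gconn]; auto intro!: rot_adj)+
 thus "gconn lat_adj ((%i. (rot ^^ k) (i, j)) ` {a..b})" "gconn lat_adj ((%i. (rot ^^ k) (j, i)) ` {a..b})"
  by (simp_all add: UNION_singleton_eq_range)
qed

lemma connected_gconn_UN:
 assumes I: "gconn iadj I" and F: "!!i. i : I ==> connected (F i)"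
  and e: "!!i j. i : I ==> j : I ==> iadj i j ==> F i Int F j ~= {}"
  and ne: "!!i. i : I ==> F i ~= {}"
 shows "connected (UN i:I. F i)"
proof (cases "I = {}")
 case False
 then obtain i0 z0 where i0: "i0 : I" "z0 : F i0" using ne by blast
 let ?T = "UN i:I. F i"
 let ?P = "%i. F i <= connected_component_set ?T z0"
 have all: "?P i" if i: "i : I" for i
 proof (rule ccontr)
  assume c: "~ ?P i"
  have "?P i0" using i0 F by (intro connected_component_maximal) auto
  then obtain x y where xy: "x : I" "y : I" "?P x" "~ ?P y" "iadj x y" using gconn_edge[where P = ?P, OF I i0(1) _ i c] by blast
  then obtain u where u: "u : F x" "u : F y" using e by blast
  hence "connected_component ?T z0 u" using xy by blast
  moreover have "F y <= connected_component_set ?T u" using u xy F by (intro connected_component_maximal) auto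
  ultimately have "?P y" using connected_component_eq by blast
  thus False using xy by blast
 qed
 have "?T <= connected_component_set ?T z0" using all by blast
 hence "connected_component_set ?T z0 = ?T" using connected_component_subset by blast
 thus ?thesis by (metis connected_connected_component)
qed simp

lemma Re_Im_ii_power: "Re (\<i> ^ n) * Im (\<i> ^ n) = 0"
proof -
 have "\<i> ^ n : {1, \<i>, - 1, - \<i>}" by (induction n) auto
 thus ?thesis by auto
qed

lemma inverse_ii_power: "1 / \<i> ^ k = \<i> ^ (3 * k)"
proof -
 have "\<i> ^ (3 * k) * \<i> ^ k = (\<i> ^ 4) ^ k" by (simp add: power_add[symmetric])
 also have "\<i> ^ 4 = (1::complex)" by (simp)
 finally show ?thesis by (simp add: field_simps)
qed

definition near_int :: "real => int => bool" where
 "near_int x i \<longleftrightarrow> of_int i - 1 / 2 <= x & x <= of_int i + 1 / 2"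

lemma near_int_minus: "near_int (- x) i \<longleftrightarrow> near_int x (- i)" by (auto simp: near_int_def)

locale carpet_frame = carpet_setup +
 fixes c e :: complex and s :: "nat => real"
 assumes ne: "norm e = 1" and s0: "s 0 = dl 0 / 2" "s 2 = dl 0 / 2" and s13: "dl 0 / (2 * K2) <= s 1 + s 3"
  and s_abs: "\<bar>s 1\<bar> <= dl 0" "\<bar>s 3\<bar> <= dl 0"
  and corner: "!!k. k < 4 ==> c + of_real (s k) * (e * \<i> ^ k) : frontier Om"
  and ray_out: "!!k t. k < 4 ==> s k < t ==> c + of_real t * (e * \<i> ^ k) ~: closure Om"
  and near_c: "!!z. z : closure Om ==> dist c z <= dl 0"
begin

definition ray_pt :: "nat => real => complex" where "ray_pt k t = c + of_real t * (e * \<i> ^ k)"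

definition cor_pt :: "nat => complex" where "cor_pt k = ray_pt k (s k)"

definition ray :: "nat => complex set" where "ray k = ray_pt k ` {s k..}"

text \<open>The rays from the corners to infinity divide the exterior of \<open>Om\<close> into the
  regions that determine the four sides of the quadrilateral.\<close>

definition KK :: "complex set" where "KK = closure Om Un (UN k<4. ray k)"

lemma s_le: "k < 4 ==> \<bar>s k\<bar> <= dl 0"
proof -
 assume "k < 4"
 hence "k = 0 | k = 1 | k = 2 | k = 3" by auto
 thus ?thesis using s0 s_abs by auto
qed

lemma dist_ray_pt: "dist (ray_pt k t) (ray_pt k u) = \<bar>t - u\<bar>"
proof -
 have "ray_pt k t - ray_pt k u = of_real (t - u) * (e * \<i> ^ k)" by (simp add: ray_pt_def algebra_simps)
 thus ?thesis by (simp only: dist_norm norm_mult norm_power norm_of_real ne) simp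
qed

lemma cor_frontier: "k < 4 ==> cor_pt k : frontier Om" using corner by (simp add: cor_pt_def ray_pt_def)

lemma continuous_ray_pt: "continuous_on A (ray_pt k)" unfolding ray_pt_def by (intro continuous_intros)

end

locale carpet_grid = carpet_frame +
 fixes ep :: real
 assumes ep: "0 < ep" "16 * ep <= dl 0"
begin

text \<open>The set \<open>closure Om\<close> lies in the ball of radius \<open>dl 0\<close> about
  \<open>c\<close>; the factor 4 leaves enough room for the border of the grid to meet
  \<open>KK\<close> only near the axes.\<close>

definition N :: int where "N = \<lceil>4 * dl 0 / ep\<rceil>"

lemma e0: "e ~= 0" using ne by auto

definition Fr :: "nat => complex => complex" where "Fr k = frame c (of_real ep * e * \<i> ^ k)"

lemma ze: "of_real ep * e * \<i> ^ k ~= 0" "norm (of_real ep * e * \<i> ^ k) = ep" using ep e0 by (auto simp: norm_mult norm_power ne)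

lemma dist_Fr: "dist z z' = ep * dist (Fr k z) (Fr k z')" unfolding Fr_def dist_frame[OF ze(1)] ze(2) using ep by simp

lemma Fr_c: "Fr k c = 0" by (simp add: Fr_def frame_def)

lemma Fr_Suc: "Re (Fr (Suc k) z) = Im (Fr k z)" "Im (Fr (Suc k) z) = - Re (Fr k z)"
proof -
 have "of_real ep * e * \<i> ^ Suc k = (of_real ep * e * \<i> ^ k) * \<i>" by (simp)
 hence "Fr (Suc k) z = Fr k z / \<i>" by (simp only: Fr_def frame_def divide_divide_eq_left)
 also have "... = - (\<i> * Fr k z)" by (simp)
 finally show "Re (Fr (Suc k) z) = Im (Fr k z)" "Im (Fr (Suc k) z) = - Re (Fr k z)" by auto
qed

lemma Fr_ray_pt: "Fr k (ray_pt m t) = of_real (t / ep) * \<i> ^ (m + 3 * k)"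
proof -
 have "Fr k (ray_pt m t) = of_real (t / ep) * \<i> ^ m * (1 / \<i> ^ k)" using e0 by (simp add: Fr_def frame_def ray_pt_def field_simps)
 thus ?thesis unfolding inverse_ii_power by (simp add: power_add)
qed

lemma Fr_ray_pt_same: "Fr k (ray_pt k t) = of_real (t / ep)" using e0 by (simp add: Fr_def frame_def ray_pt_def field_simps)

lemma Fr_ray_axis: "Re (Fr k (ray_pt m t)) * Im (Fr k (ray_pt m t)) = 0" using Re_Im_ii_power[of "m + 3 * k"] unfolding Fr_ray_pt by auto

definition cell :: "int \<times> int => complex set" where
 "cell v = {z. near_int (Re (Fr 0 z)) (fst v) & near_int (Im (Fr 0 z)) (snd v)}"

lemma cell_rot: "z : cell ((rot ^^ k) v) \<longleftrightarrow> near_int (Re (Fr k z)) (fst v) & near_int (Im (Fr k z)) (snd v)"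
proof (induction k arbitrary: v)
 case (Suc k)
 have "z : cell ((rot ^^ Suc k) v) \<longleftrightarrow> z : cell ((rot ^^ k) (rot v))" by (simp add: funpow_swap1)
 also have "... \<longleftrightarrow> near_int (Re (Fr k z)) (- snd v) & near_int (Im (Fr k z)) (fst v)" unfolding Suc by (simp add: rot_def)
 finally show ?case unfolding Fr_Suc near_int_minus by blast
qed (simp add: cell_def)

lemma Fr_surj: obtains z where "Fr k z = x" using frame_unframe[OF ze(1)] by (metis Fr_def)

lemma continuous_on_Fr [continuous_intros]: "continuous_on A f ==> continuous_on A (%x. Fr k (f x))"
 unfolding Fr_def by (rule continuous_on_frame[OF ze(1)])

lemma cell_convex: "convex (cell v)"
proof -
 have lin: "Fr 0 (u *\<^sub>R x + v *\<^sub>R y) = u *\<^sub>R Fr 0 x + v *\<^sub>R Fr 0 y" if "u + v = 1" for u v x y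
 proof -
  have "u *\<^sub>R x + v *\<^sub>R y - c = u *\<^sub>R (x - c) + v *\<^sub>R (y - c)" using that
   by (simp add: algebra_simps scaleR_add_left[symmetric])
  thus ?thesis by (simp add: Fr_def frame_def add_divide_distrib scaleR_conv_of_real)
 qed
 show ?thesis
 proof (rule convexI)
  fix x y and u w :: real assume h: "x : cell v" "y : cell v" "0 <= u" "0 <= w" "u + w = 1"
  let ?B = "cbox (Complex (of_int (fst v) - 1/2) (of_int (snd v) - 1/2)) (Complex (of_int (fst v) + 1/2) (of_int (snd v) + 1/2))"
  have B: "z : cell v \<longleftrightarrow> Fr 0 z : ?B" for z by (auto simp: cell_def near_int_def in_cbox_complex_iff)
  have "u *\<^sub>R Fr 0 x + w *\<^sub>R Fr 0 y : ?B" by (rule convexD[OF convex_box(1)]) (use h B in auto)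
  thus "u *\<^sub>R x + w *\<^sub>R y : cell v" unfolding B lin[OF h(5)] .
 qed
qed

lemma cell_connected: "connected (cell v)" by (rule convex_connected[OF cell_convex])

lemma cell_closed: "closed (cell v)" unfolding cell_def near_int_def by (intro closed_Collect_conj closed_Collect_le continuous_intros)

lemma cell_diam: assumes "z : cell v" "z' : cell v" shows "dist z z' <= 2 * ep"
proof -
 have "dist (Fr 0 z) (Fr 0 z') <= \<bar>Re (Fr 0 z) - Re (Fr 0 z')\<bar> + \<bar>Im (Fr 0 z) - Im (Fr 0 z')\<bar>"
  using cmod_le[of "Fr 0 z - Fr 0 z'"] by (simp add: dist_norm)
 also have "... <= 2"
 proof -
  have "\<bar>Re (Fr 0 z) - Re (Fr 0 z')\<bar> <= 1" "\<bar>Im (Fr 0 z) - Im (Fr 0 z')\<bar> <= 1"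
   using assms unfolding cell_def near_int_def mem_Collect_eq by linarith+
  thus ?thesis by simp
 qed
 finally show ?thesis using dist_Fr[of z z' 0] ep by simp
qed

lemma cell_of: obtains v where "z : cell v"
proof
 show "z : cell (\<lfloor>Re (Fr 0 z) + 1/2\<rfloor>, \<lfloor>Im (Fr 0 z) + 1/2\<rfloor>)"
  unfolding cell_def near_int_def mem_Collect_eq fst_conv snd_conv by linarith
qed

lemma cell_nonempty: "cell v ~= {}"
proof -
 obtain z where "Fr 0 z = Complex (of_int (fst v)) (of_int (snd v))" by (rule Fr_surj)
 hence "z : cell v" by (simp add: cell_def near_int_def)
 thus ?thesis by blast
qed

lemma cell_adj: assumes "lat_adj u v" shows "cell u Int cell v ~= {}"
proof -
 obtain z where z: "Fr 0 z = Complex ((of_int (fst u) + of_int (fst v)) / 2) ((of_int (snd u) + of_int (snd v)) / 2)" by (rule Fr_surj)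
 obtain i j k l where [simp]: "u = (i, j)" "v = (k, l)" by (cases u; cases v) auto
 have "k - i = 1 | k - i = 0 | k - i = - 1" "l - j = 1 | l - j = 0 | l - j = - 1" using assms by (auto simp: lat_adj_def)
 hence "\<bar>real_of_int k - real_of_int i\<bar> <= 1" "\<bar>real_of_int l - real_of_int j\<bar> <= 1" by linarith+
 hence "z : cell u Int cell v" unfolding Int_iff cell_def near_int_def mem_Collect_eq z by (simp; linarith)
 thus ?thesis by blast
qed

lemma cell_in_box: assumes "z : cell v" "dist c z <= 3 * dl 0" shows "v : {- N..N} \<times> {- N..N}"
proof -
 have "ep * norm (Fr 0 z) <= 3 * dl 0" using assms(2) dist_Fr[of c z 0] by (simp add: Fr_c)
 hence n: "norm (Fr 0 z) <= 3 * dl 0 / ep" using ep by (simp add: field_simps)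
 have "4 * dl 0 / ep <= of_int N" by (simp add: N_def)
 moreover have "3 * dl 0 / ep + 1 <= 4 * dl 0 / ep" using ep by (simp add: field_simps)
 ultimately have "norm (Fr 0 z) + 1 <= of_int N" using n by linarith
 hence "\<bar>Re (Fr 0 z)\<bar> + 1 <= of_int N" "\<bar>Im (Fr 0 z)\<bar> + 1 <= of_int N"
  using abs_Re_le_cmod[of "Fr 0 z"] abs_Im_le_cmod[of "Fr 0 z"] by linarith+
 hence "\<bar>of_int (fst v)\<bar> <= real_of_int N" "\<bar>of_int (snd v)\<bar> <= real_of_int N"
  using assms(1) unfolding cell_def near_int_def mem_Collect_eq by linarith+
 thus ?thesis by (cases v) auto
qed

lemma N_bounds: "16 <= N" "4 * dl 0 <= of_int N * ep" "of_int N * ep <= 5 * dl 0"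
proof -
 have 1: "4 * dl 0 / ep <= of_int N" "of_int N < 4 * dl 0 / ep + 1" unfolding N_def by linarith+
 thus "4 * dl 0 <= of_int N * ep" using ep by (simp add: field_simps)
 have "of_int N * ep < 4 * dl 0 + ep" using 1(2) ep by (simp add: field_simps)
 thus "of_int N * ep <= 5 * dl 0" using ep by linarith
 have "64 <= 4 * dl 0 / ep" using ep by (simp add: field_simps)
 thus "16 <= N" using 1(1) by linarith
qed

definition cm :: "complex set => (int \<times> int) set" where "cm E = {v. cell v Int E ~= {}}"

text \<open>Two closed cells with a common point differ by at most 1 in each coordinate, and the
  mixed cell \<open>(k, j)\<close> contains the point too. It is reached from both by at most a unit
  step, whichever way the diagonals run.\<close>

lemma cm_gconn:
 assumes E: "connected E" and fin: "finite (cm E)"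
 shows "gconn lat_adj (cm E)"
proof (rule gconnI)
 fix A p q assume A: "A <= cm E" "p : A" "q : cm E" "q ~: A"
  and no: "!!x y. x : A ==> y : cm E ==> y ~: A ==> ~ lat_adj x y"
 define C1 C2 where "C1 = (UN v:A. cell v)" and "C2 = (UN v:cm E - A. cell v)"
 have cl: "closed C1" "closed C2" unfolding C1_def C2_def using fin A(1) finite_subset by (auto intro!: closed_UN cell_closed)
 have cov: "E <= C1 Un C2"
 proof
  fix z assume z: "z : E"
  obtain v where "z : cell v" by (rule cell_of)
  thus "z : C1 Un C2" using z by (auto simp: C1_def C2_def cm_def)
 qed
 have "C1 Int C2 Int E = {}"
 proof (rule ccontr)
  assume "C1 Int C2 Int E ~= {}"
  then obtain z u v where z: "z : E" "u : A" "z : cell u" "v : cm E" "v ~: A" "z : cell v" by (auto simp: C1_def C2_def)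
  obtain i j k l where [simp]: "u = (i, j)" "v = (k, l)" by (cases u; cases v) auto
  have "\<bar>real_of_int k - real_of_int i\<bar> <= 1" "\<bar>real_of_int l - real_of_int j\<bar> <= 1"
   using z(3,6) unfolding cell_def near_int_def by (simp_all; linarith)+
  hence kl: "\<bar>k - i\<bar> <= 1" "\<bar>l - j\<bar> <= 1" by linarith+
  have w: "(k, j) : cm E" using z by (auto simp: cm_def cell_def)
  show False
  proof (cases "(k, j) : A")
   case True
   have "~ lat_adj (k, j) (k, l)" using no[OF True z(4,5)] by simp
   hence "l - j ~= 1" "l - j ~= - 1" by (auto simp: lat_adj_def)
   hence "l = j" using kl(2) by linarith
   thus False using True z by auto
  next
   case False
   have "~ lat_adj (i, j) (k, j)" using no[of "(i, j)" "(k, j)"] z w False by simp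
   hence "k - i ~= 1" "k - i ~= - 1" by (auto simp: lat_adj_def)
   hence "k = i" using kl(1) by linarith
   thus False using False z by auto
  qed
 qed
 moreover have "C1 Int E ~= {}" "C2 Int E ~= {}" using A by (auto simp: C1_def C2_def cm_def)
 ultimately show False using connected_closedD[OF E, of C1 C2] cl cov by blast
qed

lemma cm_finite: assumes "bounded E" shows "finite (cm E)"
proof -
 obtain r where r: "!!z. z : E ==> dist c z <= r" using assms bounded_any_center[of E c] by blast
 define n where "n = \<lceil>r / ep + 1\<rceil>"
 have "cm E <= {- n..n} \<times> {- n..n}"
 proof
  fix v assume "v : cm E"
  then obtain z where z: "z : cell v" "z : E" by (auto simp: cm_def)
  have "ep * norm (Fr 0 z) <= r" using r[OF z(2)] dist_Fr[of c z 0] by (simp add: Fr_c)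
  hence "norm (Fr 0 z) <= r / ep" using ep by (simp add: field_simps)
  hence "\<bar>Re (Fr 0 z)\<bar> <= r / ep" "\<bar>Im (Fr 0 z)\<bar> <= r / ep"
   using abs_Re_le_cmod[of "Fr 0 z"] abs_Im_le_cmod[of "Fr 0 z"] by linarith+
  moreover have "r / ep + 1 <= of_int n" by (simp add: n_def)
  ultimately have "\<bar>of_int (fst v)\<bar> <= real_of_int n" "\<bar>of_int (snd v)\<bar> <= real_of_int n"
   using z(1) unfolding cell_def near_int_def mem_Collect_eq by linarith+
  thus "v : {- n..n} \<times> {- n..n}" by (cases v) auto
 qed
 thus ?thesis by (rule finite_subset) simp
qed

definition G :: "(int \<times> int) set" where "G = {- N..N} \<times> {- N..N}"

definition free :: "(int \<times> int) set" where "free = {v : G. cell v Int KK = {}}"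

definition cor :: "nat => int \<times> int" where "cor k = (rot ^^ k) (N, N)"

text \<open>The component of the free cells at the \<open>k\<close>-th corner of the grid, that is,
  the outside region between two consecutive rays. Tiles adjacent to it will form the
  \<open>k\<close>-th side.\<close>

definition A :: "nat => (int \<times> int) set" where "A k = gcomp lat_adj free (cor k)"

lemma finG: "finite G" by (simp add: G_def)

lemma rot_G: "(rot ^^ k) v : G \<longleftrightarrow> v : G"
proof -
 have "rot u : G \<longleftrightarrow> u : G" for u by (cases u) (auto simp: G_def rot_def)
 thus ?thesis by (induction k) simp_all
qed

lemma ring_free:
 assumes "1 <= i" "1 <= j" "i <= N" "j <= N" "i = N | j = N"
 shows "(rot ^^ k) (i, j) : free"
proof -
 have "z ~: KK" if z: "z : cell ((rot ^^ k) (i, j))" for z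
 proof
  assume "z : KK"
  have zz: "of_int i - 1/2 <= Re (Fr k z)" "of_int j - 1/2 <= Im (Fr k z)" using z by (auto simp: cell_rot near_int_def)
  moreover have "1 <= real_of_int i" "1 <= real_of_int j" using assms(1,2) by simp_all
  ultimately have pos: "0 < Re (Fr k z)" "0 < Im (Fr k z)" by linarith+
  have "of_int N - 1/2 <= Re (Fr k z) | of_int N - 1/2 <= Im (Fr k z)" using assms(5) zz by auto
  hence "of_int N - 1/2 <= norm (Fr k z)" using abs_Re_le_cmod[of "Fr k z"] abs_Im_le_cmod[of "Fr k z"] by linarith
  hence "ep * (of_int N - 1/2) <= dist c z" using dist_Fr[of c z k] ep by (simp add: Fr_c)
  hence "dl 0 < dist c z" using N_bounds(2) ep by (simp add: algebra_simps)
  hence "z ~: closure Om" using near_c by force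
  then obtain m t where "z = ray_pt m t" using \<open>z : KK\<close> by (auto simp: KK_def ray_def)
  thus False using Fr_ray_axis[of k m t] pos by simp
 qed
 thus ?thesis using rot_G[of k "(i, j)"] assms by (auto simp: free_def G_def)
qed

lemma ring_A:
 assumes "1 <= j" "j <= N"
 shows "(rot ^^ k) (N, j) : A k" "(rot ^^ k) (j, N) : A k"
proof -
 have N1: "1 <= N" using N_bounds by simp
 have "(%i. (rot ^^ k) (N, i)) ` {1..N} <= A k" unfolding A_def
  by (intro gcomp_maximal rot_col_gconn) (use ring_free N1 in "auto simp: cor_def")
 moreover have "(%i. (rot ^^ k) (i, N)) ` {1..N} <= A k" unfolding A_def
  by (intro gcomp_maximal rot_row_gconn) (use ring_free N1 in "auto simp: cor_def")
 ultimately show "(rot ^^ k) (N, j) : A k" "(rot ^^ k) (j, N) : A k" using assms by auto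
qed

lemma A_free: "A k <= free" by (simp add: A_def gcomp_subset)

lemma A_gconn: "gconn lat_adj (A k)" by (simp add: A_def gconn_gcomp)

lemma cor_A: "cor k : A k" using ring_A(1)[of N k] N_bounds by (simp add: cor_def)

lemma A_absorb: "v : A k ==> u : free ==> lat_adj v u ==> u : A k"
 using gcomp_absorb[OF symp_lat_adj, of "{u}" free u v "cor k"] sympD[OF symp_lat_adj] unfolding A_def by auto

definition prv :: "nat => nat" where "prv k = (k + 3) mod 4"

lemma rot_prv: "k < 4 ==> (rot ^^ prv k) (1, j) = (rot ^^ k) (j, - 1)"
proof -
 assume "k < 4"
 hence "k = 0 | k = 1 | k = 2 | k = 3" by auto
 moreover have "prv 0 = 3" "prv 1 = 0" "prv 2 = 1" "prv 3 = 2" by (simp_all add: prv_def)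
 ultimately show ?thesis by (elim disjE) (simp_all add: rot_def numeral_2_eq_2 numeral_3_eq_3)
qed

text \<open>Beyond \<open>t0\<close> the ray keeps away from \<open>closure Om\<close>, so the two
  rows of cells along it are free. They run to the border of the grid and join the corner regions on
  either side of the ray.\<close>

lemma side_row_A:
 assumes k: "k < 4" and t0: "s k <= t0" "!!z t. z : closure Om ==> t0 <= t ==> 2 * ep < dist z (ray_pt k t)"
  and i: "t0 <= of_int i * ep" "i <= N"
 shows "(rot ^^ k) (i, 1) : A k" "(rot ^^ k) (i, - 1) : A (prv k)"
proof -
 have N1: "1 <= N" using N_bounds by simp
 have iN: "- N <= i"
 proof (rule ccontr)
  assume "~ ?thesis"
  hence "of_int i <= - real_of_int N" by simp
  hence "of_int i * ep <= - of_int N * ep" using ep by (intro mult_right_mono) auto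
  thus False using i(1) t0(1) s_le[OF k] N_bounds(2) dl_pos[of 0] by linarith
 qed
 have fr: "(rot ^^ k) (n, \<sigma>) : free" if n: "i <= n" "n <= N" and \<sigma>: "\<sigma> = 1 | \<sigma> = - 1" for n \<sigma> :: int
 proof -
  have "z ~: KK" if z: "z : cell ((rot ^^ k) (n, \<sigma>))" for z
  proof
   assume "z : KK"
   have n1: "near_int (Re (Fr k z)) n" "near_int (Im (Fr k z)) \<sigma>" using z by (auto simp: cell_rot)
   hence zz: "\<bar>Re (Fr k z) - of_int n\<bar> <= 1/2" unfolding near_int_def by linarith
   have im: "Im (Fr k z) ~= 0" "\<bar>Im (Fr k z)\<bar> <= 3/2" using \<sigma> n1(2) unfolding near_int_def by (elim disjE; simp; linarith)+
   have "of_int i * ep <= of_int n * ep" using n(1) ep by (intro mult_right_mono) auto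
   hence tn: "t0 <= of_int n * ep" using i(1) by linarith
   have "z ~: closure Om"
   proof
    assume "z : closure Om"
    hence "2 * ep < dist z (ray_pt k (of_int n * ep))" using t0(2) tn by blast
    moreover have "dist z (ray_pt k (of_int n * ep)) <= ep * 2"
    proof -
     have "norm (Fr k z - of_int n) <= \<bar>Re (Fr k z) - of_int n\<bar> + \<bar>Im (Fr k z)\<bar>" using cmod_le[of "Fr k z - of_int n"] by simp
     also have "... <= 2" using zz im(2) by linarith
     finally show ?thesis using dist_Fr[of z "ray_pt k (of_int n * ep)" k] ep by (simp add: Fr_ray_pt_same dist_norm)
    qed
    ultimately show False by simp
   qed
   then obtain m t where m: "m < 4" "z = ray_pt m t" "s m <= t" using \<open>z : KK\<close> by (auto simp: KK_def ray_def)
   have re: "Re (Fr k z) = 0" using Fr_ray_axis[of k m t] im m(2) by simp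
   have "norm (Fr k z) = \<bar>Im (Fr k z)\<bar>" using re by (simp add: cmod_def)
   moreover have "norm (Fr k z) = \<bar>t\<bar> / ep" using ep unfolding m(2) Fr_ray_pt by (simp add: norm_mult norm_power norm_divide)
   ultimately have ts: "\<bar>t\<bar> / ep <= 3/2" using im by simp
   \<comment> \<open>A point of some ray in such a cell lies within \<open>3 / 2 * ep\<close> of
     \<open>c\<close>. Rays 0 and 2 start at distance \<open>dl 0 / 2\<close> from \<open>c\<close>,
     and so do the rows along them, which leaves only rays collinear with ray
     \<open>k\<close>.\<close>
   have big: "8 <= dl 0 / 2 / ep" using ep by (simp add: field_simps)
   show False
   proof (cases "m = 0 | m = 2")
    case True
    hence "dl 0 / 2 <= \<bar>t\<bar>" using m(3) s0 by auto
    hence "dl 0 / 2 / ep <= \<bar>t\<bar> / ep" using ep by (intro divide_right_mono) auto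
    thus False using ts big by linarith
   next
    case False
    hence m13: "m = 1 | m = 3" using m(1) by auto
    show False
    proof (cases "k = 0 | k = 2")
     case True
     hence "dl 0 / 2 <= of_int n * ep" using t0(1) tn s0 by auto
     hence "dl 0 / 2 / ep <= of_int n" using ep by (simp add: field_simps)
     thus False using big zz re by linarith
    next
     case False
     hence "k = 1 | k = 3" using k by auto
     hence "even (m + 3 * k)" using m13 by auto
     then obtain l where "m + 3 * k = 2 * l" by (elim evenE)
     hence "\<i> ^ (m + 3 * k) = of_real ((- 1) ^ l)" by (simp)
     thus False using im(1) unfolding m(2) Fr_ray_pt by (simp del: of_real_power)
    qed
   qed
  qed
  moreover have "(n, \<sigma>) : G" using n iN \<sigma> N1 by (auto simp: G_def)
  ultimately show ?thesis using rot_G[of k "(n, \<sigma>)"] by (auto simp: free_def)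
 qed
 have "(%n. (rot ^^ k) (n, 1)) ` {i..N} <= A k" unfolding A_def
  by (rule gcomp_absorb[OF symp_lat_adj _ rot_row_gconn, of _ _ _ _ _ "(rot ^^ k) (N, 1)" "(rot ^^ k) (N, 1)"])
   (use fr i ring_A(1)[of 1 k] N1 in \<open>auto simp: A_def\<close>)
 thus "(rot ^^ k) (i, 1) : A k" using i by auto
 have "(rot ^^ k) (N, - 1) : A (prv k)" using ring_A(2)[of 1 "prv k"] rot_prv[OF k, of N] N1 by simp
 hence "(%n. (rot ^^ k) (n, - 1)) ` {i..N} <= A (prv k)" unfolding A_def
  by (intro gcomp_absorb[OF symp_lat_adj _ rot_row_gconn, of _ _ _ _ _ "(rot ^^ k) (N, - 1)" "(rot ^^ k) (N, - 1)"])
   (use fr i in auto)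
 thus "(rot ^^ k) (i, - 1) : A (prv k)" using i by auto
qed

end

lemma quotient_gconn:
 assumes C: "gconn adj C" and cov: "!!v. v : C ==> EX t:V. v : t"
  and dis: "!!s t v. s : V ==> t : V ==> v : s ==> v : t ==> s = t"
 shows "gconn (%s t. EX a:s. EX b:t. adj a b) {t : V. t Int C ~= {}}"
proof (rule gconnI)
 fix A s t assume A: "A <= {t : V. t Int C ~= {}}" "s : A" "t : {t : V. t Int C ~= {}}" "t ~: A"
  and no: "!!x y. x : A ==> y : {t : V. t Int C ~= {}} ==> y ~: A ==> ~ (EX a:x. EX b:y. adj a b)"
 obtain p q where pq: "p : s" "p : C" "q : t" "q : C" using A by blast
 have "q ~: \<Union>A" using A pq dis by blast
 then obtain x y where xy: "x : C" "y : C" "x : \<Union>A" "y ~: \<Union>A" "adj x y"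
  using gconn_edge[OF C pq(2), where P = "%v. v : \<Union>A"] pq A by blast
 obtain u where u: "u : V" "y : u" using cov xy by blast
 thus False using no[of _ u] xy u by blast
qed

context carpet_grid begin

lemma rot_surj: obtains u where "v = (rot ^^ k) u"
proof -
 have "EX u. v = (rot ^^ k) u"
 proof (induction k arbitrary: v)
  case (Suc k)
  obtain u where "(snd v, - fst v) = (rot ^^ k) u" using Suc by blast
  hence "rot (snd v, - fst v) = (rot ^^ Suc k) u" by simp
  hence "v = (rot ^^ Suc k) u" by (simp add: rot_def)
  thus ?case by blast
 qed simp
 thus thesis using that by blast
qed

lemma Im_Fr_ray_same: "Re (Fr k (ray_pt k t)) = t / ep" "Im (Fr k (ray_pt k t)) = 0" unfolding Fr_ray_pt_same by simp_all

lemma ray_cell: "ray_pt k t : cell ((rot ^^ k) u) \<longleftrightarrow> near_int (t / ep) (fst u) & snd u = 0"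
proof -
 have "near_int 0 i \<longleftrightarrow> i = 0" for i :: int
 proof
  assume "near_int 0 i"
  hence "of_int i - 1 / 2 <= (0::real)" "0 <= of_int i + (1 / 2 :: real)" unfolding near_int_def by auto
  thus "i = 0" by linarith
 qed (simp add: near_int_def)
 thus ?thesis unfolding cell_rot Im_Fr_ray_same by simp
qed

lemma near_N: "near_int (of_int N * ep / ep) N" using ep by (simp add: near_int_def)

lemma s_le_N: "k < 4 ==> s k <= of_int N * ep" "k < 4 ==> - (of_int N * ep) <= s k" using s_le[of k] N_bounds by linarith+

lemma ray_KK: "k < 4 ==> s k <= t ==> ray_pt k t : KK" by (auto simp: KK_def ray_def)

lemma axis_cell: assumes "k < 4" shows "(rot ^^ k) (N, 0) : G - free" "ray_pt k (of_int N * ep) : cell ((rot ^^ k) (N, 0))"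
proof -
 show 1: "ray_pt k (of_int N * ep) : cell ((rot ^^ k) (N, 0))" unfolding ray_cell using near_N by simp
 have "ray_pt k (of_int N * ep) : KK" using ray_KK s_le_N assms by blast
 moreover have "(rot ^^ k) (N, 0) : G" unfolding rot_G using N_bounds by (simp add: G_def)
 ultimately show "(rot ^^ k) (N, 0) : G - free" using 1 by (auto simp: free_def)
qed

text \<open>Unlike \<open>KK\<close> this set is bounded, so the cells meeting it are finitely many;
  they turn out to be exactly the cells of the grid that are not free.\<close>

definition KB :: "complex set" where "KB = closure Om Un (UN k<4. ray_pt k ` {s k..of_int N * ep})"

lemma KB_connected: "connected KB"
proof -
 have "connected (closure Om Un ray_pt k ` {s k..of_int N * ep})" if "k < 4" for k
 proof (rule connected_Un)
  show "connected (ray_pt k ` {s k..of_int N * ep})" by (intro connected_continuous_image continuous_ray_pt) simp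
  have "cor_pt k : closure Om" using cor_frontier[OF that] by (simp add: frontier_def)
  moreover have "cor_pt k : ray_pt k ` {s k..of_int N * ep}" using s_le_N[OF that] by (simp add: cor_pt_def)
  ultimately show "closure Om Int ray_pt k ` {s k..of_int N * ep} ~= {}" by blast
 qed (use Om_props connected_imp_connected_closure in blast)
 hence "connected (\<Union>((%k. closure Om Un ray_pt k ` {s k..of_int N * ep}) ` {..<4}))"
  using Om_props(4) by (intro connected_Union) fastforce+
 moreover have "(\<Union>((%k. closure Om Un ray_pt k ` {s k..of_int N * ep}) ` {..<4})) = KB"
  unfolding KB_def by (auto simp: lessThan_empty_iff)
 ultimately show ?thesis by simp
qed

lemma KB_sub: "KB <= KK" by (auto simp: KB_def KK_def ray_def)

lemma KB_cells: "cm KB = G - free"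
proof
 show "cm KB <= G - free"
 proof
  fix v assume v: "v : cm KB"
  then obtain z where z: "z : cell v" "z : KB" by (auto simp: cm_def)
  have "v : G"
  proof (cases "z : closure Om")
   case True
   thus ?thesis using near_c[OF True] cell_in_box[OF z(1)] dl_pos[of 0] by (simp add: G_def)
  next
   case False
   then obtain k t where k: "k < 4" "z = ray_pt k t" "s k <= t" "t <= of_int N * ep" using z by (auto simp: KB_def)
   obtain u where u: "v = (rot ^^ k) u" by (rule rot_surj)
   have n: "near_int (t / ep) (fst u)" "snd u = 0" using z(1) unfolding u k(2) ray_cell by auto
   have "t / ep <= of_int N" "- of_int N <= t / ep" using k s_le_N(2)[OF k(1)] ep by (simp_all add: field_simps)
   hence "of_int (fst u) <= real_of_int N + 1 / 2" "- real_of_int N - 1 / 2 <= of_int (fst u)" using n(1) unfolding near_int_def by linarith+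
   hence "fst u <= N" "- N <= fst u" by linarith+
   thus ?thesis unfolding u rot_G using n(2) by (cases u) (auto simp: G_def)
  qed
  thus "v : G - free" using z KB_sub by (auto simp: free_def)
 qed
 show "G - free <= cm KB"
 proof
  fix v assume v: "v : G - free"
  then obtain z where z: "z : cell v" "z : KK" by (auto simp: free_def)
  show "v : cm KB"
  proof (cases "z : KB")
   case False
   then obtain k t where k: "k < 4" "z = ray_pt k t" "s k <= t" using z by (auto simp: KB_def KK_def ray_def)
   hence t: "of_int N * ep < t" using False by (force simp: KB_def)
   obtain u where u: "v = (rot ^^ k) u" by (rule rot_surj)
   have n: "near_int (t / ep) (fst u)" "snd u = 0" using z(1) unfolding u k(2) ray_cell by auto
   have "u : G" using v unfolding u using rot_G by blast
   hence "fst u <= N" by (auto simp: G_def)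
   moreover have "of_int N <= t / ep" using t ep by (simp add: field_simps)
   hence "real_of_int N <= of_int (fst u) + 1 / 2" using n unfolding near_int_def by linarith
   ultimately have "fst u = N" by linarith
   hence "u = (N, 0)" using n(2) by (cases u) simp
   moreover have "ray_pt k (of_int N * ep) : ray_pt k ` {s k..of_int N * ep}" using s_le_N(1)[OF k(1)] by auto
   hence "ray_pt k (of_int N * ep) : KB" unfolding KB_def using k(1) by blast
   ultimately show ?thesis using axis_cell(2)[OF k(1)] unfolding cm_def u by blast
  qed (use z in "auto simp: cm_def")
 qed
qed

lemma nonfree_gconn: "gconn lat_adj (G - free)" using cm_gconn[OF KB_connected] finG unfolding KB_cells by simp

lemma rot_values: "(rot ^^ 0) (a, b) = (a, b)" "(rot ^^ 1) (a, b) = (- b, a)" "(rot ^^ 2) (a, b) = (- a, - b)" "(rot ^^ 3) (a, b) = (b, - a)"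
 by (simp_all add: rot_def numeral_2_eq_2 numeral_3_eq_3)

lemma axis_cells: "(N, 0) : G - free" "(0, N) : G - free" "(- N, 0) : G - free" "(0, - N) : G - free"
 using axis_cell(1)[of 0] axis_cell(1)[of 1] axis_cell(1)[of 2] axis_cell(1)[of 3] unfolding rot_values by simp_all

text \<open>The cells that are not free form a connected set reaching all four sides of the grid at
  the axis cells, and a free connected set between opposite sides would have to cross it.\<close>

lemma barrier:
 assumes U: "U <= free" "gconn lat_adj U" and u: "u : U" "u' : U"
  and f: "(\<bar>fst u\<bar> = N & fst u' = - fst u) | (\<bar>snd u\<bar> = N & snd u' = - snd u)"
 shows False
proof -
 have UG: "U <= {- N..N} \<times> {- N..N}" using U by (auto simp: free_def G_def)
 have BG: "G - free <= {- N..N} \<times> {- N..N}" by (auto simp: G_def)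
 have "U Int (G - free) ~= {}" using f
 proof
  assume a: "\<bar>fst u\<bar> = N & fst u' = - fst u"
  hence "(fst u = - N & fst u' = N) | (fst u' = - N & fst u = N)" by linarith
  then obtain a b where "a : U" "fst a = - N" "b : U" "fst b = N" using u by blast
  thus ?thesis using lattice_crossing[OF U(2) nonfree_gconn UG BG, of a b "(0, - N)" "(0, N)"] axis_cells by simp
 next
  assume a: "\<bar>snd u\<bar> = N & snd u' = - snd u"
  hence "(snd u = - N & snd u' = N) | (snd u' = - N & snd u = N)" by linarith
  then obtain a b where "a : U" "snd a = - N" "b : U" "snd b = N" using u by blast
  thus ?thesis using lattice_crossing[OF nonfree_gconn U(2) BG UG, of "(- N, 0)" "(N, 0)" a b] axis_cells by auto
 qed
 thus False using U(1) by blast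
qed

lemma cor_values: "cor 0 = (N, N)" "cor 1 = (- N, N)" "cor 2 = (- N, - N)" "cor 3 = (N, - N)" unfolding cor_def rot_values by simp_all

lemma less4: "k < 4 ==> k = 0 | k = 1 | k = 2 | k = (3::nat)" by auto

lemma A_disj: assumes "k < 4" "m < 4" "v : A k" "v : A m" shows "k = m"
proof (rule ccontr)
 assume "k ~= m"
 have 1: "gconn lat_adj (A k Un A m)" by (rule gconn_Un[OF symp_lat_adj A_gconn A_gconn assms(3,4)]) simp
 have 2: "A k Un A m <= free" "cor k : A k Un A m" "cor m : A k Un A m" using A_free cor_A by auto
 have N0: "0 < N" using N_bounds by simp
 have "(\<bar>fst (cor k)\<bar> = N & fst (cor m) = - fst (cor k)) | (\<bar>snd (cor k)\<bar> = N & snd (cor m) = - snd (cor k))"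
  using less4[OF assms(1)] less4[OF assms(2)] \<open>k ~= m\<close> N0 by (elim disjE) (simp_all add: cor_values cor_values(2)[unfolded One_nat_def])
 thus False by (rule barrier[OF 2(1) 1 2(2,3)])
qed

section \<open>Tiles, sides, and the duality of chains of tiles\<close>

definition bc :: "nat => int \<times> int" where "bc i = (SOME v. (SOME z. z : Q i) : cell v)"

definition In :: "nat => (int \<times> int) set" where "In i = {v : G. cell v <= Q i}"

text \<open>Only cells contained in \<open>Q i\<close> and connected to the base cell are merged, so
  the tile stays inside \<open>Q i\<close>. The set is empty when the base cell itself is not
  contained in \<open>Q i\<close>.\<close>

definition Cl :: "nat => (int \<times> int) set" where "Cl i = gcomp lat_adj (In i) (bc i)"

text \<open>Besides the cells meeting \<open>KK\<close> this keeps the pockets of free cells that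
  are cut off from the corners, so that the quadrilateral has no holes.\<close>

definition Bc :: "(int \<times> int) set" where "Bc = G - (UN k<4. A k)"

definition V :: "(int \<times> int) set set" where
 "V = {Cl i | i. 1 <= i & Cl i ~= {}} Un {{v} | v. v : Bc & (ALL i>=1. v ~: Cl i)}"

definition tadj :: "(int \<times> int) set => (int \<times> int) set => bool" where
 "tadj u t \<longleftrightarrow> (EX a:u. EX b:t. lat_adj a b)"

definition side :: "nat => (int \<times> int) set set" where
 "side k = {t : V. EX a:t. EX b:A k. lat_adj a b}"

definition body :: "(int \<times> int) set => complex set" where "body t = (UN v:t. cell v)"

definition TE :: "complex set => (int \<times> int) set set" where "TE E = {t : V. t Int cm E ~= {}}"

lemma lat_sym: "lat_adj a b ==> lat_adj b a" using symp_lat_adj by (rule sympD)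

lemma symp_tadj: "symp tadj" unfolding symp_def tadj_def using lat_sym by blast

lemma Cl_In: "Cl i <= In i" by (simp add: Cl_def gcomp_subset)

lemma Cl_gconn: "gconn lat_adj (Cl i)" by (simp add: Cl_def gconn_gcomp)

lemma Q_sub_KK: assumes "1 <= i" shows "Q i <= KK" "Q i <= closure Om"
proof -
 show "Q i <= closure Om" using closure_Q_sub[OF assms] closure_subset[of "Q i"] closure_subset[of Om] by blast
 thus "Q i <= KK" by (auto simp: KK_def)
qed

lemma Cl_cell: "v : Cl i ==> cell v <= Q i" using Cl_In by (auto simp: In_def)

lemma body_Cl: "body (Cl i) <= Q i" unfolding body_def using Cl_cell by blast

lemma Cl_nonfree: assumes "1 <= i" "v : Cl i" shows "v : G" "v ~: free"
proof -
 show "v : G" using assms Cl_In by (auto simp: In_def)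
 show "v ~: free" using Cl_cell[OF assms(2)] Q_sub_KK[OF assms(1)] cell_nonempty[of v] by (auto simp: free_def)
qed

lemma Cl_free_adj: assumes "1 <= i" "v : Cl i" "u : free" shows "~ lat_adj v u"
proof
 assume "lat_adj v u"
 hence "cell v Int cell u ~= {}" by (rule cell_adj)
 moreover have "cell v <= KK" using Cl_cell[OF assms(2)] Q_sub_KK(1)[OF assms(1)] by (rule order_trans)
 moreover have "cell u Int KK = {}" using assms(3) by (simp add: free_def)
 ultimately show False by blast
qed

lemma Cl_disj: assumes "v : Cl i" "v : Cl j" shows "i = j"
proof (rule ccontr)
 assume "i ~= j"
 hence "Q i Int Q j = {}" using closure_disj closure_subset by blast
 thus False using Cl_cell assms cell_nonempty[of v] by blast
qed

lemma Cl_side: "1 <= i ==> Cl i ~: side k" unfolding side_def using Cl_free_adj A_free by blast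

lemma side_V: "side k <= V" by (auto simp: side_def)

lemma V_cases:
 assumes "t : V"
 obtains i where "1 <= i" "t = Cl i" | v where "t = {v}" "v : Bc" "!!i. 1 <= i ==> v ~: Cl i" using assms unfolding V_def by blast

lemma V_disj: assumes "s' : V" "t : V" "v : s'" "v : t" shows "s' = t"
proof -
 have 1: "(EX i. 1 <= i & u = Cl i) | (u = {v} & (ALL i>=1. v ~: Cl i))" if "u : V" "v : u" for u
  using that by (cases rule: V_cases) auto
 show ?thesis using 1[OF assms(1,3)] 1[OF assms(2,4)] Cl_disj assms(3,4) by metis
qed

lemma Cl_Bc: "1 <= i ==> Cl i <= Bc" using Cl_nonfree A_free unfolding Bc_def by blast

lemma Union_V: "\<Union>V = Bc"
proof
 show "\<Union>V <= Bc"
 proof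
  fix v assume "v : \<Union>V"
  then obtain t where "t : V" "v : t" by blast
  thus "v : Bc" using Cl_Bc by (cases rule: V_cases) auto
 qed
 show "Bc <= \<Union>V"
 proof
  fix v assume v: "v : Bc"
  show "v : \<Union>V"
  proof (cases "ALL i>=1. v ~: Cl i")
   case True
   hence "{v} : V" using v unfolding V_def by blast
   thus ?thesis by blast
  next
   case False
   then obtain i where "1 <= i" "v : Cl i" by blast
   moreover from this have "Cl i : V" unfolding V_def by blast
   ultimately show ?thesis by blast
  qed
 qed
qed

lemma V_tile: assumes "t : V" shows "t ~= {}" "gconn lat_adj t" "t <= G"
proof -
 show "t ~= {}" using assms unfolding V_def by blast
 show "gconn lat_adj t" using assms by (cases rule: V_cases) (simp_all add: Cl_gconn)
 show "t <= G" using assms Union_V unfolding Bc_def by blast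
qed

lemma finite_V: "finite V" by (rule finite_subset[of _ "Pow G"]) (use V_tile(3) finG in auto)

lemma V_not_A: "t : V ==> v : t ==> k < 4 ==> v ~: A k" using Union_V unfolding Bc_def by blast

lemma G_gconn: "gconn lat_adj G"
proof -
 have row: "gconn lat_adj ((%j. (i, j)) ` {- N..N})" for i using rot_col_gconn[of 0 i "- N" N] by simp
 have "gconn lat_adj (UN i:{- N..N}. (%j. (i, j)) ` {- N..N})"
 proof (rule gconn_UN[OF int_interval_gconn])
  fix i j assume ij: "i : {- N..N}" "j : {- N..N}" "\<bar>i - j\<bar> = 1"
  hence "lat_adj (i, 0) (j, 0)" using rot_adj[of "(i, 0)" "(j, 0)" 0] by simp
  thus "(%l. (i, l)) ` {- N..N} Int (%l. (j, l)) ` {- N..N} ~= {} |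
   (EX a:(%l. (i, l)) ` {- N..N}. EX b:(%l. (j, l)) ` {- N..N}. lat_adj a b)" using N_bounds by force
 qed (use row N_bounds in auto)
 moreover have "(UN i:{- N..N}. (%j. (i, j)) ` {- N..N}) = G" by (auto simp: G_def)
 ultimately show ?thesis by simp
qed

lemma nonfree_Bc: "G - free <= Bc" using A_free unfolding Bc_def by blast

text \<open>The cells meeting \<open>KK\<close> are connected, and every pocket of free cells cut
  off from the corners is adjacent to one of them.\<close>

lemma Bc_gconn: "gconn lat_adj Bc"
proof -
 have ne: "(N, 0) : G - free" by (rule axis_cells)
 have ex: "EX C. C <= Bc & v : C & G - free <= C & gconn lat_adj C" if v: "v : Bc" for v
 proof (cases "v : free")
  case False
  thus ?thesis using v nonfree_Bc nonfree_gconn unfolding Bc_def by blast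
 next
  case True
  define P where "P = gcomp lat_adj free v"
  have vP: "v : P" unfolding P_def by (rule gcomp_self[OF True])
  have Pf: "P <= free" unfolding P_def by (rule gcomp_subset)
  have "(N, 0) ~: P" using ne Pf by blast
  then obtain x y where xy: "x : G" "y : G" "x : P" "y ~: P" "lat_adj x y"
   using gconn_edge[OF G_gconn, of v "%v. v : P" "(N, 0)"] vP v ne unfolding Bc_def by blast
  have yf: "y ~: free"
  proof
   assume y: "y : free"
   have "{y} <= gcomp lat_adj free v"
    by (rule gcomp_absorb[OF symp_lat_adj, of "{y}" free y x v]) (use y xy lat_sym in "auto simp: P_def")
   thus False using xy(4) by (simp add: P_def)
  qed
  have "P <= Bc"
  proof
   fix w assume w: "w : P"
   have "w ~: A k" if k: "k < 4" for k
   proof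
    assume wA: "w : A k"
    have "P <= A k" unfolding A_def by (rule gcomp_absorb[OF symp_lat_adj Pf _ w, of w]) (use wA in "auto simp: A_def P_def gconn_gcomp")
    thus False using vP v k unfolding Bc_def by blast
   qed
   thus "w : Bc" using w Pf unfolding Bc_def free_def by auto
  qed
  moreover have "gconn lat_adj (P Un (G - free))"
   by (rule gconn_Un[OF symp_lat_adj _ nonfree_gconn xy(3), of y]) (use xy yf in "auto simp: P_def gconn_gcomp")
  ultimately show ?thesis using vP nonfree_Bc by (intro exI[of _ "P Un (G - free)"]) auto
 qed
 define F where "F v = (SOME C. C <= Bc & v : C & G - free <= C & gconn lat_adj C)" for v
 have F: "F v <= Bc & v : F v & G - free <= F v & gconn lat_adj (F v)" if "v : Bc" for v unfolding F_def by (rule someI_ex[OF ex[OF that]])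
 have "gconn lat_adj (UN v:Bc. F v)"
 proof (rule gconn_UN[where iadj = "%_ _. True"])
  show "gconn (%_ _. True) Bc" unfolding gconn_def by blast
  show "gconn lat_adj (F i)" "F i ~= {}" if "i : Bc" for i using F[OF that] by auto
  show "F i Int F j ~= {} | (EX a:F i. EX b:F j. lat_adj a b)" if "i : Bc" "j : Bc" for i j
   using F[OF that(1)] F[OF that(2)] ne by blast
 qed
 moreover have "(UN v:Bc. F v) = Bc" using F by blast
 ultimately show ?thesis by simp
qed

lemma tadj_fun: "tadj = (%u t. EX a:u. EX b:t. lat_adj a b)" by (intro ext) (simp add: tadj_def)

lemma quotient_V: assumes "gconn lat_adj C" "C <= Bc" shows "gconn tadj {t : V. t Int C ~= {}}"
 unfolding tadj_fun by (rule quotient_gconn[OF assms(1)]) (use assms(2) Union_V V_disj in blast)+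

lemma V_gconn: "gconn tadj V"
proof -
 have "{t : V. t Int Bc ~= {}} = V" using Union_V V_tile(1) by blast
 thus ?thesis using quotient_V[OF Bc_gconn] by simp
qed

lemma tiles_gconn: assumes "C <= V" "gconn tadj C" shows "gconn lat_adj (\<Union>C)"
proof -
 have "gconn lat_adj (UN t:C. t)" by (rule gconn_UN[OF assms(2)]) (use assms(1) V_tile in \<open>auto simp: tadj_def\<close>)
 thus ?thesis by simp
qed

lemma attach:
 assumes C: "C <= V" "gconn tadj C" "C Int side k ~= {}" "C Int side m ~= {}"
 shows "gconn lat_adj (\<Union>C Un A k Un A m)"
proof -
 obtain s' a b where 1: "s' : C" "a : s'" "b : A k" "lat_adj a b" using C(3) by (auto simp: side_def)
 obtain t a' b' where 2: "t : C" "a' : t" "b' : A m" "lat_adj a' b'" using C(4) by (auto simp: side_def)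
 have "gconn lat_adj (\<Union>C Un A k)" by (rule gconn_Un[OF symp_lat_adj tiles_gconn[OF C(1,2)] A_gconn, of a b]) (use 1 in auto)
 thus ?thesis by (rule gconn_Un[OF symp_lat_adj _ A_gconn, of _ a' b']) (use 2 in auto)
qed

lemma A_G: "A k <= G" using A_free by (auto simp: free_def)

text \<open>Adding the corner regions \<open>A 1\<close>, \<open>A 3\<close> to one chain and
  \<open>A 0\<close>, \<open>A 2\<close> to the other makes them cross the whole grid. Their common
  cell lies in no corner region, as these are disjoint from each other and from the tiles.\<close>

lemma cross_tiles:
 assumes C: "C <= V" "gconn tadj C" "C Int side 1 ~= {}" "C Int side 3 ~= {}"
  and D: "D <= V" "gconn tadj D" "D Int side 0 ~= {}" "D Int side 2 ~= {}"
 shows "C Int D ~= {}"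
proof -
 have G: "\<Union>C Un A 1 Un A 3 <= {- N..N} \<times> {- N..N}" "\<Union>D Un A 0 Un A 2 <= {- N..N} \<times> {- N..N}"
  using C(1) D(1) V_tile(3) A_G unfolding G_def by blast+
 have cor: "cor k : A k" for k by (rule cor_A)
 have "(\<Union>C Un A 1 Un A 3) Int (\<Union>D Un A 0 Un A 2) ~= {}"
  by (rule lattice_crossing[OF attach[OF C] attach[OF D] G, of "cor 1" "cor 3" "cor 2" "cor 0"]) (use cor[of 0] cor[of 1] cor[of 2] cor[of 3] cor_values in "auto")
 then obtain v where v: "v : \<Union>C Un A 1 Un A 3" "v : \<Union>D Un A 0 Un A 2" by blast
 have m: "v : \<Union>V ==> k < 4 ==> v ~: A k" for k using V_not_A by blast
 have CD: "\<Union>C <= \<Union>V" "\<Union>D <= \<Union>V" using C(1) D(1) by blast+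
 have "~ (v : A 1 & v : A 0)" "~ (v : A 1 & v : A 2)" "~ (v : A 3 & v : A 0)" "~ (v : A 3 & v : A 2)"
  using A_disj[of 1 0 v] A_disj[of 1 2 v] A_disj[of 3 0 v] A_disj[of 3 2 v] by auto
 moreover have "v : \<Union>V ==> v ~: A 0 & v ~: A 1 & v ~: A 2 & v ~: A 3" using m[of 0] m[of 1] m[of 2] m[of 3] by simp
 ultimately have "v : \<Union>C & v : \<Union>D" using v CD by blast
 thus ?thesis using C(1) D(1) V_disj by blast
qed

text \<open>\<open>R\<close> collects the tiles reachable within \<open>W\<close> from side
  \<open>k\<close>. If it missed side \<open>m\<close>, no edge of \<open>D\<close> could lead out
  of \<open>A k\<close> together with the cells of \<open>R\<close>.\<close>

lemma reach:
 assumes W: "W <= V" and km: "k < 4" "m < 4" "k ~= m" and D: "gconn lat_adj D" "D <= \<Union>W Un A k Un A m"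
  and p: "p : D" "p : A k Un \<Union>(W Int side k)" and q: "q : D" "q : A m Un \<Union>(W Int side m)"
 shows "EX C<=W. gconn tadj C & C Int side k ~= {} & C Int side m ~= {}"
proof (rule ccontr)
 assume no: "~ ?thesis"
 define R where "R = {t. EX C<=W. gconn tadj C & t : C & C Int side k ~= {}}"
 have RW: "R <= W" and Rm: "R Int side m = {}" using no by (auto simp: R_def)
 have Rk: "t : R" if "t : W" "t : side k" for t unfolding R_def using that by (auto intro!: exI[of _ "{t}"])
 have step: "t : R" if st: "u : R" "t : W" "tadj u t" for u t
 proof -
  obtain C where C: "C <= W" "gconn tadj C" "u : C" "C Int side k ~= {}" using st by (auto simp: R_def)
  have "gconn tadj (insert t C)" by (rule gconn_insert[OF symp_tadj C(2,3) st(3)])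
  thus ?thesis unfolding R_def using C st(2) by (auto intro!: exI[of _ "insert t C"])
 qed
 let ?P = "%v. v : A k Un \<Union>R"
 have nA: "v ~: A l" if "v : t" "t : W" "l < 4" for v t l using V_not_A W that by blast
 have Pp: "?P p" using p Rk by blast
 have nq: "~ ?P q"
 proof
  assume a: "?P q"
  have "q ~: A m" using a A_disj km nA RW by blast
  then obtain t where t: "t : W" "t : side m" "q : t" using q by blast
  hence "q ~: A k" using nA km by blast
  then obtain u where "u : R" "q : u" using a by blast
  hence "u = t" using V_disj t RW W by blast
  thus False using Rm \<open>u : R\<close> t by blast
 qed
 obtain x y where xy: "x : D" "y : D" "?P x" "~ ?P y" "lat_adj x y" by (rule gconn_edge[where P = ?P, OF D(1) p(1) Pp q(1) nq]) (rule that)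
 show False
 proof (cases "y : A m")
  case True
  have "x ~: A k" using A_absorb[of x k y] xy True A_free by blast
  then obtain u where "u : R" "x : u" using xy by blast
  hence "u : side m" unfolding side_def using RW W xy True by blast
  thus False using Rm \<open>u : R\<close> by blast
 next
  case False
  then obtain t where t: "t : W" "y : t" using xy D by blast
  show False
  proof (cases "x : A k")
   case True
   hence "t : side k" unfolding side_def using t W lat_sym[OF xy(5)] by blast
   thus False using Rk[OF t(1)] t xy by blast
  next
   case False
   then obtain u where u: "u : R" "x : u" using xy by blast
   hence "tadj u t" unfolding tadj_def using t xy by blast
   thus False using step[OF u(1) t(1)] t xy by blast
  qed
 qed
qed

lemma ring_cells:
 assumes "1 <= j" "j <= N"
 shows "(N, j) : A 0" "(j, N) : A 0" "(- j, N) : A 1" "(- N, j) : A 1" "(- N, - j) : A 2" "(- j, - N) : A 2" "(j, - N) : A 3" "(N, - j) : A 3"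
 using ring_A[OF assms, of 0] ring_A[OF assms, of 1] ring_A[OF assms, of 2] ring_A[OF assms, of 3] unfolding rot_values by simp_all

text \<open>Apply lattice blocking to the cells of \<open>W\<close> together with \<open>A 0\<close>
  and \<open>A 2\<close>: a connection of the two other corners in the complement would give a chain
  from side 1 to side 3 that avoids \<open>W\<close>.\<close>

lemma block_tiles:
 assumes W: "W <= V" and hit: "!!C. C <= V ==> gconn tadj C ==> C Int side 1 ~= {} ==> C Int side 3 ~= {} ==> C Int W ~= {}"
 shows "EX D<=W. gconn tadj D & D Int side 0 ~= {} & D Int side 2 ~= {}"
proof -
 define W' where "W' = \<Union>W Un A 0 Un A 2"
 have N0: "0 < N" using N_bounds by simp
 have WG: "W' <= G" unfolding W'_def using W V_tile(3) A_G by blast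
 have nW: "v ~: W'" if "v : A k" "k = 1 | k = 3" for v k
  using that A_disj[of k 0 v] A_disj[of k 2 v] V_not_A[of _ v k] W unfolding W'_def by fastforce
 have c13: "(- N, N) : A 1" "(N, - N) : A 3" using cor_A[of 1] cor_A[of 3] unfolding cor_values by auto
 have no: False if U: "U <= G - W'" "gconn lat_adj U" "(- N, N) : U" "(N, - N) : U" for U
 proof -
  have "U <= \<Union>(V - W) Un A 1 Un A 3"
  proof
   fix v assume v: "v : U"
   show "v : \<Union>(V - W) Un A 1 Un A 3"
   proof (cases "v : Bc")
    case True
    thus ?thesis using v U Union_V unfolding W'_def by blast
   next
    case False
    then obtain k where "k < 4" "v : A k" using v U unfolding Bc_def by blast
    thus ?thesis using v U less4[of k] unfolding W'_def by auto
   qed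
  qed
  hence "EX C<=V - W. gconn tadj C & C Int side 1 ~= {} & C Int side 3 ~= {}"
   using reach[of "V - W" 1 3 U "(- N, N)" "(N, - N)"] U c13 by auto
  thus False using hit by blast
 qed
 obtain D p q where D: "D <= W'" "gconn lat_adj D" "p : D" "fst p = N | snd p = N" "q : D" "fst q = - N | snd q = - N"
  using lattice_blocking[of N W'] N0 WG nW c13 no unfolding G_def by metis
 have "p : G" "q : G" using D(1,3,5) WG by blast+
 hence pG: "\<bar>fst p\<bar> <= N" "\<bar>snd p\<bar> <= N" "\<bar>fst q\<bar> <= N" "\<bar>snd q\<bar> <= N" by (auto simp: G_def)
 have tile: "v : \<Union>(W Int side k)" if a: "v : W'" "v : G - free" "lat_adj v u" "u : A k" for v u k
 proof -
  have "v ~: A 0" "v ~: A 2" using a(2) A_free by blast+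
  then obtain t where "t : W" "v : t" using a(1) unfolding W'_def by blast
  thus ?thesis using a W unfolding side_def by blast
 qed
 have adj1: "lat_adj (N, 0) (N, 1)" "lat_adj (0, N) (1, N)" "lat_adj (- N, 0) (- N, - 1)" "lat_adj (0, - N) (- 1, - N)" by (simp_all add: lat_adj_def)
 have N1: "1 <= N" using N0 by simp
 \<comment> \<open>The end of the lattice chain is on the border of the grid, hence in a corner
   region or in an axis cell, which is adjacent to one.\<close>
 have p: "p : A 0 Un \<Union>(W Int side 0)" using D(4)
 proof
  assume "fst p = N"
  then obtain j where j: "p = (N, j)" by (cases p) auto
  consider "1 <= j" | "j = 0" | "1 <= - j" by linarith
  thus ?thesis
  proof cases
   case 1 thus ?thesis using ring_cells(1)[of j] pG j by auto
  next
   case 2 thus ?thesis using tile[of p "(N, 1)" 0] ring_cells(1)[of 1] N1 adj1 axis_cells j D by auto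
  next
   case 3 thus ?thesis using ring_cells(8)[of "- j"] nW[of p 3] pG j D by auto
  qed
 next
  assume "snd p = N"
  then obtain j where j: "p = (j, N)" by (cases p) auto
  consider "1 <= j" | "j = 0" | "1 <= - j" by linarith
  thus ?thesis
  proof cases
   case 1 thus ?thesis using ring_cells(2)[of j] pG j by auto
  next
   case 2 thus ?thesis using tile[of p "(1, N)" 0] ring_cells(2)[of 1] N1 adj1 axis_cells j D by auto
  next
   case 3 thus ?thesis using ring_cells(3)[of "- j"] nW[of p 1] pG j D by auto
  qed
 qed
 have q: "q : A 2 Un \<Union>(W Int side 2)" using D(6)
 proof
  assume "fst q = - N"
  then obtain j where j: "q = (- N, j)" by (cases q) auto
  consider "1 <= j" | "j = 0" | "1 <= - j" by linarith
  thus ?thesis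
  proof cases
   case 1 thus ?thesis using ring_cells(4)[of j] nW[of q 1] pG j D by auto
  next
   case 2 thus ?thesis using tile[of q "(- N, - 1)" 2] ring_cells(5)[of 1] N1 adj1 axis_cells j D by auto
  next
   case 3 thus ?thesis using ring_cells(5)[of "- j"] pG j by auto
  qed
 next
  assume "snd q = - N"
  then obtain j where j: "q = (j, - N)" by (cases q) auto
  consider "1 <= j" | "j = 0" | "1 <= - j" by linarith
  thus ?thesis
  proof cases
   case 1 thus ?thesis using ring_cells(7)[of j] nW[of q 3] pG j D by auto
  next
   case 2 thus ?thesis using tile[of q "(- 1, - N)" 2] ring_cells(6)[of 1] N1 adj1 axis_cells j D by auto
  next
   case 3 thus ?thesis using ring_cells(6)[of "- j"] pG j by auto
  qed
 qed
 show ?thesis by (rule reach[OF W _ _ _ D(2), of 0 2 p q]) (use D p q in "auto simp: W'_def")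
qed

theorem tiling: obtains X Y m a where "square_tiling V tadj X Y m (side 1) (side 3) (side 0) (side 2) 1 a"
 by (rule square_tiling_exists[OF finite_V symp_tadj V_gconn side_V side_V side_V side_V cross_tiles block_tiles])
  (assumption | rule that)+

lemma KK_cell_Bc: assumes "z : KK" "dist c z <= 3 * dl 0" "z : cell v" shows "v : Bc"
 using cell_in_box[OF assms(3,2)] assms nonfree_Bc unfolding free_def G_def by blast

lemma TE_gconn:
 assumes E: "connected E" "E <= KK" "E <= cball c (3 * dl 0)"
 shows "gconn tadj (TE E)"
proof -
 have "cm E <= Bc" using KK_cell_Bc E unfolding cm_def by fastforce
 moreover have "finite (cm E)" by (rule cm_finite[OF bounded_subset[OF bounded_cball E(3)]])
 ultimately show ?thesis unfolding TE_def by (intro quotient_V cm_gconn E(1))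
qed

lemma TE_iff: "t : TE E \<longleftrightarrow> t : V & body t Int E ~= {}" by (auto simp: TE_def cm_def body_def)

lemma body_connected: assumes C: "C <= V" "gconn tadj C" shows "connected (UN t:C. body t)"
proof -
 have "connected (UN v:\<Union>C. cell v)"
  by (rule connected_gconn_UN[OF tiles_gconn[OF C]]) (use cell_connected cell_nonempty cell_adj in auto)
 moreover have "(UN v:\<Union>C. cell v) = (UN t:C. body t)" by (auto simp: body_def)
 ultimately show ?thesis by simp
qed

lemma body_nonempty: "t : V ==> body t ~= {}" using V_tile(1) cell_nonempty unfolding body_def by blast

lemma point_tile: assumes "z : carpet Om Q" "z : cell v" shows "{v} : V"
proof -
 have z: "z : closure Om" using assms carpet_sub by blast
 have "v : Bc" by (rule KK_cell_Bc[OF _ _ assms(2)]) (use z near_c[OF z] dl_pos[of 0] in "auto simp: KK_def")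
 moreover have "v ~: Cl i" if "1 <= i" for i using Cl_cell[of v i] assms carpet_iff by blast
 ultimately show ?thesis unfolding V_def by blast
qed

end

section \<open>Curves that avoid a ball, and tiles at the peripheral circles\<close>

lemma open_push_outward:
 fixes x :: "'a::{real_inner, perfect_space}"
 assumes U: "open U" "w : U"
 obtains w' where "w' : U" "dist x w < dist x w'"
proof -
 obtain e where e: "0 < e" "ball w e <= U" using U open_contains_ball by blast
 show thesis
 proof (cases "w = x")
  case True
  obtain w' where "w' ~= w" "dist w' w < e" using e perfect_choose_dist by blast
  thus ?thesis using that[of w'] e True by (auto simp: dist_commute subset_eq)
 next
  case False
  define w' where "w' = w + (e / 2) *\<^sub>R sgn (w - x)"
  have "dist w w' < e" using e by (simp add: w'_def dist_norm norm_sgn)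
  moreover have "w' - x = (norm (w - x) + e / 2) *\<^sub>R sgn (w - x)" using False by (simp add: w'_def algebra_simps sgn_div_norm)
  hence "dist w' x = norm (w - x) + e / 2" using e False by (simp add: dist_norm norm_sgn)
  ultimately show ?thesis using that[of w'] e by (auto simp: dist_commute dist_norm)
 qed
qed

text \<open>Instead of \<open>x\<close> itself the path ends at the first boundary point
  \<open>a\<close> on a short segment towards \<open>x\<close>. Compactness of the part of the path
  away from \<open>a\<close> gives the radius \<open>r\<close>.\<close>

lemma frontier_approach_path:
 fixes U :: "complex set"
 assumes U: "open U" "connected U" and x: "x : frontier U" and b: "b : U" and et: "0 < et"
 obtains T a r where "connected T" "compact T" "b : T" "a : T" "a : frontier U" "T - {a} <= U" "dist x a < et" "0 < r"
  "!!z. z : T ==> et <= dist a z ==> ball z r <= U"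
proof -
 have xU: "x ~: U" using x U(1) by (simp add: frontier_def interior_open)
 have "x : closure U" using x by (simp add: frontier_def)
 then obtain w where w: "w : U" "dist w x < et" using et closure_approachable by blast
 obtain g where g: "path g" "path_image g <= U" "pathstart g = b" "pathfinish g = w"
  using connected_open_path_connected[OF U] b w unfolding path_connected_def by blast
 have "closed_segment w x Int - U ~= {}" using xU by auto
 moreover have "closed (- U)" using U by auto
 ultimately obtain a where a: "a : closed_segment w x" "a : - U" "!!y. y : closed_segment w a ==> y : - U ==> y = a"
  using first_point_on_segment by metis
 have "closed_segment w a Int frontier U ~= {}" using a(2) w(1) by (intro connected_Int_frontier) auto
 then obtain y where y: "y : closed_segment w a" "y : frontier U" by blast
 hence "y : - U" using U(1) by (simp add: frontier_def interior_open)
 hence aF: "a : frontier U" using a(3) y by blast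
 have "dist a x <= dist w x" using segment_bound(2)[OF a(1)] by (simp add: dist_norm norm_minus_commute)
 hence da: "dist x a < et" using w(2) by (simp add: dist_commute)
 define T where "T = path_image g Un closed_segment w a"
 have wg: "w : path_image g" "b : path_image g" using g by auto
 have T: "connected T" "compact T" "b : T" "a : T" unfolding T_def
  using g by (auto intro!: connected_Un connected_path_image compact_Un compact_path_image)
 have TU: "T - {a} <= U" unfolding T_def using g(2) a(3) by blast
 have "compact (T - ball a et)" using T(2) by (intro compact_diff) auto
 moreover have "T - ball a et <= U" using TU et by auto
 ultimately obtain r where r: "0 < r" "(UN z:T - ball a et. ball z r) <= U"
  using compact_subset_open_imp_ball_epsilon_subset[OF _ U(1)] by metis
 show thesis by (rule that[OF T aF TU da r(1)]) (use r(2) in \<open>auto simp: UN_subset_iff\<close>)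
qed

context carpet_setup begin

text \<open>Continue the ray from \<open>x\<close> through \<open>y\<close> until it leaves
  \<open>closure Om\<close>; the distance from \<open>x\<close> only grows.\<close>

lemma outward_segment:
 assumes "y : closure Om" "x ~= y"
 obtains a where "a : frontier Om" "closed_segment y a <= closure Om" "!!w. w : closed_segment y a ==> dist x y <= dist x w"
proof -
 define T where "T = (dl 0 + 1) / norm (y - x)"
 have T: "0 < T" "T * norm (y - x) = dl 0 + 1" using assms(2) dl_pos[of 0] by (auto simp: T_def)
 define z where "z = y + T *\<^sub>R (y - x)"
 have "dist y z = dl 0 + 1" using T by (simp add: z_def dist_norm)
 hence zQ: "z : Q 0" using dist_le_dl0[OF assms(1), of z] unfolding Q0 by auto
 have yQ: "y ~: Q 0" using assms unfolding Q0 by simp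
 have "closed_segment y z Int closure (Q 0) ~= {}" using zQ closure_subset by (metis disjoint_iff ends_in_segment(2) subsetD)
 then obtain a where a: "a : closed_segment y z" "a : frontier (Q 0)" "closed_segment y a Int Q 0 = {}"
  using closed_segment_first_frontier[OF open_Q yQ] by blast
 have d: "dist x y <= dist x w" if "w : closed_segment y a" for w
 proof -
  have "w : closed_segment y z" using that a(1) subset_closed_segment[of y a y z] by auto
  then obtain u where u: "0 <= u" "w = (1 - u) *\<^sub>R y + u *\<^sub>R z" unfolding closed_segment_def by blast
  have "w - x = (1 + u * T) *\<^sub>R (y - x)" unfolding u(2) z_def by (simp add: algebra_simps)
  hence "norm (w - x) = (1 + u * T) * norm (y - x)" using u T by simp
  moreover have "1 * norm (y - x) <= (1 + u * T) * norm (y - x)" using u T by (intro mult_right_mono) auto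
  ultimately show ?thesis by (simp add: dist_norm norm_minus_commute)
 qed
 show thesis by (rule that[of a]) (use a d frontier_Q0 Q0 in auto)
qed

text \<open>Go straight away from \<open>x\<close>. If \<open>Q i\<close> is in the way, follow its
  boundary, outside the ball, to the point \<open>m\<close> of its closure farthest from
  \<open>x\<close>; from there the ray away from \<open>x\<close> cannot enter \<open>Q i\<close>
  again.\<close>

lemma escape:
 assumes i: "1 <= i" and y: "y : closure Om" "y ~: Q i" and R: "0 < R" "(2 * K2 + 1) * R < dist x y"
 obtains D p where "connected D" "D <= closure Om" "y : D" "p : D" "p : frontier Om" "D Int Q i = {}" "D Int cball x R = {}"
  "(2 * K2 + 1) * R < dist x p"
proof -
 have RR: "R <= (2 * K2 + 1) * R" using K2 R by (simp add: algebra_simps)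
 have xy: "x ~= y"
 proof
  assume "x = y"
  hence "dist x y = 0" by simp
  thus False using R RR by linarith
 qed
 have away: "S' Int cball x R = {}" if far: "!!w. w : S' ==> dist x y <= dist x w" for S'
 proof -
  have "R < dist x w" if w: "w : S'" for w using far[OF w] R RR by linarith
  thus ?thesis by fastforce
 qed
 obtain a where a: "a : frontier Om" "closed_segment y a <= closure Om" "!!w. w : closed_segment y a ==> dist x y <= dist x w"
  using outward_segment[OF y(1) xy] by blast
 show thesis
 proof (cases "closed_segment y a Int closure (Q i) = {}")
  case True
  have "closed_segment y a Int cball x R = {}" by (rule away) (rule a(3))
  moreover have "(2 * K2 + 1) * R < dist x a" using a(3)[of a] R by simp
  ultimately show ?thesis using that[of "closed_segment y a" a] a(1,2) True closure_subset[of "Q i"] by auto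
 next
  case False
  obtain b where b: "b : closed_segment y a" "b : frontier (Q i)" "closed_segment y b Int Q i = {}"
   using closed_segment_first_frontier[OF open_Q y(2) False] by blast
  have yb: "closed_segment y b <= closed_segment y a" using b(1) by (simp add: subset_closed_segment)
  have cpt: "compact (closure (Q i))" "closure (Q i) ~= {}" using Q_props[OF i] by auto
  obtain m where m: "m : closure (Q i)" "!!w. w : closure (Q i) ==> dist x w <= dist x m" using distance_attains_sup[OF cpt, of x] by blast
  have far: "w ~: Q i" if "dist x m <= dist x w" for w
  proof
   assume "w : Q i"
   then obtain w' where "w' : Q i" "dist x w < dist x w'" using open_push_outward[OF open_Q] by blast
   thus False using m(2)[of w'] closure_subset that by fastforce
  qed
  have mF: "m : frontier (Q i)" using m(1) far[of m] closure_Q by auto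
  have bd: "dist x y <= dist x b" using a(3) b(1) by blast
  also have "... <= dist x m" using m(2) b(2) by (simp add: frontier_def)
  finally have md: "dist x y <= dist x m" .
  obtain H where H: "connected H" "H <= frontier (Q i)" "b : H" "m : H" "H Int cball x R = {}"
  proof (rule quasicircle_avoids_ball[OF qc b(2) mF, of R x])
   show "(2 * K2 + 1) * R < dist x b" "(2 * K2 + 1) * R < dist x m" "0 <= R" using bd md R by linarith+
  qed (rule that)
  have mO: "m : closure Om" using m(1) closure_Q_sub[OF i] closure_subset by blast
  have "x ~= m" using md xy by auto
  then obtain p where p: "p : frontier Om" "closed_segment m p <= closure Om" "!!w. w : closed_segment m p ==> dist x m <= dist x w"
   using outward_segment[OF mO] by blast
  define D where "D = closed_segment y b Un H Un closed_segment m p"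
  have D1: "connected D" unfolding D_def by (rule connected_Un[OF connected_Un]) (use H in auto)
  have D2: "D <= closure Om" unfolding D_def using yb a(2) H(2) p(2) closure_Q_sub[OF i] closure_subset[of Om] by (auto simp: frontier_def)
  have D3: "D Int Q i = {}" unfolding D_def using b(3) H(2) Q_frontier_disj p(3) far by blast
  have "closed_segment y b Int cball x R = {}" by (rule away) (use yb a(3) in auto)
  moreover have "closed_segment m p Int cball x R = {}" by (rule away) (use p(3) md in force)
  ultimately have D4: "D Int cball x R = {}" unfolding D_def using H(5) by blast
  show ?thesis by (rule that[OF D1 D2 _ _ p(1) D3 D4]) (use p(3)[of p] md R in \<open>auto simp: D_def\<close>)
 qed
qed

end

context carpet_frame begin

definition tip :: "real => nat => complex set" where "tip et k = ray_pt k ` {s k..s k + et}"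

lemma tip_near: "z : tip et k ==> dist (cor_pt k) z <= et" unfolding tip_def cor_pt_def by (auto simp: dist_ray_pt)

lemma tip_connected: "connected (tip et k)" unfolding tip_def by (intro connected_continuous_image continuous_ray_pt) simp

lemma tip_KK: "k < 4 ==> tip et k <= KK" by (auto simp: tip_def KK_def ray_def)

lemma cor_tip: "0 <= et ==> cor_pt k : tip et k" by (auto simp: tip_def cor_pt_def)

text \<open>Opposite corners lie on one axis, and consecutive ones differ by \<open>dl 0 / 2\<close>
  along the first axis.\<close>

lemma corner_dist:
 assumes "k < 4" "m < 4" "k ~= m" shows "dl 0 / (2 * K2) <= dist (cor_pt k) (cor_pt m)"
proof -
 have 1: "dist (cor_pt k) (cor_pt m) = norm (of_real (s k) * \<i> ^ k - of_real (s m) * \<i> ^ m)"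
 proof -
  have "cor_pt k - cor_pt m = e * (of_real (s k) * \<i> ^ k - of_real (s m) * \<i> ^ m)" by (simp add: cor_pt_def ray_pt_def algebra_simps)
  thus ?thesis by (simp only: dist_norm norm_mult ne)
 qed
 have p: "\<i> ^ 2 = (- 1 :: complex)" "\<i> ^ 3 = - \<i>" by (simp_all add: power3_eq_cube)
 have 2: "dl 0 / (2 * K2) <= dl 0 / 2" using K2 dl_pos[of 0] by (simp add: field_simps)
 have k: "k = 0 | k = 1 | k = 2 | k = 3" "m = 0 | m = 1 | m = 2 | m = 3" using assms by auto
 show ?thesis
 proof (cases "even k & even m | odd k & odd m")
  case True
  have "norm (of_real (s k) * \<i> ^ k - of_real (s m) * \<i> ^ m) = \<bar>s 0 + s 2\<bar> |
    norm (of_real (s k) * \<i> ^ k - of_real (s m) * \<i> ^ m) = \<bar>s 1 + s 3\<bar>"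
  proof -
   have "of_real (s k) * \<i> ^ k - of_real (s m) * \<i> ^ m : {of_real (s 0 + s 2), - of_real (s 0 + s 2), of_real (s 1 + s 3) * \<i>, - of_real (s 1 + s 3) * \<i>}"
    using k True assms(3) by (elim disjE) (simp_all add: p algebra_simps)
   moreover have "norm (of_real (s 1 + s 3) * \<i>) = \<bar>s 1 + s 3\<bar>" "norm (- of_real (s 1 + s 3) * \<i>) = \<bar>s 1 + s 3\<bar>"
    "norm (complex_of_real (s 0 + s 2)) = \<bar>s 0 + s 2\<bar>" "norm (- complex_of_real (s 0 + s 2)) = \<bar>s 0 + s 2\<bar>"
    by (simp_all only: norm_mult norm_minus_cancel norm_of_real norm_ii mult_1_right)
   ultimately show ?thesis by auto
  qed
  thus ?thesis unfolding 1 using s0 s13 2 dl_pos[of 0] by auto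
 next
  case False
  have "\<bar>Re (of_real (s k) * \<i> ^ k - of_real (s m) * \<i> ^ m)\<bar> = dl 0 / 2"
   using k False s0 dl_pos[of 0] by (elim disjE) (simp_all add: p)
  thus ?thesis unfolding 1 using abs_Re_le_cmod[of "of_real (s k) * \<i> ^ k - of_real (s m) * \<i> ^ m"] 2 by linarith
 qed
qed

text \<open>At most one corner is within \<open>(2 * K2 + 1) * R\<close> of \<open>x\<close>, so
  boundary arcs outside the ball lead from \<open>p\<close> to at least three corners. Each tip
  serves both sides meeting at its corner, hence all four sides are reached.\<close>

lemma corner_ring:
 assumes et: "0 < et" "et <= 2 * R" "0 < R" and small: "2 * ((2 * K2 + 1) * R) < dl 0 / (2 * K2)"
  and p: "p : frontier Om" "(2 * K2 + 1) * R < dist x p"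
 obtains D where "connected D" "D <= KK" "D <= frontier Om Un (UN k<4. tip et k)" "p : D" "D Int cball x R = {}"
  "!!k. k < 4 ==> tip et k <= D | tip et ((k + 1) mod 4) <= D"
proof -
 define far where "far k \<longleftrightarrow> k < 4 & (2 * K2 + 1) * R < dist x (cor_pt k)" for k
 have two: "far k | far m" if km: "k < 4" "m < 4" "k ~= m" for k m
 proof (rule ccontr)
  assume "~ ?thesis"
  hence "dist x (cor_pt k) <= (2 * K2 + 1) * R" "dist x (cor_pt m) <= (2 * K2 + 1) * R" using km by (auto simp: far_def)
  hence "dist (cor_pt k) (cor_pt m) <= 2 * ((2 * K2 + 1) * R)" using dist_triangle2[of "cor_pt k" "cor_pt m" x] by (simp add: dist_commute)
  thus False using corner_dist[OF km] small by linarith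
 qed
 have ex: "EX g. connected g & g <= frontier Om & p : g & cor_pt k : g & g Int cball x R = {}" if "far k" for k
 proof -
  have "quasicircle K2 (frontier Om)" using qc[of 0] frontier_Q0 by simp
  moreover have "k < 4" "(2 * K2 + 1) * R < dist x (cor_pt k)" "0 <= R" using that et(3) by (auto simp: far_def)
  ultimately show ?thesis using quasicircle_avoids_ball[OF _ p(1) cor_frontier p(2)] by metis
 qed
 then obtain g where g: "!!k. far k ==> connected (g k) & g k <= frontier Om & p : g k & cor_pt k : g k & g k Int cball x R = {}"
  by metis
 have bR: "tip et k Int cball x R = {}" if "far k" for k
 proof -
  have "R * 3 <= (2 * K2 + 1) * R" using K2 et(3) by (simp)
  hence 1: "3 * R < dist x (cor_pt k)" using that by (simp add: far_def)
  have "z ~: cball x R" if z: "z : tip et k" for z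
   using tip_near[OF z] 1 dist_triangle[of x "cor_pt k" z] et(2) by (auto simp: dist_commute)
  thus ?thesis by blast
 qed
 define D where "D = (UN k:Collect far. g k Un tip et k)"
 have far4: "far k ==> k < 4" for k by (simp add: far_def)
 have con: "connected (g k Un tip et k)" if "far k" for k
  by (rule connected_Un) (use g[OF that] tip_connected cor_tip[of et k] et(1) in \<open>auto\<close>)
 show thesis
 proof (rule that)
  have "p : (INT k:Collect far. g k Un tip et k)" using g by blast
  thus "connected D" unfolding D_def using con by (intro connected_Union) blast+
  show "D <= frontier Om Un (UN k<4. tip et k)" unfolding D_def using g far4 by blast
  thus "D <= KK" using tip_KK[of _ et] unfolding KK_def by (fastforce simp: frontier_def)
  show "p : D" unfolding D_def using two[of 0 1] g by auto
  show "D Int cball x R = {}" unfolding D_def using g bR by blast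
  show "tip et k <= D | tip et ((k + 1) mod 4) <= D" if "k < 4" for k
  proof -
   have "k = 0 | k = 1 | k = 2 | k = 3" using that by auto
   hence "k ~= (k + 1) mod 4" by auto
   hence "far k | far ((k + 1) mod 4)" using two[of k "(k + 1) mod 4"] that by simp
   thus ?thesis unfolding D_def by blast
  qed
 qed
qed

end

context carpet_grid begin

lemma side_tile:
 assumes "v : G - free" "lat_adj v u" "u : A k"
 shows "{v} : side k" "{v} : V"
proof -
 have "v ~: Cl i" if "1 <= i" for i using Cl_free_adj[OF that _ _] assms A_free by blast
 thus "{v} : V" unfolding V_def using assms(1) nonfree_Bc by blast
 thus "{v} : side k" unfolding side_def using assms by blast
qed

lemma ray_cell_nonfree:
 assumes k: "k < 4" and i: "s k <= of_int i * ep" "i <= N"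
 shows "(rot ^^ k) (i, 0) : G - free" "ray_pt k (of_int i * ep) : cell ((rot ^^ k) (i, 0))"
proof -
 show 1: "ray_pt k (of_int i * ep) : cell ((rot ^^ k) (i, 0))" unfolding ray_cell using ep by (simp add: near_int_def)
 have "- (of_int N * ep) <= of_int i * ep" using s_le_N(2)[OF k] i by linarith
 hence "of_int (- N) * ep <= of_int i * ep" by simp
 hence "- N <= i" using ep by (metis mult_right_le_imp_le of_int_le_iff)
 hence "(rot ^^ k) (i, 0) : G" unfolding rot_G using i by (simp add: G_def)
 thus "(rot ^^ k) (i, 0) : G - free" using ray_KK[OF k i(1)] 1 by (auto simp: free_def)
qed

lemma row_adj: "lat_adj ((rot ^^ k) (i, 0)) ((rot ^^ k) (i, 1))" "lat_adj ((rot ^^ k) (i, 0)) ((rot ^^ k) (i, - 1))" by (rule rot_adj; simp)+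

text \<open>A cell of the ray shortly beyond the corner has neighbours in \<open>A k\<close> and in
  \<open>A (prv k)\<close>, so its tile lies on two sides of the quadrilateral at once.\<close>

lemma corner_tile:
 assumes k: "k < 4" and et: "0 < et" "2 * et <= dl 0" "ep <= et"
  and away: "!!z t. z : closure Om ==> s k + et <= t ==> 2 * ep < dist z (ray_pt k t)"
 obtains v z where "{v} : side k" "{v} : side (prv k)" "z : cell v" "z : tip (2 * et) k"
proof -
 define i where "i = \<lceil>(s k + et) / ep\<rceil>"
 have "(s k + et) / ep <= of_int i" "of_int i < (s k + et) / ep + 1" unfolding i_def by linarith+
 hence i: "s k + et <= of_int i * ep" "of_int i * ep <= s k + 2 * et" using ep et by (simp_all add: field_simps)
 have "of_int i * ep <= of_int N * ep" using i(2) et(2) s_le[OF k] N_bounds(2) dl_pos[of 0] by linarith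
 hence iN: "i <= N" using ep by simp
 have i0: "s k <= of_int i * ep" using i by linarith
 note r = ray_cell_nonfree[OF k i0 iN]
 have sA: "(rot ^^ k) (i, 1) : A k" "(rot ^^ k) (i, - 1) : A (prv k)" using side_row_A[OF k _ _ i(1) iN] away et(1) by auto
 show thesis by (rule that[OF side_tile(1)[OF r(1) row_adj(1) sA(1)] side_tile(1)[OF r(1) row_adj(2) sA(2)] r(2)])
   (use i i0 in "auto simp: tip_def")
qed

text \<open>Along the cells of the approach path \<open>T\<close> some edge leads out of
  \<open>Cl i\<close>. Its outer cell is not contained in \<open>Q i\<close>, so it meets the
  boundary; this happens near \<open>a\<close>, since the path is deep inside \<open>Q i\<close>
  elsewhere.\<close>

lemma boundary_tile:
 assumes i: "1 <= i" and T: "connected T" "compact T" "(SOME z. z : Q i) : T" "a : T" "a : frontier (Q i)" "T - {a} <= Q i"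
  and r: "0 < r" "!!z. z : T ==> et <= dist a z ==> ball z r <= Q i" "ball (SOME z. z : Q i) r <= Q i" "2 * ep < r"
 obtains v x' where "x' : frontier (Q i)" "dist a x' <= et + 2 * ep" "x' : cell v" "{v} : V" "tadj {v} (Cl i)" "Cl i : V"
proof -
 define b where "b = (SOME z. z : Q i)"
 obtain v0 where "b : cell v0" by (rule cell_of)
 hence bb: "b : cell (bc i)" unfolding bc_def b_def by (rule someI)
 have sub: "cell v <= ball z r" if "z : cell v" for v z using cell_diam[OF that] r(4) by fastforce
 have TO: "T <= closure Om" using T(6) T(5) closure_Q_sub[OF i] closure_subset[of "Q i"] closure_subset[of Om] by (auto simp: frontier_def)
 have cmG: "cm T <= G"
 proof
  fix v assume "v : cm T"
  then obtain z where "z : cell v" "z : T" by (auto simp: cm_def)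
  thus "v : G" using cell_in_box[of z v] near_c[of z] TO dl_pos[of 0] by (auto simp: G_def)
 qed
 have bcm: "bc i : cm T" using bb T(3) by (auto simp: cm_def b_def)
 have "cell (bc i) <= Q i" using sub[OF bb] r(3) unfolding b_def by blast
 hence "bc i : In i" using bcm cmG by (auto simp: In_def)
 hence bCl: "bc i : Cl i" unfolding Cl_def by (rule gcomp_self)
 obtain va where va: "a : cell va" by (rule cell_of)
 have aQ: "a ~: Q i" using T(5) Q_frontier_disj by blast
 have vaCl: "va ~: Cl i" using va aQ Cl_cell by blast
 have vacm: "va : cm T" using va T(4) by (auto simp: cm_def)
 obtain u v where uv: "u : cm T" "v : cm T" "u : Cl i" "v ~: Cl i" "lat_adj u v"
  by (rule gconn_edge[where P = "%v. v : Cl i", OF cm_gconn[OF T(1) cm_finite[OF compact_imp_bounded[OF T(2)]]] bcm bCl vacm vaCl]) (rule that)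
 have vI: "~ cell v <= Q i"
 proof
  assume "cell v <= Q i"
  hence "v : In i" using uv(2) cmG by (auto simp: In_def)
  hence "{v} <= gcomp lat_adj (In i) (bc i)"
   by (intro gcomp_absorb[OF symp_lat_adj, of "{v}" "In i" v u]) (use uv lat_sym in "auto simp: Cl_def")
  thus False using uv(4) by (simp add: Cl_def)
 qed
 obtain z where z: "z : cell v" "z : T" using uv(2) by (auto simp: cm_def)
 have za: "dist a z < et" using r(2)[OF z(2)] sub[OF z(1)] vI by fastforce
 have "EX x'. x' : cell v & x' : frontier (Q i)"
 proof (cases "z = a")
  case False
  hence "cell v Int frontier (Q i) ~= {}" using z T(6) vI by (intro connected_Int_frontier cell_connected) auto
  thus ?thesis by blast
 qed (use z T(5) in auto)
 then obtain x' where x': "x' : cell v" "x' : frontier (Q i)" by blast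
 have "dist a x' <= et + 2 * ep" using za cell_diam[OF z(1) x'(1)] dist_triangle[of a x' z] by linarith
 moreover have "{v} : V" using point_tile[OF _ x'(1)] x'(2) frontier_sub_carpet by blast
 moreover have "tadj {v} (Cl i)" unfolding tadj_def using uv(3) lat_sym[OF uv(5)] by blast
 moreover have "Cl i : V" using i bCl unfolding V_def by blast
 ultimately show thesis using that x' by blast
qed

lemma box_edge:
 assumes "v : G" "u ~: G" "lat_adj u v"
 shows "(EX k<4. v : A k) | (EX k<4. v = (rot ^^ k) (N, 0))"
proof -
 obtain a b where ab: "v = (a, b)" by (cases v)
 obtain p q where pq: "u = (p, q)" by (cases u)
 have r: "- N <= a" "a <= N" "- N <= b" "b <= N" using assms(1) ab by (auto simp: G_def)
 have "\<bar>p - a\<bar> <= 1" "\<bar>q - b\<bar> <= 1" using assms(3) by (auto simp: lat_adj_def ab pq)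
 moreover have "p < - N | N < p | q < - N | N < q" using assms(2) by (auto simp: G_def pq)
 ultimately have edge: "a = N | a = - N | b = N | b = - N" using r by linarith
 have ax: "v = (N, 0) | v = (0, N) | v = (- N, 0) | v = (0, - N) ==> EX k<4. v = (rot ^^ k) (N, 0)"
  using rot_values[of N 0] by (elim disjE) (rule exI[of _ 0], simp; fail | rule exI[of _ 1], simp; fail | rule exI[of _ 2], simp; fail | rule exI[of _ 3], simp; fail)+
 have N1: "1 <= N" using N_bounds by simp
 have in4: "v : A 0 | v : A 1 | v : A 2 | v : A 3 ==> EX k<4. v : A k"
  by (elim disjE) (rule exI[of _ 0], simp; fail | rule exI[of _ 1], simp; fail | rule exI[of _ 2], simp; fail | rule exI[of _ 3], simp; fail)+
 show ?thesis
 proof (cases "a = 0 | b = 0")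
  case True
  thus ?thesis using ax edge ab N1 by auto
 next
  case False
  hence "1 <= a | 1 <= - a" "1 <= b | 1 <= - b" by linarith+
  hence "v : A 0 | v : A 1 | v : A 2 | v : A 3"
   using edge ring_cells[of a] ring_cells[of "- a"] ring_cells[of b] ring_cells[of "- b"] r unfolding ab by (elim disjE) simp_all
  thus ?thesis using in4 by blast
 qed
qed

text \<open>The counterpart for the exterior, where the path comes from beyond the grid.
  \<open>P\<close> marks cells outside the grid, in a corner region, or on a ray well beyond its
  corner. The edge at which \<open>P\<close> fails starts in a corner region and ends in a cell
  meeting \<open>closure Om\<close>; cells of rays are excluded because the corners are far from
  \<open>a\<close>.\<close>

lemma outer_boundary_tile:
 assumes T: "connected T" "compact T" "w : T" "20 * dl 0 <= dist c w" "a : T" "a : frontier Om" "T - {a} <= Q 0"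
  and r: "!!z. z : T ==> et' <= dist a z ==> ball z r <= Q 0"
  and et: "0 < et" "2 * et <= dl 0" "ep <= et" "4 * et + 4 * ep < r"
  and away: "!!k z t. k < 4 ==> z : closure Om ==> s k + et <= t ==> 2 * ep < dist z (ray_pt k t)"
  and nc: "!!k. k < 4 ==> et' + 4 * et + 4 * ep < dist a (cor_pt k)"
 obtains v x' k where "x' : frontier Om" "dist a x' <= et' + 2 * ep" "x' : cell v" "k < 4" "{v} : side k"
proof -
 define P where "P v \<longleftrightarrow> v ~: G | (EX k<4. v : A k) | (EX k<4. EX i. v = (rot ^^ k) (i, 0) & s k + 2 * et <= of_int i * ep)" for v
 obtain va where va: "a : cell va" by (rule cell_of)
 obtain vw where vw: "w : cell vw" by (rule cell_of)
 have cva: "va : cm T" and cvw: "vw : cm T" using va vw T by (auto simp: cm_def)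
 have near_cor: "dist z (cor_pt k) <= 4 * et + 4 * ep" if k: "k < 4" and i: "of_int i * ep < s k + 2 * et" and z: "z : cell ((rot ^^ k) (i, 0))"
  and t: "ray_pt k t : cell ((rot ^^ k) (i, 0))" "s k <= t" for z k i t
 proof -
  have "near_int (t / ep) i" using t(1) unfolding ray_cell by simp
  hence "t / ep <= of_int i + 1 / 2" unfolding near_int_def by linarith
  hence "t <= of_int i * ep + ep / 2" using ep by (simp add: field_simps)
  hence "dist (ray_pt k t) (cor_pt k) <= 2 * et + ep" unfolding cor_pt_def dist_ray_pt using i t(2) ep by linarith
  thus ?thesis using cell_diam[OF z t(1)] dist_triangle[of z "cor_pt k" "ray_pt k t"] ep et by linarith
 qed
 have close: "dist a z < et'" if z: "z : T" and w': "w' : closure Om" "dist z w' <= 4 * et + 4 * ep" for z w'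
 proof (rule ccontr)
  assume "~ ?thesis"
  hence "ball z r <= Q 0" using r[OF z] by simp
  thus False using w' et(4) unfolding Q0 by force
 qed
 have nocor: False if "z : T" "k < 4" "dist z (cor_pt k) <= 4 * et + 4 * ep" for z k
 proof -
  have "cor_pt k : closure Om" using cor_frontier[OF that(2)] by (simp add: frontier_def)
  hence "dist a z < et'" using close that by blast
  thus False using nc[OF that(2)] that(3) dist_triangle[of a "cor_pt k" z] by linarith
 qed
 have Pw: "P vw"
 proof -
  have "vw ~: G"
  proof
   assume "vw : G"
   hence "\<bar>fst vw\<bar> <= N" "\<bar>snd vw\<bar> <= N" by (auto simp: G_def)
   hence "\<bar>real_of_int (fst vw)\<bar> <= of_int N" "\<bar>real_of_int (snd vw)\<bar> <= of_int N" by linarith+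
   hence "\<bar>Re (Fr 0 w)\<bar> <= of_int N + 1/2" "\<bar>Im (Fr 0 w)\<bar> <= of_int N + 1/2" using vw unfolding cell_def near_int_def mem_Collect_eq by linarith+
   hence "norm (Fr 0 w) <= 2 * of_int N + 1" using cmod_le[of "Fr 0 w"] by linarith
   hence "ep * norm (Fr 0 w) <= ep * (2 * of_int N + 1)" using ep by (intro mult_left_mono) auto
   hence "dist c w <= 2 * (of_int N * ep) + ep" using dist_Fr[of c w 0] by (simp add: Fr_c algebra_simps)
   thus False using T(4) N_bounds(3) ep dl_pos[of 0] by linarith
  qed
  thus ?thesis by (simp add: P_def)
 qed
 have aO: "a : closure Om" using T(6) by (simp add: frontier_def)
 have vaG: "va : G - free" using cell_in_box[OF va] near_c[OF aO] va aO dl_pos[of 0] by (auto simp: free_def G_def KK_def)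
 have nP: "~ P va"
 proof
  assume "P va"
  then obtain k i where ki: "k < 4" "va = (rot ^^ k) (i, 0)" "s k + 2 * et <= of_int i * ep" using vaG A_free unfolding P_def by blast
  have "ray_pt k (of_int i * ep) : cell va" unfolding ki(2) ray_cell using ep by (simp add: near_int_def)
  hence "dist a (ray_pt k (of_int i * ep)) <= 2 * ep" by (rule cell_diam[OF va])
  thus False using away[OF ki(1) aO, of "of_int i * ep"] ki(3) et(1) by simp
 qed
 obtain u v where uv: "u : cm T" "v : cm T" "P u" "~ P v" "lat_adj u v"
  by (rule gconn_edge[where P = P, OF cm_gconn[OF T(1) cm_finite[OF compact_imp_bounded[OF T(2)]]] cvw Pw cva nP]) (rule that)
 have vG: "v : G" and vA: "!!k. k < 4 ==> v ~: A k" using uv(4) by (auto simp: P_def)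
 have vray: "of_int i * ep < s k + 2 * et" if "k < 4" "v = (rot ^^ k) (i, 0)" for k i using uv(4) that unfolding P_def by force
 obtain z where z: "z : cell v" "z : T" using uv(2) by (auto simp: cm_def)
 have uG: "u : G"
 proof (rule ccontr)
  assume "u ~: G"
  then obtain k where k: "k < 4" "v = (rot ^^ k) (N, 0)" using box_edge[OF vG _ uv(5)] vA by blast
  hence "of_int N * ep < s k + 2 * et" using vray by blast
  thus False using s_le[OF k(1)] N_bounds(2) et(2) dl_pos[of 0] by linarith
 qed
 have noray: False if k: "k < 4" and "v = (rot ^^ k) (i, 0)" "ray_pt k t : cell v" "s k <= t" for k i t
  using near_cor[OF k vray[OF k that(2)], of z t] nocor[OF z(2) k] that z(1) by auto
 \<comment> \<open>Otherwise \<open>u\<close> is a cell of a ray beyond its corner, and its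
   neighbours belong to that ray or to the two free rows along it.\<close>
 have "EX k<4. u : A k"
 proof (rule ccontr)
  assume no: "~ ?thesis"
  then obtain k i where ki: "k < 4" "u = (rot ^^ k) (i, 0)" "s k + 2 * et <= of_int i * ep" using uv(3) uG unfolding P_def by blast
  obtain v' where v': "v = (rot ^^ k) v'" by (rule rot_surj)
  obtain p q where pq: "v' = (p, q)" by (cases v')
  have "EX x y. ((rot ^^ k) (i, 0)) = x & y = (rot ^^ k) v' & lat_adj x y" using uv(5) ki v' by blast
  have d: "\<bar>p - i\<bar> <= 1 & \<bar>q\<bar> <= 1"
  proof -
   have "\<bar>fst u - fst v\<bar> <= 1 & \<bar>snd u - snd v\<bar> <= 1" using uv(5) by (auto simp: lat_adj_def)
   moreover have "\<bar>fst (rot x) - fst (rot y)\<bar> <= 1 & \<bar>snd (rot x) - snd (rot y)\<bar> <= 1 \<longleftrightarrow> \<bar>fst x - fst y\<bar> <= 1 & \<bar>snd x - snd y\<bar> <= 1" for x y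
    by (auto simp: rot_def)
   hence "\<bar>fst ((rot ^^ k) x) - fst ((rot ^^ k) y)\<bar> <= 1 & \<bar>snd ((rot ^^ k) x) - snd ((rot ^^ k) y)\<bar> <= 1 \<longleftrightarrow>
     \<bar>fst x - fst y\<bar> <= 1 & \<bar>snd x - snd y\<bar> <= 1" for x y by (induction k) auto
   ultimately have "\<bar>fst (i, 0::int) - fst v'\<bar> <= 1 & \<bar>snd (i, 0::int) - snd v'\<bar> <= 1" unfolding ki(2) v' by blast
   thus ?thesis using pq by auto
  qed
  have "v' : G" using vG unfolding v' rot_G .
  hence pN: "p <= N" using pq by (auto simp: G_def)
  have "of_int i * ep - ep <= of_int p * ep"
  proof -
   have "real_of_int (i - 1) * ep <= of_int p * ep" using d ep by (intro mult_right_mono) (linarith | simp)+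
   thus ?thesis by (simp add: algebra_simps)
  qed
  hence p: "s k + et <= of_int p * ep" using ki(3) et(3) by linarith
  note row = side_row_A[OF ki(1) _ away[OF ki(1)] p pN]
  have q: "q = 0"
  proof (rule ccontr)
   assume "q ~= 0"
   hence "q = 1 | q = - 1" using d by linarith
   hence "v : A k | v : A (prv k)" using row et(1) v' pq by auto
   thus False using vA[OF ki(1)] vA[of "prv k"] by (auto simp: prv_def)
  qed
  show False
  proof (rule noray[OF ki(1), of p "of_int p * ep"])
   show "v = (rot ^^ k) (p, 0)" using v' pq q by simp
   show "ray_pt k (of_int p * ep) : cell v" unfolding v' ray_cell pq q using ep by (simp add: near_int_def)
   show "s k <= of_int p * ep" using p et(1) by linarith
  qed
 qed
 then obtain k where k: "k < 4" "u : A k" by blast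
 have vf: "v ~: free" using A_absorb[OF k(2) _ uv(5)] vA[OF k(1)] by blast
 then obtain z' where z': "z' : cell v" "z' : KK" using vG by (auto simp: free_def)
 have z'O: "z' : closure Om"
 proof (rule ccontr)
  assume "z' ~: closure Om"
  then obtain m t where m: "m < 4" "z' = ray_pt m t" "s m <= t" using z' by (auto simp: KK_def ray_def)
  obtain v' where v': "v = (rot ^^ m) v'" by (rule rot_surj)
  have "snd v' = 0" using z'(1) unfolding m(2) v' ray_cell by simp
  thus False using noray[OF m(1), of "fst v'" t] z' m v' by (cases v') auto
 qed
 have az: "dist a z < et'" using close[OF z(2) z'O] cell_diam[OF z(1) z'(1)] et ep by simp
 have "EX x'. x' : cell v & x' : frontier Om"
 proof (cases "z = a")
  case False
  hence "z : Q 0" using T z by blast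
  hence "cell v Int frontier (Q 0) ~= {}" using z z' z'O by (intro connected_Int_frontier cell_connected) (auto simp: Q0)
  thus ?thesis using frontier_Q0 by blast
 qed (use z T in auto)
 then obtain x' where x': "x' : cell v" "x' : frontier Om" by blast
 have "dist a x' <= et' + 2 * ep" using az cell_diam[OF z(1) x'(1)] dist_triangle[of a x' z] by linarith
 thus thesis using that[OF x'(2) _ x'(1) k(1) side_tile(1)[OF _ lat_sym[OF uv(5)] k(2)]] vG vf by blast
qed

end

section \<open>Energy of annular weights\<close>

lemma ball_packing:
 fixes z :: "'i => complex"
 assumes fin: "finite I" and r: "!!i. i : I ==> 0 <= r i" and sub: "!!i. i : I ==> ball (z i) (r i) <= cball x R"
  and dis: "!!i j. i : I ==> j : I ==> i ~= j ==> ball (z i) (r i) Int ball (z j) (r j) = {}" and R: "0 <= R"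
 shows "(SUM i:I. (r i)^2) <= R\<^sup>2"
proof -
 define w where "w = unit_ball_vol (real DIM(complex))"
 have w: "0 < w" unfolding w_def by (rule unit_ball_vol_pos) simp
 have mb: "measure lebesgue (ball y ro) = w * ro\<^sup>2" if "0 <= ro" for y :: complex and ro using content_ball[OF that, of y] by (simp add: w_def)
 have mc: "measure lebesgue (cball x R) = w * R\<^sup>2" using content_cball[OF R, of x] by (simp add: w_def)
 have "(SUM i:I. measure lebesgue (ball (z i) (r i))) = measure lebesgue (\<Union>((%i. ball (z i) (r i)) ` I))"
  by (rule measure_negligible_finite_Union_image[symmetric, OF fin]) (use dis in "auto simp: pairwise_def")
 also have "... <= measure lebesgue (cball x R)" by (rule measure_mono_fmeasurable) (use sub fin in "auto")
 finally have "(SUM i:I. measure lebesgue (ball (z i) (r i))) <= w * R\<^sup>2" unfolding mc .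
 moreover have "(SUM i:I. measure lebesgue (ball (z i) (r i))) = (SUM i:I. w * (r i)^2)" by (rule sum.cong[OF refl]) (rule mb[OF r])
 ultimately have "(SUM i:I. w * (r i)^2) <= w * R\<^sup>2" by simp
 hence "w * (SUM i:I. (r i)^2) <= w * R\<^sup>2" by (simp add: sum_distrib_left)
 thus ?thesis using w by simp
qed

lemma interval_cover_sum:
 fixes l h :: "'i => real"
 assumes fin: "finite I" and cov: "{a..b} <= (UN i:I. {l i..l i + h i})" and h: "!!i. i : I ==> 0 <= h i" and ab: "a <= b"
 shows "b - a <= (SUM i:I. h i)"
proof -
 have "b - a = measure lborel {a..b}" using ab by simp
 also have "... <= measure lborel (UN i:I. {l i..l i + h i})"
 proof (rule measure_mono_fmeasurable[OF cov])
  have "{l i..l i + h i} : fmeasurable lborel" for i using fmeasurable_cbox[of "l i" "l i + h i"] by (simp)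
  thus "(UN i:I. {l i..l i + h i}) : fmeasurable lborel" using fin by (intro fmeasurable.finite_UN) auto
 qed simp
 also have "... <= (SUM i:I. measure lborel {l i..l i + h i})" by (rule measure_UNION_le[OF fin]) simp
 also have "... = (SUM i:I. h i)" using h by (intro sum.cong) auto
 finally show ?thesis .
qed

text \<open>The summands bound the energy of the single cells, of the \<open>Q i\<close> of size at
  most \<open>R\<close>, which contain comparable balls by the quasicircle condition, and of the
  larger \<open>Q i\<close>, whose number is bounded by relative separation.\<close>

definition enC :: "real => real => real" where
 "enC K2 K3 = 64 + 256 * K2\<^sup>2 + ((2 + K3) / K3)^2"

text \<open>All tiles lie in the ball of radius \<open>11 * dl 0\<close>, and the weight for the
  aspect ratio has scale \<open>dl 0 / (16 * K2 * (2 * K2 + 1))\<close>; the factor 176 is 16 times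
  11.\<close>

definition aspC :: "real => real => real" where
 "aspC K2 K3 = (176 * K2 * (2 * K2 + 1))^2 * enC K2 K3"

text \<open>The weight around \<open>Q i\<close> has scale \<open>K3 * dl i\<close> and lives in a
  ball of radius \<open>(1 + K3) * dl i\<close>.\<close>

definition sepC :: "real => real => real" where
 "sepC K2 K3 = ((1 + K3) / K3)^2 * enC K2 K3"

lemma enC_ge: "64 <= enC K2 K3" unfolding enC_def by (simp)

context carpet_grid begin

definition ix :: "(int \<times> int) set => nat" where "ix t = (SOME i. 1 <= i & t = Cl i)"

definition big :: "(int \<times> int) set => bool" where "big t \<longleftrightarrow> (EX i>=1. t = Cl i)"

definition sz :: "(int \<times> int) set => real" where "sz t = (if big t then dl (ix t) else 2 * ep)"

lemma ix: assumes "big t" shows "1 <= ix t" "t = Cl (ix t)"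
proof -
 have "EX i. 1 <= i & t = Cl i" using assms by (auto simp: big_def)
 hence "1 <= ix t & t = Cl (ix t)" unfolding ix_def by (rule someI_ex)
 thus "1 <= ix t" "t = Cl (ix t)" by auto
qed

lemma big_body: "big t ==> body t <= Q (ix t)" using ix body_Cl by metis

lemma small_tile: assumes "t : V" "~ big t" obtains v where "t = {v}"
 using assms(1) by (cases rule: V_cases) (use assms(2) in \<open>auto simp: big_def\<close>)

lemma sz_pos: "0 < sz t" using dl_pos ep by (simp add: sz_def)

lemma sz_dist: assumes "t : V" "z : body t" "z' : body t" shows "dist z z' <= sz t"
proof (cases "big t")
 case True
 hence "z : closure (Q (ix t))" "z' : closure (Q (ix t))" using big_body[OF True] assms closure_subset by blast+
 thus ?thesis using dist_le_dl ix(1)[OF True] True by (simp add: sz_def)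
next
 case False
 then obtain v where "t = {v}" using small_tile assms(1) by blast
 thus ?thesis using assms(2,3) False cell_diam by (auto simp: sz_def body_def)
qed

lemma cell_ball: obtains z where "ball z (ep / 2) <= cell v" "!!u w. w : ball z (ep / 2) ==> w : cell u ==> u = v"
proof -
 obtain z where z: "Fr 0 z = Complex (of_int (fst v)) (of_int (snd v))" by (rule Fr_surj)
 have near: "\<bar>Re (Fr 0 w) - of_int (fst v)\<bar> < 1 / 2" "\<bar>Im (Fr 0 w) - of_int (snd v)\<bar> < 1 / 2" if "w : ball z (ep / 2)" for w
 proof -
  have "ep * dist (Fr 0 z) (Fr 0 w) < ep * (1 / 2)" using that dist_Fr[of z w 0] by simp
  hence d: "norm (Fr 0 w - Fr 0 z) < 1 / 2" using ep by (simp add: dist_norm norm_minus_commute)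
  have "\<bar>Re (Fr 0 w - Fr 0 z)\<bar> < 1 / 2" using abs_Re_le_cmod[of "Fr 0 w - Fr 0 z"] d by linarith
  thus "\<bar>Re (Fr 0 w) - of_int (fst v)\<bar> < 1 / 2" by (simp add: z)
  have "\<bar>Im (Fr 0 w - Fr 0 z)\<bar> < 1 / 2" using abs_Im_le_cmod[of "Fr 0 w - Fr 0 z"] d by linarith
  thus "\<bar>Im (Fr 0 w) - of_int (snd v)\<bar> < 1 / 2" by (simp add: z)
 qed
 show thesis
 proof (rule that)
  show "ball z (ep / 2) <= cell v"
  proof
   fix w assume "w : ball z (ep / 2)"
   from near[OF this] show "w : cell v" unfolding cell_def near_int_def mem_Collect_eq by linarith
  qed
  show "u = v" if w: "w : ball z (ep / 2)" "w : cell u" for u w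
  proof -
   have "\<bar>real_of_int (fst u) - of_int (fst v)\<bar> < 1" "\<bar>real_of_int (snd u) - of_int (snd v)\<bar> < 1"
    using near[OF w(1)] w(2) unfolding cell_def near_int_def mem_Collect_eq by linarith+
   hence "fst u = fst v" "snd u = snd v" by linarith+
   thus ?thesis by (simp add: prod_eq_iff)
  qed
 qed
qed

lemma energy:
 assumes R: "8 * ep <= R"
 shows "(SUM t:{t : V. body t Int cball x R ~= {}}. (min 1 (sz t / R))^2) <= enC K2 K3"
proof -
 have R0: "0 < R" using R ep by linarith
 define U where "U = {t : V. body t Int cball x R ~= {}}"
 define U1 where "U1 = {t : U. ~ big t}"
 define U2 where "U2 = {t : U. big t & sz t <= R}"
 define U3 where "U3 = {t : U. big t & R < sz t}"
 have "finite U" unfolding U_def using finite_V by simp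
 hence fin3: "finite U1" "finite U2" "finite U3" by (simp_all add: U1_def U2_def U3_def)
 have Q_dis: "Q (ix t) Int Q (ix u) = {}" if "big t" "big u" "t ~= u" for t u
  using closure_disj[of "ix t" "ix u"] closure_subset[of "Q (ix t)"] closure_subset[of "Q (ix u)"] ix(2)[OF that(1)] ix(2)[OF that(2)] that(3)
  by fastforce
 have pt: "EX z. z : body t & dist x z <= R" if "t : U" for t using that unfolding U_def by auto
 have 1: "(SUM t:U1. (min 1 (sz t / R))^2) <= 64"
 proof -
  have ex: "EX z. ball z (ep / 2) <= body t & (ALL w:ball z (ep / 2). ALL u:U1. w : body u --> u = t)" if t: "t : U1" for t
  proof -
   have "t : V" "~ big t" using t by (auto simp: U1_def U_def)
   then obtain v where v: "t = {v}" using small_tile by blast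
   obtain z where z: "ball z (ep / 2) <= cell v" "!!u w. w : ball z (ep / 2) ==> w : cell u ==> u = v" using cell_ball by blast
   have "u = t" if "w : ball z (ep / 2)" "u : U1" "w : body u" for u w
   proof -
    have "u : V" "~ big u" using that by (auto simp: U1_def U_def)
    then obtain v' where "u = {v'}" using small_tile by blast
    thus ?thesis using z(2)[OF that(1)] that(3) v by (auto simp: body_def)
   qed
   hence "ALL w:ball z (ep / 2). ALL u:U1. w : body u --> u = t" by blast
   moreover have "ball z (ep / 2) <= body t" using z(1) v by (simp add: body_def)
   ultimately show ?thesis by blast
  qed
  obtain z where z: "!!t. t : U1 ==> ball (z t) (ep / 2) <= body t & (ALL w:ball (z t) (ep / 2). ALL u:U1. w : body u --> u = t)"
   using ex by metis
  have "(SUM t:U1. (ep / 2)^2) <= (2 * R)^2"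
  proof (rule ball_packing[OF fin3(1)])
   show "ball (z t) (ep / 2) <= cball x (2 * R)" if t: "t : U1" for t
   proof
    fix w assume w: "w : ball (z t) (ep / 2)"
    obtain p where p: "p : body t" "dist x p <= R" using pt t by (auto simp: U1_def)
    have "dist p w <= 2 * ep" using sz_dist[OF _ p(1), of w] z[OF t] w t by (auto simp: U1_def U_def sz_def)
    thus "w : cball x (2 * R)" using p(2) R ep dist_triangle[of x w p] by simp
   qed
   show "ball (z i) (ep / 2) Int ball (z j) (ep / 2) = {}" if "i : U1" "j : U1" "i ~= j" for i j
    using z[OF that(1)] z[OF that(2)] that by blast
  qed (use ep R0 in auto)
  hence "real (card U1) * ep\<^sup>2 <= 16 * R\<^sup>2" by (simp add: power_divide)
  moreover have "(SUM t:U1. (min 1 (sz t / R))^2) <= (SUM t:U1. (2 * ep / R)^2)"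
   using ep R0 by (intro sum_mono power_mono) (auto simp: U1_def sz_def)
  moreover have "(SUM t:U1. (2 * ep / R)^2) = 4 * (real (card U1) * ep\<^sup>2) / R\<^sup>2"
   by (simp add: power_divide)
  moreover have "4 * (real (card U1) * ep\<^sup>2) / R\<^sup>2 <= 4 * (16 * R\<^sup>2) / R\<^sup>2"
   using calculation(1) by (intro divide_right_mono) auto
  moreover have "4 * (16 * R\<^sup>2) / R\<^sup>2 = 64" using R0 by simp
  ultimately show ?thesis by linarith
 qed
 have 2: "(SUM t:U2. (min 1 (sz t / R))^2) <= 256 * K2\<^sup>2"
 proof -
  have b: "big t" "sz t = dl (ix t)" "t : U" "sz t <= R" if "t : U2" for t using that by (auto simp: U2_def sz_def)
  have "EX z. ball z (dl (ix t) / (8 * K2)) <= Q (ix t)" if "t : U2" for t using fat ix(1)[OF b(1)[OF that]] by blast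
  then obtain z where z: "!!t. t : U2 ==> ball (z t) (dl (ix t) / (8 * K2)) <= Q (ix t)" by metis
  have "(SUM t:U2. (dl (ix t) / (8 * K2))^2) <= (2 * R)^2"
  proof (rule ball_packing[OF fin3(2)])
   show "ball (z t) (dl (ix t) / (8 * K2)) <= cball x (2 * R)" if t: "t : U2" for t
   proof
    fix w assume w: "w : ball (z t) (dl (ix t) / (8 * K2))"
    obtain p where p: "p : body t" "dist x p <= R" using pt b[OF t] by blast
    have "p : closure (Q (ix t))" "w : closure (Q (ix t))" using big_body[OF b(1)[OF t]] p z[OF t] w closure_subset by blast+
    hence "dist p w <= R" using dist_le_dl[OF ix(1)[OF b(1)[OF t]]] b[OF t] by fastforce
    thus "w : cball x (2 * R)" using p(2) dist_triangle[of x w p] by simp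
   qed
   show "ball (z i) (dl (ix i) / (8 * K2)) Int ball (z j) (dl (ix j) / (8 * K2)) = {}" if "i : U2" "j : U2" "i ~= j" for i j
    using Q_dis[OF b(1)[OF that(1)] b(1)[OF that(2)] that(3)] z[OF that(1)] z[OF that(2)] by blast
  qed (use dl_pos K2 R0 in "auto intro: less_imp_le")
  hence "(SUM t:U2. (dl (ix t))^2) / (8 * K2)^2 <= (2 * R)^2" by (simp add: power_divide sum_divide_distrib)
  hence 3: "(SUM t:U2. (dl (ix t))^2) <= (2 * R)^2 * (8 * K2)^2" using K2 by (simp add: divide_le_eq)
  have "(SUM t:U2. (min 1 (sz t / R))^2) <= (SUM t:U2. (dl (ix t))^2 / R\<^sup>2)"
   by (rule sum_mono) (use b R0 dl_pos in "auto simp: power_divide[symmetric]")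
  also have "... = (SUM t:U2. (dl (ix t))^2) / R\<^sup>2" by (simp add: sum_divide_distrib)
  also have "... <= 256 * K2\<^sup>2" using 3 R0 by (simp add: divide_le_eq algebra_simps)
  finally show ?thesis .
 qed
 \<comment> \<open>Points chosen in these tiles are at least \<open>K3 * R\<close> apart, so balls
   of radius \<open>K3 * R / 2\<close> about them are disjoint and their number is bounded.\<close>
 have 3: "(SUM t:U3. (min 1 (sz t / R))^2) <= ((2 + K3) / K3)^2"
 proof -
  have b: "big t" "sz t = dl (ix t)" "t : U" "R < sz t" if "t : U3" for t using that by (auto simp: U3_def sz_def)
  obtain z where z: "!!t. t : U3 ==> z t : body t & dist x (z t) <= R" using pt b(3) by metis
  have "(SUM t:U3. (K3 * R / 2)^2) <= ((1 + K3 / 2) * R)^2"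
  proof (rule ball_packing[OF fin3(3)])
   show "ball (z t) (K3 * R / 2) <= cball x ((1 + K3 / 2) * R)" if t: "t : U3" for t
   proof
    fix w assume "w : ball (z t) (K3 * R / 2)"
    thus "w : cball x ((1 + K3 / 2) * R)" using z[OF t] dist_triangle[of x w "z t"] by (simp add: algebra_simps)
   qed
   show "ball (z i) (K3 * R / 2) Int ball (z j) (K3 * R / 2) = {}" if ij: "i : U3" "j : U3" "i ~= j" for i j
   proof -
    have "ix i ~= ix j" using ix(2)[OF b(1)[OF ij(1)]] ix(2)[OF b(1)[OF ij(2)]] ij(3) by metis
    moreover have "z i : closure (Q (ix i))" "z j : closure (Q (ix j))" using big_body b(1) z ij closure_subset by blast+
    ultimately have "K3 * min (dl (ix i)) (dl (ix j)) <= dist (z i) (z j)" by (rule sep_closure)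
    moreover have "K3 * R <= K3 * min (dl (ix i)) (dl (ix j))" using K3 b[OF ij(1)] b[OF ij(2)] by (intro mult_left_mono) auto
    ultimately show ?thesis by (intro disjoint_ballI) simp
   qed
  qed (use K3 R0 in auto)
  hence "real (card U3) * (K3 * R / 2)^2 <= ((1 + K3 / 2) * R)^2" by simp
  hence "real (card U3) <= ((1 + K3 / 2) * R)^2 / (K3 * R / 2)^2" using K3 R0 by (simp add: pos_le_divide_eq)
  also have "((1 + K3 / 2) * R)^2 / (K3 * R / 2)^2 = (((1 + K3 / 2) * R) / (K3 * R / 2))^2" by (simp only: power_divide)
  also have "((1 + K3 / 2) * R) / (K3 * R / 2) = (2 + K3) / K3" using R0 by (simp)
  finally have "real (card U3) <= ((2 + K3) / K3)^2" .
  moreover have "(SUM t:U3. (min 1 (sz t / R))^2) <= (SUM t:U3. 1\<^sup>2)"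
   by (intro sum_mono power_mono) (use R0 sz_pos in "auto simp: less_imp_le")
  ultimately show ?thesis by simp
 qed
 have "U = U1 Un U2 Un U3" "U1 Int U2 = {}" "(U1 Un U2) Int U3 = {}" by (auto simp: U1_def U2_def U3_def)
 hence "(SUM t:U. (min 1 (sz t / R))^2) = (SUM t:U1. (min 1 (sz t / R))^2) + (SUM t:U2. (min 1 (sz t / R))^2) + (SUM t:U3. (min 1 (sz t / R))^2)"
  using fin3 by (simp add: sum.union_disjoint)
 thus ?thesis using 1 2 3 unfolding U_def enC_def by linarith
qed

lemma energy_scaled:
 assumes R: "8 * ep <= R" and \<kappa>: "1 <= \<kappa>" "r * \<kappa> = R" and W: "W <= {t : V. body t Int cball x R ~= {}}"
 shows "(SUM t:W. (min 1 (sz t / r))^2) <= \<kappa>\<^sup>2 * enC K2 K3"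
proof -
 have R0: "0 < R" using R ep by linarith
 have r: "r = R / \<kappa>" using \<kappa> by (simp add: field_simps)
 have "(SUM t:W. (min 1 (sz t / r))^2) <= (SUM t:W. (\<kappa> * min 1 (sz t / R))^2)"
 proof (rule sum_mono, rule power_mono)
  fix t
  have "sz t / r = \<kappa> * (sz t / R)" by (simp add: r)
  thus "min 1 (sz t / r) <= \<kappa> * min 1 (sz t / R)" using \<kappa>(1) by (auto simp: min_def)
  show "0 <= min 1 (sz t / r)" using sz_pos[of t] r R0 \<kappa>(1) by simp
 qed
 also have "... = \<kappa>\<^sup>2 * (SUM t:W. (min 1 (sz t / R))^2)" by (simp add: power_mult_distrib sum_distrib_left)
 also have "(SUM t:W. (min 1 (sz t / R))^2) <= (SUM t:{t : V. body t Int cball x R ~= {}}. (min 1 (sz t / R))^2)"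
  by (rule sum_mono2) (use finite_V W in auto)
 also have "... <= enC K2 K3" by (rule energy[OF R])
 finally show ?thesis by (simp add: mult_left_mono)
qed

text \<open>The 1-Lipschitz function \<open>d\<close> maps the connected union of the bodies onto a
  set containing the interval from \<open>r1\<close> to \<open>r2\<close>, and each tile covers a
  part no longer than its size. The cut-off at 1 is harmless: one tile of size
  \<open>r2 - r1\<close> suffices alone.\<close>

lemma cover:
 assumes C: "C <= V" "gconn tadj C" and d: "!!z z'. d z <= d z' + dist z z'"
  and u: "t1 : C" "u : body t1" "d u <= r1" and w: "t2 : C" "w : body t2" "r2 <= d w" and r: "r1 < r2"
 shows "1 <= (SUM t:{t : C. EX z:body t. r1 <= d z & d z <= r2}. min 1 (sz t / (r2 - r1)))"
proof -
 define W where "W = {t : C. EX z:body t. r1 <= d z & d z <= r2}"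
 have fin: "finite W" by (rule finite_subset[OF _ finite_V]) (use C(1) in \<open>auto simp: W_def\<close>)
 have pos: "0 <= min 1 (sz t / (r2 - r1))" for t using sz_pos[of t] r by simp
 show ?thesis
 proof (cases "EX t:W. r2 - r1 <= sz t")
  case True
  then obtain t where t: "t : W" "r2 - r1 <= sz t" by blast
  hence "min 1 (sz t / (r2 - r1)) = 1" using r by simp
  thus ?thesis using member_le_sum[OF t(1), of "%t. min 1 (sz t / (r2 - r1))"] pos fin unfolding W_def[symmetric] by simp
 next
  case False
  define l where "l t = Inf (d ` body t)" for t
  have WV: "t : V" if "t : W" for t using that C(1) by (auto simp: W_def)
  have lo: "l t <= d z" and hi: "d z <= l t + sz t" if t: "t : V" and z: "z : body t" for t z
  proof -
   have b: "d z' - sz t <= d y" if "y : body t" "z' : body t" for y z' using d[of z' y] sz_dist[OF t that(2,1)] by linarith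
   have "bdd_below (d ` body t)" using b[OF _ z] by (intro bdd_belowI) auto
   thus "l t <= d z" unfolding l_def using z by (intro cInf_lower) auto
   have "d z - sz t <= l t" unfolding l_def using b[OF _ z] z by (intro cInf_greatest) auto
   thus "d z <= l t + sz t" by simp
  qed
  have cont: "continuous_on A d" for A
  proof (rule continuous_onI)
   fix y and e :: real assume "0 < e"
   have "dist (d y') (d y) <= e" if "dist y' y < e" for y' using d[of y y'] d[of y' y] that by (auto simp: dist_real_def dist_commute)
   thus "EX da>0. ALL x':A. dist x' y < da --> dist (d x') (d y) <= e" using \<open>0 < e\<close> by blast
  qed
  have con: "connected (d ` (UN t:C. body t))" by (intro connected_continuous_image cont body_connected C)
  have "{r1..r2} <= (UN t:W. {l t..l t + sz t})"
  proof
   fix y assume y: "y : {r1..r2}"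
   have "y : d ` (UN t:C. body t)" by (rule connectedD_interval[OF con, of "d u" "d w"]) (use u w y in auto)
   then obtain t z where z: "t : C" "z : body t" "y = d z" by blast
   hence "t : W" using y by (auto simp: W_def)
   thus "y : (UN t:W. {l t..l t + sz t})" using lo[OF WV z(2)] hi[OF WV z(2)] z(3) by auto
  qed
  hence "r2 - r1 <= (SUM t:W. sz t)" using fin sz_pos r by (intro interval_cover_sum) (auto intro: less_imp_le)
  hence "1 <= (SUM t:W. sz t) / (r2 - r1)" using r by simp
  also have "... = (SUM t:W. min 1 (sz t / (r2 - r1)))" unfolding sum_divide_distrib using False r by (intro sum.cong) auto
  finally show ?thesis unfolding W_def .
 qed
qed

lemma cover_dist: "dist x z <= dist x z' + dist z z'" for x z z' :: complex using dist_triangle[of x z z'] by (simp add: dist_commute)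

text \<open>The average of \<open>P\<close> annular weights. By \<open>gap\<close> a tile outside
  \<open>J\<close> meets at most one annulus, so there are no cross terms and the energy decays like
  \<open>1 / P\<close>, while a chain across all annuli keeps length at least 1.\<close>

lemma annuli_weight:
 assumes P: "0 < P" and q: "!!l. 8 * ep <= q l" "mono q"
  and gap: "!!t l. t : V - J ==> Suc l < P ==> ~ ((EX z:body t. dist x z <= 2 * q l) & (EX z:body t. q (Suc l) <= dist x z))"
 obtains ro where "!!t. 0 <= ro t" "(SUM t:V. (ro t)^2) <= 4 * enC K2 K3 / real P"
  "!!C t1 t2 u w. C <= V - J ==> gconn tadj C ==> t1 : C ==> u : body t1 ==> dist x u <= q 0 ==>
   t2 : C ==> w : body t2 ==> 2 * q (P - 1) <= dist x w ==> 1 <= sum ro C"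
proof -
 have q0: "0 < q l" for l using q(1)[of l] ep by linarith
 define M where "M l = {t : V - J. EX z:body t. q l <= dist x z & dist x z <= 2 * q l}" for l
 define a where "a l t = (if t : M l then min 1 (sz t / q l) else 0)" for l t
 define ro where "ro t = (\<Sum>l<P. a l t) / real P" for t
 have a0: "0 <= a l t" for l t using sz_pos[of t] q0[of l] by (simp add: a_def)
 have uniq: False if lm: "l < m" "m < P" "t : M l" "t : M m" for l m t
 proof -
  have "q (Suc l) <= q m" using lm(1) monoD[OF q(2), of "Suc l" m] by simp
  moreover have "t : V - J" using lm by (auto simp: M_def)
  moreover obtain z z' where "z : body t" "dist x z <= 2 * q l" "z' : body t" "q m <= dist x z'" using lm by (auto simp: M_def)
  ultimately show False using gap[of t l] lm(1,2) order_trans by (meson not_less_eq less_trans_Suc order.strict_trans1 Suc_leI)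
 qed
 have sq: "(\<Sum>l<P. a l t)^2 = (\<Sum>l<P. (a l t)^2)" for t
 proof (cases "EX l<P. t : M l")
  case True
  then obtain l where l: "l < P" "t : M l" by blast
  have z: "a m t = 0" if "m : {..<P} - {l}" for m using uniq[of l m t] uniq[of m l t] l that by (auto simp: a_def neq_iff)
  have "(\<Sum>l<P. a l t) = a l t" "(\<Sum>l<P. (a l t)^2) = (a l t)^2" using l z by (simp_all add: sum.remove[of _ l])
  thus ?thesis by simp
 next
  case False
  hence "a l t = 0" if "l < P" for l using that by (auto simp: a_def)
  thus ?thesis by simp
 qed
 show thesis
 proof (rule that)
  show "0 <= ro t" for t unfolding ro_def by (intro divide_nonneg_nonneg sum_nonneg a0) simp
  have el: "(SUM t:V. (a l t)^2) <= 4 * enC K2 K3" for l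
  proof -
   have "(SUM t:V. (a l t)^2) = (SUM t:M l. (min 1 (sz t / q l))^2)"
    unfolding a_def using finite_V by (intro sum.mono_neutral_cong_right) (auto simp: M_def)
   also have "... <= 2\<^sup>2 * enC K2 K3"
    by (rule energy_scaled[of "2 * q l" 2 "q l" _ x]) (use q(1)[of l] q0[of l] in \<open>auto simp: M_def\<close>)
   finally show ?thesis by simp
  qed
  have "(ro t)^2 = (\<Sum>l<P. (a l t)^2) / (real P)^2" for t by (simp only: ro_def power_divide sq)
  hence "(SUM t:V. (ro t)^2) = (SUM t:V. \<Sum>l<P. (a l t)^2) / (real P)^2"
   by (simp only: sum_divide_distrib[symmetric])
  also have "(SUM t:V. \<Sum>l<P. (a l t)^2) = (\<Sum>l<P. SUM t:V. (a l t)^2)" by (rule sum.swap)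
  also have "... / (real P)^2 <= (\<Sum>l<P. 4 * enC K2 K3) / (real P)^2" by (intro divide_right_mono sum_mono el) simp
  also have "... = 4 * enC K2 K3 / real P" by (simp add: power2_eq_square)
  finally show "(SUM t:V. (ro t)^2) <= 4 * enC K2 K3 / real P" .
  fix C t1 t2 u w assume C: "C <= V - J" "gconn tadj C" "t1 : C" "u : body t1" "dist x u <= q 0" "t2 : C" "w : body t2" "2 * q (P - 1) <= dist x w"
  have "1 <= (SUM t:C. a l t)" if l: "l < P" for l
  proof -
   have "q 0 <= q l" "q l <= q (P - 1)" using monoD[OF q(2)] l by auto
   hence "1 <= (SUM t:{t : C. EX z:body t. q l <= dist x z & dist x z <= 2 * q l}. min 1 (sz t / (2 * q l - q l)))"
    using C q0[of l] by (intro cover[OF _ C(2) cover_dist C(3,4) _ C(6,7)]) auto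
   also have "... = (SUM t:C. a l t)"
    unfolding a_def using C(1) finite_subset[OF _ finite_V, of C] by (intro sum.mono_neutral_cong_left) (auto simp: M_def)
   finally show ?thesis .
  qed
  hence "(\<Sum>l<P. 1) <= (\<Sum>l<P. SUM t:C. a l t)" by (intro sum_mono) simp
  also have "... = (SUM t:C. \<Sum>l<P. a l t)" by (rule sum.swap)
  finally have "real P <= (SUM t:C. \<Sum>l<P. a l t)" by simp
  thus "1 <= sum ro C" using P by (simp add: ro_def sum_divide_distrib[symmetric])
 qed
qed

lemma side_point: assumes "t : side k" obtains z where "z : body t" "z ~: closure Om"
proof -
 obtain a b where ab: "a : t" "b : A k" "lat_adj a b" using assms by (auto simp: side_def)
 obtain z where z: "z : cell a" "z : cell b" using cell_adj[OF ab(3)] by blast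
 have "b : free" using ab(2) A_free by blast
 hence "z ~: closure Om" using z(2) by (auto simp: free_def KK_def)
 thus thesis using that[of z] z(1) ab(1) by (auto simp: body_def)
qed

text \<open>The weight lives within \<open>K3 * dl i\<close> of \<open>Q i\<close>, a zone that
  every chain from \<open>Q i\<close> to a side must cross, since the outer circle is at least that
  far away. The four estimates are one statement in four reflected tilings.\<close>

lemma wall_sep:
 assumes st: "square_tiling V tadj X Y m (side 1) (side 3) (side 0) (side 2) 1 a"
  and i: "1 <= i" "Cl i : V" "0 < m (Cl i)" "8 * ep <= dl i"
 shows "m (Cl i) <= Y (Cl i) * sepC K2 K3" "m (Cl i) <= X (Cl i) * sepC K2 K3"
  "m (Cl i) <= (1 - X (Cl i) - m (Cl i)) * sepC K2 K3" "m (Cl i) <= (a - Y (Cl i) - m (Cl i)) * sepC K2 K3"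
proof -
 interpret st: square_tiling V tadj X Y m "side 1" "side 3" "side 0" "side 2" 1 a by (rule st)
 interpret tr: square_tiling V tadj Y X m "side 0" "side 2" "side 1" "side 3" a 1 by (rule st.transpose)
 interpret rf: square_tiling V tadj "%v. 1 - X v - m v" Y m "side 3" "side 1" "side 0" "side 2" 1 a by (rule st.reflect_X)
 interpret rt: square_tiling V tadj Y "%v. 1 - X v - m v" m "side 0" "side 2" "side 3" "side 1" a 1 by (rule rf.transpose)
 interpret tf: square_tiling V tadj "%v. a - Y v - m v" X m "side 2" "side 0" "side 1" "side 3" a 1 by (rule tr.reflect_X)
 interpret tt: square_tiling V tadj X "%v. a - Y v - m v" m "side 1" "side 3" "side 2" "side 0" 1 a by (rule tf.transpose)
 define d where "d z = infdist z (closure (Q i))" for z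
 define r where "r = K3 * dl i"
 have r0: "0 < r" using K3 dl_pos[of i] by (simp add: r_def)
 define W where "W = {t : V. EX z:body t. 0 <= d z & d z <= r}"
 define ro where "ro t = (if t : W then min 1 (sz t / r) else 0)" for t
 have ro0: "0 <= ro t" for t using sz_pos[of t] r0 by (simp add: ro_def)
 have cne: "closure (Q i) ~= {}" using Q_props(4)[OF i(1)] by simp
 have d0: "d z = 0" if "z : Q i" for z unfolding d_def using that closure_subset by (intro infdist_zero) blast
 have dL: "d z <= d z' + dist z z'" for z z' unfolding d_def by (rule infdist_triangle)
 have en: "(SUM t:V. (ro t)^2) <= sepC K2 K3"
 proof -
  obtain x where x: "x : Q i" using Q_props(4)[OF i(1)] by blast
  have "(SUM t:V. (ro t)^2) = (SUM t:W. (min 1 (sz t / r))^2)"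
   unfolding ro_def using finite_V by (intro sum.mono_neutral_cong_right) (auto simp: W_def)
  also have "... <= ((1 + K3) / K3)^2 * enC K2 K3"
  proof (rule energy_scaled[of "(1 + K3) * dl i" _ _ _ x])
   show "8 * ep <= (1 + K3) * dl i" using i(4) K3 dl_pos[of i] by (simp add: algebra_simps add_increasing2)
   show "1 <= (1 + K3) / K3" "r * ((1 + K3) / K3) = (1 + K3) * dl i" using K3 by (simp_all add: r_def)
   show "W <= {t : V. body t Int cball x ((1 + K3) * dl i) ~= {}}"
   proof
    fix t assume "t : W"
    then obtain z where z: "t : V" "z : body t" "d z <= r" by (auto simp: W_def)
    obtain w where w: "w : closure (Q i)" "d z = dist z w" using infdist_attains_inf[OF closed_closure cne, of z] unfolding d_def by blast
    have "dist x w <= dl i" using x w closure_subset by (intro dist_le_dl i(1)) blast+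
    hence "dist x z <= (1 + K3) * dl i" using z(3) w(2) dist_triangle2[of x z w] unfolding r_def by (simp add: algebra_simps)
    thus "t : {t : V. body t Int cball x ((1 + K3) * dl i) ~= {}}" using z by auto
   qed
  qed
  finally show ?thesis by (simp add: sepC_def)
 qed
 have adm: "1 <= sum ro C" if C: "C <= V - {Cl i}" "gconn tadj C" "C Int side k ~= {}" "EX v:C. tadj v (Cl i)" for C k
 proof -
  obtain t2 where t2: "t2 : C" "t2 : side k" using C(3) by blast
  obtain w where w: "w : body t2" "w ~: closure Om" using side_point[OF t2(2)] by blast
  have dw: "r <= d w"
  proof -
   obtain q where q: "q : closure (Q i)" "d w = dist w q" using infdist_attains_inf[OF closed_closure cne, of w] unfolding d_def by blast
   have "w : Q 0" using w(2) by (simp add: Q0)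
   hence "w : closure (Q 0)" using closure_subset by blast
   hence "K3 * min (dl 0) (dl i) <= dist w q" using q(1) i(1) by (intro sep_closure) auto
   moreover have "dl i <= dl 0"
   proof -
    have "frontier (Q i) <= closure Om" using closure_Q_sub[OF i(1)] closure_subset[of Om] by (auto simp: frontier_def)
    moreover have "frontier (Q i) ~= {}" using dl_pos[of i] unfolding dl_def by (auto)
    ultimately show ?thesis unfolding dl_def[of i] using dist_le_dl0 by (intro diameter_le) (auto simp: dist_norm)
   qed
   ultimately show ?thesis using q(2) by (simp add: r_def split: if_splits)
  qed
  obtain t1 where t1: "t1 : C" "tadj t1 (Cl i)" using C(4) by blast
  then obtain p b where pb: "p : t1" "b : Cl i" "lat_adj p b" by (auto simp: tadj_def)
  obtain u where u: "u : cell p" "u : cell b" using cell_adj[OF pb(3)] by blast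
  hence u1: "u : body t1" "d u <= 0" using pb Cl_cell[OF pb(2)] d0 by (auto simp: body_def)
  have CV: "C <= V" using C(1) by blast
  have "1 <= (SUM t:{t : C. EX z:body t. 0 <= d z & d z <= r}. min 1 (sz t / (r - 0)))"
   by (rule cover[OF CV C(2) dL t1(1) u1 t2(1) w(1) dw r0])
  also have "... = sum ro C" unfolding ro_def using CV finite_subset[OF CV finite_V] by (intro sum.mono_neutral_cong_left) (auto simp: W_def)
  finally show ?thesis .
 qed
 have "0 <= Y (Cl i)" "0 <= X (Cl i)" "0 <= 1 - X (Cl i) - m (Cl i)" "0 <= a - Y (Cl i) - m (Cl i)"
  using st.X_ge[OF i(2)] st.X_le[OF i(2)] st.Y_ge[OF i(2)] st.Y_le[OF i(2)] by auto
 note le = mult_left_mono[OF en this(1)] mult_left_mono[OF en this(2)] mult_left_mono[OF en this(3)] mult_left_mono[OF en this(4)]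
 show "m (Cl i) <= Y (Cl i) * sepC K2 K3" by (rule order_trans[OF st.wall_distance[OF i(2,3) Cl_side[OF i(1)] ro0 adm] le(1)])
 show "m (Cl i) <= X (Cl i) * sepC K2 K3" by (rule order_trans[OF tr.wall_distance[OF i(2,3) Cl_side[OF i(1)] ro0 adm] le(2)])
 show "m (Cl i) <= (1 - X (Cl i) - m (Cl i)) * sepC K2 K3" by (rule order_trans[OF rt.wall_distance[OF i(2,3) Cl_side[OF i(1)] ro0 adm] le(3)])
 show "m (Cl i) <= (a - Y (Cl i) - m (Cl i)) * sepC K2 K3" by (rule order_trans[OF tt.wall_distance[OF i(2,3) Cl_side[OF i(1)] ro0 adm] le(4)])
qed

text \<open>Cells have diameter at most \<open>2 * ep\<close>; so beyond distance \<open>et\<close>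
  from a corner, the cells around the ray miss \<open>closure Om\<close>.\<close>

definition thin :: "real => bool" where
 "thin et \<longleftrightarrow> 0 < et & 2 * et <= dl 0 & ep <= et &
   (ALL k<4. ALL z:closure Om. ALL t. s k + et <= t --> 2 * ep < dist z (ray_pt k t))"

lemma tip_side:
 assumes "thin et" "k < 4" "tip (2 * et) k <= D"
 shows "TE D Int side k ~= {}" "TE D Int side (prv k) ~= {}"
proof -
 obtain v z where v: "{v} : side k" "{v} : side (prv k)" "z : cell v" "z : tip (2 * et) k"
  using corner_tile[OF assms(2), of et] assms(1,2) unfolding thin_def by blast
 hence "{v} : TE D" unfolding TE_iff using side_V assms(3) by (auto simp: body_def)
 thus "TE D Int side k ~= {}" "TE D Int side (prv k) ~= {}" using v by auto
qed

lemma tip_ball: assumes "k < 4" "2 * et <= dl 0" shows "tip (2 * et) k <= cball c (3 * dl 0)"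
proof
 fix z assume "z : tip (2 * et) k"
 then obtain t where t: "z = ray_pt k t" "s k <= t" "t <= s k + 2 * et" by (auto simp: tip_def)
 have "c = ray_pt k 0" by (simp add: ray_pt_def)
 hence "dist c z = \<bar>t\<bar>" unfolding t(1) using dist_ray_pt[of k 0 t] by simp
 thus "z : cball c (3 * dl 0)" using t s_le[OF assms(1)] assms(2) by simp
qed

lemma tip_not_Q: assumes "k < 4" "1 <= i" shows "tip et k Int Q i = {}"
proof -
 have "z ~: Q i" if z: "z : tip et k" for z
 proof
  assume zQ: "z : Q i"
  have zO: "z : Om" using zQ closure_Q_sub[OF assms(2)] closure_subset by blast
  obtain t where t: "z = ray_pt k t" "s k <= t" using z by (auto simp: tip_def)
  show False
  proof (cases "t = s k")
   case True
   hence "z : frontier Om" using cor_frontier[OF assms(1)] t by (simp add: cor_pt_def)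
   thus False using zO Om_props(1) by (auto simp: frontier_def interior_open)
  next
   case False
   hence "z ~: closure Om" using ray_out[OF assms(1), of t] t by (simp add: ray_pt_def)
   thus False using zO closure_subset by blast
  qed
 qed
 thus ?thesis by blast
qed

lemma ring_tiles:
 assumes et: "thin et" "et <= R" and small: "2 * ((2 * K2 + 1) * R) < dl 0 / (2 * K2)"
  and p: "p : frontier Om" "(2 * K2 + 1) * R < dist x p"
 obtains D where "connected D" "D <= KK" "D <= cball c (3 * dl 0)" "p : D" "D Int cball x R = {}"
  "!!i. 1 <= i ==> D Int Q i = {}" "!!k. k < 4 ==> TE D Int side k ~= {}"
proof -
 have et0: "0 < 2 * et" "2 * et <= 2 * R" "0 < R" "2 * et <= dl 0" using et by (auto simp: thin_def)
 obtain D where D: "connected D" "D <= KK" "D <= frontier Om Un (UN k<4. tip (2 * et) k)" "p : D" "D Int cball x R = {}"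
  "!!k. k < 4 ==> tip (2 * et) k <= D | tip (2 * et) ((k + 1) mod 4) <= D" using corner_ring[OF et0(1,2,3) small p] by blast
 show thesis
 proof (rule that[OF D(1,2) _ D(4,5)])
  have "frontier Om <= cball c (3 * dl 0)" using near_c dl_pos[of 0] by (fastforce simp: frontier_def)
  thus "D <= cball c (3 * dl 0)" using D(3) tip_ball[OF _ et0(4)] by blast
  show "D Int Q i = {}" if i: "1 <= i" for i
  proof -
   have "frontier Om Int Q i = {}" using closure_disj[of 0 i] i closure_Q[of 0] closure_subset[of "Q i"] frontier_Q0 by auto
   thus ?thesis using D(3) tip_not_Q[OF _ i] by blast
  qed
  show "TE D Int side k ~= {}" if k: "k < 4" for k using D(6)[OF k]
  proof
   assume "tip (2 * et) k <= D"
   thus ?thesis using tip_side[OF et(1) k] by blast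
  next
   assume h: "tip (2 * et) ((k + 1) mod 4) <= D"
   have "k = 0 | k = 1 | k = 2 | k = 3" using k by auto
   hence "prv ((k + 1) mod 4) = k" by (auto simp: prv_def)
   thus ?thesis using tip_side(2)[OF et(1) _ h] by simp
  qed
 qed
qed

lemma V_bounded: assumes "t : V" "z : body t" shows "dist c z <= 11 * dl 0"
proof -
 obtain v where v: "v : t" "z : cell v" using assms by (auto simp: body_def)
 hence "v : G" using V_tile(3) assms by blast
 hence "\<bar>fst v\<bar> <= N" "\<bar>snd v\<bar> <= N" by (auto simp: G_def)
 hence "\<bar>real_of_int (fst v)\<bar> <= of_int N" "\<bar>real_of_int (snd v)\<bar> <= of_int N" by linarith+
 hence "\<bar>Re (Fr 0 z)\<bar> <= of_int N + 1/2" "\<bar>Im (Fr 0 z)\<bar> <= of_int N + 1/2" using v(2) unfolding cell_def near_int_def mem_Collect_eq by linarith+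
 hence "norm (Fr 0 z) <= 2 * of_int N + 1" using cmod_le[of "Fr 0 z"] by linarith
 hence "ep * norm (Fr 0 z) <= ep * (2 * of_int N + 1)" using ep by (intro mult_left_mono) auto
 hence "dist c z <= 2 * (of_int N * ep) + ep" using dist_Fr[of c z 0] by (simp add: Fr_c algebra_simps)
 thus ?thesis using N_bounds(3) ep by linarith
qed

text \<open>A crossing chain of weight below 1 would stay within \<open>R\<close> of one of its
  points \<open>x\<close>. A ring of tiles that touches all four sides and avoids this ball would
  have to meet the chain by duality.\<close>

lemma aspect:
 assumes st: "square_tiling V tadj X Y m (side 1) (side 3) (side 0) (side 2) 1 a"
  and et: "thin et" "et <= dl 0 / (16 * K2 * (2 * K2 + 1))"
 shows "1 <= a * aspC K2 K3" "a <= aspC K2 K3"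
proof -
 interpret st: square_tiling V tadj X Y m "side 1" "side 3" "side 0" "side 2" 1 a by (rule st)
 interpret tr: square_tiling V tadj Y X m "side 0" "side 2" "side 1" "side 3" a 1 by (rule st.transpose)
 define R where "R = dl 0 / (16 * K2 * (2 * K2 + 1))"
 have kk: "0 < 16 * K2 * (2 * K2 + 1)" using K2 by simp
 have R0: "0 < R" using kk dl_pos[of 0] by (simp add: R_def)
 have canc: "z / k * k = z" if "k ~= 0" for z k :: real using that by simp
 have Rk: "R * (16 * K2 * (2 * K2 + 1)) = dl 0" unfolding R_def by (rule canc) (use kk in linarith)
 hence "((2 * K2 + 1) * R) * (16 * K2) = dl 0" by (simp add: algebra_simps)
 hence RK: "(2 * K2 + 1) * R = dl 0 / (16 * K2)" using K2 by (subst nonzero_eq_divide_eq) auto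
 have pos: "0 < dl 0 / K2" using K2 dl_pos[of 0] by simp
 have small: "2 * ((2 * K2 + 1) * R) < dl 0 / (2 * K2)" unfolding RK using pos by (simp)
 define ro where "ro t = min 1 (sz t / R)" for t
 have en: "(SUM t:V. (ro t)^2) <= aspC K2 K3" unfolding ro_def aspC_def
 proof (rule energy_scaled[of "11 * dl 0" _ _ _ c])
  have "1 * 1 <= K2 * (2 * K2 + 1)" using K2 by (intro mult_mono) auto
  thus "1 <= 176 * K2 * (2 * K2 + 1)" by linarith
  show "R * (176 * K2 * (2 * K2 + 1)) = 11 * dl 0" using Rk by (simp add: algebra_simps)
  show "V <= {t : V. body t Int cball c (11 * dl 0) ~= {}}" using V_bounded body_nonempty by fastforce
 qed (use ep dl_pos[of 0] in linarith)
 have adm: "1 <= sum ro C" if C: "C <= V" "gconn tadj C" and cr: "(C Int side 1 ~= {} & C Int side 3 ~= {}) | (C Int side 0 ~= {} & C Int side 2 ~= {})" for C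
 proof (rule ccontr)
  assume lt: "~ ?thesis"
  obtain t0 where t0: "t0 : C" using cr by blast
  obtain x where x: "x : body t0" using body_nonempty t0 C by blast
  have in_ball: "dist x w < R" if w: "t : C" "w : body t" for t w
  proof (rule ccontr)
   assume "~ ?thesis"
   hence "1 <= (SUM t:{t : C. EX z:body t. 0 <= dist x z & dist x z <= R}. min 1 (sz t / (R - 0)))"
    by (intro cover[OF C cover_dist t0 x _ w _ R0]) auto
   also have "... <= (SUM t:C. ro t)"
    unfolding ro_def using sz_pos R0 finite_subset[OF C(1) finite_V] by (auto intro!: sum_mono2 simp: less_imp_le)
   finally show False using lt by simp
  qed
  have "EX k<4. (2 * K2 + 1) * R < dist x (cor_pt k)"
  proof (rule ccontr)
   assume no: "~ ?thesis"
   have "dist x (cor_pt 0) <= (2 * K2 + 1) * R" "dist x (cor_pt 1) <= (2 * K2 + 1) * R"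
    using no by (meson not_le zero_less_numeral one_less_numeral_iff semiring_norm(76) less_trans)+
   hence "dist (cor_pt 0) (cor_pt 1) <= 2 * ((2 * K2 + 1) * R)" using dist_triangle2[of "cor_pt 0" "cor_pt 1" x] by (simp add: dist_commute)
   thus False using corner_dist[of 0 1] small by simp
  qed
  then obtain k where k: "k < 4" "(2 * K2 + 1) * R < dist x (cor_pt k)" by blast
  obtain D where D: "connected D" "D <= KK" "D <= cball c (3 * dl 0)" "cor_pt k : D" "D Int cball x R = {}"
   "!!i. 1 <= i ==> D Int Q i = {}" "!!k. k < 4 ==> TE D Int side k ~= {}"
   using ring_tiles[OF et(1) _ small cor_frontier[OF k(1)] k(2)] et(2) unfolding R_def by metis
  have TE: "TE D <= V" "gconn tadj (TE D)" using TE_gconn[OF D(1-3)] by (auto simp: TE_def)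
  have "C Int TE D ~= {}" using cr cross_tiles[OF C _ _ TE] cross_tiles[OF TE _ _ C] D(7)[of 0] D(7)[of 1] D(7)[of 2] D(7)[of 3] by auto
  then obtain t where t: "t : C" "t : TE D" by blast
  then obtain w where "w : body t" "w : D" unfolding TE_iff by blast
  thus False using in_ball[OF t(1), of w] D(5) by fastforce
 qed
 have "1 <= a * (SUM t:V. (ro t)^2)" by (rule st.crossing_modulus) (use adm in blast)
 also have "... <= a * aspC K2 K3" using en st.H_pos by (intro mult_left_mono) auto
 finally show "1 <= a * aspC K2 K3" .
 have "a <= 1 * (SUM t:V. (ro t)^2)" by (rule tr.crossing_modulus) (use adm in blast)
 thus "a <= aspC K2 K3" using en by simp
qed

end

section \<open>The distortion estimate at a fixed mesh\<close>

definition dinf :: "complex => complex => real" where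
 "dinf u v = max \<bar>Re u - Re v\<bar> \<bar>Im u - Im v\<bar>"

text \<open>\<open>keyK\<close> bounds the distance of the two chains in steps of the network,
  \<open>keyP\<close> is a number of annuli that makes the energy small against a network of this
  size, and \<open>keyH\<close> is the resulting ratio of distances, with \<open>keyP * keyP\<close>
  scales of ratio \<open>8 + 4 / K3\<close>.\<close>

definition keyK :: "real => real => real => nat" where
 "keyK K2 K3 M = nat \<lceil>M * (8 * (aspC K2 K3)^2) * (2 * sepC K2 K3)\<rceil>"

definition keyP :: "real => real => real => nat" where
 "keyP K2 K3 M = nat \<lceil>4 * enC K2 K3 * (real (16 * keyK K2 K3 M + 42) * (real (4 * keyK K2 K3 M + 10))^2)\<rceil> + 1"

definition keyH :: "real => real => real => real" where
 "keyH K2 K3 M = 2 * (8 + 4 / K3) ^ (keyP K2 K3 M * keyP K2 K3 M) * (16 * K2 * (2 * K2 + 1))"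

text \<open>A path in \<open>U\<close> from \<open>b\<close> to a boundary point near \<open>x\<close>, quantitatively inside \<open>U\<close> away from its end.\<close>

definition approach :: "complex set => complex => complex => real => real => bool" where
 "approach U b x et r \<longleftrightarrow> (EX T a. connected T & compact T & b : T & a : T & a : frontier U & T - {a} <= U &
   dist x a < et & (ALL z:T. et <= dist a z --> ball z r <= U))"

context carpet_setup begin

lemma aspC_ge: "64 <= aspC K2 K3"
proof -
 have "1 * 1 <= K2 * (2 * K2 + 1)" using K2 by (intro mult_mono) auto
 hence "1 * 64 <= (176 * K2 * (2 * K2 + 1))^2 * enC K2 K3" using enC_ge by (intro mult_mono) auto
 thus ?thesis by (simp add: aspC_def)
qed

lemma sepC_ge: "64 <= sepC K2 K3"
proof -
 have "1 <= (1 + K3) / K3" using K3 by simp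
 hence "1 * 64 <= ((1 + K3) / K3)^2 * enC K2 K3" using enC_ge by (intro mult_mono) auto
 thus ?thesis by (simp add: sepC_def)
qed

lemma dl_le: assumes "1 <= i" shows "dl i <= dl 0"
proof -
 have "frontier (Q i) <= closure Om" using closure_Q_sub[OF assms] closure_subset[of Om] by (auto simp: frontier_def)
 moreover have "frontier (Q i) ~= {}" using dl_pos[of i] unfolding dl_def by (auto)
 ultimately show ?thesis unfolding dl_def[of i] using dist_le_dl0 by (intro diameter_le) (auto simp: dist_norm)
qed

lemma carpet_closure: "x : carpet Om Q ==> x : closure Om" "x : carpet Om Q ==> x ~: Q i" using carpet_sub carpet_iff by blast+

lemma local_detour:
 assumes "x : carpet Om Q" "z : carpet Om Q" "(1 + K2) * dist x z <= r0"
 obtains E where "connected E" "E <= cball x r0" "x : E" "z : E" "E Int Q i = {}"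
proof -
 obtain E where E: "connected E" "x : E" "z : E" "E Int Q i = {}" "E <= cball x ((1 + K2) * dist x z)"
  using quasicircle_detour[OF qc open_Q carpet_closure(2)[OF assms(1)] carpet_closure(2)[OF assms(2)]] by metis
 have "E <= cball x r0" using E(5) assms(3) by (meson mem_cball order_trans subsetD subsetI)
 thus thesis using that E by blast
qed

lemma ball_meets_outside:
 assumes "x : closure Om" "~ cball x r <= Om" "0 < r"
 obtains w where "w : frontier Om" "dist x w <= r"
proof (cases "x : Om")
 case False
 hence "x : frontier Om" using assms(1) Om_props(1) by (simp add: frontier_def interior_open)
 thus ?thesis using that[of x] assms(3) by simp
next
 case True
 obtain y where y: "y : cball x r" "y ~: Om" using assms(2) by blast
 have "x : cball x r Int Om" using True assms(3) by simp
 hence "cball x r Int frontier Om ~= {}" using y by (intro connected_Int_frontier convex_connected convex_cball) blast+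
 thus ?thesis using that by auto
qed

end

context carpet_frame begin

definition thinr :: "real => real => bool" where
 "thinr ep et \<longleftrightarrow> 0 < et & 2 * et <= dl 0 & ep <= et &
   (ALL k<4. ALL z:closure Om. ALL t. s k + et <= t --> 2 * ep < dist z (ray_pt k t))"

text \<open>Compactness handles the ray up to parameter \<open>2 * dl 0\<close>; farther out it is
  at distance at least \<open>dl 0\<close> from \<open>closure Om\<close>.\<close>

lemma thinr_small:
 assumes et: "0 < et" "2 * et <= dl 0"
 obtains ep0 where "0 < ep0" "!!ep. 0 < ep ==> ep < ep0 ==> thinr ep et"
proof -
 have "EX d>0. ALL z:closure Om. ALL t. s k + et <= t --> d <= dist z (ray_pt k t)" if k: "k < 4" for k
 proof -
  have c1: "compact (closure Om)" using Om_props by simp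
  have c2: "closed (ray_pt k ` {s k + et..2 * dl 0})" by (intro compact_imp_closed compact_continuous_image continuous_ray_pt) simp
  have "closure Om Int ray_pt k ` {s k + et..2 * dl 0} = {}" using ray_out[OF k] et(1) by (auto simp: ray_pt_def)
  then obtain d where d: "0 < d" "!!z w. z : closure Om ==> w : ray_pt k ` {s k + et..2 * dl 0} ==> d <= dist z w"
   using separate_compact_closed[OF c1 c2] by blast
  have "min d (dl 0) <= dist z (ray_pt k t)" if z: "z : closure Om" "s k + et <= t" for z t
  proof (cases "t <= 2 * dl 0")
   case True thus ?thesis using d(2)[OF z(1), of "ray_pt k t"] z by auto
  next
   case False
   have "c = ray_pt k 0" by (simp add: ray_pt_def)
   hence "dist c (ray_pt k t) = \<bar>t\<bar>" using dist_ray_pt[of k 0 t] by simp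
   thus ?thesis using near_c[OF z(1)] dist_triangle[of c "ray_pt k t" z] False by linarith
  qed
  thus ?thesis using d(1) dl_pos[of 0] by (intro exI[of _ "min d (dl 0)"]) auto
 qed
 then obtain d where d: "!!k. k < 4 ==> 0 < d k & (ALL z:closure Om. ALL t. s k + et <= t --> d k <= dist z (ray_pt k t))" by metis
 define e0 where "e0 = Min (d ` {..<4})"
 have e0: "0 < e0" "!!k. k < 4 ==> e0 <= d k" unfolding e0_def using d by (auto simp: lessThan_empty_iff)
 show thesis
 proof (rule that[of "min et (e0 / 2)"])
  show "thinr ep et" if "0 < ep" "ep < min et (e0 / 2)" for ep unfolding thinr_def using et that d e0(2) by fastforce
 qed (use et e0 in auto)
qed

end

context carpet_grid begin

lemma thin_iff: "thin et \<longleftrightarrow> thinr ep et" by (simp add: thin_def thinr_def)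

lemma closure_ball: "closure Om <= cball c (3 * dl 0)" "closure Om <= KK" using near_c dl_pos[of 0] by (fastforce simp: KK_def)+

lemma TE_not_Cl: "E Int Q i = {} ==> Cl i ~: TE E" unfolding TE_iff using body_Cl by blast

text \<open>A curve from \<open>y\<close> to the outer circle, avoiding the ball and
  \<open>Q i\<close>, continued along the outer circle to the corners. As its tiles touch all four
  sides, the chain is large in the rectangle.\<close>

lemma outer_chain:
 assumes i: "1 <= i" and y: "y : carpet Om Q" and et: "thin et" "et <= R" and small: "2 * ((2 * K2 + 1) * R) < dl 0 / (2 * K2)"
  and R: "(2 * K2 + 1) * R < dist x y"
 obtains F where "F <= V" "Cl i ~: F" "gconn tadj F" "!!v. y : cell v ==> {v} : F" "!!k. k < 4 ==> F Int side k ~= {}"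
  "!!t. t : F ==> EX w:body t. R < dist x w"
proof -
 have R0: "0 < R" using et by (auto simp: thin_def)
 obtain D p where D: "connected D" "D <= closure Om" "y : D" "p : D" "p : frontier Om" "D Int Q i = {}" "D Int cball x R = {}"
  "(2 * K2 + 1) * R < dist x p" using escape[OF i carpet_closure(1)[OF y] carpet_closure(2)[OF y] R0 R] by blast
 obtain D' where D': "connected D'" "D' <= KK" "D' <= cball c (3 * dl 0)" "p : D'" "D' Int cball x R = {}"
  "!!i. 1 <= i ==> D' Int Q i = {}" "!!k. k < 4 ==> TE D' Int side k ~= {}" using ring_tiles[OF et small D(5,8)] by blast
 have con: "connected (D Un D')" by (rule connected_Un[OF D(1) D'(1)]) (use D(4) D'(4) in blast)
 have sub: "D Un D' <= KK" "D Un D' <= cball c (3 * dl 0)" using D(2) D' closure_ball by blast+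
 show thesis
 proof (rule that[of "TE (D Un D')"])
  show "TE (D Un D') <= V" by (auto simp: TE_def)
  show "Cl i ~: TE (D Un D')" using D(6) D'(6)[OF i] by (intro TE_not_Cl) blast
  show "gconn tadj (TE (D Un D'))" by (rule TE_gconn[OF con sub])
  show "{v} : TE (D Un D')" if "y : cell v" for v unfolding TE_iff using point_tile[OF y that] D(3) that by (auto simp: body_def)
  show "TE (D Un D') Int side k ~= {}" if "k < 4" for k using D'(7)[OF that] unfolding disjoint_iff TE_iff by blast
  show "EX w:body t. R < dist x w" if t: "t : TE (D Un D')" for t
  proof -
   obtain w where "w : body t" "w : D Un D'" using t unfolding TE_iff by blast
   thus ?thesis using D(7) D'(5) by fastforce
  qed
 qed
qed

text \<open>A square inside that of \<open>Cl i\<close> has side 0, and then its neighbours other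
  than \<open>Cl i\<close> are trapped inside as well; but the chain \<open>F\<close> avoids
  \<open>Cl i\<close> and leads to side 1.\<close>

lemma not_in_square:
 assumes st: "square_tiling V tadj X Y m (side 1) (side 3) (side 0) (side 2) 1 a"
  and i: "1 <= i" "Cl i : V" and x: "x : carpet Om Q" "x : cell v"
  and et: "thin et" "et <= R" "2 * ((2 * K2 + 1) * R) < dl 0 / (2 * K2)" "(2 * K2 + 1) * R < dist x0 x"
  and inn: "X (Cl i) < X {v}" "X {v} < X (Cl i) + m (Cl i)" "Y (Cl i) < Y {v}" "Y {v} < Y (Cl i) + m (Cl i)"
 shows False
proof -
 interpret st: square_tiling V tadj X Y m "side 1" "side 3" "side 0" "side 2" 1 a by (rule st)
 obtain F where F: "F <= V" "Cl i ~: F" "gconn tadj F" "!!v. x : cell v ==> {v} : F" "!!k. k < 4 ==> F Int side k ~= {}"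
  using outer_chain[OF i(1) x(1) et] by metis
 define j where "j = Cl i"
 define P where "P w \<longleftrightarrow> X j < X w & X w < X j + m j & Y j < Y w & Y w < Y j + m j" for w
 have jV: "j : V" and mj: "0 < m j" using i inn by (auto simp: j_def)
 have vF: "{v} : F" by (rule F(4)[OF x(2)])
 have Pv: "P {v}" using inn by (simp add: P_def j_def)
 obtain t where t: "t : F" "t : side 1" using F(5)[of 1] by auto
 have tV: "t : V" using t(1) F(1) by blast
 have nt: "~ P t" unfolding P_def using st.sideL[OF tV t(2)] st.X_ge[OF jV] by auto
 obtain w w' where w: "w : F" "w' : F" "P w" "~ P w'" "tadj w w'" by (rule gconn_edge[where P = P, OF F(3) vF Pv t(1) nt]) (rule that)
 have wV: "w : V" "w' : V" "w ~= j" "w' ~= j" using w F by (auto simp: j_def)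
 have mw: "m w = 0" using st.disj[OF wV(1) jV wV(3) _ mj] w(3) st.m_nonneg[OF wV(1)] unfolding P_def by force
 have to: "X w <= X w' + m w'" "X w' <= X w" "Y w <= Y w' + m w'" "Y w' <= Y w"
  using st.touchX[OF wV(1,2) w(5)] st.touchX[OF wV(2,1) st.adj_sym[OF w(5)]]
   st.touchY[OF wV(1,2) w(5)] st.touchY[OF wV(2,1) st.adj_sym[OF w(5)]] mw by auto
 show False
 proof (cases "0 < m w'")
  case True
  thus ?thesis using st.disj[OF wV(2) jV wV(4) True mj] to w(3) unfolding P_def by linarith
 next
  case False
  hence "X w' = X w" "Y w' = Y w" using to by linarith+
  thus ?thesis using w(3,4) unfolding P_def by simp
 qed
qed

text \<open>The tiles joining \<open>x\<close> to \<open>tz\<close> within \<open>r0\<close> form a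
  chain \<open>E\<close> of size \<open>D\<close> in the rectangle, those from \<open>y\<close> to
  the sides a chain \<open>F\<close> of size at least 1 / 2. If the conclusion failed, the two would
  be closer than \<open>M * D\<close>, and a network of step comparable to \<open>D\<close> would
  join them at weight below 1, against the annuli between \<open>r0\<close> and \<open>R\<close>.
  \<open>Ei\<close> provides \<open>E\<close> when an exceptional \<open>Q i\<close> must be
  avoided.\<close>

theorem key:
 assumes st: "square_tiling V tadj X Y m (side 1) (side 3) (side 0) (side 2) 1 a"
  and et: "thin et" "et <= r0" "8 * ep <= r0" and M: "1 <= M"
  and x: "x : carpet Om Q" "x : cell vx" and y: "y : carpet Om Q" "y : cell vy" and xy: "keyH K2 K3 M * r0 <= dist x y"
  and tz: "tz : V"
  and E0: "EX E. connected E & E <= KK & E <= cball x r0 & x : E & E Int body tz ~= {}"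
  and Ei: "!!i. 1 <= i ==> cball x r0 <= Om ==> EX E. connected E & E <= cball x r0 & x : E & E Int body tz ~= {} & E Int Q i = {}"
  and p: "X {vx} <= px" "px <= X {vx} + m {vx}" "Y {vx} <= py" "py <= Y {vx} + m {vx}"
  and p': "X tz <= px'" "px' <= X tz + m tz" "Y tz <= py'" "py' <= Y tz + m tz"
  and q: "X {vy} <= qx" "qx <= X {vy} + m {vy}" "Y {vy} <= qy" "qy <= Y {vy} + m {vy}"
 shows "M * max \<bar>px' - px\<bar> \<bar>py' - py\<bar> <= max \<bar>qx - px\<bar> \<bar>qy - py\<bar>"
proof (rule ccontr)
 assume contra: "~ ?thesis"
 interpret st: square_tiling V tadj X Y m "side 1" "side 3" "side 0" "side 2" 1 a by (rule st)
 define h where "h = 8 + 4 / K3"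
 define P where "P = keyP K2 K3 M"
 define k where "k = keyK K2 K3 M"
 define q' where "q' l = r0 * h ^ l" for l :: nat
 define R where "R = 2 * q' (P * P)"
 have r0: "0 < r0" using et(3) ep by linarith
 have h: "8 <= h" "4 < K3 * (h - 2)" using K3 by (auto simp: h_def algebra_simps)
 have hP: "1 <= h ^ l" for l using h by simp
 have q'Suc: "q' (Suc l) = h * q' l" for l by (simp add: q'_def)
 have q'ge: "r0 <= q' l" for l using hP[of l] r0 by (simp add: q'_def)
 have q'mono: "mono q'" unfolding q'_def using h r0 by (intro monoI mult_left_mono power_increasing) auto
 have q'pos: "0 < q' l" for l using q'ge[of l] r0 by linarith
 have P0: "0 < P" by (simp add: P_def keyP_def)
 have kk: "1 <= 16 * K2 * (2 * K2 + 1)"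
 proof -
  have "1 * 1 <= K2 * (2 * K2 + 1)" using K2 by (intro mult_mono) auto
  thus ?thesis by linarith
 qed
 have dxy: "dist x y <= dl 0" using x y carpet_closure by (intro dist_le_dl0) auto
 have "R * (16 * K2 * (2 * K2 + 1)) = keyH K2 K3 M * r0" by (simp add: R_def q'_def keyH_def P_def h_def)
 hence RH: "R * (16 * K2 * (2 * K2 + 1)) <= dist x y" using xy by simp
 have R0: "0 < R" using q'pos by (simp add: R_def)
 have rR: "2 * r0 <= R" using q'ge[of "P * P"] by (simp add: R_def)
 have Rxy: "16 * ((2 * K2 + 1) * R) <= dist x y"
 proof -
  have "1 * ((2 * K2 + 1) * R) <= K2 * ((2 * K2 + 1) * R)" using K2 R0 by (intro mult_right_mono) auto
  thus ?thesis using RH by (simp add: algebra_simps)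
 qed
 have RK: "0 < (2 * K2 + 1) * R" using K2 R0 by simp
 have small: "2 * ((2 * K2 + 1) * R) < dl 0 / (2 * K2)"
 proof -
  have "2 * ((2 * K2 + 1) * R) * (2 * K2) * 4 <= dl 0" using RH dxy by (simp add: algebra_simps)
  hence "2 * ((2 * K2 + 1) * R) * (2 * K2) < dl 0" using dl_pos[of 0] by linarith
  thus ?thesis using K2 by (subst pos_less_divide_eq) auto
 qed
 have rd: "r0 <= dl 0"
 proof -
  have "R * 1 <= R * (16 * K2 * (2 * K2 + 1))" using kk R0 by (intro mult_left_mono) auto
  thus ?thesis using RH dxy rR r0 by linarith
 qed
 have etasp: "et <= dl 0 / (16 * K2 * (2 * K2 + 1))"
 proof -
  have "et * (16 * K2 * (2 * K2 + 1)) <= R * (16 * K2 * (2 * K2 + 1))" using kk et(2) rR r0 by (intro mult_right_mono) auto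
  thus ?thesis using RH dxy kk by (subst pos_le_divide_eq) auto
 qed
 note asp = aspect[OF st et(1) etasp]
 have xO: "x : closure Om" by (rule carpet_closure(1)[OF x(1)])
 have xball: "cball x r0 <= cball c (3 * dl 0)"
 proof
  fix w assume "w : cball x r0"
  thus "w : cball c (3 * dl 0)" using near_c[OF xO] dist_triangle[of c w x] rd dl_pos[of 0] by simp
 qed
 have TEx: "{vx} : TE E" if "x : E" for E unfolding TE_iff using point_tile[OF x] x(2) that by (auto simp: body_def)
 have TEz: "tz : TE E" if "E Int body tz ~= {}" for E unfolding TE_iff using tz that by blast
 have TEr: "EX u:body t. dist x u <= r0" if "t : TE E" "E <= cball x r0" for t E using that unfolding TE_iff by fastforce
 have single: False if t: "t : V" "~ big t" and u: "u : body t" "dist x u <= 2 * q' l" and w: "w : body t" "q' (Suc l) <= dist x w" for t u w l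
 proof -
  have "dist u w <= 2 * ep" using sz_dist[OF t(1) u(1) w(1)] t(2) by (simp add: sz_def)
  moreover have "8 * q' l <= q' (Suc l)" unfolding q'Suc using h q'pos[of l] by (intro mult_right_mono) auto
  ultimately show False using u(2) w(2) dist_triangle[of x w u] q'ge[of l] et(3) ep by linarith
 qed
 \<comment> \<open>Two scales: \<open>P\<close> blocks of \<open>P\<close> annuli. If some
   \<open>Q i\<close> spans a block, it is the exceptional one and the annuli of that block are
   used; otherwise no tile spans a block, and the blocks themselves act as annuli.\<close>
 have "EX i J g. 1 <= i & (J = {} | J = {Cl i} & Cl i : V & 8 * ep <= dl i) & (ALL l. r0 <= g l) & mono g & 2 * g (P - 1) <= R &
   (ALL t l. t : V - J & Suc l < P --> ~ ((EX z:body t. dist x z <= 2 * g l) & (EX z:body t. g (Suc l) <= dist x z))) &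
   (EX E<=V - J. gconn tadj E & {vx} : E & tz : E & (ALL t:E. EX u:body t. dist x u <= r0))"
 proof (cases "EX i>=1. EX b<P. (EX z:Q i. dist x z <= 2 * q' (b * P)) & (EX z:Q i. q' (b * P + P) <= dist x z)")
  case True
  then obtain i b z z' where i: "1 <= i" "b < P" and z: "z : Q i" "dist x z <= 2 * q' (b * P)" "z' : Q i" "q' (b * P + P) <= dist x z'" by blast
  define J where "J = (if Cl i : V then {Cl i} else {})"
  define g where "g l = q' (b * P + l)" for l
  have cQ: "w : Q j ==> w : closure (Q j)" for w j using closure_subset by blast
  have dli: "(h - 2) * q' (b * P + l) <= dl i" if "l < P" for l
  proof -
   have "q' (b * P + l) * h <= q' (b * P + P)" using monoD[OF q'mono, of "Suc (b * P + l)" "b * P + P"] that by (simp add: q'Suc mult.commute)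
   moreover have "q' (b * P) <= q' (b * P + l)" by (rule monoD[OF q'mono]) simp
   moreover have "dist z z' <= dl i" using z cQ by (intro dist_le_dl i(1)) auto
   ultimately show ?thesis using z(2,4) dist_triangle[of x z' z] by (simp add: algebra_simps)
  qed
  have dl0: "(h - 2) * q' (b * P) <= dl i" using dli[of 0] P0 by simp
  have epi: "8 * ep <= dl i"
  proof -
   have "1 * q' (b * P) <= (h - 2) * q' (b * P)" using h q'pos[of "b * P"] by (intro mult_right_mono) auto
   thus ?thesis using dl0 q'ge[of "b * P"] et(3) by linarith
  qed
  \<comment> \<open>\<open>Q i\<close> is large and close to \<open>x\<close>, so by separation the
    outer circle is farther than \<open>r0\<close> from \<open>x\<close>, and a detour within
    \<open>r0\<close> stays in \<open>Om\<close>.\<close>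
  have inO: "cball x r0 <= Om"
  proof (rule ccontr)
   assume "~ ?thesis"
   then obtain w where w: "w : frontier Om" "dist x w <= r0" using ball_meets_outside[OF xO _ r0] by blast
   have "w : closure (Q 0)" using w(1) closure_Q[of 0] frontier_Q0 by simp
   hence "K3 * min (dl 0) (dl i) <= dist w z" using cQ[OF z(1)] i(1) by (intro sep_closure) auto
   hence "K3 * dl i <= dist w z" using dl_le[OF i(1)] by (simp)
   also have "... <= 4 * q' (b * P)" using w(2) z(2) dist_triangle2[of w z x] q'ge[of "b * P"] q'pos[of "b * P"] by (simp add: dist_commute)
   finally have "K3 * ((h - 2) * q' (b * P)) <= 4 * q' (b * P)" using dl0 K3 by (meson mult_left_mono less_imp_le order_trans)
   moreover have "4 * q' (b * P) < K3 * (h - 2) * q' (b * P)" using h(2) q'pos[of "b * P"] by (intro mult_strict_right_mono)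
   ultimately show False by (simp)
  qed
  \<comment> \<open>Another region reaching from one annulus to the next would be large and close to
    \<open>Q i\<close>. Separation forbids this because \<open>K3 * (h - 2)\<close> exceeds 4, which
    explains the choice of \<open>h\<close>.\<close>
  have gap: False if t: "t : V - J" "Suc l < P" and u: "u : body t" "dist x u <= 2 * g l" and w: "w : body t" "g (Suc l) <= dist x w" for t l u w
  proof (cases "big t")
   case False
   thus ?thesis using single[of t u "b * P + l" w] t u w by (simp add: g_def)
  next
   case True
   have "ix t ~= i" using t(1) ix(2)[OF True] by (auto simp: J_def)
   have uw: "u : Q (ix t)" "w : Q (ix t)" using big_body[OF True] u w by auto
   have "(h - 2) * g l <= dist u w" using u(2) w(2) dist_triangle[of x w u] by (simp add: g_def q'Suc algebra_simps)
   also have "... <= dl (ix t)" using uw cQ by (intro dist_le_dl ix(1)[OF True]) auto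
   finally have "(h - 2) * g l <= min (dl i) (dl (ix t))" using dli[of l] t(2) by (simp add: g_def)
   hence "K3 * ((h - 2) * g l) <= K3 * min (dl i) (dl (ix t))" using K3 by (intro mult_left_mono) auto
   also have "... <= dist z u" using \<open>ix t ~= i\<close> cQ z(1) uw(1) by (intro sep_closure) auto
   also have "... <= 4 * g l" using z(2) u(2) dist_triangle2[of z u x] monoD[OF q'mono, of "b * P" "b * P + l"] by (simp add: g_def dist_commute)
   finally have "K3 * (h - 2) * g l <= 4 * g l" by (simp)
   moreover have "4 * g l < K3 * (h - 2) * g l" using h(2) q'pos by (intro mult_strict_right_mono) (simp_all add: g_def)
   ultimately show False by linarith
  qed
  obtain E where E: "connected E" "E <= cball x r0" "x : E" "E Int body tz ~= {}" "E Int Q i = {}" using Ei[OF i(1) inO] by blast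
  have EK: "E <= KK" "E <= cball c (3 * dl 0)" using E(2) inO closure_subset[of Om] closure_ball by blast+
  have "TE E <= V - J" using TE_not_Cl[OF E(5)] by (auto simp: TE_def J_def)
  moreover have "gconn tadj (TE E)" by (rule TE_gconn[OF E(1) EK])
  ultimately have EE: "EX E<=V - J. gconn tadj E & {vx} : E & tz : E & (ALL t:E. EX u:body t. dist x u <= r0)"
   using TEx[OF E(3)] TEz[OF E(4)] TEr[OF _ E(2)] by blast
  have gm: "mono g" unfolding g_def by (intro monoI monoD[OF q'mono]) simp
  have gR: "2 * g (P - 1) <= R"
  proof -
   have "b * P + P = (b + 1) * P" by simp
   also have "... <= P * P" using i(2) by (intro mult_right_mono) auto
   finally have "q' (b * P + (P - 1)) <= q' (P * P)" by (intro monoD[OF q'mono]) simp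
   thus ?thesis by (simp add: g_def R_def)
  qed
  have JJ: "J = {} | J = {Cl i} & Cl i : V & 8 * ep <= dl i" using epi by (auto simp: J_def)
  have gl: "ALL l. r0 <= g l" using q'ge by (simp add: g_def)
  have gap': "ALL t l. t : V - J & Suc l < P --> ~ ((EX z:body t. dist x z <= 2 * g l) & (EX z:body t. g (Suc l) <= dist x z))"
   using gap by blast
  show ?thesis by (rule exI[of _ i], rule exI[of _ J], rule exI[of _ g]) (intro conjI i(1) JJ gl gm gR gap' EE)
 next
  case False
  define g where "g l = q' (l * P)" for l
  have gap: False if t: "t : V" "Suc l < P" and u: "u : body t" "dist x u <= 2 * g l" and w: "w : body t" "g (Suc l) <= dist x w" for t l u w
  proof (cases "big t")
   case False
   have "q' (Suc (l * P)) <= g (Suc l)" unfolding g_def using P0 by (intro monoD[OF q'mono]) simp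
   thus ?thesis using single[OF t(1) False u(1), of "l * P" w] u w by (simp add: g_def)
  next
   case True
   have "u : Q (ix t)" "w : Q (ix t)" using big_body[OF True] u w by auto
   moreover have "g (Suc l) = q' (l * P + P)" by (simp add: g_def add.commute)
   ultimately show ?thesis using False ix(1)[OF True] t(2) u(2) w(2) unfolding g_def by (metis Suc_lessD)
  qed
  obtain E where E: "connected E" "E <= KK" "E <= cball x r0" "x : E" "E Int body tz ~= {}" using E0 by blast
  have "gconn tadj (TE E)" by (rule TE_gconn[OF E(1,2)]) (use E(3) xball in blast)
  moreover have "TE E <= V - {}" by (auto simp: TE_def)
  ultimately have EE: "EX E<=V - {}. gconn tadj E & {vx} : E & tz : E & (ALL t:E. EX u:body t. dist x u <= r0)"
   using TEx[OF E(4)] TEz[OF E(5)] TEr[OF _ E(3)] by blast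
  have gm: "mono g" unfolding g_def by (intro monoI monoD[OF q'mono]) simp
  have gR: "2 * g (P - 1) <= R"
  proof -
   have "q' ((P - 1) * P) <= q' (P * P)" by (intro monoD[OF q'mono] mult_right_mono) auto
   thus ?thesis by (simp add: g_def R_def)
  qed
  have gl: "ALL l. r0 <= g l" using q'ge by (simp add: g_def)
  have gap': "ALL t l. t : V - {} & Suc l < P --> ~ ((EX z:body t. dist x z <= 2 * g l) & (EX z:body t. g (Suc l) <= dist x z))"
   using gap by blast
  have "1 <= (1::nat)" "{} = {} | {} = {Cl 1} & Cl 1 : V & 8 * ep <= dl 1" by auto
  from this gl gm gR gap' EE show ?thesis by - (rule exI[of _ "1::nat"], rule exI[of _ "{}"], rule exI[of _ g], intro conjI; assumption)
 qed
 then obtain i J g where i: "1 <= i" and J: "J = {} | J = {Cl i} & Cl i : V & 8 * ep <= dl i"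
  and gl: "ALL l. r0 <= g l" and g2: "mono g" "2 * g (P - 1) <= R"
  and gp: "ALL t l. t : V - J & Suc l < P --> ~ ((EX z:body t. dist x z <= 2 * g l) & (EX z:body t. g (Suc l) <= dist x z))"
  and EE: "EX E<=V - J. gconn tadj E & {vx} : E & tz : E & (ALL t:E. EX u:body t. dist x u <= r0)"
  by - (erule exE, erule exE, erule exE, (erule conjE)+, rule that; assumption)
 note g = spec[OF gl] g2
 have gap: "~ ((EX z:body t. dist x z <= 2 * g l) & (EX z:body t. g (Suc l) <= dist x z))" if "t : V - J" "Suc l < P" for t l
  by (rule mp[OF spec[OF spec[OF gp]]]) (intro conjI that)
 obtain E where E: "E <= V - J" "gconn tadj E" "{vx} : E" "tz : E" "!!t. t : E ==> EX u:body t. dist x u <= r0"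
  using EE by metis
 have g8: "8 * ep <= g l" for l using g(1)[of l] et(3) by linarith
 obtain ro where ro: "!!t. 0 <= ro t" "(SUM t:V. (ro t)^2) <= 4 * enC K2 K3 / real P"
  "!!C t1 t2 u w. C <= V - J ==> gconn tadj C ==> t1 : C ==> u : body t1 ==> dist x u <= g 0 ==>
   t2 : C ==> w : body t2 ==> 2 * g (P - 1) <= dist x w ==> 1 <= sum ro C" using annuli_weight[OF P0 g8 g(2) gap] by blast
 have etR: "et <= R" using et(2) rR r0 by linarith
 have Rlt: "(2 * K2 + 1) * R < dist x y" using Rxy RK by linarith
 obtain F where F: "F <= V" "Cl i ~: F" "gconn tadj F" "!!v. y : cell v ==> {v} : F" "!!k. k < 4 ==> F Int side k ~= {}"
  "!!t. t : F ==> EX w:body t. R < dist x w" using outer_chain[OF i y(1) et(1) etR small Rlt] by metis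
 have FJ: "F <= V - J" using F(1,2) J by auto
 \<comment> \<open>\<open>F\<close> touches the left and the right side of a rectangle of width 1,
   and one of them is at distance at least 1 / 2 from \<open>qx\<close>.\<close>
 have "EX f' qx' qy'. f' : F & X f' <= qx' & qx' <= X f' + m f' & Y f' <= qy' & qy' <= Y f' + m f' & 1 / 2 <= \<bar>qx' - qx\<bar>"
 proof -
  obtain t1 t3 where t: "t1 : F" "t1 : side 1" "t3 : F" "t3 : side 3" using F(5)[of 1] F(5)[of 3] by auto
  have tV: "t1 : V" "t3 : V" using t F(1) by blast+
  note sd = st.sideL[OF tV(1) t(2)] st.sideR[OF tV(2) t(4)] st.m_nonneg[OF tV(1)] st.m_nonneg[OF tV(2)]
  show ?thesis
  proof (cases "qx <= 1 / 2")
   case True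
   hence "1 / 2 <= \<bar>(X t3 + m t3) - qx\<bar>" using sd by linarith
   thus ?thesis using t(3) sd by (intro exI[of _ t3] exI[of _ "X t3 + m t3"] exI[of _ "Y t3"]) auto
  next
   case False
   hence "1 / 2 <= \<bar>X t1 - qx\<bar>" using sd by linarith
   thus ?thesis using t(1) sd by (intro exI[of _ t1] exI[of _ "X t1"] exI[of _ "Y t1"]) auto
  qed
 qed
 then obtain f' qx' qy' where f': "f' : F" and q2: "X f' <= qx'" "qx' <= X f' + m f'" "Y f' <= qy'" "qy' <= Y f' + m f'" "1 / 2 <= \<bar>qx' - qx\<bar>"
  by blast
 define D where "D = max \<bar>px' - px\<bar> \<bar>py' - py\<bar>"
 have nn: "max \<bar>qx - px\<bar> \<bar>qy - py\<bar> < M * D" using contra unfolding D_def by linarith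
 have near: "\<bar>qx - px\<bar> < M * D" "\<bar>qy - py\<bar> < M * D" using nn by simp_all
 have D0: "0 < D"
 proof (rule ccontr)
  assume "~ 0 < D"
  hence "M * D <= 0" using M by (intro mult_nonneg_nonpos) auto
  thus False using near(1) by linarith
 qed
 define CA where "CA = aspC K2 K3"
 define CS where "CS = sepC K2 K3"
 have CA: "64 <= CA" "1 <= a * CA" "a <= CA" using aspC_ge asp by (auto simp: CA_def)
 have CS: "64 <= CS" using sepC_ge by (simp add: CS_def)
 have xV: "{vx} : V" using E by blast
 have DCA: "D <= CA" unfolding D_def using p p' st.X_ge[OF xV] st.X_le[OF xV] st.Y_ge[OF xV] st.Y_le[OF xV]
   st.X_ge[OF tz] st.X_le[OF tz] st.Y_ge[OF tz] st.Y_le[OF tz] CA by (auto simp: max_def abs_if)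
 \<comment> \<open>From \<open>D <= CA\<close> and \<open>1 <= a * CA\<close> this step is at most
   \<open>D / 8\<close>, 1 / 8 and \<open>a\<close>.\<close>
 define tt1 where "tt1 = D / (8 * CA\<^sup>2)"
 have CA2: "CA <= CA\<^sup>2" "1 <= CA\<^sup>2" using CA mult_mono[of 1 CA 1 CA] by (auto simp: power2_eq_square)
 have ttD: "tt1 * (8 * CA\<^sup>2) = D" using CA by (simp add: tt1_def)
 have tt0: "0 < tt1" using D0 CA by (simp add: tt1_def)
 have t4: "8 * tt1 <= D" using ttD tt0 CA2 mult_left_mono[of 1 "CA\<^sup>2" "8 * tt1"] by (simp add: algebra_simps)
 have tCA: "8 * tt1 * CA <= 1"
 proof -
  have "(8 * tt1 * CA) * CA <= 1 * CA" using ttD DCA by (simp add: power2_eq_square)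
  thus ?thesis using CA by (simp)
 qed
 have t1: "tt1 * 8 <= 1"
 proof -
  have "8 * tt1 * 1 <= 8 * tt1 * CA" using tt0 CA by (intro mult_left_mono) auto
  thus ?thesis using tCA by linarith
 qed
 have ta: "tt1 <= a"
 proof -
  have "0 < tt1 * CA" using tt0 CA by (intro mult_pos_pos) auto
  moreover have "8 * (tt1 * CA) <= 1" using tCA by (simp)
  ultimately have "tt1 * CA <= 1" by linarith
  hence "tt1 * CA <= a * CA" using CA(2) by linarith
  thus ?thesis using CA by (simp)
 qed
 have kM: "M * (8 * CA\<^sup>2) * (2 * CS) <= real k" unfolding k_def keyK_def CA_def CS_def by linarith
 have "EX tt>0. tt <= 1 & tt <= a & 4 * tt <= D & 4 * tt <= 1 / 2 & M * D <= real k * tt &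
   (J = {} | (EX j:V. J = {j} & (m j <= tt / 2 | (tt <= m j & tt <= X j & X j + m j + tt <= 1 & tt <= Y j & Y j + m j + tt <= a))))"
 \<comment> \<open>A small exceptional square is simply avoided by the lines. A larger one is kept
   at distance \<open>tt1 / (2 * CS)\<close> from the sides by \<open>wall_sep\<close>, and the step
   is shrunk to that value.\<close>
 proof (cases "J = {} | m (Cl i) <= tt1 / 2")
  case True
  have "M * D = M * (8 * CA\<^sup>2) * tt1" using ttD by (simp add: algebra_simps)
  also have "... <= M * (8 * CA\<^sup>2) * (2 * CS) * tt1"
   using M CS tt0 mult_left_mono[of 1 "2 * CS" "M * (8 * CA\<^sup>2)"] by (intro mult_right_mono) auto
  also have "... <= real k * tt1" using kM tt0 by (intro mult_right_mono) auto
  finally show ?thesis using tt0 t1 ta t4 True J by (intro exI[of _ tt1]) auto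
 next
  case False
  hence J': "J = {Cl i}" "Cl i : V" "8 * ep <= dl i" and mj: "tt1 / 2 < m (Cl i)" using J by auto
  define tt where "tt = tt1 / (2 * CS)"
  have tt: "tt * (2 * CS) = tt1" "0 < tt" using CS tt0 by (simp_all add: tt_def)
  have "tt <= tt * CS" using tt(2) CS by simp
  hence tt1': "2 * tt <= tt1" "tt <= m (Cl i)" using tt(1) mj by (simp_all)
  have m0: "0 < m (Cl i)" using mj tt0 by linarith
  have wall: "tt <= w" if "m (Cl i) <= w * CS" for w
  proof -
   have "tt * CS <= w * CS" using that mj tt(1) by (simp add: algebra_simps)
   thus ?thesis using CS by (simp)
  qed
  note ws = wall_sep[OF st i J'(2) m0 J'(3), folded CS_def]
  have DD: "D = (tt * (2 * CS)) * (8 * CA\<^sup>2)" by (simp only: tt(1) ttD)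
  have "M * D = M * (8 * CA\<^sup>2) * (2 * CS) * tt" unfolding DD by (simp)
  also have "... <= real k * tt" using kM tt(2) by (intro mult_right_mono) auto
  finally show ?thesis using tt(2) tt1' t1 t4 J'(1,2) wall[OF ws(1)] wall[OF ws(2)] wall[OF ws(3)] wall[OF ws(4)] by (intro exI[of _ tt]) auto
 qed
 then obtain tt where tt: "0 < tt" "tt <= 1" "tt <= a" "4 * tt <= D" "4 * tt <= 1 / 2" "M * D <= real k * tt"
  and Jc: "J = {} | (EX j:V. J = {j} & (m j <= tt / 2 | (tt <= m j & tt <= X j & X j + m j + tt <= 1 & tt <= Y j & Y j + m j + tt <= a)))" by blast
 have en: "(SUM v:V. (ro v)^2) * (real (16 * k + 42) * (real (4 * k + 10))^2) < 1"
 proof -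
  define B where "B = real (16 * k + 42) * (real (4 * k + 10))^2"
  have B0: "0 <= B" by (simp add: B_def)
  have "4 * enC K2 K3 * B < real P" unfolding P_def keyP_def B_def k_def by linarith
  hence "4 * enC K2 K3 / real P * B < 1" using P0 by (simp)
  moreover have "(SUM v:V. (ro v)^2) * B <= 4 * enC K2 K3 / real P * B" using ro(2) B0 by (rule mult_right_mono)
  ultimately show ?thesis unfolding B_def by linarith
 qed
 have farE: "4 * tt <= \<bar>px' - px\<bar> | 4 * tt <= \<bar>py' - py\<bar>" using tt(4) by (auto simp: D_def split: if_splits)
 have farF: "4 * tt <= \<bar>qx' - qx\<bar> | 4 * tt <= \<bar>qy' - qy\<bar>" using tt(5) q2(5) by auto
 have n1: "\<bar>qx - px\<bar> <= real k * tt" "\<bar>qy - py\<bar> <= real k * tt" using near tt(6) by linarith+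
 have "EX C<=V - J. gconn tadj C & C Int E ~= {} & C Int F ~= {} & sum ro C < 1"
  by (rule st.network_chain[where ro = ro and tt = tt and J = J and E = E and e = "{vx}" and e' = tz and F = F and f = "{vy}" and f' = f'
    and px = px and py = py and px' = px' and py' = py' and qx = qx and qy = qy and qx' = qx' and qy' = qy' and k = k])
   (rule ro(1) | fact tt(1) tt(2) tt(3) Jc E(1) E(2) E(3) E(4) p p' farE FJ F(3) F(4)[OF y(2)] f' q q2(1) q2(2) q2(3) q2(4) farF n1 en | blast)+
 then obtain C where C: "C <= V - J" "gconn tadj C" "C Int E ~= {}" "C Int F ~= {}" "sum ro C < 1" by blast
 obtain t1 t2 where t: "t1 : C" "t1 : E" "t2 : C" "t2 : F" using C by blast
 obtain u w where u: "u : body t1" "dist x u <= r0" and w: "w : body t2" "R < dist x w" using E(5)[OF t(2)] F(6)[OF t(4)] by blast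
 have "1 <= sum ro C" by (rule ro(3)[OF C(1,2) t(1) u(1) _ t(3) w(1)]) (use u w g(1)[of 0] g(3) in linarith)+
 thus False using C(5) by linarith
qed

end

section \<open>The data of one mesh, prepared for the limit\<close>

text \<open>Corner \<open>k\<close> lies between the sides \<open>prv k\<close> and
  \<open>k\<close>. With side 0 at the bottom and side 1 on the left, corner 1 is the
  origin.\<close>

definition rect_corner :: "nat => real => complex" where
 "rect_corner k a = Complex (if k = 1 | k = 2 then 0 else 1) (if k = 2 | k = 3 then a else 0)"

text \<open>The results for mesh \<open>ep\<close> in a form free of cells and tiles, so that the
  limit only sees \<open>f\<close>, \<open>q\<close>, \<open>w\<close> and \<open>a\<close>. The
  metric estimates hold once \<open>ep\<close> is fine enough for the points and radii
  involved.\<close>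

locale carpet_level = carpet_frame +
 fixes ep :: real and f :: "complex => complex" and q :: "nat => complex" and w :: "nat => real" and a :: real
 assumes L_asp: "!!et. thinr ep et ==> et <= dl 0 / (16 * K2 * (2 * K2 + 1)) ==> 1 <= a * aspC K2 K3 & a <= aspC K2 K3"
  and L_f: "!!x. x : carpet Om Q ==> 0 <= Re (f x) & Re (f x) <= 1 & 0 <= Im (f x) & Im (f x) <= a"
  and L_q: "!!i. 1 <= i ==> 0 <= w i & 0 <= Re (q i) & Re (q i) + w i <= 1 & 0 <= Im (q i) & Im (q i) + w i <= a"
  and L_disj: "!!i j. 1 <= i ==> 1 <= j ==> i ~= j ==> 0 < w i ==> 0 < w j ==>
   Re (q i) + w i <= Re (q j) | Re (q j) + w j <= Re (q i) | Im (q i) + w i <= Im (q j) | Im (q j) + w j <= Im (q i)"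
  and L_out: "!!i x et R x0. 1 <= i ==> x : carpet Om Q ==> thinr ep et ==> et <= R ==> 2 * ((2 * K2 + 1) * R) < dl 0 / (2 * K2) ==>
   (2 * K2 + 1) * R < dist x0 x ==>
   Re (f x) <= Re (q i) | Re (q i) + w i <= Re (f x) | Im (f x) <= Im (q i) | Im (q i) + w i <= Im (f x)"
  and L_key: "!!M et r0 x y z. 1 <= M ==> thinr ep et ==> et <= r0 ==> 8 * ep <= r0 ==> x : carpet Om Q ==> y : carpet Om Q ==> z : carpet Om Q ==>
   keyH K2 K3 M * r0 <= dist x y ==> (1 + K2) * dist x z <= r0 ==> M * dinf (f z) (f x) <= dinf (f y) (f x)"
  and L_cor: "!!M et r0 k y. 1 <= M ==> thinr ep et ==> 2 * et <= r0 ==> 8 * ep <= r0 ==> k < 4 ==> y : carpet Om Q ==>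
   keyH K2 K3 M * r0 <= dist (cor_pt k) y ==> M * dinf (rect_corner k a) (f (cor_pt k)) <= dinf (f y) (f (cor_pt k))"
  and L_bd: "!!M et r0 i x y et' r. 1 <= M ==> thinr ep et ==> et <= r0 ==> 8 * ep <= r0 ==> 1 <= i ==> x : frontier (Q i) ==> y : carpet Om Q ==>
   keyH K2 K3 M * r0 <= dist x y ==> approach (Q i) (SOME z. z : Q i) x et' r ==> ball (SOME z. z : Q i) r <= Q i ==> 2 * ep < r ==>
   (1 + K2) * (2 * et' + 2 * ep) <= r0 ==>
   EX p. Re (q i) <= Re p & Re p <= Re (q i) + w i & Im (q i) <= Im p & Im p <= Im (q i) + w i & M * dinf p (f x) <= dinf (f y) (f x)"
  and L_obd: "!!M et r0 x y et' r u. 1 <= M ==> thinr ep et ==> et <= r0 ==> 8 * ep <= r0 ==> x : frontier Om ==> y : carpet Om Q ==>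
   keyH K2 K3 M * r0 <= dist x y ==> approach (Q 0) u x et' r ==> 20 * dl 0 <= dist c u ==> 4 * et + 4 * ep < r ==>
   (!!k. k < 4 ==> 2 * et' + 4 * et + 4 * ep < dist x (cor_pt k)) ==> (1 + K2) * (2 * et' + 2 * ep) <= r0 ==>
   EX p. (Re p = 0 | Re p = 1 | Im p = 0 | Im p = a) & M * dinf p (f x) <= dinf (f y) (f x)"

context carpet_grid begin

definition cl :: "complex => int \<times> int" where "cl z = (SOME v. z : cell v)"

lemma cl: "z : cell (cl z)"
proof -
 obtain v where "z : cell v" by (rule cell_of)
 thus ?thesis unfolding cl_def by (rule someI)
qed

context
 fixes X Y m :: "(int \<times> int) set => real" and a :: real
 assumes st: "square_tiling V tadj X Y m (side 1) (side 3) (side 0) (side 2) 1 a"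
begin

interpretation st: square_tiling V tadj X Y m "side 1" "side 3" "side 0" "side 2" 1 a by (rule st)

definition pos :: "complex => complex" where "pos z = Complex (X {cl z}) (Y {cl z})"

lemma key_pos:
 assumes et: "thin et" "et <= r0" "8 * ep <= r0" and M: "1 <= M"
  and xy: "x : carpet Om Q" "y : carpet Om Q" "keyH K2 K3 M * r0 <= dist x y" and tz: "tz : V"
  and E0: "EX E. connected E & E <= KK & E <= cball x r0 & x : E & E Int body tz ~= {}"
  and Ei: "!!i. 1 <= i ==> cball x r0 <= Om ==> EX E. connected E & E <= cball x r0 & x : E & E Int body tz ~= {} & E Int Q i = {}"
  and p: "X tz <= Re p" "Re p <= X tz + m tz" "Y tz <= Im p" "Im p <= Y tz + m tz"
 shows "M * dinf p (pos x) <= dinf (pos y) (pos x)"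
proof -
 have V: "{cl x} : V" "{cl y} : V" using point_tile xy cl by blast+
 have "M * max \<bar>Re p - X {cl x}\<bar> \<bar>Im p - Y {cl x}\<bar> <= max \<bar>X {cl y} - X {cl x}\<bar> \<bar>Y {cl y} - Y {cl x}\<bar>"
  by (rule key[OF st et M xy(1) cl xy(2) cl xy(3) tz E0 Ei _ _ _ _ p]) (use st.m_nonneg[OF V(1)] st.m_nonneg[OF V(2)] in auto)
 thus ?thesis by (simp add: dinf_def pos_def)
qed

lemma key_near:
 assumes et: "thin et" "et <= r0" "8 * ep <= r0" and M: "1 <= M"
  and xy: "x : carpet Om Q" "y : carpet Om Q" "keyH K2 K3 M * r0 <= dist x y"
  and z: "z : carpet Om Q" "(1 + K2) * dist x z <= r0" "z : cell v"
  and p: "X {v} <= Re p" "Re p <= X {v} + m {v}" "Y {v} <= Im p" "Im p <= Y {v} + m {v}"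
 shows "M * dinf p (pos x) <= dinf (pos y) (pos x)"
proof (rule key_pos[OF et M xy point_tile[OF z(1,3)] _ _ p])
 have zb: "z : body {v}" using z(3) by (simp add: body_def)
 obtain E where E: "connected E" "E <= cball x r0" "x : E" "z : E" "E Int Q 0 = {}" using local_detour[OF xy(1) z(1,2)] by metis
 have "E <= KK" using E(5) closure_ball(2) by (auto simp: Q0)
 thus "EX E. connected E & E <= KK & E <= cball x r0 & x : E & E Int body {v} ~= {}" using E zb by blast
 show "EX E. connected E & E <= cball x r0 & x : E & E Int body {v} ~= {} & E Int Q i = {}" for i
 proof -
  obtain E where "connected E" "E <= cball x r0" "x : E" "z : E" "E Int Q i = {}" using local_detour[OF xy(1) z(1,2)] by metis
  thus ?thesis using zb by blast
 qed
qed

text \<open>A region \<open>Q i\<close> that owns no tile at this mesh is given the degenerate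
  square of side 0 at the origin. A boundary point is compared with a common point of the tile of
  \<open>Cl i\<close> and an adjacent cell.\<close>

lemma level_of_tiling:
 "carpet_level Om Q K2 K3 c e s ep pos (%i. if Cl i : V then Complex (X (Cl i)) (Y (Cl i)) else 0) (%i. if Cl i : V then m (Cl i) else 0) a"
proof (unfold_locales, goal_cases)
 case (1 et)
 thus ?case using aspect[OF st] thin_iff by blast
next
 case (2 x)
 hence "{cl x} : V" using point_tile cl by blast
 thus ?case using st.X_ge st.X_le st.Y_ge st.Y_le st.m_nonneg unfolding pos_def complex.sel by (meson add_increasing2 order_trans le_add_same_cancel1)
next
 case (3 i)
 thus ?case using st.X_ge st.X_le st.Y_ge st.Y_le st.m_nonneg st.H_pos by auto
next
 case (4 i j)
 obtain v where v: "v : Cl i" using 4(4) V_tile(1)[of "Cl i"] by (auto split: if_splits)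
 have "Cl i ~= Cl j" using 4(3) Cl_disj[OF v, of j] v by auto
 thus ?case using 4(4,5) st.disj[of "Cl i" "Cl j"] by (auto)
next
 case (5 i x et R x0)
 show ?case
 proof (cases "Cl i : V")
  case True
  thus ?thesis using not_in_square[OF st 5(1) True 5(2) cl _ 5(4-6)] 5(3) unfolding thin_iff pos_def by (auto simp: not_less[symmetric])
 next
  case False thus ?thesis by (auto)
 qed
next
 case (6 M et r0 x y z)
 have zV: "{cl z} : V" using point_tile[OF 6(7) cl] .
 show ?case by (rule key_near[OF _ 6(3,4,1,5,6,8,7,9) cl]) (use 6(2) st.m_nonneg[OF zV] in \<open>auto simp: thin_iff pos_def\<close>)
next
 case (7 M et r0 k y)
 have th: "thin et" "0 < et" "2 * et <= dl 0" "ep <= et" using 7(2) by (auto simp: thin_iff thinr_def)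
 have aw: "2 * ep < dist z (ray_pt k t)" if "z : closure Om" "s k + et <= t" for z t using 7(2,5) that unfolding thinr_def by blast
 obtain v z where v: "{v} : side k" "{v} : side (prv k)" "z : cell v" "z : tip (2 * et) k"
  using corner_tile[OF 7(5) th(2-4) aw] by blast
 have vV: "{v} : V" using v(1) side_V by blast
 have cS: "cor_pt k : carpet Om Q" using cor_frontier[OF 7(5)] frontier_sub_carpet[of 0] frontier_Q0 by auto
 have xt: "cor_pt k : tip (2 * et) k" using cor_tip th(2) by simp
 have tb: "tip (2 * et) k <= cball (cor_pt k) r0" using tip_near 7(3) by fastforce
 have etr: "et <= r0" using th(2) 7(3) by linarith
 have zb: "z : body {v}" using v(3) by (simp add: body_def)
 have sd: "X {v} = 0" if "k = 1 | k = 2" using st.sideL[OF vV] v(1,2) that by (auto simp: prv_def)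
 have sd2: "X {v} + m {v} = 1" if "k = 0 | k = 3" using st.sideR[OF vV] v(1,2) that by (auto simp: prv_def)
 have sd3: "Y {v} = 0" if "k = 0 | k = 1" using st.sideB[OF vV] v(1,2) that by (auto simp: prv_def)
 have sd4: "Y {v} + m {v} = a" if "k = 2 | k = 3" using st.sideT[OF vV] v(1,2) that by (auto simp: prv_def)
 have rc: "X {v} <= Re (rect_corner k a)" "Re (rect_corner k a) <= X {v} + m {v}" "Y {v} <= Im (rect_corner k a)" "Im (rect_corner k a) <= Y {v} + m {v}"
  using less4[OF 7(5)] sd sd2 sd3 sd4 st.m_nonneg[OF vV] unfolding rect_corner_def complex.sel by (elim disjE; simp)+
 show ?case
 proof (rule key_pos[OF th(1) etr 7(4,1) cS 7(6,7) vV _ _ rc])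
  show "EX E. connected E & E <= KK & E <= cball (cor_pt k) r0 & cor_pt k : E & E Int body {v} ~= {}"
   using tip_connected tip_KK[OF 7(5)] tb xt zb v(4) by blast
  fix i assume "cball (cor_pt k) r0 <= Om"
  moreover have "cor_pt k : cball (cor_pt k) r0" using etr th(2) by simp
  ultimately have "cor_pt k : Om" by blast
  thus "EX E. connected E & E <= cball (cor_pt k) r0 & cor_pt k : E & E Int body {v} ~= {} & E Int Q i = {}"
   using cor_frontier[OF 7(5)] Om_props(1) by (simp add: frontier_def interior_open)
 qed
next
 case (8 M et r0 i x y et' r)
 obtain T b where T: "connected T" "compact T" "(SOME z. z : Q i) : T" "b : T" "b : frontier (Q i)" "T - {b} <= Q i" "dist x b < et'"
  "!!z. z : T ==> et' <= dist b z ==> ball z r <= Q i" using 8(9) unfolding approach_def by blast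
 have r: "0 < r" using 8(11) ep by linarith
 obtain v x' where v: "x' : frontier (Q i)" "dist b x' <= et' + 2 * ep" "x' : cell v" "{v} : V" "tadj {v} (Cl i)" "Cl i : V"
  using boundary_tile[OF 8(5) T(1-6) r T(8) 8(10,11)] by blast
 have "dist x x' <= 2 * et' + 2 * ep" using T(7) v(2) dist_triangle[of x x' b] by linarith
 hence d: "(1 + K2) * dist x x' <= r0" using 8(12) K2 mult_left_mono[of "dist x x'" "2 * et' + 2 * ep" "1 + K2"] by linarith
 have S: "x : carpet Om Q" "x' : carpet Om Q" using 8(6) v(1) frontier_sub_carpet by blast+
 define p where "p = Complex (max (X {v}) (X (Cl i))) (max (Y {v}) (Y (Cl i)))"
 note tt = st.touchX[OF v(4,6,5)] st.touchX[OF v(6,4) st.adj_sym[OF v(5)]] st.touchY[OF v(4,6,5)] st.touchY[OF v(6,4) st.adj_sym[OF v(5)]]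
  st.m_nonneg[OF v(4)] st.m_nonneg[OF v(6)]
 have "M * dinf p (pos x) <= dinf (pos y) (pos x)"
  by (rule key_near[OF _ 8(3,4,1) S(1) 8(7,8) S(2) d v(3)]) (use 8(2) tt in \<open>auto simp: p_def thin_iff\<close>)
 thus ?case using tt v(6) by (intro exI[of _ p]) (auto simp: p_def)
next
 case (9 M et r0 x y et' r u)
 obtain T b where T: "connected T" "compact T" "u : T" "b : T" "b : frontier (Q 0)" "T - {b} <= Q 0" "dist x b < et'"
  "!!z. z : T ==> et' <= dist b z ==> ball z r <= Q 0" using 9(8) unfolding approach_def by blast
 have th: "0 < et" "2 * et <= dl 0" "ep <= et" using 9(2) by (auto simp: thinr_def)
 have aw: "2 * ep < dist z (ray_pt k t)" if "k < 4" "z : closure Om" "s k + et <= t" for k z t using 9(2) that unfolding thinr_def by blast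
 have nc: "et' + 4 * et + 4 * ep < dist b (cor_pt k)" if "k < 4" for k using 9(11)[OF that] T(7) dist_triangle[of x "cor_pt k" b] by linarith
 have bO: "b : frontier Om" using T(5) frontier_Q0 by simp
 obtain v x' k where v: "x' : frontier Om" "dist b x' <= et' + 2 * ep" "x' : cell v" "k < 4" "{v} : side k"
  using outer_boundary_tile[OF T(1-3) 9(9) T(4) bO T(6) T(8) th 9(10) aw nc] by blast
 have vV: "{v} : V" using v(5) side_V by blast
 have "dist x x' <= 2 * et' + 2 * ep" using T(7) v(2) dist_triangle[of x x' b] by linarith
 hence d: "(1 + K2) * dist x x' <= r0" using 9(12) K2 mult_left_mono[of "dist x x'" "2 * et' + 2 * ep" "1 + K2"] by linarith
 have S: "x : carpet Om Q" "x' : carpet Om Q" using 9(5) v(1) frontier_sub_carpet[of 0] frontier_Q0 by auto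
 define p where "p = Complex (if k = 3 then X {v} + m {v} else X {v}) (if k = 2 then Y {v} + m {v} else Y {v})"
 have "M * dinf p (pos x) <= dinf (pos y) (pos x)"
  by (rule key_near[OF _ 9(3,4,1) S(1) 9(6,7) S(2) d v(3)]) (use 9(2) st.m_nonneg[OF vV] in \<open>auto simp: p_def thin_iff\<close>)
 moreover have "Re p = 0 | Re p = 1 | Im p = 0 | Im p = a"
  using less4[OF v(4)] v(5) st.sideL[OF vV] st.sideR[OF vV] st.sideB[OF vV] st.sideT[OF vV] unfolding p_def complex.sel by (elim disjE) auto
 ultimately show ?case by blast
qed

end

lemma level_exists: "EX f q w a. carpet_level Om Q K2 K3 c e s ep f q w a"
 by (rule tiling) (rule exI, rule exI, rule exI, rule exI, erule level_of_tiling)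

end

section \<open>Passage to the limit\<close>

text \<open>Tychonoff in place of a diagonal sequence: the index set will be as large as the carpet,
  where a common convergent subsequence cannot be expected, but a finer filter along which every
  coordinate converges exists.\<close>

lemma cluster_filter:
 fixes G :: "nat => 'j => complex"
 assumes ev: "\<forall>\<^sub>F n in sequentially. ALL j. norm (G n j) <= B"
 obtains \<F> F where "\<F> ~= bot" "\<F> <= sequentially" "!!j. ((%n. G n j) \<longlongrightarrow> F j) \<F>"
proof -
 define K where "K = (PiE UNIV (%_::'j. cball (0::complex) B))"
 have K: "compact K"
 proof -
  have "compactin (product_topology (%_::'j. euclidean :: complex topology) UNIV) K" unfolding K_def by (subst compactin_PiE) auto
  thus ?thesis unfolding euclidean_product_topology by simp
 qed
 have "\<forall>\<^sub>F y in filtermap G sequentially. y : K" unfolding eventually_filtermap using ev by eventually_elim (auto simp: K_def)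
 moreover have "filtermap G sequentially ~= bot" by (simp add: filtermap_bot_iff)
 ultimately obtain F where F: "inf (nhds F) (filtermap G sequentially) ~= bot" using K unfolding compact_filter by blast
 define \<F> where "\<F> = inf sequentially (filtercomap G (nhds F))"
 have "\<F> ~= bot"
 proof
  assume "\<F> = bot"
  hence "eventually (%_. False) \<F>" by simp
  then obtain P R where PR: "eventually P sequentially" "eventually R (filtercomap G (nhds F))" "!!n. ~ (P n & R n)"
   unfolding \<F>_def eventually_inf by blast
  then obtain R' where R': "eventually R' (nhds F)" "!!n. R' (G n) ==> R n" unfolding eventually_filtercomap by blast
  have "eventually (%y. EX n. P n & y = G n) (filtermap G sequentially)" unfolding eventually_filtermap using PR(1) by eventually_elim blast
  hence "eventually (%_. False) (inf (nhds F) (filtermap G sequentially))"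
   unfolding eventually_inf using R' PR(3) by (intro exI[of _ R'] exI[of _ "%y. EX n. P n & y = G n"]) blast
  thus False using F by (simp add: trivial_limit_def)
 qed
 moreover have "\<F> <= sequentially" by (simp add: \<F>_def)
 moreover have "((%n. G n j) \<longlongrightarrow> F j) \<F>" for j
 proof -
  have "\<F> <= filtercomap G (nhds F)" by (simp add: \<F>_def)
  hence "filterlim G (nhds F) \<F>" using filterlim_filtercomap filterlim_mono by (metis order_refl)
  show ?thesis
  proof (rule topological_tendstoI)
   fix S assume S: "open S" "F j : S"
   have "open ((%y. y j) -` S)" by (rule open_vimage[OF S(1) continuous_on_product_coordinates])
   hence "eventually (%y. y : (%y. y j) -` S) (nhds F)" using S(2) by (intro eventually_nhds_in_open) auto
   thus "eventually (%n. G n j : S) \<F>" using \<open>filterlim G (nhds F) \<F>\<close> unfolding filterlim_iff by auto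
  qed
 qed
 ultimately show thesis using that by blast
qed

lemma cancel_eighth: "0 < k ==> k * (r / (8 * k)) = r / 8" for k r :: real by simp

lemma dinf_simps: "dinf u u = 0" "dinf u v = dinf v u" "0 <= dinf u v" by (auto simp: dinf_def)

lemma dinf_dist: "dinf u v <= dist u v" "dist u v <= 2 * dinf u v"
proof -
 show "dinf u v <= dist u v" using abs_Re_le_cmod[of "u - v"] abs_Im_le_cmod[of "u - v"] by (simp add: dinf_def dist_norm)
 have "dist u v <= \<bar>Re u - Re v\<bar> + \<bar>Im u - Im v\<bar>" using cmod_le[of "u - v"] by (simp add: dist_norm)
 thus "dist u v <= 2 * dinf u v" by (auto simp: dinf_def max_def)
qed

lemma abs_le_dinf: "\<bar>Re u - Re v\<bar> <= dinf u v" "\<bar>Im u - Im v\<bar> <= dinf u v" by (simp_all add: dinf_def)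

lemma dinf_triangle: "dinf u v <= dinf u x + dinf x v"
proof -
 have "\<bar>Re u - Re v\<bar> <= dinf u x + dinf x v" "\<bar>Im u - Im v\<bar> <= dinf u x + dinf x v"
  using abs_le_dinf[of u x] abs_le_dinf[of x v] by linarith+
 thus ?thesis unfolding dinf_def[of u v] by (rule max.boundedI)
qed

lemma dinf_0: assumes "dinf u v <= 0" shows "u = v"
proof -
 have "dist u v <= 0" using dinf_dist(2)[of u v] assms by linarith
 thus ?thesis by simp
qed

lemma tendsto_dinf: "(g \<longlongrightarrow> u) F ==> (h \<longlongrightarrow> v) F ==> ((%n. dinf (g n) (h n)) \<longlongrightarrow> dinf u v) F"
 unfolding dinf_def by (intro tendsto_max tendsto_rabs tendsto_diff tendsto_Re tendsto_Im)

text \<open>Turns estimates valid for every factor \<open>M\<close> into exact boundary relations in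
  the limit.\<close>

lemma multiples_bounded_imp_nonpos: fixes t :: real assumes "!!M. 1 <= M ==> M * t <= B" shows "t <= 0"
proof (rule ccontr)
 assume "~ t <= 0"
 hence t: "0 < t" by simp
 have "max 1 ((B + 1) / t) * t <= B" by (rule assms) simp
 moreover have "(B + 1) / t * t <= max 1 ((B + 1) / t) * t" using t by (intro mult_right_mono) auto
 ultimately show False using t by simp
qed

locale carpet_limit = carpet_frame +
 fixes f :: "complex => complex" and q :: "nat => complex" and w :: "nat => real" and a :: real
 assumes A_a: "0 < a"
  and A_f: "!!x. x : carpet Om Q ==> 0 <= Re (f x) & Re (f x) <= 1 & 0 <= Im (f x) & Im (f x) <= a"
  and A_q: "!!i. 1 <= i ==> 0 <= w i & 0 <= Re (q i) & Re (q i) + w i <= 1 & 0 <= Im (q i) & Im (q i) + w i <= a"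
  and A_disj: "!!i j. 1 <= i ==> 1 <= j ==> i ~= j ==> 0 < w i ==> 0 < w j ==>
   Re (q i) + w i <= Re (q j) | Re (q j) + w j <= Re (q i) | Im (q i) + w i <= Im (q j) | Im (q j) + w j <= Im (q i)"
  and A_out: "!!i x. 1 <= i ==> x : carpet Om Q ==>
   Re (f x) <= Re (q i) | Re (q i) + w i <= Re (f x) | Im (f x) <= Im (q i) | Im (q i) + w i <= Im (f x)"
  and A_key: "!!M x y z. 1 <= M ==> x : carpet Om Q ==> y : carpet Om Q ==> z : carpet Om Q ==> x ~= y ==>
   keyH K2 K3 M * (1 + K2) * dist x z <= dist x y ==> M * dinf (f z) (f x) <= dinf (f y) (f x)"
  and A_cor: "!!k. k < 4 ==> f (cor_pt k) = rect_corner k a"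
  and A_bd: "!!i x. 1 <= i ==> x : frontier (Q i) ==>
   Re (q i) <= Re (f x) & Re (f x) <= Re (q i) + w i & Im (q i) <= Im (f x) & Im (f x) <= Im (q i) + w i"
  and A_obd: "!!x. x : frontier Om ==> Re (f x) = 0 | Re (f x) = 1 | Im (f x) = 0 | Im (f x) = a"

context carpet_setup begin

lemma approach_exists:
 assumes "x : frontier (Q i)" "b : Q i" "0 < et"
 obtains r where "0 < r" "approach (Q i) b x et r" "ball b r <= Q i"
proof -
 obtain T p r where T: "connected T" "compact T" "b : T" "p : T" "p : frontier (Q i)" "T - {p} <= Q i" "dist x p < et" "0 < r"
  "!!z. z : T ==> et <= dist p z ==> ball z r <= Q i" using frontier_approach_path[OF open_Q connected_Q assms] by metis
 obtain r' where r': "0 < r'" "ball b r' <= Q i" using open_Q assms(2) open_contains_ball by blast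
 have "ball z (min r r') <= Q i" if "z : T" "et <= dist p z" for z using T(9)[OF that] by auto
 hence "approach (Q i) b x et (min r r')" unfolding approach_def using T by blast
 moreover have "ball b (min r r') <= Q i" using r'(2) by auto
 ultimately show thesis using that[of "min r r'"] T(8) r'(1) by simp
qed

lemma keyH_pos: "0 < keyH K2 K3 M"
proof -
 have "0 < 8 + 4 / K3" using K3 by (simp add: add_pos_pos)
 thus ?thesis unfolding keyH_def using K2 by simp
qed

lemma frontier_carpet: "x : frontier Om ==> x : carpet Om Q" using frontier_sub_carpet[of 0] frontier_Q0 by auto

end

context carpet_frame begin

lemma cor_carpet: "k < 4 ==> cor_pt k : carpet Om Q" using cor_frontier frontier_carpet by blast

lemma other_point: obtains y where "y : carpet Om Q" "y ~= x"
proof -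
 have "0 < dl 0 / (2 * K2)" using dl_pos[of 0] K2 by simp
 hence "cor_pt 0 ~= cor_pt 1" using corner_dist[of 0 1] by auto
 thus thesis using that[of "cor_pt 0"] that[of "cor_pt 1"] cor_carpet by fastforce
qed

text \<open>For fixed points and fixed \<open>M\<close> the mesh conditions hold for all large
  \<open>n\<close>, so each estimate passes to the limit. At corners and boundary points a bounded
  quantity dominates \<open>M\<close> times the discrepancy for every \<open>M\<close>, so the
  discrepancy vanishes.\<close>

theorem limit_exists: "EX f q w a. carpet_limit Om Q K2 K3 c e s f q w a"
proof -
 define ep where "ep n = dl 0 / 16 * inverse (real (Suc n))" for n
 have ep0: "0 < ep n" for n using dl_pos[of 0] by (simp add: ep_def)
 have grid: "carpet_grid Om Q K2 K3 c e s (ep n)" for n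
 proof unfold_locales
  have "inverse (real (Suc n)) <= 1" by (simp add: inverse_le_1_iff)
  hence "dl 0 * inverse (real (Suc n)) <= dl 0 * 1" using dl_pos[of 0] by (intro mult_left_mono) auto
  thus "16 * ep n <= dl 0" by (simp add: ep_def)
 qed (rule ep0)
 have "ALL n. EX f q w a. carpet_level Om Q K2 K3 c e s (ep n) f q w a" using carpet_grid.level_exists[OF grid] by blast
 then obtain f' q' w' a' where lev: "!!n. carpet_level Om Q K2 K3 c e s (ep n) (f' n) (q' n) (w' n) (a' n)" by metis
 have "(%n. dl 0 / 16 * inverse (real (Suc n))) \<longlonglongrightarrow> 0" by (intro tendsto_mult_right_zero LIMSEQ_inverse_real_of_nat)
 hence ev_small: "\<forall>\<^sub>F n in sequentially. ep n < r" if "0 < r" for r using order_tendstoD(2)[OF _ that] unfolding ep_def by blast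
 have ev_thin: "\<forall>\<^sub>F n in sequentially. thinr (ep n) et" if et: "0 < et" "2 * et <= dl 0" for et
 proof -
  obtain ep1 where ep1: "0 < ep1" "!!ep. 0 < ep ==> ep < ep1 ==> thinr ep et" using thinr_small[OF et] by blast
  show ?thesis using ev_small[OF ep1(1)] by eventually_elim (use ep1(2) ep0 in blast)
 qed
 define CA where "CA = aspC K2 K3"
 have CA: "64 <= CA" using aspC_ge by (simp add: CA_def)
 have ev_a: "\<forall>\<^sub>F n in sequentially. 1 <= a' n * CA & a' n <= CA"
 proof -
  define et where "et = min (dl 0 / 2) (dl 0 / (16 * K2 * (2 * K2 + 1)))"
  have "0 < et" "2 * et <= dl 0" using dl_pos[of 0] K2 by (auto simp: et_def)
  from ev_thin[OF this] show ?thesis by eventually_elim (use carpet_level.L_asp[OF lev] in "auto simp: et_def CA_def")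
 qed
 \<comment> \<open>All data of one mesh in a single family: values of the map, corners and sides of
   the squares, and the height of the rectangle.\<close>
 define G :: "nat => complex + nat + nat + unit => complex" where
  "G n j = (case j of Inl z => if z : carpet Om Q then f' n z else 0 | Inr j' => (case j' of Inl i => if 1 <= i then q' n i else 0
   | Inr j'' => (case j'' of Inl i => if 1 <= i then of_real (w' n i) else 0 | Inr _ => of_real (a' n))))" for n j
 have "\<forall>\<^sub>F n in sequentially. ALL j. norm (G n j) <= 1 + CA" using ev_a
 proof eventually_elim
  case (elim n)
  have 1: "norm z <= 1 + CA" if "0 <= Re z" "Re z <= 1" "0 <= Im z" "Im z <= a' n" for z using cmod_le[of z] that elim by linarith
  have 0: "0 < a' n" using elim CA by (smt (verit) mult_nonpos_nonneg)
  have "norm (q' n i) <= 1 + CA & \<bar>w' n i\<bar> <= 1 + CA" if "1 <= i" for i using carpet_level.L_q[OF lev that, of n] 1[of "q' n i"] CA by auto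
  moreover have "norm (f' n z) <= 1 + CA" if "z : carpet Om Q" for z using carpet_level.L_f[OF lev that, of n] 1 by blast
  ultimately show ?case using 0 elim CA unfolding G_def by (auto split: sum.splits)
 qed
 then obtain \<F> F where \<F>: "\<F> ~= bot" "\<F> <= sequentially" "!!j. ((%n. G n j) \<longlongrightarrow> F j) \<F>" using cluster_filter by blast
 define f where "f z = F (Inl z)" for z
 define q where "q i = F (Inr (Inl i))" for i
 define w where "w i = Re (F (Inr (Inr (Inl i))))" for i
 define a where "a = Re (F (Inr (Inr (Inr ()))))"
 have Tf: "((%n. f' n z) \<longlongrightarrow> f z) \<F>" if "z : carpet Om Q" for z using \<F>(3)[of "Inl z"] that by (simp add: G_def f_def)
 have Tq: "((%n. q' n i) \<longlongrightarrow> q i) \<F>" if "1 <= i" for i using \<F>(3)[of "Inr (Inl i)"] that by (simp add: G_def q_def)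
 have Tw: "((%n. w' n i) \<longlongrightarrow> w i) \<F>" if "1 <= i" for i using tendsto_Re[OF \<F>(3)[of "Inr (Inr (Inl i))"]] that by (simp add: G_def w_def)
 have Ta: "(a' \<longlongrightarrow> a) \<F>" using tendsto_Re[OF \<F>(3)[of "Inr (Inr (Inr ()))"]] by (simp add: G_def a_def)
 have TfR: "((%n. Re (f' n z)) \<longlongrightarrow> Re (f z)) \<F>" "((%n. Im (f' n z)) \<longlongrightarrow> Im (f z)) \<F>" if "z : carpet Om Q" for z
  by (intro tendsto_Re tendsto_Im Tf that)+
 have TqR: "((%n. Re (q' n i)) \<longlongrightarrow> Re (q i)) \<F>" "((%n. Im (q' n i)) \<longlongrightarrow> Im (q i)) \<F>" if "1 <= i" for i
  by (intro tendsto_Re tendsto_Im Tq that)+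
 have ev: "eventually P \<F>" if "eventually P sequentially" for P by (rule filter_leD[OF \<F>(2) that])
 have le: "y <= x" if "(g \<longlongrightarrow> y) \<F>" "(h \<longlongrightarrow> x) \<F>" "\<forall>\<^sub>F n in sequentially. g n <= h n" for g h :: "nat => real" and x y
  by (rule tendsto_le[OF \<F>(1) that(2,1) ev[OF that(3)]])
 have bnd: "\<forall>\<^sub>F n in sequentially. dinf (f' n y) (f' n x) <= 1 + CA" if "x : carpet Om Q" "y : carpet Om Q" for x y using ev_a
 proof eventually_elim
  case (elim n)
  show ?case using carpet_level.L_f[OF lev that(1), of n] carpet_level.L_f[OF lev that(2), of n] elim unfolding dinf_def by (auto simp: max_def)
 qed
 have base: "EX et>0. et <= b & (\<forall>\<^sub>F n in sequentially. thinr (ep n) et & ep n < b)" if "0 < b" for b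
 proof -
  have "0 < min b (dl 0 / 2)" "2 * min b (dl 0 / 2) <= dl 0" using that dl_pos[of 0] by auto
  from ev_thin[OF this] have "\<forall>\<^sub>F n in sequentially. thinr (ep n) (min b (dl 0 / 2)) & ep n < b" using ev_small[OF that] by eventually_elim simp
  thus ?thesis using that dl_pos[of 0] by (intro exI[of _ "min b (dl 0 / 2)"]) auto
 qed
 have a_pos: "0 < a"
 proof -
  have "\<forall>\<^sub>F n in sequentially. 1 / CA <= a' n" using ev_a by eventually_elim (use CA in "simp add: field_simps")
  hence "1 / CA <= a" by (rule le[OF tendsto_const Ta])
  thus ?thesis using CA by (smt (verit) divide_pos_pos)
 qed
 have key: "M * dinf (f z) (f x) <= dinf (f y) (f x)"
  if M: "1 <= M" and xyz: "x : carpet Om Q" "y : carpet Om Q" "z : carpet Om Q" "x ~= y" and d: "keyH K2 K3 M * (1 + K2) * dist x z <= dist x y" for M x y z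
 proof -
  define r0 where "r0 = dist x y / keyH K2 K3 M"
  have r0: "0 < r0" "keyH K2 K3 M * r0 <= dist x y" using keyH_pos[of M] xyz(4) by (auto simp: r0_def)
  have d': "(1 + K2) * dist x z <= r0" using d keyH_pos[of M] by (simp add: r0_def pos_le_divide_eq mult_ac)
  obtain et where et: "0 < et" "et <= r0 / 8" "\<forall>\<^sub>F n in sequentially. thinr (ep n) et & ep n < r0 / 8" using base[of "r0 / 8"] r0 by auto
  have "\<forall>\<^sub>F n in sequentially. M * dinf (f' n z) (f' n x) <= dinf (f' n y) (f' n x)" using et(3)
  proof eventually_elim
   case (elim n)
   show ?case by (rule carpet_level.L_key[OF lev M, of n et r0]) (use elim et r0 d' xyz in auto)
  qed
  thus ?thesis by (rule le[rotated 2]) (intro tendsto_mult_left tendsto_dinf Tf xyz)+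
 qed
 have cor: "f (cor_pt k) = rect_corner k a" if k: "k < 4" for k
 proof -
  obtain y where y: "y : carpet Om Q" "y ~= cor_pt k" using other_point by blast
  have "M * dinf (rect_corner k a) (f (cor_pt k)) <= 1 + CA" if M: "1 <= M" for M
  proof -
   define r0 where "r0 = dist (cor_pt k) y / keyH K2 K3 M"
   have r0: "0 < r0" "keyH K2 K3 M * r0 <= dist (cor_pt k) y" using keyH_pos[of M] y by (auto simp: r0_def)
   obtain et where et: "0 < et" "et <= r0 / 8" "\<forall>\<^sub>F n in sequentially. thinr (ep n) et & ep n < r0 / 8" using base[of "r0 / 8"] r0 by auto
   have 1: "\<forall>\<^sub>F n in sequentially. M * dinf (rect_corner k (a' n)) (f' n (cor_pt k)) <= 1 + CA"
    using et(3) bnd[OF cor_carpet[OF k] y(1)]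
   proof eventually_elim
    case (elim n)
    have "M * dinf (rect_corner k (a' n)) (f' n (cor_pt k)) <= dinf (f' n y) (f' n (cor_pt k))"
     by (rule carpet_level.L_cor[OF lev M, of n et r0]) (use elim et r0 y k in auto)
    thus ?case using elim by linarith
   qed
   have "((%n. rect_corner k (a' n)) \<longlongrightarrow> rect_corner k a) \<F>"
    unfolding rect_corner_def by (cases "k = 2 | k = 3") (auto intro!: tendsto_Complex Ta)
   thus ?thesis by (intro le[OF _ tendsto_const 1] tendsto_mult_left tendsto_dinf Tf cor_carpet k)
  qed
  hence "dinf (rect_corner k a) (f (cor_pt k)) <= 0" by (rule multiples_bounded_imp_nonpos)
  thus ?thesis using dinf_0 by force
 qed
 have bd: "Re (q i) <= Re (f x) & Re (f x) <= Re (q i) + w i & Im (q i) <= Im (f x) & Im (f x) <= Im (q i) + w i"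
  if i: "1 <= i" and x: "x : frontier (Q i)" for i x
 proof -
  have xS: "x : carpet Om Q" using frontier_sub_carpet x by blast
  obtain y where y: "y : carpet Om Q" "y ~= x" using other_point by blast
  have bQ: "(SOME z. z : Q i) : Q i" using Q_props(4)[OF i] by (simp add: some_in_eq)
  have evM: "\<forall>\<^sub>F n in sequentially. M * (Re (q' n i) - Re (f' n x)) <= 1 + CA & M * (Re (f' n x) - (Re (q' n i) + w' n i)) <= 1 + CA &
   M * (Im (q' n i) - Im (f' n x)) <= 1 + CA & M * (Im (f' n x) - (Im (q' n i) + w' n i)) <= 1 + CA" if M: "1 <= M" for M
  proof -
   define r0 where "r0 = dist x y / keyH K2 K3 M"
   have r0: "0 < r0" "keyH K2 K3 M * r0 <= dist x y" using keyH_pos[of M] y by (auto simp: r0_def)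
   define et' where "et' = r0 / (8 * (1 + K2))"
   have et'0: "0 < et'" "(1 + K2) * et' = r0 / 8" unfolding et'_def using r0 K2 cancel_eighth[of "1 + K2"] by auto
   obtain r where r: "0 < r" "approach (Q i) (SOME z. z : Q i) x et' r" "ball (SOME z. z : Q i) r <= Q i"
    using approach_exists[OF x bQ et'0(1)] by blast
   define b where "b = min (r0 / 8) (min (r / 2) et')"
   have "0 < b" using r0 r et'0 by (simp add: b_def)
   then obtain et where et: "0 < et" "et <= b" "\<forall>\<^sub>F n in sequentially. thinr (ep n) et & ep n < b" using base by blast
   show ?thesis using et(3) bnd[OF xS y(1)]
   proof eventually_elim
    case (elim n)
    have "(1 + K2) * (2 * et' + 2 * ep n) <= (1 + K2) * (4 * et')" using elim K2 by (intro mult_left_mono) (auto simp: b_def)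
    hence small: "(1 + K2) * (2 * et' + 2 * ep n) <= r0" using et'0(2) r0(1) by (simp)
    have "EX p. Re (q' n i) <= Re p & Re p <= Re (q' n i) + w' n i & Im (q' n i) <= Im p & Im p <= Im (q' n i) + w' n i &
      M * dinf p (f' n x) <= dinf (f' n y) (f' n x)"
     by (rule carpet_level.L_bd[OF lev M, of n et r0 i x y et' r]) (use elim et r0 i x y r small in "auto simp: b_def")
    then obtain p where p: "Re (q' n i) <= Re p" "Re p <= Re (q' n i) + w' n i" "Im (q' n i) <= Im p" "Im p <= Im (q' n i) + w' n i"
      "M * dinf p (f' n x) <= 1 + CA" using elim by force
    have mt: "M * t <= 1 + CA" if "t <= dinf p (f' n x)" for t using mult_left_mono[OF that, of M] M p(5) by linarith
    show ?case using abs_le_dinf[of p "f' n x"] p(1-4) by (intro conjI mt) linarith+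
   qed
  qed
  have np: "t <= 0" if "(g \<longlongrightarrow> t) \<F>" "!!M. 1 <= M ==> \<forall>\<^sub>F n in sequentially. M * g n <= 1 + CA" for g t
   by (rule multiples_bounded_imp_nonpos) (rule le[OF tendsto_mult_left[OF that(1)] tendsto_const that(2)])
  have "Re (q i) - Re (f x) <= 0" by (rule np[OF tendsto_diff[OF TqR(1)[OF i] TfR(1)[OF xS]]]) (rule eventually_mono[OF evM], auto)
  moreover have "Re (f x) - (Re (q i) + w i) <= 0"
   by (rule np[OF tendsto_diff[OF TfR(1)[OF xS] tendsto_add[OF TqR(1)[OF i] Tw[OF i]]]]) (rule eventually_mono[OF evM], auto)
  moreover have "Im (q i) - Im (f x) <= 0" by (rule np[OF tendsto_diff[OF TqR(2)[OF i] TfR(2)[OF xS]]]) (rule eventually_mono[OF evM], auto)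
  moreover have "Im (f x) - (Im (q i) + w i) <= 0"
   by (rule np[OF tendsto_diff[OF TfR(2)[OF xS] tendsto_add[OF TqR(2)[OF i] Tw[OF i]]]]) (rule eventually_mono[OF evM], auto)
  ultimately show ?thesis by auto
 qed
 have obd: "Re (f x) = 0 | Re (f x) = 1 | Im (f x) = 0 | Im (f x) = a" if x: "x : frontier Om" for x
 proof (cases "EX k<4. x = cor_pt k")
  case True
  thus ?thesis using cor by (auto simp: rect_corner_def)
 next
  case False
  have xS: "x : carpet Om Q" by (rule frontier_carpet[OF x])
  obtain y where y: "y : carpet Om Q" "y ~= x" using other_point by blast
  \<comment> \<open>A base point of the exterior that lies beyond every grid, whose cells stay
    within \<open>11 * dl 0\<close> of \<open>c\<close>.\<close>
  define u where "u = c + of_real (20 * dl 0)"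
  have du: "dist c u = 20 * dl 0" using dl_pos[of 0] by (simp add: u_def dist_norm)
  have uQ: "u : Q 0" using near_c[of u] du dl_pos[of 0] by (auto simp: Q0)
  define dm where "dm = Min ((%k. dist x (cor_pt k)) ` {..<4})"
  have dm: "0 < dm" "!!k. k < 4 ==> dm <= dist x (cor_pt k)" unfolding dm_def using False by (auto simp: lessThan_empty_iff)
  define g where "g n = min (min \<bar>Re (f' n x)\<bar> \<bar>Re (f' n x) - 1\<bar>) (min \<bar>Im (f' n x)\<bar> \<bar>Im (f' n x) - a' n\<bar>)" for n
  define g0 where "g0 = min (min \<bar>Re (f x)\<bar> \<bar>Re (f x) - 1\<bar>) (min \<bar>Im (f x)\<bar> \<bar>Im (f x) - a\<bar>)"
  have Tg: "(g \<longlongrightarrow> g0) \<F>" unfolding g_def g0_def by (intro tendsto_min tendsto_rabs tendsto_diff TfR xS Ta tendsto_const)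
  have "M * g0 <= 1 + CA" if M: "1 <= M" for M
  proof -
   define r0 where "r0 = dist x y / keyH K2 K3 M"
   have r0: "0 < r0" "keyH K2 K3 M * r0 <= dist x y" using keyH_pos[of M] y by (auto simp: r0_def)
   define et' where "et' = min (r0 / (8 * (1 + K2))) (dm / 8)"
   have "0 < r0 / (8 * (1 + K2))" using r0 K2 by simp
   hence et'0: "0 < et'" "et' <= dm / 8" using dm(1) unfolding et'_def by (simp, intro min.cobounded2)
   have "(1 + K2) * et' <= (1 + K2) * (r0 / (8 * (1 + K2)))" using K2 by (intro mult_left_mono) (auto simp: et'_def)
   also have "... = r0 / 8" by (rule cancel_eighth) (use K2 in linarith)
   finally have et'1: "(1 + K2) * et' <= r0 / 8" .
   have x0: "x : frontier (Q 0)" using x frontier_Q0 by simp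
   obtain r where r: "0 < r" "approach (Q 0) u x et' r" using approach_exists[OF x0 uQ et'0(1)] by blast
   define b where "b = min (min (r0 / 8) (dm / 32)) (min (r / 16) et')"
   have "0 < b" using r0 r et'0 by (simp add: b_def)
   then obtain et where et: "0 < et" "et <= b" "\<forall>\<^sub>F n in sequentially. thinr (ep n) et & ep n < b" using base by blast
   have "\<forall>\<^sub>F n in sequentially. M * g n <= 1 + CA" using et(3) bnd[OF xS y(1)]
   proof eventually_elim
    case (elim n)
    have b: "et <= r0 / 8" "et <= dm / 32" "et <= r / 16" "ep n < r0 / 8" "ep n < dm / 32" "ep n < r / 16" "ep n < et'"
     using elim(1) et(2) by (auto simp: b_def)
    have "(1 + K2) * (2 * et' + 2 * ep n) <= (1 + K2) * (4 * et')" using b K2 by (intro mult_left_mono) auto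
    hence small: "(1 + K2) * (2 * et' + 2 * ep n) <= r0" using et'1 r0(1) by (simp)
    have cr: "2 * et' + 4 * et + 4 * ep n < dist x (cor_pt k)" if "k < 4" for k using dm(2)[OF that] b et'0 by linarith
    have "EX p. (Re p = 0 | Re p = 1 | Im p = 0 | Im p = a' n) & M * dinf p (f' n x) <= dinf (f' n y) (f' n x)"
     by (rule carpet_level.L_obd[OF lev M, of n et r0 x y u et' r]) (use elim(1) b et(1) r0 x y r small du cr in auto)
    then obtain p where p: "Re p = 0 | Re p = 1 | Im p = 0 | Im p = a' n" "M * dinf p (f' n x) <= 1 + CA" using elim(2) by force
    have "g n <= \<bar>Re (f' n x)\<bar>" "g n <= \<bar>Re (f' n x) - 1\<bar>" "g n <= \<bar>Im (f' n x)\<bar>" "g n <= \<bar>Im (f' n x) - a' n\<bar>"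
     unfolding g_def by (simp_all add: min_le_iff_disj)
    hence "g n <= dinf p (f' n x)" using p(1) abs_le_dinf[of p "f' n x"] by (elim disjE) linarith+
    hence "M * g n <= M * dinf p (f' n x)" using M by (intro mult_left_mono) auto
    thus ?case using p(2) by linarith
   qed
   thus ?thesis by (rule le[OF tendsto_mult_left[OF Tg] tendsto_const])
  qed
  hence "g0 <= 0" by (rule multiples_bounded_imp_nonpos)
  thus ?thesis unfolding g0_def by (auto simp: min_def split: if_splits)
 qed
 have out: "Re (f x) <= Re (q i) | Re (q i) + w i <= Re (f x) | Im (f x) <= Im (q i) | Im (q i) + w i <= Im (f x)"
  if i: "1 <= i" and x: "x : carpet Om Q" for i x
 proof -
  obtain y where y: "y : carpet Om Q" "y ~= x" using other_point by blast
  have kp: "0 < 2 * K2 + 1" "0 < dl 0 / (2 * K2)" using K2 dl_pos[of 0] by auto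
  define R where "R = min (dist y x) (dl 0 / (2 * K2)) / (4 * (2 * K2 + 1))"
  have R0: "0 < R" using y kp by (simp add: R_def)
  have R1: "4 * ((2 * K2 + 1) * R) = min (dist y x) (dl 0 / (2 * K2))"
  proof -
   have "z / k * k = z" if "k ~= 0" for z k :: real using that by simp
   from this[of "4 * (2 * K2 + 1)" "min (dist y x) (dl 0 / (2 * K2))"] have "R * (4 * (2 * K2 + 1)) = min (dist y x) (dl 0 / (2 * K2))"
    unfolding R_def using kp(1) by (metis less_irrefl mult_eq_0_iff zero_neq_numeral)
   thus ?thesis by (simp only: mult_ac)
  qed
  have R2: "2 * ((2 * K2 + 1) * R) < dl 0 / (2 * K2)" "(2 * K2 + 1) * R < dist y x" using R1 mult_pos_pos[OF kp(1) R0] by linarith+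
  obtain et where et: "0 < et" "et <= R" "\<forall>\<^sub>F n in sequentially. thinr (ep n) et & ep n < R" using base[OF R0] by blast
  \<comment> \<open>The disjunction is encoded as nonnegativity of a continuous function, which
    limits preserve.\<close>
  define g where "g F Q W = max (max (Re Q - Re F) (Re F - (Re Q + W))) (max (Im Q - Im F) (Im F - (Im Q + W)))" for F Q W
  have "((%n. g (f' n x) (q' n i) (w' n i)) \<longlongrightarrow> g (f x) (q i) (w i)) \<F>"
   unfolding g_def by (intro tendsto_max tendsto_diff tendsto_add TfR TqR Tw x i)
  moreover have "\<forall>\<^sub>F n in sequentially. 0 <= g (f' n x) (q' n i) (w' n i)" using et(3)
  proof eventually_elim
   case (elim n)
   show ?case using carpet_level.L_out[OF lev i x _ et(2) R2, of n] elim unfolding g_def by (auto simp: max_def)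
  qed
  ultimately have "0 <= g (f x) (q i) (w i)" by (rule le[OF tendsto_const])
  thus ?thesis unfolding g_def by (auto)
 qed
 have disj: "Re (q i) + w i <= Re (q j) | Re (q j) + w j <= Re (q i) | Im (q i) + w i <= Im (q j) | Im (q j) + w j <= Im (q i)"
  if ij: "1 <= i" "1 <= j" "i ~= j" "0 < w i" "0 < w j" for i j
 proof -
  define g where "g Q Q' W W' = max (max (Re Q' - (Re Q + W)) (Re Q - (Re Q' + W'))) (max (Im Q' - (Im Q + W)) (Im Q - (Im Q' + W')))" for Q Q' W W'
  have "((%n. g (q' n i) (q' n j) (w' n i) (w' n j)) \<longlongrightarrow> g (q i) (q j) (w i) (w j)) \<F>"
   unfolding g_def by (intro tendsto_max tendsto_diff tendsto_add TqR Tw ij)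
  moreover have "\<forall>\<^sub>F n in \<F>. 0 <= g (q' n i) (q' n j) (w' n i) (w' n j)"
   using order_tendstoD(1)[OF Tw[OF ij(1)] ij(4)] order_tendstoD(1)[OF Tw[OF ij(2)] ij(5)]
  proof eventually_elim
   case (elim n)
   show ?case using carpet_level.L_disj[OF lev ij(1-3), of n] elim unfolding g_def by (auto simp: max_def)
  qed
  ultimately have "0 <= g (q i) (q j) (w i) (w j)" by (rule tendsto_lowerbound[OF _ _ \<F>(1)])
  thus ?thesis unfolding g_def by (auto)
 qed
 have "carpet_limit Om Q K2 K3 c e s f q w a"
 proof unfold_locales
  show "0 <= Re (f x) & Re (f x) <= 1 & 0 <= Im (f x) & Im (f x) <= a" if x: "x : carpet Om Q" for x
   using carpet_level.L_f[OF lev x] le[OF tendsto_const TfR(1)[OF x]] le[OF TfR(1)[OF x] tendsto_const]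
    le[OF tendsto_const TfR(2)[OF x]] le[OF TfR(2)[OF x] Ta] by simp
  show "0 <= w i & 0 <= Re (q i) & Re (q i) + w i <= 1 & 0 <= Im (q i) & Im (q i) + w i <= a" if i: "1 <= i" for i
   using carpet_level.L_q[OF lev i] le[OF tendsto_const Tw[OF i]] le[OF tendsto_const TqR(1)[OF i]]
    le[OF tendsto_add[OF TqR(1)[OF i] Tw[OF i]] tendsto_const] le[OF tendsto_const TqR(2)[OF i]]
    le[OF tendsto_add[OF TqR(2)[OF i] Tw[OF i]] Ta] by simp
 qed (fact a_pos | rule key disj out cor bd obd; assumption)+
 thus ?thesis by blast
qed

end

section \<open>Majorants that are increasing homeomorphisms\<close>

text \<open>\<open>\<phi>\<close> regularises \<open>B\<close> by a supremum over rescaled ramps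
  \<open>p\<close>: it lies between \<open>B t\<close> and \<open>B (2 * t)\<close>, is monotone and
  locally Lipschitz. Adding the identity makes it strictly increasing and onto.\<close>

lemma increasing_homeomorphism_majorant:
 fixes B :: "real => real"
 assumes mono: "!!s t. 0 < s ==> s <= t ==> B s <= B t" and nn: "!!t. 0 < t ==> 0 <= B t"
  and small: "!!e. 0 < e ==> EX t>0. B t <= e"
 obtains et where "increasing_homeomorphism et" "!!t. 0 < t ==> B t <= et t"
proof -
 define p where "p r = min 1 (max 0 (2 * r - 1))" for r :: real
 have p: "0 <= p r" "p r <= 1" for r by (auto simp: p_def)
 have p1: "p r = 1" if "1 <= r" for r using that by (simp add: p_def)
 have p0: "p r = 0" if "2 * r <= 1" for r using that by (simp add: p_def)
 have pmono: "p r <= p r'" if "r <= r'" for r r' using that by (auto simp: p_def)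
 have plip: "p r <= p r' + 2 * \<bar>r - r'\<bar>" for r r' by (auto simp: p_def abs_if)
 define \<phi> where "\<phi> t = (SUP u\<in>{0<..}. B u * p (t / u))" for t
 have bd: "B u * p (t / u) <= B (2 * t)" if t: "0 < t" and u: "0 < u" for t u
 proof (cases "u <= 2 * t")
  case True
  have "B u * p (t / u) <= B u * 1" using nn[OF u] p by (intro mult_left_mono) auto
  thus ?thesis using mono[OF u True] by simp
 next
  case False
  hence "p (t / u) = 0" using u by (intro p0) (simp)
  thus ?thesis using nn[of "2 * t"] t by simp
 qed
 have bdd: "bdd_above ((%u. B u * p (t / u)) ` {0<..})" if "0 < t" for t using bd[OF that] by (intro bdd_aboveI2) auto
 have up: "B u * p (t / u) <= \<phi> t" if "0 < t" "0 < u" for t u unfolding \<phi>_def using that bdd by (intro cSUP_upper) auto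
 have least: "\<phi> t <= C" if "!!u. 0 < u ==> B u * p (t / u) <= C" for t C unfolding \<phi>_def using that by (intro cSUP_least) auto
 have ge: "B t <= \<phi> t" if "0 < t" for t using up[OF that that] that p1[of 1] by simp
 have le2: "\<phi> t <= B (2 * t)" if "0 < t" for t by (rule least) (rule bd[OF that])
 have nonneg: "0 <= \<phi> t" if "0 < t" for t using ge[OF that] nn[OF that] by linarith
 have \<phi>mono: "\<phi> t <= \<phi> t'" if t: "0 < t" "t <= t'" for t t'
 proof (rule least)
  fix u :: real assume u: "0 < u"
  have "B u * p (t / u) <= B u * p (t' / u)" using nn[OF u] t u by (intro mult_left_mono pmono divide_right_mono) auto
  also have "... <= \<phi> t'" using t u by (intro up) auto
  finally show "B u * p (t / u) <= \<phi> t'" .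
 qed
 have lip: "\<phi> t <= \<phi> t' + (4 * B (4 * t0) / t0) * \<bar>t - t'\<bar>"
  if t: "0 < t0" "t0 / 2 <= t" "t <= 2 * t0" "t0 / 2 <= t'" "t' <= 2 * t0" for t t' t0
 proof (rule least)
  fix u :: real assume u: "0 < u"
  have t'0: "0 < t'" "0 < t" using t by linarith+
  have L0: "0 <= (4 * B (4 * t0) / t0) * \<bar>t - t'\<bar>" using nn[of "4 * t0"] t(1) by (intro mult_nonneg_nonneg divide_nonneg_pos) auto
  consider "u <= t0 / 2" | "t0 / 2 < u" "u <= 4 * t0" | "4 * t0 < u" by linarith
  thus "B u * p (t / u) <= \<phi> t' + (4 * B (4 * t0) / t0) * \<bar>t - t'\<bar>"
  proof cases
   case 1
   hence "p (t / u) = 1" "p (t' / u) = 1" using t u by (auto intro!: p1)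
   thus ?thesis using up[OF t'0(1) u] L0 by simp
  next
   case 2
   have "\<bar>t / u - t' / u\<bar> = \<bar>t - t'\<bar> / u" using u by (simp add: diff_divide_distrib[symmetric])
   also have "... <= \<bar>t - t'\<bar> / (t0 / 2)" using 2 t by (intro divide_left_mono) auto
   finally have "2 * \<bar>t / u - t' / u\<bar> <= 2 * (\<bar>t - t'\<bar> / (t0 / 2))" by (rule mult_left_mono) simp
   hence "p (t / u) <= p (t' / u) + 2 * (\<bar>t - t'\<bar> / (t0 / 2))" by (rule order_trans[OF plip add_left_mono])
   hence "B u * p (t / u) <= B u * (p (t' / u) + 2 * (\<bar>t - t'\<bar> / (t0 / 2)))" using nn[OF u] by (intro mult_left_mono)
   also have "... = B u * p (t' / u) + B u * (2 * (\<bar>t - t'\<bar> / (t0 / 2)))" by (simp add: distrib_left)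
   also have "... <= \<phi> t' + B (4 * t0) * (2 * (\<bar>t - t'\<bar> / (t0 / 2)))"
    using up[OF t'0(1) u] mono[OF u 2(2)] t by (intro add_mono mult_right_mono) auto
   also have "B (4 * t0) * (2 * (\<bar>t - t'\<bar> / (t0 / 2))) = (4 * B (4 * t0) / t0) * \<bar>t - t'\<bar>" by simp
   finally show ?thesis .
  next
   case 3
   hence "p (t / u) = 0" using t by (intro p0) (simp)
   thus ?thesis using nonneg[OF t'0(1)] L0 by simp
  qed
 qed
 define et where "et t = t + \<phi> t" for t
 have "isCont \<phi> t0" if t0: "0 < t0" for t0
 proof -
  define C where "C = 4 * B (4 * t0) / t0"
  have "\<forall>\<^sub>F t in at t0. dist (\<phi> t) (\<phi> t0) <= C * \<bar>t - t0\<bar>" unfolding eventually_at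
  proof (intro exI[of _ "t0 / 2"] conjI ballI impI)
   fix t assume "t ~= t0 & dist t t0 < t0 / 2"
   hence "\<bar>t - t0\<bar> < t0 / 2" by (simp add: dist_real_def)
   hence "t0 / 2 <= t" "t <= 2 * t0" by linarith+
   thus "dist (\<phi> t) (\<phi> t0) <= C * \<bar>t - t0\<bar>"
    using lip[OF t0, of t t0] lip[OF t0, of t0 t] unfolding C_def dist_real_def abs_minus_commute[of t0 t] by linarith
  qed (use t0 in simp)
  note ev = this
  have "((%t. C * \<bar>t - t0\<bar>) \<longlongrightarrow> C * \<bar>t0 - t0\<bar>) (at t0)" by (intro tendsto_intros)
  hence z: "((%t. C * \<bar>t - t0\<bar>) \<longlongrightarrow> 0) (at t0)" by simp
  have "\<forall>\<^sub>F t in at t0. 0 <= dist (\<phi> t) (\<phi> t0)" by simp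
  hence "((%t. dist (\<phi> t) (\<phi> t0)) \<longlongrightarrow> 0) (at t0)" by (rule tendsto_sandwich[OF _ ev tendsto_const z])
  thus ?thesis unfolding isCont_def by (rule tendsto_dist_iff[THEN iffD2])
 qed
 hence cont: "continuous_on {0<..} et" unfolding et_def by (intro continuous_on_add continuous_on_id continuous_at_imp_continuous_on) auto
 have smono: "et t < et t'" if "0 < t" "t < t'" for t t' using \<phi>mono[of t t'] that by (simp add: et_def)
 have smo: "strict_mono_on {0<..} et" using smono by (auto intro!: strict_mono_onI)
 hence inj: "inj_on et {0<..}" by (rule strict_mono_on_imp_inj_on)
 have img: "et ` {0<..} = {0<..}"
 proof
  show "et ` {0<..} <= {0<..}" using nonneg by (auto simp: et_def add_pos_nonneg)
  show "{0<..} <= et ` {0<..}"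
  proof
   fix y :: real assume "y : {0<..}"
   hence y: "0 < y" by simp
   obtain t where t: "0 < t" "B t <= y / 2" using small[of "y / 2"] y by auto
   define t1 where "t1 = min (t / 2) (y / 2)"
   have t1: "0 < t1" "2 * t1 <= t" "t1 <= y / 2" using t y by (auto simp: t1_def)
   have "\<phi> t1 <= y / 2" using le2[OF t1(1)] mono[of "2 * t1" t] t1 t by simp
   hence lo: "et t1 <= y" using t1 by (simp add: et_def)
   have hi: "y <= et y" using nonneg[OF y] by (simp add: et_def)
   have "continuous_on {t1..y} et" by (rule continuous_on_subset[OF cont]) (use t1 in auto)
   then obtain x where "t1 <= x" "x <= y" "et x = y" using IVT'[of et t1 y y] lo hi t1 y by auto
   thus "y : et ` {0<..}" using t1 by force
  qed
 qed
 obtain g where "homeomorphism {0<..} (et ` {0<..}) et g" using invariance_of_domain_homeomorphism[OF _ cont _ inj] by auto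
 hence "increasing_homeomorphism et" unfolding increasing_homeomorphism_def img using smo by blast
 moreover have "B t <= et t" if "0 < t" for t using ge[OF that] that by (simp add: et_def)
 ultimately show thesis using that by blast
qed

section \<open>Connectedness of the carpet\<close>

text \<open>In a separation of \<open>A - U\<close> the connected boundary of \<open>U\<close> lies
  on one side; adding \<open>closure U\<close> to that side separates \<open>A\<close>.\<close>

lemma connected_diff_open:
 fixes A U :: "'a::topological_space set"
 assumes A: "connected A" "closed A" and U: "open U" "closure U <= A" "connected (frontier U)" "frontier U ~= {}"
 shows "connected (A - U)" unfolding connected_closed
proof (rule notI, elim exE conjE)
 fix C D assume CD: "closed C" "closed D" "A - U <= C Un D" "C Int D Int (A - U) = {}" "C Int (A - U) ~= {}" "D Int (A - U) ~= {}"
 have sub: "frontier U <= A - U" using U(1,2) by (auto simp: frontier_def interior_open)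
 have cAU: "closed (A - U)" using A(2) U(1) by (rule closed_Diff)
 have cu: "closure U = U Un frontier U" using closure_Un_frontier[of U] by blast
 have split: False
  if CD: "closed C" "closed D" "A - U <= C Un D" "C Int D Int (A - U) = {}" "D Int (A - U) ~= {}" and f: "frontier U <= C" for C D
 proof -
  have "closed ((C Int (A - U)) Un closure U)" "closed (D Int (A - U))" using CD cAU by (auto intro!: closed_Int)
  moreover have "A <= ((C Int (A - U)) Un closure U) Un (D Int (A - U))" using CD(3) closure_subset[of U] by blast
  moreover have "((C Int (A - U)) Un closure U) Int (D Int (A - U)) Int A = {}" using CD(4) f unfolding cu by blast
  moreover have "((C Int (A - U)) Un closure U) Int A ~= {}" using U(2,4) cu by blast
  moreover have "(D Int (A - U)) Int A ~= {}" using CD(5) by blast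
  ultimately show False using A(1) unfolding connected_closed by blast
 qed
 have "frontier U <= C | frontier U <= D"
 proof (rule ccontr)
  assume "~ ?thesis"
  hence "C Int frontier U ~= {}" "D Int frontier U ~= {}" "frontier U <= C Un D" "C Int D Int frontier U = {}" using CD(3,4) sub by blast+
  thus False using U(3) CD(1,2) unfolding connected_closed by blast
 qed
 thus False
 proof
  assume "frontier U <= C" thus False using split[OF CD(1,2,3,4,6)] by blast
 next
  assume f: "frontier U <= D"
  have "A - U <= D Un C" "D Int C Int (A - U) = {}" using CD(3,4) by blast+
  thus False using split[OF CD(2,1) _ _ CD(5) f] by blast
 qed
qed

context carpet_setup begin

lemma carpet_compact: "compact (carpet Om Q)"
proof -
 have "compact (closure Om - (UN i:{1..}. Q i))" using Om_props open_Q by (intro compact_diff) auto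
 thus ?thesis by (simp add: carpet_def)
qed

text \<open>The carpet is the intersection of a decreasing sequence of compact connected sets, each
  obtained from the previous one by removing one \<open>Q i\<close>.\<close>

lemma carpet_connected: "connected (carpet Om Q)"
proof -
 define S where "S n = closure Om - (UN i:{1..n}. Q i)" for n
 have S: "compact (S n)" for n unfolding S_def using Om_props open_Q by (intro compact_diff) auto
 have con: "connected (S n)" for n
 proof (induction n)
  case 0 thus ?case using Om_props by (simp add: S_def connected_imp_connected_closure)
 next
  case (Suc n)
  have eq: "S (Suc n) = S n - Q (Suc n)" by (auto simp: S_def atLeastAtMostSuc_conv)
  have "closure (Q (Suc n)) <= closure Om" using closure_Q_sub[of "Suc n"] closure_subset[of Om] by auto
  moreover have "closure (Q (Suc n)) Int Q i = {}" if "i : {1..n}" for i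
   using closure_disj[of "Suc n" i] that closure_subset[of "Q i"] by auto
  ultimately have sub: "closure (Q (Suc n)) <= S n" unfolding S_def by blast
  have "frontier (Q (Suc n)) ~= {}" using dl_pos[of "Suc n"] unfolding dl_def by (auto)
  thus ?case unfolding eq using Suc compact_imp_closed[OF S] open_Q sub jordan_curve_connected[OF jordan_frontier] by (intro connected_diff_open) auto
 qed
 have "connected (\<Inter> (range S))" by (rule connected_nest[OF S con]) (auto simp: S_def)
 moreover have "\<Inter> (range S) = carpet Om Q" unfolding S_def carpet_def by force
 ultimately show ?thesis by simp
qed

end

section \<open>The control function\<close>

definition qsH :: "real => real => real" where "qsH K2 K3 = keyH K2 K3 1 * (1 + K2)"

text \<open>Infimum of the available bounds for the distortion at ratio \<open>t\<close>: a packing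
  bound valid for every \<open>t\<close>, and \<open>2 / M\<close> whenever \<open>t\<close> is
  small enough for the estimate with factor \<open>M\<close>. The latter make the values arbitrarily
  small near 0.\<close>

definition qsB :: "real => real => real => real" where
 "qsB K2 K3 t = Inf ({2 * 3 ^ (nat \<lceil>(2 * (qsH K2 K3)^3 * t + 1)^2\<rceil> + 1)} Un {2 / M | M. 1 <= M & keyH K2 K3 M * (1 + K2) * t <= 1})"

lemma keyH_nonneg: "0 < K2 ==> 0 < K3 ==> 0 < keyH K2 K3 M" unfolding keyH_def by (simp add: add_pos_pos)

lemma qsB_bdd: "bdd_below ({2 * 3 ^ n} Un {2 / M | M. 1 <= M & P M})" for P :: "real => bool" by (intro bdd_belowI[of _ 0]) auto

lemma qs_majorant:
 assumes K: "0 < K2" "0 < K3"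
 obtains et where "increasing_homeomorphism et" "!!t. 0 < t ==> qsB K2 K3 t <= et t"
proof (rule increasing_homeomorphism_majorant[of "qsB K2 K3"])
 have H: "0 < keyH K2 K3 M * (1 + K2)" for M using keyH_nonneg[OF K] K by simp
 have H1: "0 < qsH K2 K3" using H[of 1] by (simp add: qsH_def)
 show "qsB K2 K3 s <= qsB K2 K3 t" if st: "0 < s" "s <= t" for s t unfolding qsB_def[of _ _ t]
 proof (rule cInf_greatest)
  fix b assume b: "b : {2 * 3 ^ (nat \<lceil>(2 * (qsH K2 K3)^3 * t + 1)^2\<rceil> + 1)} Un {2 / M | M. 1 <= M & keyH K2 K3 M * (1 + K2) * t <= 1}"
  have low: "qsB K2 K3 s <= x" if "x : {2 * 3 ^ (nat \<lceil>(2 * (qsH K2 K3)^3 * s + 1)^2\<rceil> + 1)} Un {2 / M | M. 1 <= M & keyH K2 K3 M * (1 + K2) * s <= 1}" for x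
   unfolding qsB_def by (rule cInf_lower[OF that qsB_bdd])
  show "qsB K2 K3 s <= b" using b
  proof
   assume b: "b : {2 * 3 ^ (nat \<lceil>(2 * (qsH K2 K3)^3 * t + 1)^2\<rceil> + 1)}"
   have "(2 * (qsH K2 K3)^3 * s + 1)^2 <= (2 * (qsH K2 K3)^3 * t + 1)^2"
    using st H1 by (intro power_mono add_right_mono mult_left_mono) auto
   hence "nat \<lceil>(2 * (qsH K2 K3)^3 * s + 1)^2\<rceil> <= nat \<lceil>(2 * (qsH K2 K3)^3 * t + 1)^2\<rceil>" by (intro nat_mono ceiling_mono)
   hence pw: "(2::real) * 3 ^ (nat \<lceil>(2 * (qsH K2 K3)^3 * s + 1)^2\<rceil> + 1) <= 2 * 3 ^ (nat \<lceil>(2 * (qsH K2 K3)^3 * t + 1)^2\<rceil> + 1)"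
    by (intro mult_left_mono power_increasing) auto
   have b': "b = 2 * 3 ^ (nat \<lceil>(2 * (qsH K2 K3)^3 * t + 1)^2\<rceil> + 1)" using b by blast
   show ?thesis unfolding b' by (rule order_trans[OF low[OF UnI1[OF singletonI]] pw])
  next
   assume "b : {2 / M | M. 1 <= M & keyH K2 K3 M * (1 + K2) * t <= 1}"
   then obtain M where M: "b = 2 / M" "1 <= M" "keyH K2 K3 M * (1 + K2) * t <= 1" by blast
   have "keyH K2 K3 M * (1 + K2) * s <= keyH K2 K3 M * (1 + K2) * t" using st H[of M] by (intro mult_left_mono) auto
   thus ?thesis using M by (intro low) auto
  qed
 qed auto
 show "0 <= qsB K2 K3 t" for t unfolding qsB_def by (rule cInf_greatest) auto
 show "EX t>0. qsB K2 K3 t <= e" if e: "0 < e" for e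
 proof -
  define M where "M = max 1 (2 / e)"
  define t where "t = 1 / (keyH K2 K3 M * (1 + K2))"
  have M: "1 <= M" "2 / e <= M" by (auto simp: M_def)
  have "2 / M <= e" using M e by (simp add: field_simps)
  moreover have "keyH K2 K3 M * (1 + K2) * t <= 1" unfolding t_def by simp
  hence "qsB K2 K3 t <= 2 / M" unfolding qsB_def using M(1) by (intro cInf_lower qsB_bdd) blast
  moreover have "0 < t" using H[of M] by (simp add: t_def)
  ultimately show ?thesis by force
 qed
qed (rule that)

section \<open>Quasisymmetry of the limit map\<close>

context carpet_limit begin

abbreviation S where "S \<equiv> carpet Om Q"

lemma cont_f: "continuous_on S f" unfolding continuous_on_iff
proof (intro ballI allI impI)
 fix x and e :: real assume x: "x : S" and e: "0 < e"
 obtain y where y: "y : S" "y ~= x" using other_point by blast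
 define M where "M = max 1 (4 * dinf (f y) (f x) / e)"
 have M: "1 <= M" "4 * dinf (f y) (f x) / e <= M" by (auto simp: M_def)
 have kp: "0 < keyH K2 K3 M * (1 + K2)" using keyH_pos[of M] K2 by simp
 show "EX d>0. ALL x':S. dist x' x < d --> dist (f x') (f x) < e"
 proof (intro exI[of _ "dist x y / (keyH K2 K3 M * (1 + K2))"] conjI ballI impI)
  show "0 < dist x y / (keyH K2 K3 M * (1 + K2))" using y kp by simp
  fix z assume z: "z : S" "dist z x < dist x y / (keyH K2 K3 M * (1 + K2))"
  hence "keyH K2 K3 M * (1 + K2) * dist x z <= dist x y" using kp by (simp add: dist_commute pos_less_divide_eq mult.commute)
  hence "M * dinf (f z) (f x) <= dinf (f y) (f x)" using A_key[OF M(1) x y(1) z(1)] y(2) by blast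
  moreover have "4 * dinf (f y) (f x) <= M * e" using M(2) e by (simp add: pos_divide_le_eq)
  ultimately have "M * (4 * dinf (f z) (f x)) <= M * e" by linarith
  hence "4 * dinf (f z) (f x) <= e" using M(1) by simp
  thus "dist (f z) (f x) < e" using dinf_dist(2)[of "f z" "f x"] e by linarith
 qed
qed

lemma qsH_pos: "1 <= qsH K2 K3"
proof -
 have h: "1 <= (8 + 4 / K3) ^ n" for n using K3 by (intro one_le_power) (simp)
 have k: "1 <= 16 * K2 * (2 * K2 + 1)"
 proof -
  have "1 * 1 <= K2 * (2 * K2 + 1)" using K2 by (intro mult_mono) auto
  thus ?thesis by linarith
 qed
 have "1 * 1 <= (2 * (8 + 4 / K3) ^ (keyP K2 K3 1 * keyP K2 K3 1)) * (16 * K2 * (2 * K2 + 1))"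
  using h[of "keyP K2 K3 1 * keyP K2 K3 1"] k by (intro mult_mono) auto
 hence "1 * 1 <= keyH K2 K3 1 * (1 + K2)" unfolding keyH_def using K2 by (intro mult_mono) auto
 thus ?thesis by (simp add: qsH_def)
qed

text \<open>The estimate with factor 1 read backwards: it gives lower bounds for distances in the
  carpet from comparisons in the image.\<close>

lemma farther:
 assumes "x : S" "y : S" "z : S" "x ~= y" "dinf (f y) (f x) < dinf (f z) (f x)"
 shows "dist x y < qsH K2 K3 * dist x z" using A_key[of 1 x y z] assms unfolding qsH_def by force

lemma attain:
 assumes "x : S" "y : S" "0 <= v" "v <= dinf (f y) (f x)"
 obtains u where "u : S" "dinf (f u) (f x) = v"
proof -
 have "continuous_on S (%u. dinf (f u) (f x))" unfolding dinf_def by (intro continuous_intros cont_f)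
 hence "connected ((%u. dinf (f u) (f x)) ` S)" by (rule connected_continuous_image[OF _ carpet_connected])
 moreover have "dinf (f x) (f x) : (%u. dinf (f u) (f x)) ` S" "dinf (f y) (f x) : (%u. dinf (f u) (f x)) ` S"
  using imageI[OF assms(1), of "%u. dinf (f u) (f x)"] imageI[OF assms(2), of "%u. dinf (f u) (f x)"] by simp_all
 moreover have "dinf (f x) (f x) <= v" using assms(3) by (simp only: dinf_simps(1))
 ultimately have "v : (%u. dinf (f u) (f x)) ` S" using assms(4) by (rule connectedD_interval)
 thus thesis using that by blast
qed

text \<open>Otherwise, by connectedness, there are points \<open>b k\<close> with images at distance
  \<open>ro / 3 ^ k\<close> from that of \<open>x\<close>. By \<open>farther\<close> they are
  separated at a scale comparable to \<open>dist x z\<close>, yet all those with index in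
  \<open>{1..n}\<close> lie in a ball of radius comparable to \<open>t * dist x z\<close>; packing
  bounds \<open>n\<close>.\<close>

lemma ratio:
 assumes xyz: "x : S" "y : S" "z : S" "x ~= z" and t: "0 < t" "dist x y <= t * dist x z" and n: "(2 * (qsH K2 K3)^3 * t + 1)^2 < real n"
 shows "dinf (f y) (f x) <= 3 ^ n * dinf (f z) (f x)"
proof (rule ccontr)
 assume contra: "~ ?thesis"
 define ro where "ro = dinf (f y) (f x)"
 define d where "d = dist x z"
 define H where "H = qsH K2 K3"
 have H: "1 <= H" using qsH_pos by (simp add: H_def)
 have d0: "0 < d" using xyz by (simp add: d_def)
 have ro: "3 ^ n * dinf (f z) (f x) < ro" using contra by (simp add: ro_def)
 hence ro0: "0 < ro" using dinf_simps(3)[of "f z" "f x"] by (smt (verit) mult_nonneg_nonneg zero_le_power)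
 have "EX u. u : S & dinf (f u) (f x) = ro / 3 ^ k" for k :: nat
 proof -
  have "ro / 3 ^ k <= ro" using ro0 by (simp add: divide_le_eq one_le_power)
  thus ?thesis using attain[OF xyz(1,2), of "ro / 3 ^ k"] ro0 unfolding ro_def[symmetric] by (metis divide_nonneg_pos less_imp_le zero_less_numeral zero_less_power)
 qed
 then obtain b where b: "!!k. b k : S & dinf (f (b k)) (f x) = ro / 3 ^ k" by metis
 have bx: "x ~= b k" for k using b[of k] ro0 dinf_simps(1)[of "f x"] by auto
 have lo: "d < H * dist x (b k)" if "k <= n" for k
 proof -
  have "dinf (f z) (f x) < ro / 3 ^ n" using ro by (simp add: pos_less_divide_eq mult.commute)
  also have "... <= ro / 3 ^ k" using ro0 that by (intro divide_left_mono power_increasing) auto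
  finally show ?thesis unfolding d_def H_def using farther[OF xyz(1,3) _ xyz(4), of "b k"] b[of k] by simp
 qed
 have hi: "dist x (b k) <= H * t * d" if "1 <= k" for k
 proof -
  have "(1::real) < 3 ^ k" using that by (intro one_less_power) auto
  hence "ro / 3 ^ k < ro" using ro0 by (simp add: divide_less_eq)
  hence "dist x (b k) < H * dist x y" unfolding H_def using farther[OF xyz(1) _ xyz(2) bx[of k]] b[of k] unfolding ro_def by simp
  also have "... <= H * (t * d)" using t(2) H unfolding d_def by (intro mult_left_mono) auto
  finally show ?thesis by (simp)
 qed
 have sepd: "d / H\<^sup>2 < dist (b k) (b l)" if kl: "k < l" "l <= n" for k l
 proof -
  have "ro / 3 ^ l * 3 <= ro / 3 ^ k"
  proof -
   have "(3::real) ^ Suc k <= 3 ^ l" using kl by (intro power_increasing) auto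
   hence "ro / 3 ^ l <= ro / 3 ^ Suc k" using ro0 by (intro divide_left_mono) auto
   thus ?thesis by (simp add: field_simps)
  qed
  moreover have "ro / 3 ^ k <= dinf (f (b k)) (f (b l)) + ro / 3 ^ l" using dinf_triangle[of "f (b k)" "f x" "f (b l)"] b by simp
  moreover have "0 < ro / 3 ^ l" using ro0 by simp
  moreover have "A * 3 <= B ==> B <= C + A ==> 0 < A ==> A < C" for A B C :: real by linarith
  ultimately have "ro / 3 ^ l < dinf (f (b k)) (f (b l))" by blast
  hence "dinf (f x) (f (b l)) < dinf (f (b k)) (f (b l))" using b[of l] dinf_simps(2)[of "f x" "f (b l)"] by metis
  hence "dist (b l) x < H * dist (b l) (b k)" unfolding H_def using farther[of "b l" x "b k"] b xyz(1) bx[of l] by auto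
  hence "H * dist x (b l) < H * (H * dist (b k) (b l))" using H by (simp add: dist_commute)
  hence "d < H\<^sup>2 * dist (b k) (b l)" using lo[OF kl(2)] by (simp add: power2_eq_square)
  thus ?thesis using H by (simp add: pos_divide_less_eq mult.commute)
 qed
 define \<sigma> where "\<sigma> = d / H\<^sup>2"
 have \<sigma>: "0 < \<sigma>" using d0 H by (simp add: \<sigma>_def)
 have "(SUM k:{1..n}. (\<sigma> / 2)^2) <= (H * t * d + \<sigma> / 2)^2"
 proof (rule ball_packing)
  show "ball (b k) (\<sigma> / 2) <= cball x (H * t * d + \<sigma> / 2)" if "k : {1..n}" for k
  proof
   fix u assume "u : ball (b k) (\<sigma> / 2)"
   thus "u : cball x (H * t * d + \<sigma> / 2)" using hi[of k] that dist_triangle[of x u "b k"] by simp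
  qed
  show "ball (b k) (\<sigma> / 2) Int ball (b l) (\<sigma> / 2) = {}" if "k : {1..n}" "l : {1..n}" "k ~= l" for k l
  proof (rule disjoint_ballI)
   show "\<sigma> / 2 + \<sigma> / 2 <= dist (b k) (b l)"
    using that sepd[of k l] sepd[of l k] unfolding \<sigma>_def[symmetric] by (cases "k < l") (auto simp: dist_commute)
  qed
 qed (use \<sigma> d0 t H in auto)
 hence "real n * (\<sigma> / 2)^2 <= (H * t * d + \<sigma> / 2)^2" by simp
 hence "real n <= (H * t * d + \<sigma> / 2)^2 / (\<sigma> / 2)^2" using \<sigma> by (simp add: pos_le_divide_eq)
 also have "... = ((H * t * d + \<sigma> / 2) / (\<sigma> / 2))^2" by (simp only: power_divide)
 also have "(H * t * d + \<sigma> / 2) / (\<sigma> / 2) = 2 * H ^ 3 * t + 1"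
 proof -
  have "d = \<sigma> * H\<^sup>2" using H by (simp add: \<sigma>_def)
  hence "H * t * d + \<sigma> / 2 = (2 * H ^ 3 * t + 1) * (\<sigma> / 2)" by (simp add: algebra_simps power2_eq_square power3_eq_cube)
  thus ?thesis using \<sigma> by simp
 qed
 finally show False using n by (simp add: H_def)
qed

text \<open>If two points had the same image, \<open>ratio\<close> would collapse the whole carpet
  to one point, whereas the corners go to different corners of the rectangle.\<close>

lemma inj_f: "inj_on f S"
proof (rule inj_onI, rule ccontr)
 fix x z assume xz: "x : S" "z : S" "f x = f z" "x ~= z"
 have eq: "f y = f x" if y: "y : S" for y
 proof -
  define t where "t = dist x y / dist x z + 1"
  have t: "0 < t" unfolding t_def by (intro add_nonneg_pos) auto
  have "t * dist x z = dist x y + dist x z" using xz by (simp add: t_def distrib_right)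
  hence t: "0 < t" "dist x y <= t * dist x z" using t by simp_all
  obtain n where n: "(2 * (qsH K2 K3)^3 * t + 1)^2 < real n" using reals_Archimedean2 by blast
  have "dinf (f y) (f x) <= 3 ^ n * dinf (f z) (f x)" by (rule ratio[OF xz(1) y xz(2,4) t n])
  thus ?thesis using dinf_0 by (simp add: xz(3) dinf_simps)
 qed
 have "f (cor_pt 0) = f (cor_pt 1)" using eq cor_carpet by simp
 thus False using A_cor[of 0] A_cor[of 1] by (simp add: rect_corner_def)
qed

lemma quasisymmetric_bound:
 assumes xyz: "x : S" "y : S" "z : S" "x ~= y" "y ~= z" "x ~= z"
 shows "dist (f x) (f y) / dist (f x) (f z) <= qsB K2 K3 (dist x y / dist x z)"
proof -
 define t where "t = dist x y / dist x z"
 have t: "0 < t" "dist x y <= t * dist x z" using xyz by (auto simp: t_def)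
 have fz: "0 < dist (f x) (f z)" using inj_onD[OF inj_f, of x z] xyz by auto
 show ?thesis unfolding t_def[symmetric] qsB_def
 proof (rule cInf_greatest)
  fix B assume "B : {2 * 3 ^ (nat \<lceil>(2 * (qsH K2 K3)^3 * t + 1)^2\<rceil> + 1)} Un {2 / M | M. 1 <= M & keyH K2 K3 M * (1 + K2) * t <= 1}"
  thus "dist (f x) (f y) / dist (f x) (f z) <= B"
  proof
   assume B: "B : {2 * 3 ^ (nat \<lceil>(2 * (qsH K2 K3)^3 * t + 1)^2\<rceil> + 1)}"
   define n where "n = nat \<lceil>(2 * (qsH K2 K3)^3 * t + 1)^2\<rceil> + 1"
   have "(2 * (qsH K2 K3)^3 * t + 1)^2 < real n" unfolding n_def by linarith
   hence "dinf (f y) (f x) <= 3 ^ n * dinf (f z) (f x)" by (rule ratio[OF xyz(1,2,3,6) t])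
   also have "... <= 3 ^ n * dist (f x) (f z)" using dinf_dist(1)[of "f z" "f x"] by (intro mult_left_mono) (auto simp: dist_commute)
   finally have "dist (f x) (f y) <= 2 * 3 ^ n * dist (f x) (f z)" using dinf_dist(2)[of "f y" "f x"] by (simp add: dist_commute)
   thus ?thesis using B fz unfolding n_def[symmetric] by (simp add: pos_divide_le_eq)
  next
   assume "B : {2 / M | M. 1 <= M & keyH K2 K3 M * (1 + K2) * t <= 1}"
   then obtain M where M: "B = 2 / M" "1 <= M" "keyH K2 K3 M * (1 + K2) * t <= 1" by blast
   have "keyH K2 K3 M * (1 + K2) * dist x y = keyH K2 K3 M * (1 + K2) * t * dist x z" using xyz(6) by (simp add: t_def)
   also have "... <= 1 * dist x z" using M(3) by (intro mult_right_mono) auto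
   finally have "M * dinf (f y) (f x) <= dinf (f z) (f x)" using A_key[OF M(2) xyz(1,3,2,6)] by simp
   moreover have "M * dist (f y) (f x) <= M * (2 * dinf (f y) (f x))" using M(2) by (intro mult_left_mono dinf_dist) simp
   ultimately have "M * dist (f x) (f y) <= 2 * dist (f x) (f z)" using dinf_dist(1)[of "f z" "f x"] by (simp add: dist_commute)
   hence "dist (f x) (f y) <= 2 * dist (f x) (f z) / M" using M(2) by (simp add: pos_le_divide_eq mult.commute)
   thus ?thesis unfolding M(1) using fz by (simp add: pos_divide_le_eq)
  qed
 qed simp
qed

end

section \<open>The image is a square carpet\<close>

text \<open>If \<open>J'\<close> missed a point of \<open>J\<close>, the inside and the outside of
  \<open>J\<close> would be joined through that point, and the complement of \<open>J'\<close> would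
  be connected.\<close>

lemma jordan_curve_subset_eq:
 assumes J: "jordan_curve J" "jordan_curve J'" "J' <= J"
 shows "J' = J"
proof (rule ccontr)
 assume "J' ~= J"
 note io = jordan_curve_inside_outside[OF J(1)] and io' = jordan_curve_inside_outside[OF J(2)]
 obtain p where p: "p : J" "p ~: J'" using J(3) \<open>J' ~= J\<close> by blast
 have cl: "closure (inside J) = inside J Un J" "closure (outside J) = outside J Un J"
  using closure_Un_frontier[of "inside J"] closure_Un_frontier[of "outside J"] io(11,12) by auto
 have "connected (inside J Un (J - J'))" by (rule connected_intermediate_closure[OF io(3)]) (use cl(1) in auto)
 moreover have "connected (outside J Un (J - J'))" by (rule connected_intermediate_closure[OF io(6)]) (use cl(2) in auto)
 ultimately have "connected ((inside J Un (J - J')) Un (outside J Un (J - J')))" by (rule connected_Un) (use p in blast)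
 moreover have "(inside J Un (J - J')) Un (outside J Un (J - J')) = - J'" using io(10) J(3) by blast
 ultimately have "connected (- J')" by simp
 thus False using io'(1,2,4,5,9,10) unfolding connected_def by blast
qed

lemma box_region:
 assumes "Re u < Re v" "Im u < Im v"
 shows "closure (box u v) = cbox u v" "frontier (box u v) = cbox u v - box u v" "jordan_curve (frontier (box u v))" "jordan_region (box u v)"
  "box u v ~= {}"
proof -
 have "Complex ((Re u + Re v) / 2) ((Im u + Im v) / 2) : box u v" using assms by (simp add: in_box_complex_iff)
 thus ne: "box u v ~= {}" by blast
 thus cl: "closure (box u v) = cbox u v" by (rule closure_box)
 show fr: "frontier (box u v) = cbox u v - box u v" by (simp add: frontier_def cl interior_open[OF open_box])
 have "path_image (rectpath u v) = cbox u v - box u v" using assms by (intro path_image_rectpath_cbox_minus_box) auto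
 moreover have "simple_path (rectpath u v)" using assms by auto
 ultimately show jc: "jordan_curve (frontier (box u v))" unfolding jordan_curve_def fr by (intro exI[of _ "rectpath u v"]) auto
 have "inside (frontier (box u v)) = interior (box u v)" by (rule inside_frontier_eq_interior) (auto)
 thus "jordan_region (box u v)" unfolding jordan_region_def using jc by (metis interior_open open_box)
qed

context carpet_limit begin

definition R' :: "complex set" where "R' = box 0 (Complex 1 a)"

definition Q' :: "nat => complex set" where "Q' i = (if i = 0 then - closure R' else box (q i) (q i + Complex (w i) (w i)))"

lemma frontier_point_S: "x : frontier (Q i) ==> x : S" using frontier_sub_carpet by blast

lemma frontier_disj: "i ~= j ==> frontier (Q i) Int frontier (Q j) = {}" using closure_disj[of i j] by (auto simp: frontier_def)

text \<open>A square of side 0 would send a whole peripheral circle to one point.\<close>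

lemma w_pos: assumes "1 <= i" shows "0 < w i"
proof (rule ccontr)
 assume "~ 0 < w i"
 hence w0: "w i = 0" using A_q[OF assms] by simp
 obtain u v where uv: "u : frontier (Q i)" "v : frontier (Q i)" "u ~= v" using jordan_curve_two_points[OF jordan_frontier] by blast
 have "f u = q i" "f v = q i" using A_bd[OF assms uv(1)] A_bd[OF assms uv(2)] w0 by (auto simp: complex_eq_iff)
 thus False using inj_onD[OF inj_f, of u v] frontier_point_S uv by metis
qed

lemma R'_region:
 "closure R' = cbox 0 (Complex 1 a)" "frontier R' = cbox 0 (Complex 1 a) - R'" "jordan_curve (frontier R')" "jordan_region R'" "R' ~= {}"
 using box_region[of 0 "Complex 1 a"] A_a by (simp_all add: R'_def)

lemma Q'_region:
 assumes "1 <= i"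
 shows "Q' i = box (q i) (q i + Complex (w i) (w i))" "closure (Q' i) = cbox (q i) (q i + Complex (w i) (w i))" "frontier (Q' i) = closure (Q' i) - Q' i"
  "jordan_curve (frontier (Q' i))" "jordan_region (Q' i)" "Q' i ~= {}" "open (Q' i)"
proof -
 show eq: "Q' i = box (q i) (q i + Complex (w i) (w i))" using assms by (simp add: Q'_def)
 note b = box_region[of "q i" "q i + Complex (w i) (w i)"]
 show cl: "closure (Q' i) = cbox (q i) (q i + Complex (w i) (w i))" unfolding eq using w_pos[OF assms] by (intro b(1)) auto
 show "frontier (Q' i) = closure (Q' i) - Q' i" unfolding cl unfolding eq using w_pos[OF assms] by (intro b(2)) auto
 show "jordan_curve (frontier (Q' i))" unfolding eq using w_pos[OF assms] by (intro b(3)) auto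
 show "jordan_region (Q' i)" unfolding eq using w_pos[OF assms] by (intro b(4)) auto
 show "Q' i ~= {}" unfolding eq using w_pos[OF assms] by (intro b(5)) auto
 show "open (Q' i)" unfolding eq by (rule open_box)
qed

lemma jordan_image: assumes "jordan_curve J" "J <= S" shows "jordan_curve (f ` J)"
proof -
 obtain \<gamma> where g: "simple_path \<gamma>" "pathfinish \<gamma> = pathstart \<gamma>" "path_image \<gamma> = J" using jordan_curveE[OF assms(1)] .
 have "simple_path (f \<circ> \<gamma>)"
  using g assms(2) by (intro simple_path_continuous_image) (auto intro: continuous_on_subset[OF cont_f] inj_on_subset[OF inj_f])
 thus ?thesis unfolding jordan_curve_def using g
  by (intro exI[of _ "f \<circ> \<gamma>"]) (simp add: path_image_compose pathfinish_compose pathstart_compose)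
qed

text \<open>The limit estimates put the image into the boundary of the square; being a Jordan curve
  itself, it is all of that boundary.\<close>

lemma image_frontier: assumes i: "1 <= i" shows "f ` frontier (Q i) = frontier (Q' i)"
proof (rule jordan_curve_subset_eq[OF Q'_region(4)[OF i] jordan_image[OF jordan_frontier]])
 show "frontier (Q i) <= S" using frontier_point_S by blast
 show "f ` frontier (Q i) <= frontier (Q' i)"
 proof (rule image_subsetI)
  fix x assume x: "x : frontier (Q i)"
  show "f x : frontier (Q' i)" unfolding Q'_region(3)[OF i] Q'_region(2)[OF i] unfolding Q'_region(1)[OF i]
   using A_bd[OF i x] A_out[OF i frontier_point_S[OF x]] by (auto simp: in_cbox_complex_iff in_box_complex_iff)
 qed
qed

lemma image_outer_frontier: "f ` frontier Om = frontier R'"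
proof (rule jordan_curve_subset_eq[OF R'_region(3) jordan_image[OF jordan_Om]])
 show "frontier Om <= S" using frontier_carpet by blast
 show "f ` frontier Om <= frontier R'"
 proof (rule image_subsetI)
  fix x assume x: "x : frontier Om"
  show "f x : frontier R'" unfolding R'_region(2) unfolding R'_def
   using A_f[OF frontier_carpet[OF x]] A_obd[OF x] by (auto simp: in_cbox_complex_iff in_box_complex_iff)
 qed
qed

lemma image_sub: "f ` S <= carpet R' Q'"
proof (rule image_subsetI)
 fix x assume x: "x : S"
 have "f x : closure R'" unfolding R'_region(1) using A_f[OF x] by (simp add: in_cbox_complex_iff)
 moreover have "f x ~: Q' i" if "1 <= i" for i unfolding Q'_region(1)[OF that] using A_out[OF that x] by (auto simp: in_box_complex_iff)
 ultimately show "f x : carpet R' Q'" by (auto simp: carpet_def)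
qed

text \<open>
  A point \<open>p\<close> of the target missed by \<open>f\<close> lies in no closed square. An extension of \<open>f\<close> to \<open>closure Om\<close>
  takes the value \<open>p\<close> in finitely many \<open>Q i\<close> only, where it can be redefined with values in the
  closed squares; projecting from \<open>p\<close> then retracts \<open>closure Om\<close> to its frontier.
\<close>

lemma image_onto: "carpet R' Q' <= f ` S"
proof
 fix p assume p: "p : carpet R' Q'"
 show "p : f ` S"
 proof (rule ccontr)
  assume nf: "p ~: f ` S"
  have pR: "p : R'"
  proof -
   have "p : closure R'" using p by (simp add: carpet_def)
   moreover have "p ~: frontier R'" using nf image_outer_frontier frontier_carpet by blast
   ultimately show ?thesis using R'_region(1,2) by blast
  qed
  have pQ: "p ~: closure (Q' i)" if i: "1 <= i" for i
  proof
   assume "p : closure (Q' i)"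
   moreover have "p ~: Q' i" using p i by (auto simp: carpet_def)
   ultimately have "p : f ` frontier (Q i)" using image_frontier[OF i] Q'_region(3)[OF i] by blast
   thus False using nf frontier_point_S by blast
  qed
  have clS: "closed S" using carpet_compact compact_imp_closed by blast
  obtain G where G: "continuous_on UNIV G" "!!x. x : S ==> G x = f x" using Tietze_unbounded[OF cont_f, of UNIV] clS by auto
  define Bad where "Bad = closure Om Int G -` {p}"
  have "closed (G -` {p})" by (intro closed_vimage G(1)) auto
  hence "compact Bad" unfolding Bad_def using Om_props by (intro compact_Int_closed) auto
  moreover have "Bad <= (UN i:{1..}. Q i)"
  proof
   fix z assume z: "z : Bad"
   hence "z ~: S" using G(2) nf by (auto simp: Bad_def)
   thus "z : (UN i:{1..}. Q i)" using z by (auto simp: Bad_def carpet_def)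
  qed
  ultimately obtain I where I: "I <= {1..}" "finite I" "Bad <= (UN i:I. Q i)" using compactE_image[of Bad "{1..}" Q] open_Q by metis
  have I1: "1 <= i" if "i : I" for i using I(1) that by auto
  \<comment> \<open>Dugundji extension from the peripheral circle, with values in the convex set
    \<open>closure (Q' i)\<close>, which does not contain \<open>p\<close>.\<close>
  have ex: "EX g. continuous_on UNIV g & range g <= closure (Q' i) & (ALL x:frontier (Q i). g x = f x)" if i: "i : I" for i
  proof -
   have 1: "convex (closure (Q' i))" "closure (Q' i) ~= {}" using Q'_region(2,6)[OF I1[OF i]] by (auto)
   have 2: "continuous_on (frontier (Q i)) f" by (rule continuous_on_subset[OF cont_f]) (use frontier_point_S in blast)
   have 3: "f ` frontier (Q i) <= closure (Q' i)" using image_frontier[OF I1[OF i]] by (auto simp: frontier_def)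
   have 4: "closedin (top_of_set UNIV) (frontier (Q i))" by simp
   show ?thesis by (rule Dugundji[OF 1 4 2 3]) blast
  qed
  then obtain g where g: "!!i. i : I ==> continuous_on UNIV (g i) & range (g i) <= closure (Q' i) & (ALL x:frontier (Q i). g i x = f x)" by metis
  \<comment> \<open>The pieces \<open>T i\<close> are pasted along peripheral circles, where the
    maps on both sides agree with \<open>f\<close>.\<close>
  define T where "T i = (if i = 0 then closure Om - (UN j:I. Q j) else closure (Q i))" for i
  define h where "h i = (if i = 0 then G else g i)" for i
  have h: "continuous_on UNIV (h i)" if "i : insert 0 I" for i using that G(1) g by (auto simp: h_def)
  have clT: "closed (T i)" for i unfolding T_def using open_Q by auto
  have TO: "T i <= closure Om" if "i : insert 0 I" for i using that I1[of i] closure_Q_sub[of i] closure_subset[of Om] by (auto simp: T_def)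
  have fr: "x : frontier (Q i)" if "i : I" "x : T 0" "x : closure (Q i)" for x i using that closure_Q by (auto simp: T_def)
  have agree: "h i x = h j x" if ij: "i : insert 0 I" "j : insert 0 I" "x : T i" "x : T j" for i j x
  proof (cases "i = j")
   case False
   have one: "h 0 x = h k x" if "k : I" "x : T 0" "x : T k" for k
   proof -
    have "x : frontier (Q k)" using fr that I1[of k] by (auto simp: T_def split: if_splits)
    thus ?thesis using g[OF that(1)] G(2) frontier_point_S by (auto simp: h_def)
   qed
   show ?thesis
   proof (cases "i = 0 | j = 0")
    case True
    thus ?thesis using one[of i] one[of j] ij by auto
   next
    case nz: False
    thus ?thesis using closure_disj[OF False] ij by (auto simp: T_def)
   qed
  qed simp
  have cover: "closure Om <= (UN i:insert 0 I. T i)" using I1 closure_subset by (fastforce simp: T_def)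
  obtain F where F: "continuous_map (top_of_set (closure Om)) euclidean F" "!!x i. i : insert 0 I ==> x : closure Om Int T i ==> F x = h i x"
  proof (rule pasting_lemma_exists_closed[of "insert 0 I" "top_of_set (closure Om)" T euclidean h])
   show "topspace (top_of_set (closure Om)) <= \<Union> (T ` insert 0 I)" using cover by simp
   show "closedin (top_of_set (closure Om)) (T i)" if "i : insert 0 I" for i using clT TO[OF that] by (intro closed_subset) auto
   show "continuous_map (subtopology (top_of_set (closure Om)) (T i)) euclidean (h i)" if "i : insert 0 I" for i
    using continuous_on_subset[OF h[OF that]] by (simp add: subtopology_subtopology)
   show "h i x = h j x" if "i : insert 0 I" "j : insert 0 I" "x : topspace (top_of_set (closure Om)) Int T i Int T j" for i j x
    using agree that by blast
   show "finite (insert 0 I)" using I(2) by simp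
   fix F assume F: "continuous_map (top_of_set (closure Om)) euclidean F"
    "!!x i. i : insert 0 I ==> x : topspace (top_of_set (closure Om)) Int T i ==> F x = h i x"
   show thesis by (rule that[OF F(1)]) (rule F(2), assumption, simp)
  qed
  have cF: "continuous_on (closure Om) F" using F(1) by simp
  have Fp: "F z ~= p" if z: "z : closure Om" for z
  proof -
   obtain i where i: "i : insert 0 I" "z : T i" using cover z by blast
   have Fz: "F z = h i z" using F(2) i z by blast
   show ?thesis
   proof (cases "i = 0")
    case True
    hence "z ~: Bad" using i(2) I(3) by (auto simp: T_def)
    thus ?thesis using z Fz True by (auto simp: Bad_def h_def)
   next
    case False
    hence "h i z : closure (Q' i)" using g i(1) by (auto simp: h_def)
    thus ?thesis using Fz pQ[of i] False by auto
   qed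
  qed
  have Ff: "F x = f x" if x: "x : frontier Om" for x
  proof -
   have "x : closure Om" "x : T 0" using frontier_carpet[OF x] I(1) by (auto simp: T_def frontier_def carpet_def)
   hence "F x = h 0 x" using F(2)[of 0 x] by blast
   thus ?thesis using G(2)[OF frontier_carpet[OF x]] by (simp add: h_def)
  qed
  have oR: "open R'" "bounded R'" "convex R'" by (auto simp: R'_def)
  have iR: "interior R' ~= {}" using oR R'_region(5) by (simp add: interior_open)
  have "rel_frontier R' retract_of (affine hull R' - {p})"
   using oR(2,3) pR rel_interior_nonempty_interior[OF iR] oR(1) by (intro rel_frontier_retract_of_punctured_affine_hull) (auto simp: interior_open)
  hence "frontier R' retract_of (UNIV - {p})" using rel_frontier_nonempty_interior[OF iR] affine_hull_nonempty_interior[OF iR] by simp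
  then obtain \<phi> where \<phi>: "retraction (UNIV - {p}) (frontier R') \<phi>" unfolding retract_of_def by blast
  have \<phi>': "continuous_on (UNIV - {p}) \<phi>" "!!x. x ~= p ==> \<phi> x : frontier R'" "!!x. x : frontier R' ==> \<phi> x = x"
   using \<phi> unfolding retraction_def by auto
  have fO: "frontier Om <= S" using frontier_carpet by blast
  obtain k where k: "homeomorphism (frontier Om) (frontier R') f k"
   using homeomorphism_compact[OF jordan_curve_compact[OF jordan_Om] continuous_on_subset[OF cont_f fO] image_outer_frontier inj_on_subset[OF inj_f fO]] by blast
  \<comment> \<open>The composite of the pasted map, the projection from \<open>p\<close> and the
    inverse of \<open>f\<close> on the boundary fixes \<open>frontier Om\<close> and maps
    \<open>Om\<close> into it.\<close>
  have "Om <= frontier Om"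
  proof (rule frontier_subset_retraction[of Om "frontier Om" "k \<circ> (\<phi> \<circ> F)"])
   show "continuous_on (closure Om) (k \<circ> (\<phi> \<circ> F))" using cF Fp \<phi>'(1,2) homeomorphism_cont2[OF k]
    by (intro continuous_on_compose) (auto elim!: continuous_on_subset)
   show "k \<circ> (\<phi> \<circ> F) : Om \<rightarrow> frontier Om"
   proof
    fix z assume "z : Om"
    hence "\<phi> (F z) : frontier R'" using Fp \<phi>'(2) closure_subset[of Om] by blast
    thus "(k \<circ> (\<phi> \<circ> F)) z : frontier Om" using homeomorphism_image2[OF k] by auto
   qed
   show "(k \<circ> (\<phi> \<circ> F)) x = x" if x: "x : frontier Om" for x
   proof -
    have "f x : frontier R'" using image_outer_frontier x by blast
    thus ?thesis using Ff[OF x] \<phi>'(3)[of "f x"] homeomorphism_apply1[OF k x] by simp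
   qed
  qed (use Om_props in auto)
  thus False using Om_props(1,4) by (auto simp: frontier_def interior_open)
 qed
qed

lemma image_eq: "f ` S = carpet R' Q'" using image_sub image_onto by blast

lemma frontier_image_disj: assumes "1 <= i" "1 <= j" "i ~= j" shows "frontier (Q' i) Int frontier (Q' j) = {}"
proof -
 have "f ` frontier (Q i) Int f ` frontier (Q j) = f ` (frontier (Q i) Int frontier (Q j))"
  using frontier_point_S by (intro inj_on_image_Int[OF inj_f, symmetric]) blast+
 thus ?thesis using image_frontier[OF assms(1)] image_frontier[OF assms(2)] frontier_disj[OF assms(3)] by simp
qed

text \<open>The open squares are disjoint in the limit, and their boundaries are images of disjoint
  circles under an injective map.\<close>

lemma closure_Q'_disj: assumes ij: "1 <= i" "1 <= j" "i ~= j" shows "closure (Q' i) Int closure (Q' j) = {}"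
proof -
 have "Q' i Int Q' j = {}" unfolding Q'_region(1)[OF ij(1)] Q'_region(1)[OF ij(2)] using A_disj[OF ij w_pos[OF ij(1)] w_pos[OF ij(2)]]
  by (auto simp: in_box_complex_iff disjoint_iff)
 hence "Q' i Int closure (Q' j) = {}" "Q' j Int closure (Q' i) = {}"
  using open_Int_closure_eq_empty[OF Q'_region(7)[OF ij(1)]] open_Int_closure_eq_empty[OF Q'_region(7)[OF ij(2)]] by blast+
 thus ?thesis using frontier_image_disj[OF ij] Q'_region(3)[OF ij(1)] Q'_region(3)[OF ij(2)] by blast
qed

text \<open>A point of the closed square outside \<open>R'\<close> would lie on both boundaries,
  hence be the image of points of two disjoint circles.\<close>

lemma closure_Q'_sub: assumes i: "1 <= i" shows "closure (Q' i) <= R'"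
proof
 fix p assume p: "p : closure (Q' i)"
 show "p : R'"
 proof (rule ccontr)
  assume nR: "p ~: R'"
  have "p : closure R'" using p A_q[OF i] unfolding R'_region(1) Q'_region(2)[OF i] by (auto simp: in_cbox_complex_iff)
  hence pf: "p : f ` frontier Om" using nR R'_region(1,2) image_outer_frontier by blast
  have "p ~: Q' i" using nR A_q[OF i] unfolding R'_def Q'_region(1)[OF i] by (auto simp: in_box_complex_iff)
  hence pf': "p : f ` frontier (Q i)" using p Q'_region(3)[OF i] image_frontier[OF i] by blast
  have "f ` frontier (Q 0) Int f ` frontier (Q i) = f ` (frontier (Q 0) Int frontier (Q i))"
   using frontier_point_S by (intro inj_on_image_Int[OF inj_f, symmetric]) blast+
  thus False using pf pf' frontier_disj[of 0 i] i frontier_Q0 by auto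
 qed
qed

lemma dl_le_diameter: "1 <= i ==> dl i <= diameter (Q i)"
 unfolding dl_def using Q_props(2)[of i] diameter_closure[of "Q i"] diameter_subset[of "frontier (Q i)" "closure (Q i)"] by (auto simp: frontier_def)

text \<open>Uniform continuity: opposite corners of \<open>Q' i\<close> are images of two points of
  the small circle \<open>frontier (Q i)\<close>.\<close>

lemma diameter_Q'_tendsto: "(%i. diameter (Q' i)) \<longlonglongrightarrow> 0"
proof (rule metric_LIMSEQ_I)
 fix r :: real assume r: "0 < r"
 have "uniformly_continuous_on S f" by (rule compact_uniformly_continuous[OF cont_f carpet_compact])
 then obtain d where d: "0 < d" "!!x y. x : S ==> y : S ==> dist x y < d ==> dist (f x) (f y) < r / 4"
  using r unfolding uniformly_continuous_on_def by (metis divide_pos_pos zero_less_numeral)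
 have "(%i. diameter (Q i)) \<longlonglongrightarrow> 0" using carpet by (simp add: sierpinski_carpet_def)
 then obtain n where n: "!!i. n <= i ==> \<bar>diameter (Q i)\<bar> < d" using d(1) metric_LIMSEQ_D by (metis dist_real_def diff_zero)
 show "EX no. ALL i>=no. dist (diameter (Q' i)) 0 < r"
 proof (intro exI[of _ "max 1 n"] allI impI)
  fix i assume "max 1 n <= i"
  hence i: "1 <= i" "n <= i" by auto
  define v where "v = q i + Complex (w i) (w i)"
  have "q i : frontier (Q' i)" "v : frontier (Q' i)"
   unfolding Q'_region(3)[OF i(1)] Q'_region(2)[OF i(1)] unfolding Q'_region(1)[OF i(1)] v_def
   using w_pos[OF i(1)] by (auto simp: in_cbox_complex_iff in_box_complex_iff)
  then obtain x y where xy: "x : frontier (Q i)" "y : frontier (Q i)" "f x = q i" "f y = v" using image_frontier[OF i(1)] by (metis imageE)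
  have "dist x y <= dl i" using xy by (intro dist_le_dl i(1)) (auto simp: frontier_def)
  hence "dist x y < d" using dl_le_diameter[OF i(1)] n[OF i(2)] by linarith
  hence "dist (q i) v < r / 4" using d(2) xy frontier_point_S by metis
  hence "dinf (q i) v < r / 4" using dinf_dist(1) by (meson le_less_trans)
  hence w: "w i < r / 4" by (simp add: dinf_def v_def)
  have "diameter (Q' i) <= 2 * w i"
  proof (rule diameter_le)
   fix z z' assume z: "z : Q' i" "z' : Q' i"
   have "\<bar>Re z - Re z'\<bar> <= w i" "\<bar>Im z - Im z'\<bar> <= w i" using z unfolding Q'_region(1)[OF i(1)] by (auto simp: in_box_complex_iff)
   hence "dinf z z' <= w i" by (simp add: dinf_def)
   thus "norm (z - z') <= 2 * w i" using dinf_dist(2)[of z z'] by (simp add: dist_norm)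
  qed (use Q'_region(6)[OF i(1)] in simp)
  moreover have "0 <= diameter (Q' i)" by (rule diameter_ge_0) (simp add: Q'_region(1)[OF i(1)])
  ultimately show "dist (diameter (Q' i)) 0 < r" using w by (simp)
 qed
qed

lemma homeo: obtains g where "homeomorphism S (carpet R' Q') f g" using homeomorphism_compact[OF carpet_compact cont_f image_eq inj_f] by blast

text \<open>By invariance of domain the inverse map would carry an open subset of the image to an
  open subset of the carpet.\<close>

lemma interior_image: "interior (carpet R' Q') = {}"
proof -
 obtain g where g: "homeomorphism S (carpet R' Q') f g" by (rule homeo)
 define W where "W = interior (carpet R' Q')"
 have WS: "W <= carpet R' Q'" by (simp add: W_def interior_subset)
 have "open (g ` W)"
 proof (rule invariance_of_domain)
  show "continuous_on W g" using homeomorphism_cont2[OF g] WS by (rule continuous_on_subset)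
  show "inj_on g W" using homeomorphism_apply2[OF g] WS by (intro inj_on_inverseI[where g = f]) blast
 qed (simp add: W_def)
 moreover have "g ` W <= S" using homeomorphism_image2[OF g] WS by blast
 ultimately have "g ` W <= interior S" by (rule interior_maximal[rotated])
 moreover have "interior S = {}" using carpet by (simp add: sierpinski_carpet_def)
 ultimately show ?thesis by (simp add: W_def)
qed

lemma square_carpet_image: "square_carpet R' Q'"
proof -
 have "sierpinski_carpet R' Q'" unfolding sierpinski_carpet_def
  using R'_region(4) Q'_region(5) closure_Q'_sub closure_Q'_disj diameter_Q'_tendsto interior_image by (simp add: Q'_def[of 0])
 moreover have "axis_rectangle R'" unfolding axis_rectangle_def R'_def using A_a by (intro exI[of _ 0] exI[of _ "Complex 1 a"]) simp
 moreover have "axis_square (Q' i)" if i: "1 <= i" for i unfolding axis_square_def Q'_region(1)[OF i] using w_pos[OF i]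
  by (intro exI[of _ "q i"] exI[of _ "q i + Complex (w i) (w i)"]) simp
 ultimately show ?thesis by (simp add: square_carpet_def)
qed

lemma quasisymmetry_f:
 assumes "!!t. 0 < t ==> qsB K2 K3 t <= et t"
 shows "quasisymmetry et S (carpet R' Q') f"
proof -
 have "dist (f x) (f y) / dist (f x) (f z) <= et (dist x y / dist x z)" if "x : S" "y : S" "z : S" "x ~= y & y ~= z & x ~= z" for x y z
  using quasisymmetric_bound[of x y z] that assms[of "dist x y / dist x z"] by fastforce
 thus ?thesis unfolding quasisymmetry_def using homeo by metis
qed

end

theorem theorem2:
  fixes K2 K3 :: real
  assumes "K2 > 0" and "K3 > 0"
  shows "\<exists>\<eta>. increasing_homeomorphism \<eta> \<and>
    (\<forall>\<Omega> Q.
       sierpinski_carpet \<Omega> Q \<and>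
       carpet \<Omega> Q \<in> null_sets lebesgue \<and>
       (\<forall>i. quasicircle K2 (frontier (Q i))) \<and>
       relatively_separated K3 (\<lambda>i. frontier (Q i)) \<longrightarrow>
       (\<exists>\<Omega>' Q' f.
          square_carpet \<Omega>' Q' \<and>
          quasisymmetry \<eta> (carpet \<Omega> Q) (carpet \<Omega>' Q') f \<and>
          f ` frontier \<Omega> = frontier \<Omega>'))"
proof -
 obtain et where et: "increasing_homeomorphism et" "!!t. 0 < t ==> qsB K2 K3 t <= et t" using qs_majorant[OF assms] by blast
 have "EX Om' Q' f. square_carpet Om' Q' & quasisymmetry et (carpet Om Q) (carpet Om' Q') f & f ` frontier Om = frontier Om'"
  if h: "sierpinski_carpet Om Q" "ALL i. quasicircle K2 (frontier (Q i))" "relatively_separated K3 (%i. frontier (Q i))" for Om Q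
 proof -
  interpret carpet_setup Om Q K2 K3 by unfold_locales (use h assms in auto)
  obtain c e s where "carpet_frame Om Q K2 K3 c e s"
  proof (rule corner_data)
   fix c e :: complex and s :: "nat => real"
   assume "norm e = 1" "s 0 = dl 0 / 2" "s 2 = dl 0 / 2" "dl 0 / (2 * K2) <= s 1 + s 3" "\<bar>s 1\<bar> <= dl 0" "\<bar>s 3\<bar> <= dl 0"
    "!!k. k < 4 ==> c + of_real (s k) * (e * \<i> ^ k) : frontier Om"
    "!!k t. k < 4 ==> s k < t ==> c + of_real t * (e * \<i> ^ k) ~: closure Om"
    "!!z. z : closure Om ==> dist c z <= dl 0"
   hence "carpet_frame Om Q K2 K3 c e s" by unfold_locales
   thus thesis by (rule that)
  qed
  then obtain f q w a where "carpet_limit Om Q K2 K3 c e s f q w a" using carpet_frame.limit_exists by blast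
  then interpret carpet_limit Om Q K2 K3 c e s f q w a .
  show ?thesis using square_carpet_image quasisymmetry_f[OF et(2)] image_outer_frontier by blast
 qed
 thus ?thesis using et(1) by blast
qed

end
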